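(* Let $0<\alpha<1/2$. There is a positive real number $\varepsilon_0$ such that: if $\theta^0\in H^{2-2\alpha}(\mathbb R^2)$ satisfies $\|\theta^0\|_{H^{2-2\alpha}}<\varepsilon_0$, then there exists a global solution $\theta$ of $$\partial_t\theta+|D|^{2\alpha}\theta+u_\theta\cdot\nabla\theta=0,\qquad \theta(0,x)=\theta^0(x),$$ with $u_\theta=(-\partial_2|D|^{-1}\theta,\ \partial_1|D|^{-1}\theta)$, such that $$\theta\in C([0,\infty),H^{2-2\alpha}(\mathbb R^2))\cap L^2(\mathbb R^+,\dot H^{2-\alpha}(\mathbb R^2)),$$ and for all $t\ge 0$, $$\|\theta(t)\|_{H^{2-2\alpha}}^2+\int_0^t\big\||D|^\alpha\theta(\tau)\big\|_{H^{2-2\alpha}}^2\,d\tau\le\|\theta^0\|_{H^{2-2\alpha}}^2.$$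
   Context: $|D|^s$ is the Fourier multiplier $\widehat{|D|^s f}(\xi)=|\xi|^s\widehat f(\xi)$. $H^s(\mathbb R^2)$ is the inhomogeneous Sobolev space and $\dot H^s(\mathbb R^2)$ the homogeneous one; for $s>0$ the $H^s$ norm is taken to be $\|f\|_{H^s}^2=\|f\|_{L^2}^2+\||D|^sf\|_{L^2}^2$. *)

theory Defs
  imports "HOL-Analysis.Analysis"
begin

text \<open>Points of the plane are vectors in real^2; functions on the plane are complex valued
  (real functions are embedded via complex_of_real).  Fourier transform convention:
  fourier phi xi = integral of phi x * exp(-i x.xi) dx (unnormalised).\<close>

type_synonym pt = "real ^ 2"

definition L2c :: "(pt \<Rightarrow> complex) \<Rightarrow> bool" where
  "L2c f \<longleftrightarrow> f \<in> borel_measurable lborel \<and> integrable lborel (\<lambda>x. (cmod (f x))\<^sup>2)"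

definition L2norm_sq :: "(pt \<Rightarrow> complex) \<Rightarrow> real" where
  "L2norm_sq f = (LINT x|lborel. (cmod (f x))\<^sup>2)"

definition testc :: "(pt \<Rightarrow> complex) \<Rightarrow> bool" where
  "testc \<phi> \<longleftrightarrow> continuous_on UNIV \<phi> \<and> bounded {x. \<phi> x \<noteq> 0}"

definition fourier :: "(pt \<Rightarrow> complex) \<Rightarrow> pt \<Rightarrow> complex" where
  "fourier \<phi> \<xi> = (LINT x|lborel. \<phi> x * cis (- (x \<bullet> \<xi>)))"

text \<open>g is the (L^2, Plancherel) Fourier transform of f, characterised by duality
  against test functions; this determines g up to null sets.\<close>
definition is_FT :: "(pt \<Rightarrow> complex) \<Rightarrow> (pt \<Rightarrow> complex) \<Rightarrow> bool" where
  "is_FT f g \<longleftrightarrow> L2c f \<and> L2c g \<and>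
     (\<forall>\<phi>. testc \<phi> \<longrightarrow> (LINT x|lborel. f x * fourier \<phi> x) = (LINT \<xi>|lborel. g \<xi> * \<phi> \<xi>))"

definition FTL2 :: "(pt \<Rightarrow> complex) \<Rightarrow> pt \<Rightarrow> complex" where
  "FTL2 f = (SOME g. is_FT f g)"

definition fmult :: "(pt \<Rightarrow> complex) \<Rightarrow> (pt \<Rightarrow> complex) \<Rightarrow> pt \<Rightarrow> complex" where
  "fmult m f = (SOME h. is_FT h (\<lambda>\<xi>. m \<xi> * FTL2 f \<xi>))"

definition Dpow :: "real \<Rightarrow> (pt \<Rightarrow> complex) \<Rightarrow> pt \<Rightarrow> complex" where
  "Dpow s f = fmult (\<lambda>\<xi>. complex_of_real (norm \<xi> powr s)) f"

definition pderiv2 :: "2 \<Rightarrow> (pt \<Rightarrow> complex) \<Rightarrow> pt \<Rightarrow> complex" where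
  "pderiv2 j f = fmult (\<lambda>\<xi>. \<i> * complex_of_real (\<xi> $ j)) f"

text \<open>u_theta = (-d_2 |D|^{-1} theta, d_1 |D|^{-1} theta); symbols -i xi_2/|xi| and i xi_1/|xi|.\<close>
definition sqg_u1 :: "(pt \<Rightarrow> complex) \<Rightarrow> pt \<Rightarrow> complex" where
  "sqg_u1 f = fmult (\<lambda>\<xi>. - \<i> * complex_of_real (\<xi> $ 2 / norm \<xi>)) f"

definition sqg_u2 :: "(pt \<Rightarrow> complex) \<Rightarrow> pt \<Rightarrow> complex" where
  "sqg_u2 f = fmult (\<lambda>\<xi>. \<i> * complex_of_real (\<xi> $ 1 / norm \<xi>)) f"

text \<open>Homogeneous seminorm squared, normalised by Plancherel: ||D|^s f|_{L^2}^2.\<close>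
definition hdot_norm_sq :: "real \<Rightarrow> (pt \<Rightarrow> complex) \<Rightarrow> real" where
  "hdot_norm_sq s f = (1 / (2*pi)\<^sup>2) * (LINT \<xi>|lborel. ((norm \<xi> powr (2 * s)) * (cmod (FTL2 f \<xi>))\<^sup>2))"

definition sob_norm_sq :: "real \<Rightarrow> (pt \<Rightarrow> complex) \<Rightarrow> real" where
  "sob_norm_sq s f = L2norm_sq f + hdot_norm_sq s f"

definition sob_norm :: "real \<Rightarrow> (pt \<Rightarrow> complex) \<Rightarrow> real" where
  "sob_norm s f = sqrt (sob_norm_sq s f)"

definition in_H :: "real \<Rightarrow> (pt \<Rightarrow> complex) \<Rightarrow> bool" where
  "in_H s f \<longleftrightarrow> (\<exists>g. is_FT f g) \<and>
     integrable lborel (\<lambda>\<xi>. (1 + (norm \<xi>)\<^sup>2) powr s * (cmod (FTL2 f \<xi>))\<^sup>2)"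

text \<open>Homogeneous space, for functions already in L^2.\<close>
definition in_Hdot :: "real \<Rightarrow> (pt \<Rightarrow> complex) \<Rightarrow> bool" where
  "in_Hdot s f \<longleftrightarrow> (\<exists>g. is_FT f g) \<and>
     integrable lborel (\<lambda>\<xi>. (norm \<xi> powr (2 * s)) * (cmod (FTL2 f \<xi>))\<^sup>2)"

abbreviation cR :: "(pt \<Rightarrow> real) \<Rightarrow> pt \<Rightarrow> complex" where
  "cR f \<equiv> (\<lambda>x. complex_of_real (f x))"

definition cont_H :: "real \<Rightarrow> (real \<Rightarrow> pt \<Rightarrow> real) \<Rightarrow> bool" where
  "cont_H s \<theta> \<longleftrightarrow> (\<forall>t\<ge>0. in_H s (cR (\<theta> t))) \<and>
     (\<forall>t\<ge>0. ((\<lambda>\<tau>. sob_norm s (\<lambda>x. cR (\<theta> \<tau>) x - cR (\<theta> t) x)) \<longlongrightarrow> 0) (at t within {0..}))"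

definition L2_Hdot :: "real \<Rightarrow> (real \<Rightarrow> pt \<Rightarrow> real) \<Rightarrow> bool" where
  "L2_Hdot s \<theta> \<longleftrightarrow> (AE \<tau> in lborel. \<tau> \<ge> 0 \<longrightarrow> in_Hdot s (cR (\<theta> \<tau>))) \<and>
     set_integrable lborel {0..} (\<lambda>\<tau>. hdot_norm_sq s (cR (\<theta> \<tau>)))"

text \<open>Weak (in space, integrated in time) formulation of
  d_t theta + |D|^{2 alpha} theta + u_theta . grad theta = 0, theta(0) = theta0.\<close>
definition sqg_solution :: "real \<Rightarrow> (pt \<Rightarrow> real) \<Rightarrow> (real \<Rightarrow> pt \<Rightarrow> real) \<Rightarrow> bool" where
  "sqg_solution \<alpha> \<theta>0 \<theta> \<longleftrightarrow>
    (\<forall>t\<ge>0. \<forall>\<phi>. testc \<phi> \<longrightarrow>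
      (let F = (\<lambda>s. LINT x|lborel.
                   (Dpow (2*\<alpha>) (cR (\<theta> s)) x
                    + sqg_u1 (cR (\<theta> s)) x * pderiv2 1 (cR (\<theta> s)) x
                    + sqg_u2 (cR (\<theta> s)) x * pderiv2 2 (cR (\<theta> s)) x) * \<phi> x)
       in set_integrable lborel {0..t} F \<and>
          (LINT x|lborel. cR (\<theta> t) x * \<phi> x) - (LINT x|lborel. cR \<theta>0 x * \<phi> x)
          + (LINT s:{0..t}|lborel. F s) = 0))"

end

(*
  On the Fourier side the equation reads w' = -|xi|^(2 alpha) w - advection(w,w), where advection is a convolution
  with the antisymmetric kernel sqg_kernel(xi,eta) = (xi_2 eta_1 - xi_1 eta_2) / |xi - eta|, bounded by
  |xi| and by |eta|.  The system truncated to a ball is a bounded ODE in L2.  Antisymmetry of sqg_kernel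
  makes the L2 energy exact, and in the H^s energy (s = 2 - 2 alpha) it replaces the weight by the
  difference of its values at xi and eta.  This commutator is bounded by
  C |w|_(H^s) |w|_(H^(s+alpha))^2, so it is absorbed by the dissipation for small data.  The truncated
  solutions are Cauchy in L2, Fatou's lemma passes the energy inequality to the limit, and the
  commutator bound with weights cut off at R, R -> infinity, shows that the H^s norm of the limit
  varies continuously in time, which together with pointwise convergence gives strong continuity.
*)

theory Submission
  imports Defs "HOL-Probability.Probability"
begin

section \<open>L2 functions on the plane\<close>

abbreviation lborel2 :: "('a::euclidean_space \<times> 'b::euclidean_space) measure" where
  "lborel2 \<equiv> lborel \<Otimes>\<^sub>M lborel"

definition L2norm :: "(pt \<Rightarrow> complex) \<Rightarrow> real" where
  "L2norm f = sqrt (L2norm_sq f)"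

lemma L2norm_sq_nonneg [simp]: "0 \<le> L2norm_sq f"
  unfolding L2norm_sq_def by simp

lemma L2norm_nonneg [simp]: "0 \<le> L2norm f"
  by (simp add: L2norm_def)

lemma L2norm_squared: "(L2norm f)\<^sup>2 = L2norm_sq f"
  by (simp add: L2norm_def)

lemma L2c_measurable [measurable_dest]: "L2c f \<Longrightarrow> f \<in> borel_measurable borel"
  by (simp add: L2c_def)

lemma L2c_integrable: "L2c f \<Longrightarrow> integrable lborel (\<lambda>x. (cmod (f x))\<^sup>2)"
  by (simp add: L2c_def)

lemma L2c_nn_integral: "L2c f \<Longrightarrow> (\<integral>\<^sup>+x. ennreal ((cmod (f x))\<^sup>2) \<partial>lborel) = ennreal ((L2norm f)\<^sup>2)"
  unfolding L2norm_squared L2norm_sq_def by (rule nn_integral_eq_integral) (auto simp: L2c_def)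

lemma L2c_nn_leI:
  assumes [measurable]: "f \<in> borel_measurable borel"
    and bound: "(\<integral>\<^sup>+x. ennreal ((cmod (f x))\<^sup>2) \<partial>lborel) \<le> ennreal (B\<^sup>2)" and "0 \<le> B"
  shows "L2c f" "L2norm f \<le> B"
proof -
  show f: "L2c f"
    unfolding L2c_def integrable_iff_bounded using bound by (auto intro: le_less_trans)
  have "ennreal ((L2norm f)\<^sup>2) \<le> ennreal (B\<^sup>2)"
    using bound L2c_nn_integral[OF f] by simp
  then show "L2norm f \<le> B"
    using \<open>0 \<le> B\<close> power2_le_imp_le[of "L2norm f" B] by (simp add: ennreal_le_iff)
qed

lemma L2c_mono:
  assumes [measurable]: "L2c f" "g \<in> borel_measurable borel"
    and dominated: "AE x in lborel. cmod (g x) \<le> B * cmod (f x)" and "0 \<le> B"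
  shows "L2c g" "L2norm g \<le> B * L2norm f"
proof -
  have "(\<integral>\<^sup>+x. ennreal ((cmod (g x))\<^sup>2) \<partial>lborel) \<le> (\<integral>\<^sup>+x. ennreal (B\<^sup>2) * ennreal ((cmod (f x))\<^sup>2) \<partial>lborel)"
    using dominated
    by (intro nn_integral_mono_AE)
       (auto simp: ennreal_mult[symmetric] power_mult_distrib[symmetric] intro!: ennreal_leI power_mono)
  also have "\<dots> = ennreal (B\<^sup>2) * ennreal ((L2norm f)\<^sup>2)"
    by (simp add: nn_integral_cmult L2c_nn_integral[OF assms(1)])
  also have "\<dots> = ennreal ((B * L2norm f)\<^sup>2)"
    by (simp add: ennreal_mult[symmetric] power_mult_distrib)
  finally show "L2c g" "L2norm g \<le> B * L2norm f"
    using L2c_nn_leI[OF assms(2), of "B * L2norm f"] \<open>0 \<le> B\<close> by auto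
qed

lemma L2norm_cong_AE:
  assumes [measurable]: "f \<in> borel_measurable borel" "g \<in> borel_measurable borel"
    and "AE x in lborel. f x = g x"
  shows "L2norm f = L2norm g"
  unfolding L2norm_def L2norm_sq_def using assms(3)
  by (intro arg_cong[where f=sqrt] integral_cong_AE) (auto elim!: AE_mp)

lemma L2c_cong_AE:
  assumes "L2c f" "g \<in> borel_measurable borel" "AE x in lborel. f x = g x"
  shows "L2c g"
  by (rule L2c_mono(1)[where B=1, OF assms(1,2)]) (use assms(3) in auto)

lemma L2c_cmult [intro]: "L2c f \<Longrightarrow> L2c (\<lambda>x. c * f x)"
  by (rule L2c_mono(1)[where B="cmod c" and f=f]) (auto simp: norm_mult dest!: L2c_measurable)

lemma L2norm_cmult: "L2norm (\<lambda>x. c * f x) = cmod c * L2norm f"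
  unfolding L2norm_def L2norm_sq_def by (simp add: norm_mult power_mult_distrib real_sqrt_mult)

lemma L2c_add [intro]:
  assumes [measurable]: "L2c f" "L2c g" shows "L2c (\<lambda>x. f x + g x)"
proof -
  have "(cmod (f x + g x))\<^sup>2 \<le> 2 * (cmod (f x))\<^sup>2 + 2 * (cmod (g x))\<^sup>2" for x
  proof -
    have "(cmod (f x + g x))\<^sup>2 \<le> (cmod (f x) + cmod (g x))\<^sup>2"
      by (intro power_mono norm_triangle_ineq) auto
    also have "\<dots> \<le> 2 * (cmod (f x))\<^sup>2 + 2 * (cmod (g x))\<^sup>2"
      using sum_squares_bound[of "cmod (f x)" "cmod (g x)"] by (simp add: power2_sum)
    finally show ?thesis .
  qed
  moreover have "integrable lborel (\<lambda>x. 2 * (cmod (f x))\<^sup>2 + 2 * (cmod (g x))\<^sup>2)"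
    using assms by (intro Bochner_Integration.integrable_add integrable_mult_right L2c_integrable)
  ultimately have "integrable lborel (\<lambda>x. (cmod (f x + g x))\<^sup>2)"
    by (intro Bochner_Integration.integrable_bound[OF \<open>integrable lborel _\<close>]) auto
  then show ?thesis by (simp add: L2c_def)
qed

lemma L2c_diff [intro]: "L2c f \<Longrightarrow> L2c g \<Longrightarrow> L2c (\<lambda>x. f x - g x)"
  using L2c_add[OF _ L2c_cmult, of f g "-1"] by simp

lemma borel_measurable_cnj [measurable (raw)]:
  "f \<in> borel_measurable M \<Longrightarrow> (\<lambda>x. cnj (f x)) \<in> borel_measurable M"
  by (rule borel_measurable_continuous_on[where f=cnj]) (auto intro: continuous_intros)

lemma L2c_cnj [intro]: "L2c f \<Longrightarrow> L2c (\<lambda>x. cnj (f x))"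
  by (rule L2c_mono(1)[where B=1 and f=f]) (auto dest!: L2c_measurable)

lemma L2c_cmod: "L2c f \<Longrightarrow> L2c (\<lambda>x. complex_of_real (cmod (f x)))"
  by (rule L2c_mono(1)[where B=1 and f=f]) (auto dest!: L2c_measurable)

lemma L2norm_cmod: "L2norm (\<lambda>x. complex_of_real (cmod (f x))) = L2norm f"
  by (simp add: L2norm_def L2norm_sq_def)

lemma L2c_zero [simp]: "L2c (\<lambda>x. 0)"
  by (simp add: L2c_def)

lemma L2norm_zero [simp]: "L2norm (\<lambda>x. 0) = 0"
  by (simp add: L2norm_def L2norm_sq_def)

lemma ennreal_power2_le_imp_le:
  assumes "(a::ennreal)\<^sup>2 \<le> b\<^sup>2" shows "a \<le> b"
proof (cases "b = \<top>")
  case False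
  then obtain y where y: "b = ennreal y" "0 \<le> y" by (cases b) auto
  have "a \<noteq> \<top>"
    using assms y by (auto simp: power2_eq_square ennreal_top_mult ennreal_mult[symmetric] top_unique)
  then obtain x where x: "a = ennreal x" "0 \<le> x" by (cases a) auto
  have "x\<^sup>2 \<le> y\<^sup>2" using assms x y by (simp add: ennreal_power)
  then have "x \<le> y" using y(2) by (rule power2_le_imp_le)
  then show ?thesis using x y by (simp add: ennreal_leI)
qed simp

lemma L2_Cauchy_Schwarz_nn:
  assumes [measurable]: "L2c f" "L2c g"
  shows "(\<integral>\<^sup>+x. ennreal (cmod (f x) * cmod (g x)) \<partial>lborel) \<le> ennreal (L2norm f * L2norm g)"
proof (rule ennreal_power2_le_imp_le)
  have "(\<integral>\<^sup>+x. ennreal (cmod (f x)) * ennreal (cmod (g x)) \<partial>lborel)\<^sup>2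
      \<le> (\<integral>\<^sup>+x. ennreal (cmod (f x)) ^ 2 \<partial>lborel) * (\<integral>\<^sup>+x. ennreal (cmod (g x)) ^ 2 \<partial>lborel)"
    by (rule Cauchy_Schwarz_nn_integral) auto
  also have "\<dots> = ennreal ((L2norm f * L2norm g)\<^sup>2)"
    by (simp add: ennreal_power L2c_nn_integral[OF assms(1)] L2c_nn_integral[OF assms(2)] ennreal_mult power_mult_distrib)
  finally show "(\<integral>\<^sup>+x. ennreal (cmod (f x) * cmod (g x)) \<partial>lborel)\<^sup>2 \<le> (ennreal (L2norm f * L2norm g))\<^sup>2"
    by (simp add: ennreal_mult[symmetric] ennreal_power)
qed

lemma L2c_mult_integrable_norm:
  assumes [measurable]: "L2c f" "L2c g"
  shows "integrable lborel (\<lambda>x. cmod (f x) * cmod (g x))"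
  unfolding integrable_iff_bounded using L2_Cauchy_Schwarz_nn[OF assms]
  by (auto simp: abs_mult intro: le_less_trans)

lemma L2c_mult_integrable:
  assumes [measurable]: "L2c f" "L2c g"
  shows "integrable lborel (\<lambda>x. f x * g x)"
  by (rule Bochner_Integration.integrable_bound[OF L2c_mult_integrable_norm[OF assms]]) (auto simp: norm_mult)

lemma L2_Cauchy_Schwarz:
  assumes "L2c f" "L2c g"
  shows "(LINT x|lborel. cmod (f x) * cmod (g x)) \<le> L2norm f * L2norm g"
proof -
  have "ennreal (LINT x|lborel. cmod (f x) * cmod (g x)) = (\<integral>\<^sup>+x. ennreal (cmod (f x) * cmod (g x)) \<partial>lborel)"
    by (rule nn_integral_eq_integral[symmetric]) (auto intro: L2c_mult_integrable_norm[OF assms])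
  also note L2_Cauchy_Schwarz_nn[OF assms]
  finally show ?thesis by (simp add: ennreal_le_iff)
qed

lemma L2_Cauchy_Schwarz_integral:
  assumes "L2c f" "L2c g"
  shows "cmod (LINT x|lborel. f x * g x) \<le> L2norm f * L2norm g"
proof -
  have "cmod (LINT x|lborel. f x * g x) \<le> (LINT x|lborel. cmod (f x * g x))"
    by (rule integral_norm_bound)
  also have "\<dots> \<le> L2norm f * L2norm g" using L2_Cauchy_Schwarz[OF assms] by (simp add: norm_mult)
  finally show ?thesis .
qed

lemma L2norm_triangle:
  assumes "L2c f" "L2c g"
  shows "L2norm (\<lambda>x. f x + g x) \<le> L2norm f + L2norm g"
proof (rule power2_le_imp_le)
  have "(L2norm (\<lambda>x. f x + g x))\<^sup>2 = (LINT x|lborel. (cmod (f x + g x))\<^sup>2)"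
    by (simp add: L2norm_squared L2norm_sq_def)
  also have "\<dots> \<le> (LINT x|lborel. (cmod (f x))\<^sup>2 + (cmod (g x))\<^sup>2 + 2 * (cmod (f x) * cmod (g x)))"
  proof (rule integral_mono)
    show "integrable lborel (\<lambda>x. (cmod (f x + g x))\<^sup>2)" using assms by (intro L2c_integrable L2c_add)
    show "integrable lborel (\<lambda>x. (cmod (f x))\<^sup>2 + (cmod (g x))\<^sup>2 + 2 * (cmod (f x) * cmod (g x)))"
      using assms by (intro Bochner_Integration.integrable_add integrable_mult_right L2c_integrable L2c_mult_integrable_norm)
    fix x
    have "(cmod (f x + g x))\<^sup>2 \<le> (cmod (f x) + cmod (g x))\<^sup>2"
      by (intro power_mono norm_triangle_ineq) auto
    then show "(cmod (f x + g x))\<^sup>2 \<le> (cmod (f x))\<^sup>2 + (cmod (g x))\<^sup>2 + 2 * (cmod (f x) * cmod (g x))"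
      by (simp add: power2_sum)
  qed
  also have "\<dots> = (L2norm f)\<^sup>2 + (L2norm g)\<^sup>2 + 2 * (LINT x|lborel. cmod (f x) * cmod (g x))"
    using assms by (simp add: L2c_integrable L2c_mult_integrable_norm L2norm_squared L2norm_sq_def)
  also have "\<dots> \<le> (L2norm f + L2norm g)\<^sup>2"
    using L2_Cauchy_Schwarz[OF assms] by (simp add: power2_sum)
  finally show "(L2norm (\<lambda>x. f x + g x))\<^sup>2 \<le> (L2norm f + L2norm g)\<^sup>2" .
qed simp

lemma L2norm_minus_commute: "L2norm (\<lambda>x. f x - g x) = L2norm (\<lambda>x. g x - f x)"
  by (simp add: L2norm_def L2norm_sq_def norm_minus_commute)

lemma L2norm_triangle_diff:
  assumes "L2c f" "L2c g" "L2c h"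
  shows "L2norm (\<lambda>x. f x - h x) \<le> L2norm (\<lambda>x. f x - g x) + L2norm (\<lambda>x. g x - h x)"
  using L2norm_triangle[of "\<lambda>x. f x - g x" "\<lambda>x. g x - h x"] assms by auto

lemma L2norm_reverse_triangle:
  assumes "L2c f" "L2c g"
  shows "\<bar>L2norm f - L2norm g\<bar> \<le> L2norm (\<lambda>x. f x - g x)"
  using L2norm_triangle[OF L2c_diff[OF assms] assms(2)] L2norm_triangle[OF L2c_diff[OF assms(2,1)] assms(1)]
  by (simp add: L2norm_minus_commute[of f g] abs_le_iff)

lemma nn_integral_Fatou:
  assumes [measurable]: "\<And>k::nat. u k \<in> borel_measurable M"
    and lim: "AE x in M. (\<lambda>k. u k x) \<longlonglongrightarrow> v x"
    and bound: "eventually (\<lambda>k. (\<integral>\<^sup>+x. u k x \<partial>M) \<le> B) sequentially"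
  shows "(\<integral>\<^sup>+x. v x \<partial>M) \<le> (B::ennreal)"
proof -
  have "(\<integral>\<^sup>+x. v x \<partial>M) = (\<integral>\<^sup>+x. liminf (\<lambda>k. u k x) \<partial>M)"
    by (rule nn_integral_cong_AE) (use lim in eventually_elim, simp add: lim_imp_Liminf)
  also have "\<dots> \<le> liminf (\<lambda>k. \<integral>\<^sup>+x. u k x \<partial>M)" by (rule nn_integral_liminf) simp
  also have "\<dots> \<le> liminf (\<lambda>k::nat. B)" by (rule Liminf_mono[OF bound])
  also have "\<dots> = B" by (simp add: Liminf_const)
  finally show ?thesis .
qed

lemma L2_Fatou:
  assumes f [measurable]: "\<And>k::nat. L2c (f k)" and g [measurable]: "g \<in> borel_measurable borel"
    and lim: "AE x in lborel. (\<lambda>k. f k x) \<longlonglongrightarrow> g x"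
    and bound: "eventually (\<lambda>k. L2norm (f k) \<le> B) sequentially"
  shows "L2c g" "L2norm g \<le> B"
proof -
  have "0 \<le> B" using bound by (auto dest!: eventually_happens intro: order_trans[OF L2norm_nonneg])
  moreover have "(\<integral>\<^sup>+x. ennreal ((cmod (g x))\<^sup>2) \<partial>lborel) \<le> ennreal (B\<^sup>2)"
  proof (rule nn_integral_Fatou)
    show "AE x in lborel. (\<lambda>k. ennreal ((cmod (f k x))\<^sup>2)) \<longlonglongrightarrow> ennreal ((cmod (g x))\<^sup>2)"
      using lim by eventually_elim (intro tendsto_intros tendsto_ennrealI)
    show "eventually (\<lambda>k. (\<integral>\<^sup>+x. ennreal ((cmod (f k x))\<^sup>2) \<partial>lborel) \<le> ennreal (B\<^sup>2)) sequentially"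
      unfolding L2c_nn_integral[OF f] using bound by eventually_elim (auto intro!: ennreal_leI power_mono)
  qed simp
  ultimately show "L2c g" "L2norm g \<le> B" using L2c_nn_leI[OF g] by auto
qed

lemma convergent_if_summable_differences:
  fixes x :: "nat \<Rightarrow> 'a::banach"
  assumes "summable (\<lambda>k. x (Suc k) - x k)" shows "convergent x"
proof -
  have "convergent (\<lambda>n. \<Sum>k<n. x (Suc k) - x k)" using assms by (simp add: summable_iff_convergent)
  then have "convergent (\<lambda>n. x n - x 0)" by (simp only: sum_lessThan_telescope)
  from convergent_add[OF this convergent_const[of "x 0"]] show ?thesis by simp
qed

lemma summable_if_weighted_squares_finite:
  fixes x :: "nat \<Rightarrow> complex"
  assumes finite: "(\<Sum>k. ennreal (2^k * (cmod (x k))\<^sup>2)) \<noteq> \<top>"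
  shows "summable x"
proof -
  define S where "S = enn2real (\<Sum>k. ennreal (2^k * (cmod (x k))\<^sup>2))"
  have "cmod (x k) \<le> sqrt S * (sqrt (1/2))^k" for k
  proof (rule power2_le_imp_le)
    have "ennreal (2^k * (cmod (x k))\<^sup>2) \<le> ennreal S"
      unfolding S_def using finite sum_le_suminf[OF summableI, of "{k}" "\<lambda>k. ennreal (2^k * (cmod (x k))\<^sup>2)"]
      by (simp add: less_top)
    then have "(cmod (x k))\<^sup>2 \<le> S * (1/2)^k"
      by (simp add: S_def ennreal_le_iff power_divide mult.commute pos_le_divide_eq)
    also have "\<dots> = (sqrt S * (sqrt (1/2))^k)\<^sup>2"
      by (simp add: S_def power_mult_distrib power_mult[symmetric] mult.commute[of k] power_mult del: real_sqrt_divide)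
    finally show "(cmod (x k))\<^sup>2 \<le> (sqrt S * (sqrt (1/2))^k)\<^sup>2" .
    show "0 \<le> sqrt S * (sqrt (1/2))^k" by (simp add: S_def)
  qed
  then show ?thesis
    by (intro summable_comparison_test[OF _ summable_mult[OF summable_geometric]]) (auto simp: real_sqrt_divide)
qed

lemma L2_geometric_AE_convergent:
  assumes f [measurable]: "\<And>k::nat. L2c (f k)"
    and geometric: "\<And>k. L2norm (\<lambda>x. f (Suc k) x - f k x) \<le> (1/2)^k"
  shows "AE x in lborel. convergent (\<lambda>k. f k x)"
proof -
  have "(\<integral>\<^sup>+x. (\<Sum>k. ennreal (2^k * (cmod (f (Suc k) x - f k x))\<^sup>2)) \<partial>lborel)
     = (\<Sum>k. ennreal (2^k) * ennreal ((L2norm (\<lambda>x. f (Suc k) x - f k x))\<^sup>2))"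
    by (subst nn_integral_suminf) (auto simp: ennreal_mult nn_integral_cmult L2c_nn_integral[OF L2c_diff[OF f f]])
  also have "\<dots> \<le> (\<Sum>k. ennreal ((1/2)^k))"
  proof (rule suminf_le)
    fix k
    have "(L2norm (\<lambda>x. f (Suc k) x - f k x))\<^sup>2 \<le> ((1/2)^k)\<^sup>2" by (intro power_mono geometric) simp
    then have "2^k * (L2norm (\<lambda>x. f (Suc k) x - f k x))\<^sup>2 \<le> (1/2)^k"
      by (simp add: power2_eq_square power_divide field_simps)
    then show "ennreal (2^k) * ennreal ((L2norm (\<lambda>x. f (Suc k) x - f k x))\<^sup>2) \<le> ennreal ((1/2)^k)"
      by (simp add: ennreal_mult[symmetric] ennreal_leI)
  qed auto
  also have "\<dots> = ennreal (\<Sum>k. (1/2)^k)" by (intro suminf_ennreal2) (auto intro: summable_geometric)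
  also have "\<dots> < \<infinity>" by simp
  finally have "AE x in lborel. (\<Sum>k. ennreal (2^k * (cmod (f (Suc k) x - f k x))\<^sup>2)) \<noteq> \<infinity>"
    by (intro nn_integral_PInf_AE) auto
  then show ?thesis
    by eventually_elim (auto intro!: convergent_if_summable_differences summable_if_weighted_squares_finite)
qed

lemma L2_Cauchy_AE_limit:
  assumes f [measurable]: "\<And>k::nat. L2c (f k)" and g [measurable]: "g \<in> borel_measurable borel"
    and r: "strict_mono r" and lim: "AE x in lborel. (\<lambda>j. f (r j) x) \<longlonglongrightarrow> g x"
    and Cauchy: "\<And>e. 0 < e \<Longrightarrow> \<exists>N. \<forall>j\<ge>N. \<forall>k\<ge>N. L2norm (\<lambda>x. f j x - f k x) \<le> e"
  shows "L2c g" "(\<lambda>k. L2norm (\<lambda>x. f k x - g x)) \<longlonglongrightarrow> 0"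
proof -
  have near: "\<exists>N. \<forall>k\<ge>N. L2c (\<lambda>x. g x - f k x) \<and> L2norm (\<lambda>x. g x - f k x) \<le> e" if "0 < e" for e
  proof -
    obtain N where N: "\<And>j k. j \<ge> N \<Longrightarrow> k \<ge> N \<Longrightarrow> L2norm (\<lambda>x. f j x - f k x) \<le> e"
      using Cauchy[of e] \<open>0 < e\<close> by metis
    have "L2c (\<lambda>x. g x - f k x) \<and> L2norm (\<lambda>x. g x - f k x) \<le> e" if "k \<ge> N" for k
    proof -
      have diff_lim: "AE x in lborel. (\<lambda>j. f (r j) x - f k x) \<longlonglongrightarrow> g x - f k x"
        using lim by eventually_elim (intro tendsto_intros)
      have diff_bound: "eventually (\<lambda>j. L2norm (\<lambda>x. f (r j) x - f k x) \<le> e) sequentially"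
        using eventually_ge_at_top[of N]
        by eventually_elim (use that N order_trans[OF _ strict_mono_imp_increasing[OF r]] in blast)
      show ?thesis using L2_Fatou[OF L2c_diff[OF f f] _ diff_lim diff_bound] by auto
    qed
    then show ?thesis by blast
  qed
  obtain k where "L2c (\<lambda>x. g x - f k x)" using near[of 1] by auto
  from L2c_add[OF this f[of k]] show "L2c g" by simp
  show "(\<lambda>k. L2norm (\<lambda>x. f k x - g x)) \<longlonglongrightarrow> 0"
  proof (rule LIMSEQ_I)
    fix e :: real assume "0 < e"
    then obtain N where "\<forall>k\<ge>N. L2norm (\<lambda>x. g x - f k x) \<le> e / 2" using near[of "e/2"] by auto
    with \<open>0 < e\<close> show "\<exists>N. \<forall>k\<ge>N. norm (L2norm (\<lambda>x. f k x - g x) - 0) < e"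
      by (intro exI[of _ N]) (auto simp: L2norm_minus_commute[of _ g] intro: le_less_trans)
  qed
qed

theorem L2_complete:
  assumes f [measurable]: "\<And>k::nat. L2c (f k)"
    and Cauchy: "\<And>e. 0 < e \<Longrightarrow> \<exists>N. \<forall>j\<ge>N. \<forall>k\<ge>N. L2norm (\<lambda>x. f j x - f k x) \<le> e"
  obtains g where "L2c g" "(\<lambda>k. L2norm (\<lambda>x. f k x - g x)) \<longlonglongrightarrow> 0"
proof -
  obtain N where N: "\<And>i j k. j \<ge> N i \<Longrightarrow> k \<ge> N i \<Longrightarrow> L2norm (\<lambda>x. f j x - f k x) \<le> (1/2)^i"
    using Cauchy[of "(1/2)^i" for i] by (metis zero_less_power half_gt_zero_iff zero_less_one)
  define r where "r i = i + (\<Sum>j\<le>i. N j)" for i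
  have r: "strict_mono r" by (rule strict_monoI_Suc) (simp add: r_def)
  have "N i \<le> r i" for i
    using member_le_sum[of i "{..i}" N] by (simp add: r_def trans_le_add2)
  moreover have "r i \<le> r (Suc i)" for i using r by (simp add: strict_mono_less_eq)
  ultimately have "L2norm (\<lambda>x. f (r (Suc i)) x - f (r i) x) \<le> (1/2)^i" for i
    by (intro N) (auto intro: order_trans)
  then have "AE x in lborel. convergent (\<lambda>i. f (r i) x)"
    by (rule L2_geometric_AE_convergent[of "\<lambda>i. f (r i)", OF f])
  then have "AE x in lborel. (\<lambda>i. f (r i) x) \<longlonglongrightarrow> lim (\<lambda>i. f (r i) x)"
    by eventually_elim (simp add: convergent_LIMSEQ_iff)
  from L2_Cauchy_AE_limit[OF f _ r this Cauchy] show thesis by (intro that) auto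
qed

lemma testc_bound:
  assumes "testc \<phi>"
  obtains R B where "0 < R" "0 < B" "\<And>x. norm x > R \<Longrightarrow> \<phi> x = 0" "\<And>x. cmod (\<phi> x) \<le> B"
proof -
  obtain R where R: "\<And>x. \<phi> x \<noteq> 0 \<Longrightarrow> norm x \<le> R" "0 < R"
    using assms unfolding testc_def bounded_pos by auto
  have "compact (\<phi> ` cball 0 R)"
    using assms by (intro compact_continuous_image) (auto simp: testc_def intro: continuous_on_subset)
  then obtain B where B: "0 < B" "\<And>x. x \<in> cball 0 R \<Longrightarrow> cmod (\<phi> x) \<le> B"
    by (auto dest!: compact_imp_bounded simp: bounded_pos)
  show ?thesis
  proof (rule that[OF R(2) B(1)])
    fix x show "norm x > R \<Longrightarrow> \<phi> x = 0" using R(1)[of x] by force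
    show "cmod (\<phi> x) \<le> B" using B R(1)[of x] by (cases "\<phi> x = 0") (auto simp: less_imp_le)
  qed
qed

lemma testcI:
  assumes "continuous_on UNIV \<phi>" "\<And>x. norm x > R \<Longrightarrow> \<phi> x = 0"
  shows "testc \<phi>"
  unfolding testc_def using assms by (auto intro!: boundedI[of _ R] simp: not_less[symmetric])

lemma testc_mult_continuous:
  assumes "testc \<phi>" "continuous_on UNIV \<psi>" shows "testc (\<lambda>x. \<psi> x * \<phi> x)"
proof -
  obtain R where "\<And>x. norm x > R \<Longrightarrow> \<phi> x = 0" using testc_bound[OF assms(1)] by metis
  then show ?thesis using assms by (intro testcI[of _ R]) (auto simp: testc_def intro: continuous_on_mult)
qed

lemma testc_diff:
  assumes "testc \<phi>" "testc \<psi>" shows "testc (\<lambda>x. \<phi> x - \<psi> x)"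
proof -
  have "{x. \<phi> x - \<psi> x \<noteq> 0} \<subseteq> {x. \<phi> x \<noteq> 0} \<union> {x. \<psi> x \<noteq> 0}" by auto
  then show ?thesis using assms unfolding testc_def
    by (auto intro: bounded_subset[OF bounded_Un[THEN iffD2]] continuous_on_diff)
qed

lemma testc_measurable [measurable_dest]: "testc \<phi> \<Longrightarrow> \<phi> \<in> borel_measurable borel"
  by (simp add: testc_def borel_measurable_continuous_onI)

lemma integrable_bounded_support:
  fixes f :: "'a::euclidean_space \<Rightarrow> 'b::{banach, second_countable_topology}"
  assumes [measurable]: "f \<in> borel_measurable borel"
    and "\<And>x. norm x > R \<Longrightarrow> f x = 0" "\<And>x. norm (f x) \<le> B"
  shows "integrable lborel f"
proof -
  have "integrable lborel (\<lambda>x. B * indicator (cball (0::'a) R) x)"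
    by (intro integrable_mult_right integrable_real_indicator) (auto simp: emeasure_bounded_finite[unfolded infinity_ennreal_def])
  then show ?thesis
    by (rule Bochner_Integration.integrable_bound)
       (use assms(2,3) order_trans[OF norm_ge_zero assms(3)] in \<open>auto simp: indicator_def not_le\<close>)
qed

lemma testc_integrable: "testc \<phi> \<Longrightarrow> integrable lborel \<phi>"
  using testc_measurable by (metis integrable_bounded_support testc_bound)

lemma L2c_bounded_support:
  assumes [measurable]: "f \<in> borel_measurable borel"
    and "\<And>x. norm x > R \<Longrightarrow> f x = 0" "\<And>x. cmod (f x) \<le> B"
  shows "L2c f"
  unfolding L2c_def using assms(2,3)
  by (auto intro!: integrable_bounded_support[where R=R and B="B\<^sup>2"] power_mono)

lemma testc_L2c: "testc \<phi> \<Longrightarrow> L2c \<phi>"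
  using testc_measurable by (metis L2c_bounded_support testc_bound)

definition bump :: "real \<Rightarrow> pt \<Rightarrow> complex" where
  "bump R x = complex_of_real (max 0 (min 1 (R + 1 - norm x)))"

lemma bump_eq_1: "norm x \<le> R \<Longrightarrow> bump R x = 1"
  by (simp add: bump_def)

lemma cmod_bump_le: "cmod (bump R x) \<le> 1"
  by (simp add: bump_def)

lemma testc_bump: "testc (bump R)"
  unfolding bump_def[abs_def] by (rule testcI[of _ "R + 1"]) (auto intro!: continuous_intros)

lemma L2_dominated_convergence:
  assumes [measurable]: "\<And>k::nat. f k \<in> borel_measurable borel" "L2c h"
    and lim: "AE x in lborel. (\<lambda>k. f k x) \<longlonglongrightarrow> 0"
    and dominated: "\<And>k. AE x in lborel. cmod (f k x) \<le> cmod (h x)"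
  shows "(\<lambda>k. L2norm (f k)) \<longlonglongrightarrow> 0"
proof -
  have "(\<lambda>k. LINT x|lborel. (cmod (f k x))\<^sup>2) \<longlonglongrightarrow> (LINT x|(lborel::pt measure). (0::real))"
  proof (rule integral_dominated_convergence[where f="\<lambda>x. 0" and s="\<lambda>k x. (cmod (f k x))\<^sup>2" and w="\<lambda>x. (cmod (h x))\<^sup>2"])
    show "AE x in lborel. (\<lambda>k. (cmod (f k x))\<^sup>2) \<longlonglongrightarrow> 0"
      using lim by eventually_elim (auto intro!: tendsto_eq_intros)
    show "AE x in lborel. norm ((cmod (f k x))\<^sup>2) \<le> (cmod (h x))\<^sup>2" for k
      using dominated[of k] by eventually_elim (auto intro!: power_mono)
  qed (use assms(2) in \<open>auto simp: L2c_def\<close>)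
  then have "(\<lambda>k. sqrt (LINT x|lborel. (cmod (f k x))\<^sup>2)) \<longlonglongrightarrow> sqrt 0"
    by (intro tendsto_real_sqrt) simp
  then show ?thesis by (simp add: L2norm_def L2norm_sq_def)
qed

lemma borel_AE_limit_continuous:
  fixes f :: "'a::euclidean_space \<Rightarrow> 'b::euclidean_space"
  assumes "f \<in> borel_measurable borel"
  obtains g where "\<And>n. continuous_on UNIV (g n)" "AE x in lborel. (\<lambda>n. g n x) \<longlonglongrightarrow> f x"
proof -
  have "f measurable_on UNIV"
    using assms by (intro lebesgue_measurable_imp_measurable_on) (auto simp: measurable_completion)
  then obtain N g where N: "negligible N" and g: "\<And>n. continuous_on UNIV (g n)"
    and lim: "\<And>x. x \<notin> N \<Longrightarrow> (\<lambda>n. g n x) \<longlonglongrightarrow> f x"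
    unfolding measurable_on_def by auto
  have "AE x in lebesgue. x \<notin> N" using N by (auto simp: negligible_iff_null_sets intro: AE_not_in)
  then have "AE x in lborel. x \<notin> N" by (simp add: AE_completion_iff)
  then have "AE x in lborel. (\<lambda>n. g n x) \<longlonglongrightarrow> f x" by eventually_elim (rule lim)
  with g show thesis by (rule that)
qed

lemma testc_AE_approximation:
  assumes f: "f \<in> borel_measurable borel" "\<And>x. norm x > R \<Longrightarrow> f x = 0" "\<And>x. cmod (f x) \<le> R" and "0 < R"
  obtains \<phi> where "\<And>k::nat. testc (\<phi> k)" "\<And>k x. cmod (\<phi> k x) \<le> R * cmod (bump R x)"
    "AE x in lborel. (\<lambda>k. \<phi> k x) \<longlonglongrightarrow> f x"
proof -
  obtain g where g: "\<And>n. continuous_on UNIV (g n)" "AE x in lborel. (\<lambda>n. g n x) \<longlonglongrightarrow> f x"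
    using borel_AE_limit_continuous[OF f(1)] by blast
  let ?clamp = "closest_point (cball (0::complex) R)"
  have clamp: "cmod (?clamp z) \<le> R" for z
    using closest_point_in_set[of "cball (0::complex) R" z] \<open>0 < R\<close> by auto
  have cont: "continuous_on UNIV ?clamp"
    using \<open>0 < R\<close> by (intro continuous_on_closest_point) auto
  define \<phi> where "\<phi> n x = ?clamp (g n x) * bump R x" for n x
  show thesis
  proof
    show "testc (\<phi> k)" for k
      unfolding \<phi>_def by (intro testc_mult_continuous testc_bump continuous_on_compose2[OF cont g(1)]) auto
    show "cmod (\<phi> k x) \<le> R * cmod (bump R x)" for k x
      unfolding \<phi>_def norm_mult by (intro mult_right_mono clamp) auto
    show "AE x in lborel. (\<lambda>k. \<phi> k x) \<longlonglongrightarrow> f x"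
      using g(2)
    proof eventually_elim
      case (elim x)
      have "(\<lambda>k. ?clamp (g k x)) \<longlonglongrightarrow> ?clamp (f x)"
        using continuous_on_tendsto_compose[OF cont elim] by simp
      also have "?clamp (f x) = f x" using f(3) by (simp add: closest_point_self)
      finally have "(\<lambda>k. \<phi> k x) \<longlonglongrightarrow> f x * bump R x" unfolding \<phi>_def by (intro tendsto_intros)
      also have "f x * bump R x = f x" using f(2)[of x] bump_eq_1[of x R] by fastforce
      finally show ?case .
    qed
  qed
qed

lemma testc_dense_bounded:
  assumes f [measurable]: "f \<in> borel_measurable borel"
    and bounds: "\<And>x. norm x > R \<Longrightarrow> f x = 0" "\<And>x. cmod (f x) \<le> R" and "0 < R"
  obtains \<phi> where "\<And>k::nat. testc (\<phi> k)" "(\<lambda>k. L2norm (\<lambda>x. \<phi> k x - f x)) \<longlonglongrightarrow> 0"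
proof -
  obtain \<phi> where \<phi> [measurable]: "\<And>k::nat. testc (\<phi> k)" and small: "\<And>k x. cmod (\<phi> k x) \<le> R * cmod (bump R x)"
    and lim: "AE x in lborel. (\<lambda>k. \<phi> k x) \<longlonglongrightarrow> f x"
    using testc_AE_approximation[OF f bounds \<open>0 < R\<close>] by blast
  have "(\<lambda>k. L2norm (\<lambda>x. \<phi> k x - f x)) \<longlonglongrightarrow> 0"
  proof (rule L2_dominated_convergence[where h="\<lambda>x. complex_of_real (2 * R) * bump R x"])
    show "L2c (\<lambda>x. complex_of_real (2 * R) * bump R x)" by (intro L2c_cmult testc_L2c testc_bump)
    show "AE x in lborel. (\<lambda>k. \<phi> k x - f x) \<longlonglongrightarrow> 0"
      using lim by eventually_elim (rule LIM_zero)
    have "cmod (f x) \<le> R * cmod (bump R x)" for x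
      using bounds[of x] bump_eq_1[of x R] \<open>0 < R\<close> by (cases "norm x \<le> R") auto
    then have "cmod (\<phi> k x - f x) \<le> R * cmod (bump R x) + R * cmod (bump R x)" for k x
      using small by (intro order_trans[OF norm_triangle_ineq4] add_mono)
    then show "AE x in lborel. cmod (\<phi> k x - f x) \<le> cmod (complex_of_real (2 * R) * bump R x)" for k
      using \<open>0 < R\<close> by (auto simp: norm_mult mult.assoc)
  qed measurable
  with \<phi> show thesis by (rule that)
qed

lemma L2_truncation_tendsto:
  assumes [measurable]: "L2c f"
  shows "(\<lambda>k. L2norm (\<lambda>x. (if norm x \<le> real k \<and> cmod (f x) \<le> real k then f x else 0) - f x)) \<longlonglongrightarrow> 0"
proof (rule L2_dominated_convergence[OF _ assms])
  show "AE x in lborel. (\<lambda>k. (if norm x \<le> real k \<and> cmod (f x) \<le> real k then f x else 0) - f x) \<longlonglongrightarrow> 0"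
  proof (intro AE_I2 tendsto_eventually)
    fix x
    obtain m :: nat where "max (norm x) (cmod (f x)) \<le> real m" using real_arch_simple by blast
    then show "eventually (\<lambda>k. (if norm x \<le> real k \<and> cmod (f x) \<le> real k then f x else 0) - f x = 0) sequentially"
      by (intro eventually_mono[OF eventually_ge_at_top[of m]]) auto
  qed
qed auto

theorem testc_dense:
  assumes [measurable]: "L2c f" and "0 < e"
  obtains \<phi> where "testc \<phi>" "L2norm (\<lambda>x. \<phi> x - f x) < e"
proof -
  define F where "F k x = (if norm x \<le> real k \<and> cmod (f x) \<le> real k then f x else 0)" for k x
  have "eventually (\<lambda>k. L2norm (\<lambda>x. F k x - f x) < e/2) sequentially"
    using L2_truncation_tendsto[OF assms(1)] \<open>0 < e\<close> unfolding F_def by (intro order_tendstoD) auto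
  from eventually_happens[OF eventually_conj[OF this eventually_gt_at_top[of "0::nat"]]]
  obtain k where k: "L2norm (\<lambda>x. F k x - f x) < e/2" "k > 0" by auto
  have [measurable]: "F k \<in> borel_measurable borel" unfolding F_def by measurable
  have F: "L2c (F k)" by (rule L2c_mono(1)[OF assms(1), where B=1]) (auto simp: F_def)
  obtain \<phi> where \<phi>: "\<And>j::nat. testc (\<phi> j)" "(\<lambda>j. L2norm (\<lambda>x. \<phi> j x - F k x)) \<longlonglongrightarrow> 0"
    by (rule testc_dense_bounded[of "F k" "real k"]) (use k(2) in \<open>auto simp: F_def\<close>)
  have "eventually (\<lambda>j. L2norm (\<lambda>x. \<phi> j x - F k x) < e/2) sequentially"
    using \<phi>(2) \<open>0 < e\<close> by (intro order_tendstoD) auto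
  then obtain j where "L2norm (\<lambda>x. \<phi> j x - F k x) < e/2" by (auto dest: eventually_happens)
  with L2norm_triangle_diff[OF testc_L2c[OF \<phi>(1)] F assms(1), of j] k(1)
  have "L2norm (\<lambda>x. \<phi> j x - f x) < e" by simp
  with \<phi>(1) show thesis by (rule that)
qed

section \<open>The Fourier transform of integrable functions\<close>

lemma nn_integral_affine:
  fixes f :: "'a::euclidean_space \<Rightarrow> ennreal"
  assumes [measurable]: "f \<in> borel_measurable borel" and c: "c \<noteq> 0"
  shows "(\<integral>\<^sup>+x. f x \<partial>lborel) = ennreal (\<bar>c\<bar> ^ DIM('a)) * (\<integral>\<^sup>+x. f (t + c *\<^sub>R x) \<partial>lborel)"
  by (subst lborel_affine[OF c, of t])
     (simp add: nn_integral_density nn_integral_distr nn_integral_cmult ennreal_power)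

lemma nn_integral_shift:
  fixes f :: "'a::euclidean_space \<Rightarrow> ennreal"
  assumes "f \<in> borel_measurable borel"
  shows "(\<integral>\<^sup>+x. f (x - t) \<partial>lborel) = (\<integral>\<^sup>+x. f x \<partial>lborel)"
  using nn_integral_affine[OF assms, of 1 "-t"] by simp

lemma nn_integral_reflect:
  fixes f :: "'a::euclidean_space \<Rightarrow> ennreal"
  assumes "f \<in> borel_measurable borel"
  shows "(\<integral>\<^sup>+x. f (t - x) \<partial>lborel) = (\<integral>\<^sup>+x. f x \<partial>lborel)"
  using nn_integral_affine[OF assms, of "-1" t] by simp

lemma integrable_affine:
  fixes f :: "'a::euclidean_space \<Rightarrow> 'b::{banach, second_countable_topology}"
  assumes f: "integrable lborel f" and c: "c \<noteq> 0"
  shows "integrable lborel (\<lambda>x. f (t + c *\<^sub>R x))"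
  using f f[THEN borel_measurable_integrable] c unfolding integrable_iff_bounded
  by (subst (asm) nn_integral_affine[where c=c and t=t]) (auto simp: ennreal_mult_less_top)

lemma integrable_affine_iff:
  fixes f :: "'a::euclidean_space \<Rightarrow> 'b::{banach, second_countable_topology}"
  assumes c: "c \<noteq> 0"
  shows "integrable lborel (\<lambda>x. f (t + c *\<^sub>R x)) \<longleftrightarrow> integrable lborel f"
  using integrable_affine[of f c t] integrable_affine[of "\<lambda>x. f (t + c *\<^sub>R x)" "1/c" "-(1/c) *\<^sub>R t"] c
  by (auto simp: scaleR_diff_right)

lemma integral_affine:
  fixes f :: "'a::euclidean_space \<Rightarrow> 'b::{banach, second_countable_topology}"
  assumes c: "c \<noteq> 0"
  shows "(LINT x|lborel. f x) = \<bar>c\<bar> ^ DIM('a) *\<^sub>R (LINT x|lborel. f (t + c *\<^sub>R x))"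
proof cases
  assume f [measurable]: "integrable lborel f"
  then show ?thesis
    using c integrable_affine[OF f c, of t]
    by (subst lborel_affine[OF c, of t]) (simp add: integral_density integral_distr)
next
  assume "\<not> integrable lborel f" with c show ?thesis
    by (simp add: integrable_affine_iff not_integrable_integral_eq)
qed

lemma integral_shift:
  fixes f :: "'a::euclidean_space \<Rightarrow> 'b::{banach, second_countable_topology}"
  shows "(LINT x|lborel. f (x - t)) = (LINT x|lborel. f x)"
  using integral_affine[of 1 f "-t"] by simp

lemma integral_reflect:
  fixes f :: "'a::euclidean_space \<Rightarrow> 'b::{banach, second_countable_topology}"
  shows "(LINT x|lborel. f (t - x)) = (LINT x|lborel. f x)"
  using integral_affine[of "-1" f "t"] by simp

lemma integral_uminus:
  fixes f :: "'a::euclidean_space \<Rightarrow> 'b::{banach, second_countable_topology}"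
  shows "(LINT x|lborel. f (- x)) = (LINT x|lborel. f x)"
  using integral_reflect[of f 0] by simp

lemma integrable_reflect:
  fixes f :: "'a::euclidean_space \<Rightarrow> 'b::{banach, second_countable_topology}"
  shows "integrable lborel f \<Longrightarrow> integrable lborel (\<lambda>x. f (t - x))"
  using integrable_affine[of f "-1" t] by simp

lemma L2_reflect:
  assumes [measurable]: "L2c f"
  shows "L2c (\<lambda>x. f (t - x))" "L2norm (\<lambda>x. f (t - x)) = L2norm f"
proof -
  have [measurable]: "f \<in> borel_measurable borel" by simp
  show "L2c (\<lambda>x. f (t - x))" "L2norm (\<lambda>x. f (t - x)) = L2norm f"
  using integrable_reflect[OF L2c_integrable[OF assms], of t] integral_reflect[of "\<lambda>x. (cmod (f x))\<^sup>2" t]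
  by (auto simp: L2c_def L2norm_def L2norm_sq_def)
qed

lemma L2c_uminus_arg [intro]: "L2c f \<Longrightarrow> L2c (\<lambda>x. f (- x))"
  using L2_reflect(1)[of f 0] by simp

definition vec2 :: "real \<times> real \<Rightarrow> pt" where
  "vec2 p = fst p *\<^sub>R axis 1 1 + snd p *\<^sub>R axis 2 1"

lemma vec2_nth [simp]: "vec2 p $ 1 = fst p" "vec2 p $ 2 = snd p"
  by (simp_all add: vec2_def axis_def)

lemma vec2_measurable [measurable]: "vec2 \<in> borel_measurable lborel2"
  unfolding vec2_def by measurable

lemma Basis_pt: "(Basis :: pt set) = {axis 1 1, axis 2 1}"
  by (auto simp: Basis_vec_def UNIV_2)

lemma inner_pt: "(x::pt) \<bullet> y = x $ 1 * y $ 1 + x $ 2 * y $ 2"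
  by (simp add: inner_vec_def UNIV_2)

lemma norm_pt_sq: "(norm (x::pt))\<^sup>2 = (x $ 1)\<^sup>2 + (x $ 2)\<^sup>2"
  by (subst power2_norm_eq_inner) (simp add: inner_pt power2_eq_square)

lemma lborel_vec2: "(lborel :: pt measure) = distr lborel2 borel vec2"
proof (rule lborel_eqI)
  fix l u :: pt
  assume "\<And>b. b \<in> Basis \<Longrightarrow> l \<bullet> b \<le> u \<bullet> b"
  from this[of "axis 1 1"] this[of "axis 2 1"] have ordered: "l $ 1 \<le> u $ 1" "l $ 2 \<le> u $ 2"
    by (auto simp: Basis_pt inner_axis)
  have "vec2 -` box l u \<inter> space lborel2 = {l$1<..<u$1} \<times> {l$2<..<u$2}"
    by (auto simp: box_def Basis_pt inner_axis space_pair_measure)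
  then have "emeasure (distr lborel2 borel vec2) (box l u) = ennreal (u$1 - l$1) * ennreal (u$2 - l$2)"
    using ordered by (simp add: emeasure_distr lborel.emeasure_pair_measure_Times)
  also have "\<dots> = ennreal (\<Prod>b\<in>Basis. (u - l) \<bullet> b)"
    using ordered by (simp add: Basis_pt axis_eq_axis inner_axis ennreal_mult)
  finally show "emeasure (distr lborel2 borel vec2) (box l u) = (\<Prod>b\<in>Basis. (u - l) \<bullet> b)" by simp
qed simp

lemma integrable_prod_mult:
  fixes f :: "'a::euclidean_space \<Rightarrow> complex" and h :: "'b::euclidean_space \<Rightarrow> complex"
  assumes f [measurable]: "integrable lborel f" and h [measurable]: "integrable lborel h"
  shows "integrable lborel2 (\<lambda>(x, y). f x * h y)"
proof (rule lborel_pair.Fubini_integrable)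
  show "integrable lborel (\<lambda>x. LINT y|lborel. norm (case (x, y) of (x, y) \<Rightarrow> f x * h y))"
    using f by (simp add: norm_mult)
qed (use h in auto)

lemma borel_measurable_cis [measurable (raw)]:
  "f \<in> borel_measurable M \<Longrightarrow> (\<lambda>x. cis (f x)) \<in> borel_measurable M"
  by (rule borel_measurable_continuous_on[where f=cis]) (auto intro: continuous_on_cis continuous_on_id)

lemma gauss_1d:
  shows "integrable lborel (\<lambda>a. cis (- (t * a)) * complex_of_real (exp (- a\<^sup>2 / 2)))" (is "integrable lborel ?g")
    and "(LINT a|lborel. cis (- (t * a)) * complex_of_real (exp (- a\<^sup>2 / 2)))
        = complex_of_real (sqrt (2*pi) * exp (- t\<^sup>2 / 2))"
proof -
  have g_eq: "?g a = complex_of_real (sqrt (2*pi)) * (std_normal_density a *\<^sub>R iexp (- t * a))" for a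
    by (simp add: std_normal_density_def cis_conv_exp scaleR_conv_of_real)
  have "integrable lborel (\<lambda>a. std_normal_density a *\<^sub>R iexp (- t * a))"
    by (rule Bochner_Integration.integrable_bound[OF integrable_std_normal_moment[of 0]]) auto
  then show "integrable lborel ?g" unfolding g_eq by (rule integrable_mult_right)
  have "(LINT a|lborel. std_normal_density a *\<^sub>R iexp (- t * a)) = char std_normal_distribution (-t)"
    unfolding char_def by (subst integral_density) auto
  also have "\<dots> = complex_of_real (exp (- t\<^sup>2 / 2))" by (simp add: char_std_normal_distribution)
  finally show "(LINT a|lborel. ?g a) = complex_of_real (sqrt (2*pi) * exp (- t\<^sup>2 / 2))"
    by (simp only: g_eq integral_mult_right_zero of_real_mult)
qed

definition gauss :: "pt \<Rightarrow> real" where "gauss \<xi> = exp (- (norm \<xi>)\<^sup>2 / 2)"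

lemma gauss_measurable [measurable]: "gauss \<in> borel_measurable borel"
  unfolding gauss_def by measurable

lemma gauss_nonneg [simp]: "0 \<le> gauss \<xi>"
  by (simp add: gauss_def)

lemma gauss_vec2: "gauss (vec2 (a, b)) = exp (- a\<^sup>2 / 2) * exp (- b\<^sup>2 / 2)"
  unfolding gauss_def norm_pt_sq exp_add[symmetric] by (simp add: field_simps)

lemma gauss_2d:
  shows "integrable lborel (\<lambda>\<xi>. cis (- (z \<bullet> \<xi>)) * complex_of_real (gauss \<xi>))" (is "integrable lborel ?F")
    and "(LINT \<xi>|lborel. cis (- (z \<bullet> \<xi>)) * complex_of_real (gauss \<xi>)) = complex_of_real (2 * pi * gauss z)"
proof -
  let ?g = "\<lambda>t a. cis (- (t * a)) * complex_of_real (exp (- a\<^sup>2 / 2))"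
  have product: "?F (vec2 p) = (case p of (a, b) \<Rightarrow> ?g (z$1) a * ?g (z$2) b)" for p
  proof (cases p)
    case (Pair a b)
    have "cis (- (z \<bullet> vec2 p)) = cis (- (z$1 * a)) * cis (- (z$2 * b))" by (simp add: inner_pt Pair cis_mult)
    then show ?thesis unfolding Pair by (simp only: gauss_vec2 of_real_mult prod.case mult_ac)
  qed
  have int: "integrable lborel2 (\<lambda>p. ?F (vec2 p))"
    unfolding product by (rule integrable_prod_mult[OF gauss_1d(1) gauss_1d(1)])
  show "integrable lborel ?F"
    by (subst lborel_vec2, subst integrable_distr_eq) (use int in auto)
  have "(LINT \<xi>|lborel. ?F \<xi>) = (LINT p|lborel2. ?F (vec2 p))"
    by (subst lborel_vec2, subst integral_distr) auto
  also have "\<dots> = (LINT a|lborel. LINT b|lborel. ?g (z$1) a * ?g (z$2) b)"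
    unfolding product by (subst lborel_pair.integral_fst[symmetric]) (use int product in auto)
  also have "\<dots> = complex_of_real (sqrt (2*pi) * exp (- (z$1)\<^sup>2 / 2)) * complex_of_real (sqrt (2*pi) * exp (- (z$2)\<^sup>2 / 2))"
    by (simp only: integral_mult_right_zero integral_mult_left_zero gauss_1d(2))
  also have "\<dots> = complex_of_real ((sqrt (2*pi) * sqrt (2*pi)) * (exp (- (z$1)\<^sup>2 / 2) * exp (- (z$2)\<^sup>2 / 2)))"
    by (simp only: of_real_mult mult_ac)
  also have "\<dots> = complex_of_real (2 * pi * gauss z)"
    by (simp add: gauss_def norm_pt_sq exp_add[symmetric] add_divide_distrib)
  finally show "(LINT \<xi>|lborel. ?F \<xi>) = complex_of_real (2 * pi * gauss z)" .
qed

lemma gauss_integrable: "integrable lborel gauss"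
  using integrable_norm[OF gauss_2d(1)[of 0]] by (simp add: gauss_def[abs_def])

lemma gauss_integral: "(LINT \<xi>|lborel. gauss \<xi>) = 2 * pi"
proof -
  have "complex_of_real (LINT \<xi>|lborel. gauss \<xi>) = complex_of_real (2 * pi)"
    using gauss_2d(2)[of 0] by (simp add: gauss_def)
  then show ?thesis by (simp only: of_real_eq_iff)
qed

lemma gauss_scaled_integrable: "0 < (e::real) \<Longrightarrow> integrable lborel (\<lambda>\<xi>. gauss (e *\<^sub>R \<xi>))"
  using integrable_affine[OF gauss_integrable, of e 0] by simp

lemma fourier_measurable [measurable (raw)]:
  assumes [measurable]: "f \<in> borel_measurable borel"
  shows "fourier f \<in> borel_measurable borel"
  unfolding fourier_def by measurable

lemma fourier_integrable:
  assumes "integrable lborel f"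
  shows "integrable lborel (\<lambda>x. f x * cis (- (x \<bullet> \<xi>)))"
  by (rule Bochner_Integration.integrable_bound[OF assms]) 
     (use assms[THEN borel_measurable_integrable] in \<open>auto simp: norm_mult\<close>)

lemma fourier_bound:
  assumes "integrable lborel f"
  shows "cmod (fourier f \<xi>) \<le> (LINT x|lborel. cmod (f x))"
  unfolding fourier_def using integral_norm_bound[of lborel "\<lambda>x. f x * cis (- (x \<bullet> \<xi>))"]
  by (simp add: norm_mult)

lemma fourier_diff:
  assumes "integrable lborel f" "integrable lborel g"
  shows "fourier (\<lambda>x. f x - g x) \<xi> = fourier f \<xi> - fourier g \<xi>"
  unfolding fourier_def
  using fourier_integrable[OF assms(1)] fourier_integrable[OF assms(2)] by (simp add: left_diff_distrib)

lemma cnj_lint: "cnj (LINT x|M. f x) = (LINT x|M. cnj (f x))"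
  by (rule Bochner_Integration.integral_cnj[symmetric])

lemma fourier_cnj: "fourier (\<lambda>x. cnj (f x)) \<xi> = cnj (fourier f (- \<xi>))"
  unfolding fourier_def cnj_lint
  by (rule Bochner_Integration.integral_cong) (simp_all add: cis_cnj)

lemma fourier_multiplication:
  assumes f [measurable]: "integrable lborel f" and h [measurable]: "integrable lborel h"
  shows "(LINT \<xi>|lborel. fourier f \<xi> * h \<xi>) = (LINT x|lborel. f x * fourier h x)"
proof -
  have int: "integrable lborel2 (\<lambda>(x, \<xi>). f x * h \<xi> * cis (- (x \<bullet> \<xi>)))"
    by (rule Bochner_Integration.integrable_bound[OF integrable_prod_mult[OF f h]]) (auto simp: norm_mult)
  have "(LINT \<xi>|lborel. fourier f \<xi> * h \<xi>) = (LINT \<xi>|lborel. LINT x|lborel. f x * h \<xi> * cis (- (x \<bullet> \<xi>)))"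
    unfolding fourier_def by (subst integral_mult_left_zero[symmetric]) (simp add: mult_ac)
  also have "\<dots> = (LINT x|lborel. LINT \<xi>|lborel. f x * h \<xi> * cis (- (x \<bullet> \<xi>)))"
    by (rule lborel_pair.Fubini_integral[OF int])
  also have "\<dots> = (LINT x|lborel. f x * fourier h x)"
    unfolding fourier_def by (subst integral_mult_right_zero[symmetric]) (simp add: mult_ac inner_commute)
  finally show ?thesis .
qed

lemma gauss_modulated_fourier:
  assumes e: "0 < (e::real)"
  shows "integrable lborel (\<lambda>\<xi>. complex_of_real (gauss (e *\<^sub>R \<xi>)) * cis (x \<bullet> \<xi>))" (is "integrable lborel ?g")
    and "fourier (\<lambda>\<xi>. complex_of_real (gauss (e *\<^sub>R \<xi>)) * cis (x \<bullet> \<xi>)) y =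
        complex_of_real (2 * pi / e\<^sup>2 * gauss ((1/e) *\<^sub>R (y - x)))"
proof -
  let ?z = "(1/e) *\<^sub>R (y - x)"
  have rescale: "cis (- (?z \<bullet> (0 + e *\<^sub>R \<xi>))) * complex_of_real (gauss (0 + e *\<^sub>R \<xi>)) = ?g \<xi> * cis (- (\<xi> \<bullet> y))" for \<xi>
    using e by (simp add: cis_mult inner_diff_left inner_commute[of \<xi> y])
  have "complex_of_real (2 * pi * gauss ?z) = \<bar>e\<bar> ^ DIM(pt) *\<^sub>R fourier ?g y"
    unfolding gauss_2d(2)[symmetric] fourier_def
    by (subst integral_affine[of e _ 0]) (use e in simp, simp only: rescale)
  then show "fourier ?g y = complex_of_real (2 * pi / e\<^sup>2 * gauss ?z)"
    using e by (simp add: scaleR_conv_of_real power2_eq_square field_simps)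
  show "integrable lborel ?g"
    by (rule Bochner_Integration.integrable_bound[OF gauss_scaled_integrable[OF e]]) (auto simp: norm_mult)
qed

definition gauss_mean :: "(pt \<Rightarrow> complex) \<Rightarrow> real \<Rightarrow> pt \<Rightarrow> complex" where
  "gauss_mean \<phi> e x = (LINT z|lborel. \<phi> (x + e *\<^sub>R z) * complex_of_real (gauss z))"

lemma gauss_mean_measurable [measurable (raw)]:
  assumes [measurable]: "\<phi> \<in> borel_measurable borel"
  shows "gauss_mean \<phi> e \<in> borel_measurable borel"
  unfolding gauss_mean_def[abs_def] by measurable

lemma gauss_mean_bound:
  assumes [measurable]: "\<phi> \<in> borel_measurable borel" and B: "0 \<le> B" "\<And>x. cmod (\<phi> x) \<le> B"
  shows "cmod (gauss_mean \<phi> e x) \<le> B * (2 * pi)"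
proof -
  have "cmod (gauss_mean \<phi> e x) \<le> (LINT z|lborel. cmod (\<phi> (x + e *\<^sub>R z) * complex_of_real (gauss z)))"
    unfolding gauss_mean_def by (rule integral_norm_bound)
  also have "\<dots> \<le> (LINT z|lborel. B * gauss z)"
    using B by (intro integral_mono' integrable_mult_right gauss_integrable) (auto simp: norm_mult intro!: mult_right_mono)
  finally show ?thesis by (simp add: gauss_integral)
qed

lemma gauss_mean_tendsto:
  assumes \<phi>: "continuous_on UNIV \<phi>" "\<And>x. cmod (\<phi> x) \<le> B" and e: "e \<longlonglongrightarrow> 0"
  shows "(\<lambda>k. gauss_mean \<phi> (e k) x) \<longlonglongrightarrow> \<phi> x * (2 * pi)"
proof -
  have [measurable]: "\<phi> \<in> borel_measurable borel" using \<phi>(1) by (rule borel_measurable_continuous_onI)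
  have "(\<lambda>k. gauss_mean \<phi> (e k) x) \<longlonglongrightarrow> (LINT z|lborel. \<phi> x * complex_of_real (gauss z))"
    unfolding gauss_mean_def
  proof (rule integral_dominated_convergence)
    show "AE z in lborel. (\<lambda>k. \<phi> (x + e k *\<^sub>R z) * complex_of_real (gauss z)) \<longlonglongrightarrow> \<phi> x * complex_of_real (gauss z)"
    proof (rule AE_I2)
      fix z :: pt
      have "(\<lambda>k. x + e k *\<^sub>R z) \<longlonglongrightarrow> x + 0 *\<^sub>R z" by (intro tendsto_intros e)
      then have "(\<lambda>k. \<phi> (x + e k *\<^sub>R z)) \<longlonglongrightarrow> \<phi> x"
        by (intro continuous_on_tendsto_compose[OF \<phi>(1)]) auto
      then show "(\<lambda>k. \<phi> (x + e k *\<^sub>R z) * complex_of_real (gauss z)) \<longlonglongrightarrow> \<phi> x * complex_of_real (gauss z)"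
        by (intro tendsto_intros)
    qed
    show "integrable lborel (\<lambda>z. B * gauss z)" by (intro integrable_mult_right gauss_integrable)
    show "AE z in lborel. norm (\<phi> (x + e k *\<^sub>R z) * complex_of_real (gauss z)) \<le> B * gauss z" for k
      using \<phi>(2) by (auto simp: norm_mult intro!: mult_right_mono)
  qed auto
  then show ?thesis by (simp add: gauss_integral)
qed

lemma fourier_cnj_gauss:
  assumes \<phi>: "integrable lborel \<phi>" and e: "0 < (e::real)"
  shows "fourier (\<lambda>\<xi>. cnj (fourier \<phi> \<xi>) * complex_of_real (gauss (e *\<^sub>R \<xi>))) x = cnj (2 * pi * gauss_mean \<phi> e x)"
proof -
  let ?g = "\<lambda>\<xi>. complex_of_real (gauss (e *\<^sub>R \<xi>)) * cis (x \<bullet> \<xi>)"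
  have "fourier (\<lambda>\<xi>. cnj (fourier \<phi> \<xi>) * complex_of_real (gauss (e *\<^sub>R \<xi>))) x = cnj (LINT \<xi>|lborel. fourier \<phi> \<xi> * ?g \<xi>)"
    unfolding fourier_def[of "\<lambda>\<xi>. cnj (fourier \<phi> \<xi>) * _ \<xi>"] cnj_lint
    by (rule Bochner_Integration.integral_cong) (simp_all add: cis_cnj inner_commute mult_ac)
  also have "(LINT \<xi>|lborel. fourier \<phi> \<xi> * ?g \<xi>) = (LINT y|lborel. \<phi> y * fourier ?g y)"
    by (rule fourier_multiplication[OF \<phi> gauss_modulated_fourier(1)[OF e]])
  also have "\<dots> = (LINT y|lborel. \<phi> y * complex_of_real (2 * pi / e\<^sup>2 * gauss ((1/e) *\<^sub>R (y - x))))"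
    by (simp only: gauss_modulated_fourier(2)[OF e])
  also have "\<dots> = e\<^sup>2 *\<^sub>R (LINT z|lborel. \<phi> (x + e *\<^sub>R z) * complex_of_real (2 * pi / e\<^sup>2 * gauss z))"
    using e by (subst integral_affine[of e _ x]) auto
  also have "\<dots> = e\<^sup>2 *\<^sub>R (LINT z|lborel. complex_of_real (2 * pi / e\<^sup>2) * (\<phi> (x + e *\<^sub>R z) * complex_of_real (gauss z)))"
    by (simp only: of_real_mult mult_ac)
  also have "\<dots> = 2 * pi * gauss_mean \<phi> e x"
    unfolding gauss_mean_def using e by (simp only: integral_mult_right_zero) (simp add: scaleR_conv_of_real)
  finally show ?thesis .
qed

lemma fourier_energy_gauss:
  assumes \<phi> [measurable]: "integrable lborel \<phi>" and e: "0 < (e::real)"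
  shows "(LINT \<xi>|lborel. complex_of_real ((cmod (fourier \<phi> \<xi>))\<^sup>2 * gauss (e *\<^sub>R \<xi>))) =
    (LINT x|lborel. \<phi> x * cnj (2 * pi * gauss_mean \<phi> e x))"
proof -
  define h where "h \<xi> = cnj (fourier \<phi> \<xi>) * complex_of_real (gauss (e *\<^sub>R \<xi>))" for \<xi>
  have [measurable]: "\<phi> \<in> borel_measurable borel" using borel_measurable_integrable[OF \<phi>] by simp
  have "integrable lborel h"
  proof (rule Bochner_Integration.integrable_bound)
    show "integrable lborel (\<lambda>\<xi>. (LINT x|lborel. cmod (\<phi> x)) * gauss (e *\<^sub>R \<xi>))"
      by (intro integrable_mult_right gauss_scaled_integrable e)
    show "AE \<xi> in lborel. norm (h \<xi>) \<le> norm ((LINT x|lborel. cmod (\<phi> x)) * gauss (e *\<^sub>R \<xi>))"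
      using fourier_bound[OF \<phi>] by (auto simp: h_def norm_mult intro!: mult_right_mono)
  qed (simp add: h_def[abs_def])
  then have "(LINT \<xi>|lborel. fourier \<phi> \<xi> * h \<xi>) = (LINT x|lborel. \<phi> x * fourier h x)"
    by (rule fourier_multiplication[OF \<phi>])
  also have "fourier h = (\<lambda>x. cnj (2 * pi * gauss_mean \<phi> e x))"
    unfolding h_def[abs_def] by (rule ext) (rule fourier_cnj_gauss[OF \<phi> e])
  finally show ?thesis by (simp add: h_def complex_norm_square mult_ac del: of_real_power)
qed

lemma fourier_energy_gauss_tendsto:
  assumes \<phi>: "testc \<phi>" and e: "\<And>k. 0 < e k" "e \<longlonglongrightarrow> 0"
  shows "(\<lambda>k. LINT \<xi>|lborel. (cmod (fourier \<phi> \<xi>))\<^sup>2 * gauss (e k *\<^sub>R \<xi>)) \<longlonglongrightarrow> (2 * pi * L2norm \<phi>)\<^sup>2"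
proof -
  note [measurable] = testc_measurable[OF \<phi>]
  have int: "integrable lborel \<phi>" by (rule testc_integrable[OF \<phi>])
  obtain B where B: "0 < B" "\<And>x. cmod (\<phi> x) \<le> B" using testc_bound[OF \<phi>] by metis
  have cont: "continuous_on UNIV \<phi>" using \<phi> by (simp add: testc_def)
  have "(\<lambda>k. LINT x|lborel. \<phi> x * cnj (2 * pi * gauss_mean \<phi> (e k) x)) \<longlonglongrightarrow> (LINT x|lborel. \<phi> x * cnj (2 * pi * (\<phi> x * (2 * pi))))"
  proof (rule integral_dominated_convergence[where w="\<lambda>x. cmod (\<phi> x) * (2 * pi * (B * (2 * pi)))"])
    show "integrable lborel (\<lambda>x. cmod (\<phi> x) * (2 * pi * (B * (2 * pi))))"
      using int by auto
    have "cmod (\<phi> x) * (2 * pi * cmod (gauss_mean \<phi> (e k) x)) \<le> cmod (\<phi> x) * (2 * pi * (B * (2 * pi)))" for k x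
      using B by (intro mult_left_mono gauss_mean_bound) auto
    then show "AE x in lborel. norm (\<phi> x * cnj (2 * pi * gauss_mean \<phi> (e k) x))
        \<le> cmod (\<phi> x) * (2 * pi * (B * (2 * pi)))" for k
      by (simp add: norm_mult)
    show "AE x in lborel. (\<lambda>k. \<phi> x * cnj (2 * pi * gauss_mean \<phi> (e k) x)) \<longlonglongrightarrow> \<phi> x * cnj (2 * pi * (\<phi> x * (2 * pi)))"
      by (intro AE_I2 tendsto_intros gauss_mean_tendsto[OF cont B(2) e(2)])
  qed auto
  also have "(LINT x|lborel. \<phi> x * cnj (2 * pi * (\<phi> x * (2 * pi))))
      = (LINT x|lborel. complex_of_real ((2*pi)\<^sup>2) * complex_of_real ((cmod (\<phi> x))\<^sup>2))"
    by (intro Bochner_Integration.integral_cong refl) (simp only: complex_norm_square, simp add: power2_eq_square mult_ac)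
  also have "\<dots> = complex_of_real ((2 * pi * L2norm \<phi>)\<^sup>2)"
    unfolding power_mult_distrib[of "2 * pi"] L2norm_squared L2norm_sq_def of_real_mult integral_complex_of_real[symmetric]
    by (rule integral_mult_right_zero)
  finally show ?thesis
    unfolding fourier_energy_gauss[OF int e(1), symmetric] integral_complex_of_real tendsto_of_real_iff .
qed

lemma nn_integral_fourier_gauss_tendsto:
  assumes \<phi> [measurable]: "integrable lborel \<phi>" and e: "\<And>k. 0 < e k" "decseq e" "e \<longlonglongrightarrow> 0"
  shows "(\<lambda>k. ennreal (LINT \<xi>|lborel. (cmod (fourier \<phi> \<xi>))\<^sup>2 * gauss (e k *\<^sub>R \<xi>)))
     \<longlonglongrightarrow> (\<integral>\<^sup>+\<xi>. ennreal ((cmod (fourier \<phi> \<xi>))\<^sup>2) \<partial>lborel)"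
proof -
  let ?f = "\<lambda>k \<xi>. (cmod (fourier \<phi> \<xi>))\<^sup>2 * gauss (e k *\<^sub>R \<xi>)"
  have [measurable]: "\<phi> \<in> borel_measurable borel" using borel_measurable_integrable[OF \<phi>] by simp
  have "integrable lborel (?f k)" for k
  proof (rule Bochner_Integration.integrable_bound)
    show "integrable lborel (\<lambda>\<xi>. (LINT x|lborel. cmod (\<phi> x))\<^sup>2 * gauss (e k *\<^sub>R \<xi>))"
      by (intro integrable_mult_right gauss_scaled_integrable e)
  qed (auto intro!: mult_right_mono power_mono fourier_bound[OF \<phi>])
  then have as_nn: "ennreal (LINT \<xi>|lborel. ?f k \<xi>) = (\<integral>\<^sup>+\<xi>. ennreal (?f k \<xi>) \<partial>lborel)" for k
    by (rule nn_integral_eq_integral[symmetric]) auto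
  show ?thesis unfolding as_nn
  proof (rule nn_integral_LIMSEQ)
    show "incseq (\<lambda>k \<xi>. ennreal (?f k \<xi>))"
    proof (rule incseq_SucI, rule le_funI)
      fix k and \<xi> :: pt
      have "(e (Suc k) * norm \<xi>)\<^sup>2 \<le> (e k * norm \<xi>)\<^sup>2"
        using decseq_SucD[OF e(2)] by (intro power_mono mult_right_mono) (auto simp: less_imp_le[OF e(1)])
      then show "ennreal (?f k \<xi>) \<le> ennreal (?f (Suc k) \<xi>)"
        unfolding gauss_def using e(1) by (intro ennreal_leI mult_left_mono) (auto simp: abs_of_pos)
    qed
    fix \<xi> :: pt
    have "(\<lambda>k. ?f k \<xi>) \<longlonglongrightarrow> (cmod (fourier \<phi> \<xi>))\<^sup>2 * exp (- (norm (0 *\<^sub>R \<xi>))\<^sup>2 / 2)"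
      unfolding gauss_def by (intro tendsto_intros e(3)) auto
    then show "(\<lambda>k. ennreal (?f k \<xi>)) \<longlonglongrightarrow> ennreal ((cmod (fourier \<phi> \<xi>))\<^sup>2)"
      by (intro tendsto_ennrealI) simp
  qed auto
qed

theorem plancherel_testc:
  assumes \<phi>: "testc \<phi>"
  shows "L2c (fourier \<phi>)" "L2norm (fourier \<phi>) = 2 * pi * L2norm \<phi>"
proof -
  note [measurable] = testc_measurable[OF \<phi>]
  define e where "e k = 1 / real (Suc k)" for k
  have "decseq e" by (rule decseq_SucI) (simp add: e_def frac_le)
  have "e \<longlonglongrightarrow> 0" unfolding e_def by (rule LIMSEQ_Suc[OF lim_1_over_n])
  have "0 < e k" for k by (simp add: e_def)
  note e = this \<open>decseq e\<close> \<open>e \<longlonglongrightarrow> 0\<close>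
  have energy: "(\<integral>\<^sup>+\<xi>. ennreal ((cmod (fourier \<phi> \<xi>))\<^sup>2) \<partial>lborel) = ennreal ((2 * pi * L2norm \<phi>)\<^sup>2)"
    by (rule LIMSEQ_unique[OF nn_integral_fourier_gauss_tendsto[OF testc_integrable[OF \<phi>] e]
          tendsto_ennrealI[OF fourier_energy_gauss_tendsto[OF \<phi> e(1,3)]]])
  show L2c: "L2c (fourier \<phi>)" by (rule L2c_nn_leI(1)[where B="2 * pi * L2norm \<phi>"]) (auto simp: energy)
  have "(L2norm (fourier \<phi>))\<^sup>2 = (2 * pi * L2norm \<phi>)\<^sup>2"
    using energy L2c_nn_integral[OF L2c] by simp
  then show "L2norm (fourier \<phi>) = 2 * pi * L2norm \<phi>"
    by (rule power2_eq_imp_eq) auto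
qed

section \<open>The Plancherel transform\<close>

lemma tendsto_of_norm_diff_le:
  fixes f :: "'b \<Rightarrow> 'a::real_normed_vector"
  assumes "eventually (\<lambda>x. norm (f x - l) \<le> e x) F" "(e \<longlongrightarrow> 0) F"
  shows "(f \<longlongrightarrow> l) F"
  by (rule LIM_zero_cancel) (rule Lim_null_comparison[OF assms])

lemma L2_pairing_tendsto:
  assumes f: "\<And>k::nat. L2c (f k)" and g: "L2c g" and h: "L2c h"
    and lim: "(\<lambda>k. L2norm (\<lambda>x. f k x - g x)) \<longlonglongrightarrow> 0"
  shows "(\<lambda>k. LINT x|lborel. f k x * h x) \<longlonglongrightarrow> (LINT x|lborel. g x * h x)"
proof (rule tendsto_of_norm_diff_le[OF always_eventually tendsto_mult_left_zero[OF lim]], rule allI)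
  fix k
  have "(LINT x|lborel. f k x * h x) - (LINT x|lborel. g x * h x) = (LINT x|lborel. (f k x - g x) * h x)"
    using L2c_mult_integrable[OF f h, of k] L2c_mult_integrable[OF g h] by (simp add: left_diff_distrib)
  then show "cmod ((LINT x|lborel. f k x * h x) - (LINT x|lborel. g x * h x)) \<le> L2norm (\<lambda>x. f k x - g x) * L2norm h"
    using L2_Cauchy_Schwarz_integral[OF L2c_diff[OF f g] h, of k] by simp
qed

lemma L2norm_tendsto:
  assumes f: "\<And>k::nat. L2c (f k)" and g: "L2c g"
    and lim: "(\<lambda>k. L2norm (\<lambda>x. f k x - g x)) \<longlonglongrightarrow> 0"
  shows "(\<lambda>k. L2norm (f k)) \<longlonglongrightarrow> L2norm g"
  by (rule tendsto_of_norm_diff_le[OF _ lim]) (use L2norm_reverse_triangle[OF f g] in auto)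

lemma L2_convergent_imp_Cauchy:
  assumes f: "\<And>k::nat. L2c (f k)" and g: "L2c g"
    and lim: "(\<lambda>k. L2norm (\<lambda>x. f k x - g x)) \<longlonglongrightarrow> 0" and "0 < e"
  shows "\<exists>N. \<forall>j\<ge>N. \<forall>k\<ge>N. L2norm (\<lambda>x. f j x - f k x) \<le> e"
proof -
  have "eventually (\<lambda>k. L2norm (\<lambda>x. f k x - g x) < e/2) sequentially"
    using lim \<open>0 < e\<close> by (intro order_tendstoD) auto
  then obtain N where N: "\<And>k. k \<ge> N \<Longrightarrow> L2norm (\<lambda>x. f k x - g x) < e/2" by (auto simp: eventually_sequentially)
  have "L2norm (\<lambda>x. f j x - f k x) \<le> e" if "j \<ge> N" "k \<ge> N" for j k
    using L2norm_triangle_diff[OF f g f, of j k] N[OF that(1)] N[OF that(2)] by (simp add: L2norm_minus_commute[of g])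
  then show ?thesis by blast
qed

lemma L2norm_eq_0_AE:
  assumes "L2c f" "L2norm f = 0" shows "AE x in lborel. f x = 0"
proof -
  have "(LINT x|lborel. (cmod (f x))\<^sup>2) = 0" using assms(2) by (simp add: L2norm_def L2norm_sq_def)
  then show ?thesis
    by (subst (asm) integral_nonneg_eq_0_iff_AE[OF L2c_integrable[OF assms(1)]]) auto
qed

lemma testc_L2_approximation:
  assumes f: "L2c f"
  obtains \<phi> where "\<And>k::nat. testc (\<phi> k)" "(\<lambda>k. L2norm (\<lambda>x. \<phi> k x - f x)) \<longlonglongrightarrow> 0"
proof -
  have "\<exists>\<phi>. testc \<phi> \<and> L2norm (\<lambda>x. \<phi> x - f x) < inverse (real (Suc k))" for k
    using testc_dense[OF f, of "inverse (real (Suc k))"] by auto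
  then obtain \<phi> where \<phi>: "\<And>k. testc (\<phi> k)" "\<And>k. L2norm (\<lambda>x. \<phi> k x - f x) < inverse (real (Suc k))" by metis
  have "(\<lambda>k. L2norm (\<lambda>x. \<phi> k x - f x)) \<longlonglongrightarrow> 0"
    by (rule tendsto_of_norm_diff_le[OF _ LIMSEQ_inverse_real_of_nat]) (use \<phi>(2) in \<open>auto simp del: of_nat_Suc intro!: always_eventually less_imp_le\<close>)
  with \<phi>(1) show thesis by (rule that)
qed

lemma testc_orthogonal_AE:
  assumes q: "L2c q" and orthogonal: "\<And>\<psi>. testc \<psi> \<Longrightarrow> (LINT x|lborel. q x * \<psi> x) = 0"
  shows "AE x in lborel. q x = 0"
proof -
  obtain \<phi> where \<phi>: "\<And>k::nat. testc (\<phi> k)" "(\<lambda>k. L2norm (\<lambda>x. \<phi> k x - cnj (q x))) \<longlonglongrightarrow> 0"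
    using testc_L2_approximation[OF L2c_cnj[OF q]] by blast
  have "(\<lambda>k. LINT x|lborel. q x * \<phi> k x) \<longlonglongrightarrow> (LINT x|lborel. q x * cnj (q x))"
    using L2_pairing_tendsto[OF testc_L2c[OF \<phi>(1)] L2c_cnj[OF q] q \<phi>(2)] by (simp only: mult.commute)
  then have "(LINT x|lborel. q x * cnj (q x)) = 0"
    using orthogonal[OF \<phi>(1)] by (simp add: LIMSEQ_const_iff)
  moreover have "(LINT x|lborel. q x * cnj (q x)) = complex_of_real ((L2norm q)\<^sup>2)"
    unfolding L2norm_squared L2norm_sq_def integral_complex_of_real[symmetric] complex_norm_square ..
  ultimately have "L2norm q = 0" by simp
  then show ?thesis by (rule L2norm_eq_0_AE[OF q])
qed

lemma testc_orthogonal_locally_AE: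
  assumes q: "\<And>k::nat. L2c (\<lambda>x. q x * bump k x)" and orthogonal: "\<And>\<psi>. testc \<psi> \<Longrightarrow> (LINT x|lborel. q x * \<psi> x) = 0"
  shows "AE x in lborel. q x = 0"
proof -
  have "AE x in lborel. q x * bump k x = 0" for k :: nat
  proof (rule testc_orthogonal_AE[OF q])
    fix \<psi> assume "testc \<psi>"
    then have "testc (\<lambda>x. bump k x * \<psi> x)" by (rule testc_mult_continuous) (use testc_bump in \<open>simp add: testc_def\<close>)
    from orthogonal[OF this] show "(LINT x|lborel. q x * bump k x * \<psi> x) = 0" by (simp only: mult.assoc)
  qed
  then have "AE x in lborel. \<forall>k::nat. q x * bump k x = 0" unfolding AE_all_countable by (intro allI)
  then show ?thesis
  proof eventually_elim
    case (elim x)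
    obtain k :: nat where "norm x \<le> real k" using real_arch_simple by blast
    then show ?case using elim[rule_format, of k] by (simp add: bump_eq_1)
  qed
qed

lemma is_FT_testc: assumes "testc \<phi>" shows "is_FT \<phi> (fourier \<phi>)"
  unfolding is_FT_def
  using testc_L2c[OF assms] plancherel_testc(1)[OF assms]
    fourier_multiplication[OF testc_integrable[OF assms] testc_integrable] by auto

lemma is_FT_L2c: "is_FT f g \<Longrightarrow> L2c f" "is_FT f g \<Longrightarrow> L2c g"
  by (auto simp: is_FT_def)

lemma is_FT_add:
  assumes "is_FT f g" "is_FT f' g'" shows "is_FT (\<lambda>x. f x + f' x) (\<lambda>x. g x + g' x)"
  unfolding is_FT_def
proof (intro conjI allI impI)
  fix \<phi> assume \<phi>: "testc \<phi>"
  note L2c = is_FT_L2c[OF assms(1)] is_FT_L2c[OF assms(2)]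
  note \<phi>_L2c = plancherel_testc(1)[OF \<phi>] testc_L2c[OF \<phi>]
  show "(LINT x|lborel. (f x + f' x) * fourier \<phi> x) = (LINT \<xi>|lborel. (g \<xi> + g' \<xi>) * \<phi> \<xi>)"
    using assms \<phi> L2c_mult_integrable[OF L2c(1) \<phi>_L2c(1)] L2c_mult_integrable[OF L2c(3) \<phi>_L2c(1)]
      L2c_mult_integrable[OF L2c(2) \<phi>_L2c(2)] L2c_mult_integrable[OF L2c(4) \<phi>_L2c(2)]
    unfolding is_FT_def by (simp add: distrib_right)
qed (use assms in \<open>auto simp: is_FT_def\<close>)

lemma is_FT_cmult:
  assumes "is_FT f g" shows "is_FT (\<lambda>x. c * f x) (\<lambda>x. c * g x)"
  using assms unfolding is_FT_def by (auto simp: mult.assoc)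

lemma is_FT_diff:
  assumes "is_FT f g" "is_FT f' g'" shows "is_FT (\<lambda>x. f x - f' x) (\<lambda>x. g x - g' x)"
  using is_FT_add[OF assms(1) is_FT_cmult[OF assms(2), of "-1"]] by simp

lemma is_FT_cong_AE:
  assumes FT: "is_FT f g" and [measurable]: "f' \<in> borel_measurable borel" "g' \<in> borel_measurable borel"
    and AE: "AE x in lborel. f x = f' x" "AE x in lborel. g x = g' x"
  shows "is_FT f' g'"
  unfolding is_FT_def
proof (intro conjI allI impI)
  note L2c [measurable] = is_FT_L2c[OF FT]
  show "L2c f'" "L2c g'" using L2c_cong_AE[OF L2c(1) _ AE(1)] L2c_cong_AE[OF L2c(2) _ AE(2)] by auto
  fix \<phi> assume \<phi> [measurable]: "testc \<phi>"
  note [measurable] = plancherel_testc(1)[OF \<phi>]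
  have "(LINT x|lborel. f x * fourier \<phi> x) = (LINT x|lborel. f' x * fourier \<phi> x)"
    using AE(1) by (intro integral_cong_AE) auto
  moreover have "(LINT x|lborel. g x * \<phi> x) = (LINT x|lborel. g' x * \<phi> x)"
    using AE(2) by (intro integral_cong_AE) auto
  ultimately show "(LINT x|lborel. f' x * fourier \<phi> x) = (LINT x|lborel. g' x * \<phi> x)"
    using FT \<phi> unfolding is_FT_def by auto
qed

lemma is_FT_unique:
  assumes "is_FT f g" "is_FT f g'" shows "AE x in lborel. g x = g' x"
proof -
  have "is_FT (\<lambda>x. f x - f x) (\<lambda>x. g x - g' x)" by (rule is_FT_diff[OF assms])
  then have "AE x in lborel. g x - g' x = 0"
    by (intro testc_orthogonal_AE) (auto simp: is_FT_def)
  then show ?thesis by simp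
qed

lemma is_FT_closed:
  assumes FT: "\<And>k::nat. is_FT (f k) (g k)" and L2c: "L2c u" "L2c v"
    and lim: "(\<lambda>k. L2norm (\<lambda>x. f k x - u x)) \<longlonglongrightarrow> 0" "(\<lambda>k. L2norm (\<lambda>x. g k x - v x)) \<longlonglongrightarrow> 0"
  shows "is_FT u v"
  unfolding is_FT_def
proof (intro conjI allI impI L2c)
  fix \<psi> assume \<psi>: "testc \<psi>"
  have "(\<lambda>k. LINT x|lborel. f k x * fourier \<psi> x) \<longlonglongrightarrow> (LINT x|lborel. u x * fourier \<psi> x)"
    by (rule L2_pairing_tendsto[OF is_FT_L2c(1)[OF FT] L2c(1) plancherel_testc(1)[OF \<psi>] lim(1)])
  moreover have "(\<lambda>k. LINT x|lborel. g k x * \<psi> x) \<longlonglongrightarrow> (LINT x|lborel. v x * \<psi> x)"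
    by (rule L2_pairing_tendsto[OF is_FT_L2c(2)[OF FT] L2c(2) testc_L2c[OF \<psi>] lim(2)])
  ultimately show "(LINT x|lborel. u x * fourier \<psi> x) = (LINT x|lborel. v x * \<psi> x)"
    using FT \<psi> by (auto simp: is_FT_def intro: LIMSEQ_unique)
qed

theorem is_FT_exists_isometric:
  assumes f: "L2c f"
  shows "\<exists>g. is_FT f g \<and> L2norm g = 2 * pi * L2norm f"
proof -
  obtain \<phi> where \<phi>: "\<And>k::nat. testc (\<phi> k)" "(\<lambda>k. L2norm (\<lambda>x. \<phi> k x - f x)) \<longlonglongrightarrow> 0"
    using testc_L2_approximation[OF f] by blast
  note \<phi>_L2c = testc_L2c[OF \<phi>(1)] and F_L2c = plancherel_testc(1)[OF \<phi>(1)]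
  have isometry: "L2norm (\<lambda>\<xi>. fourier (\<phi> j) \<xi> - fourier (\<phi> k) \<xi>) = 2 * pi * L2norm (\<lambda>x. \<phi> j x - \<phi> k x)" for j k
    unfolding fourier_diff[OF testc_integrable[OF \<phi>(1)] testc_integrable[OF \<phi>(1)], symmetric]
    by (rule plancherel_testc(2)[OF testc_diff[OF \<phi>(1) \<phi>(1)]])
  obtain g where g: "L2c g" "(\<lambda>k. L2norm (\<lambda>x. fourier (\<phi> k) x - g x)) \<longlonglongrightarrow> 0"
  proof (rule L2_complete[of "\<lambda>k. fourier (\<phi> k)", OF F_L2c])
    fix e :: real assume "0 < e"
    then show "\<exists>N. \<forall>j\<ge>N. \<forall>k\<ge>N. L2norm (\<lambda>x. fourier (\<phi> j) x - fourier (\<phi> k) x) \<le> e"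
      using L2_convergent_imp_Cauchy[OF \<phi>_L2c f \<phi>(2), of "e / (2 * pi)"] unfolding isometry by (simp add: field_simps)
  qed
  have "(\<lambda>k. L2norm (fourier (\<phi> k))) \<longlonglongrightarrow> 2 * pi * L2norm f"
    unfolding plancherel_testc(2)[OF \<phi>(1)] by (intro tendsto_intros L2norm_tendsto[OF \<phi>_L2c f \<phi>(2)])
  then have "L2norm g = 2 * pi * L2norm f"
    using L2norm_tendsto[OF F_L2c g] by (rule LIMSEQ_unique[rotated])
  with is_FT_closed[OF is_FT_testc[OF \<phi>(1)] f g(1) \<phi>(2) g(2)] show ?thesis by blast
qed

lemma is_FT_L2norm:
  assumes "is_FT f g" shows "L2norm g = 2 * pi * L2norm f"
proof -
  obtain g' where g': "is_FT f g'" "L2norm g' = 2 * pi * L2norm f"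
    using is_FT_exists_isometric[OF is_FT_L2c(1)[OF assms]] by auto
  have "L2norm g = L2norm g'"
    using is_FT_L2c[OF assms] is_FT_L2c[OF g'(1)]
    by (intro L2norm_cong_AE is_FT_unique[OF assms g'(1)]) (auto simp: L2c_def)
  with g' show ?thesis by simp
qed

lemma FTL2_is_FT: "L2c f \<Longrightarrow> is_FT f (FTL2 f)"
  unfolding FTL2_def using is_FT_exists_isometric by (metis someI)

lemma is_FT_FTL2: "is_FT f g \<Longrightarrow> AE x in lborel. FTL2 f x = g x"
  by (rule is_FT_unique[OF FTL2_is_FT]) (auto dest: is_FT_L2c)

lemma is_FT_inj:
  assumes "is_FT f g" "is_FT f' g'" "AE x in lborel. g x = g' x"
  shows "AE x in lborel. f x = f' x"
proof -
  have diff: "is_FT (\<lambda>x. f x - f' x) (\<lambda>x. g x - g' x)" by (rule is_FT_diff[OF assms(1,2)])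
  have "L2norm (\<lambda>x. g x - g' x) = L2norm (\<lambda>x. 0)"
    using assms(3) is_FT_L2c(2)[OF diff] by (intro L2norm_cong_AE) (auto simp: L2c_def)
  then have "L2norm (\<lambda>x. f x - f' x) = 0" using is_FT_L2norm[OF diff] by simp
  from L2norm_eq_0_AE[OF is_FT_L2c(1)[OF diff] this] show ?thesis by simp
qed

lemma L2norm_sq_add:
  assumes "L2c f" "L2c g"
  shows "L2norm_sq (\<lambda>x. f x + g x) = L2norm_sq f + L2norm_sq g + 2 * Re (LINT x|lborel. f x * cnj (g x))"
proof -
  have int: "integrable lborel (\<lambda>x. f x * cnj (g x))"
    by (rule L2c_mult_integrable[OF assms(1) L2c_cnj[OF assms(2)]])
  have "L2norm_sq (\<lambda>x. f x + g x) = (LINT x|lborel. (cmod (f x))\<^sup>2 + (cmod (g x))\<^sup>2 + 2 * Re (f x * cnj (g x)))"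
    unfolding L2norm_sq_def
    by (intro Bochner_Integration.integral_cong refl) (simp add: cmod_add_squared cmod_power2 power2_sum algebra_simps)
  also have "\<dots> = L2norm_sq f + L2norm_sq g + 2 * (LINT x|lborel. Re (f x * cnj (g x)))"
    using integrable_Re[OF int] L2c_integrable[OF assms(1)] L2c_integrable[OF assms(2)]
    unfolding L2norm_sq_def by (simp del: times_complex.sel)
  finally show ?thesis unfolding integral_Re[OF int] .
qed

definition plancherel_const :: real where
  "plancherel_const = 1 / (2*pi)\<^sup>2"

theorem parseval:
  assumes "is_FT f g" "is_FT f' g'"
  shows "(LINT \<xi>|lborel. g \<xi> * cnj (g' \<xi>)) = (2*pi)\<^sup>2 * (LINT x|lborel. f x * cnj (f' x))" (is "?I g g' = _ * ?I f f'")
proof -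
  have isometry: "L2norm_sq b = (2*pi)\<^sup>2 * L2norm_sq a" if "is_FT a b" for a b
    using is_FT_L2norm[OF that] unfolding L2norm_squared[symmetric] by (simp add: power_mult_distrib)
  have polarize: "Re (?I g b) = (2*pi)\<^sup>2 * Re (?I f a)" if "is_FT a b" for a b
    using isometry[OF is_FT_add[OF assms(1) that]] isometry[OF assms(1)] isometry[OF that]
      L2norm_sq_add[OF is_FT_L2c(1)[OF assms(1)] is_FT_L2c(1)[OF that]]
      L2norm_sq_add[OF is_FT_L2c(2)[OF assms(1)] is_FT_L2c(2)[OF that]]
    by (simp add: algebra_simps)
  have rotate: "?I u (\<lambda>x. \<i> * v x) = - \<i> * ?I u v" for u v :: "pt \<Rightarrow> complex"
    unfolding integral_mult_right_zero[symmetric] by (intro Bochner_Integration.integral_cong refl) simp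
  have "Im (?I g g') = (2*pi)\<^sup>2 * Im (?I f f')"
    using polarize[OF is_FT_cmult[OF assms(2), of \<i>]] unfolding rotate by simp
  with polarize[OF assms(2)] have "?I g g' = ((2*pi)\<^sup>2) *\<^sub>R ?I f f'"
    by (intro complex_eqI) simp_all
  then show ?thesis by (simp add: scaleR_conv_of_real)
qed

theorem is_FT_inverse_exists:
  assumes g: "L2c g" shows "\<exists>h. is_FT h g"
proof -
  note G = FTL2_is_FT[OF g]
  define h where "h x = complex_of_real plancherel_const * FTL2 g (- x)" for x
  have h: "L2c h" unfolding h_def by (intro L2c_cmult L2c_uminus_arg is_FT_L2c(2)[OF G])
  have "(LINT x|lborel. h x * fourier \<phi> x) = (LINT x|lborel. g x * \<phi> x)" if \<phi>: "testc \<phi>" for \<phi>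
  proof -
    have cnj_\<phi>: "testc (\<lambda>x. cnj (\<phi> x))" using \<phi> unfolding testc_def by (auto intro: continuous_on_cnj)
    have "(LINT x|lborel. h x * fourier \<phi> x) = (LINT x|lborel. h (-x) * fourier \<phi> (- x))"
      using integral_uminus[of "\<lambda>x. h x * fourier \<phi> x"] by simp
    also have "\<dots> = (LINT x|lborel. complex_of_real plancherel_const * (FTL2 g x * cnj (fourier (\<lambda>x. cnj (\<phi> x)) x)))"
      by (simp add: h_def fourier_cnj mult.assoc)
    also have "\<dots> = complex_of_real plancherel_const * ((2*pi)\<^sup>2 * (LINT x|lborel. g x * cnj (cnj (\<phi> x))))"
      by (simp only: integral_mult_right_zero parseval[OF G is_FT_testc[OF cnj_\<phi>]])
    also have "\<dots> = (LINT x|lborel. g x * \<phi> x)" by (simp add: plancherel_const_def)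
    finally show ?thesis .
  qed
  with g h show ?thesis unfolding is_FT_def by blast
qed

lemma is_FT_cnj:
  assumes "is_FT f g" shows "is_FT (\<lambda>x. cnj (f x)) (\<lambda>\<xi>. cnj (g (- \<xi>)))"
  unfolding is_FT_def
proof (intro conjI allI impI)
  show "L2c (\<lambda>x. cnj (f x))" "L2c (\<lambda>\<xi>. cnj (g (- \<xi>)))" using is_FT_L2c[OF assms] by auto
  fix \<phi> assume \<phi>: "testc \<phi>"
  define \<psi> where "\<psi> x = cnj (\<phi> (- x))" for x
  obtain R where "\<And>x. norm x > R \<Longrightarrow> \<phi> x = 0" using testc_bound[OF \<phi>] by metis
  then have \<psi>: "testc \<psi>" using \<phi> unfolding \<psi>_def testc_def[of \<phi>]
    by (intro testcI[of _ R]) (auto intro!: continuous_intros continuous_on_compose2[of UNIV \<phi>])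
  have "fourier \<psi> x = cnj (fourier \<phi> x)" for x
    unfolding fourier_def cnj_lint \<psi>_def by (subst integral_uminus[symmetric]) (simp add: cis_cnj)
  then have "(LINT x|lborel. cnj (f x) * fourier \<phi> x) = cnj (LINT x|lborel. f x * fourier \<psi> x)"
    unfolding cnj_lint by simp
  also have "(LINT x|lborel. f x * fourier \<psi> x) = (LINT x|lborel. g x * \<psi> x)"
    using assms \<psi> by (simp add: is_FT_def)
  also have "cnj \<dots> = (LINT x|lborel. cnj (g (- x)) * \<phi> x)"
    unfolding cnj_lint by (subst integral_uminus[symmetric]) (simp add: \<psi>_def)
  finally show "(LINT x|lborel. cnj (f x) * fourier \<phi> x) = (LINT x|lborel. cnj (g (- x)) * \<phi> x)" .
qed

lemma is_FT_fourier:
  assumes h [measurable]: "L2c h" and int: "integrable lborel h"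
  shows "is_FT h (fourier h)"
proof -
  note FT = FTL2_is_FT[OF h]
  note FTL2 [measurable] = is_FT_L2c(2)[OF FT]
  have [measurable]: "h \<in> borel_measurable borel" by simp
  have [measurable]: "bump r \<in> borel_measurable borel" for r by (rule testc_measurable[OF testc_bump])
  have "AE \<xi> in lborel. FTL2 h \<xi> - fourier h \<xi> = 0"
  proof (rule testc_orthogonal_locally_AE)
    fix k :: nat
    have "L2c (\<lambda>\<xi>. FTL2 h \<xi> * bump k \<xi>)"
      by (rule L2c_mono(1)[OF FTL2, where B=1]) (use cmod_bump_le in \<open>auto simp: norm_mult mult_left_le\<close>)
    moreover have "L2c (\<lambda>\<xi>. fourier h \<xi> * bump k \<xi>)"
      by (rule L2c_mono(1)[OF testc_L2c[OF testc_bump[of k]], where B="LINT x|lborel. cmod (h x)"])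
         (use fourier_bound[OF int] in \<open>auto simp: norm_mult intro!: mult_right_mono\<close>)
    ultimately show "L2c (\<lambda>\<xi>. (FTL2 h \<xi> - fourier h \<xi>) * bump k \<xi>)"
      unfolding left_diff_distrib by (rule L2c_diff)
  next
    fix \<psi> assume \<psi> [measurable]: "testc \<psi>"
    have "integrable lborel (\<lambda>\<xi>. fourier h \<xi> * \<psi> \<xi>)"
      by (rule Bochner_Integration.integrable_bound[OF integrable_mult_right[OF integrable_norm[OF testc_integrable[OF \<psi>]], of "LINT x|lborel. cmod (h x)"]])
         (use fourier_bound[OF int] in \<open>auto simp: norm_mult intro!: mult_right_mono\<close>)
    then have "(LINT \<xi>|lborel. (FTL2 h \<xi> - fourier h \<xi>) * \<psi> \<xi>)
        = (LINT \<xi>|lborel. FTL2 h \<xi> * \<psi> \<xi>) - (LINT \<xi>|lborel. fourier h \<xi> * \<psi> \<xi>)"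
      using L2c_mult_integrable[OF FTL2 testc_L2c[OF \<psi>]] by (simp add: left_diff_distrib)
    also have "\<dots> = 0"
      using FT \<psi> fourier_multiplication[OF int testc_integrable[OF \<psi>]] unfolding is_FT_def by simp
    finally show "(LINT \<xi>|lborel. (FTL2 h \<xi> - fourier h \<xi>) * \<psi> \<xi>) = 0" .
  qed
  then show ?thesis by (intro is_FT_cong_AE[OF FT]) auto
qed

lemma parseval_mult:
  assumes f: "is_FT f g" and h: "L2c h" and int: "integrable lborel h"
  shows "(LINT x|lborel. f x * h x) = complex_of_real plancherel_const * (LINT \<xi>|lborel. g \<xi> * fourier h (- \<xi>))"
proof -
  have "is_FT (\<lambda>x. cnj (h x)) (fourier (\<lambda>x. cnj (h x)))"
    by (rule is_FT_fourier) (use h int in auto)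
  from parseval[OF f this] show ?thesis by (simp add: fourier_cnj plancherel_const_def)
qed

lemma fourier_mult_testc:
  assumes v: "is_FT v V" and \<phi>: "testc \<phi>"
  shows "fourier (\<lambda>x. v x * \<phi> x) (- \<zeta>)
      = complex_of_real plancherel_const * (LINT \<eta>|lborel. V \<eta> * fourier \<phi> (- (\<zeta> + \<eta>)))"
proof -
  define \<psi> where "\<psi> x = cis (x \<bullet> \<zeta>) * \<phi> x" for x
  have \<psi>: "testc \<psi>" unfolding \<psi>_def by (intro testc_mult_continuous \<phi> continuous_intros)
  have "fourier \<psi> (- \<eta>) = fourier \<phi> (- (\<zeta> + \<eta>))" for \<eta>
    unfolding fourier_def \<psi>_def by (simp add: mult_ac cis_mult inner_add_right inner_diff_right)
  moreover have "fourier (\<lambda>x. v x * \<phi> x) (- \<zeta>) = (LINT x|lborel. v x * \<psi> x)"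
    by (simp add: fourier_def \<psi>_def mult_ac)
  ultimately show ?thesis using parseval_mult[OF v testc_L2c[OF \<psi>] testc_integrable[OF \<psi>]] by simp
qed

lemma integrable_shear:
  fixes F :: "'a::euclidean_space \<Rightarrow> 'a \<Rightarrow> complex"
  assumes int: "integrable lborel2 (\<lambda>(\<xi>, \<eta>). F \<xi> \<eta>)" and [measurable]: "(\<lambda>(\<xi>, \<eta>). F \<xi> \<eta>) \<in> borel_measurable (borel \<Otimes>\<^sub>M borel)"
  shows "integrable lborel2 (\<lambda>(\<zeta>, \<eta>). F (\<zeta> + \<eta>) \<eta>)"
proof (rule integrableI_bounded)
  have "(\<integral>\<^sup>+p. norm (case p of (\<zeta>, \<eta>) \<Rightarrow> F (\<zeta> + \<eta>) \<eta>) \<partial>lborel2)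
      = (\<integral>\<^sup>+\<eta>. \<integral>\<^sup>+\<zeta>. ennreal (cmod (F (\<zeta> + \<eta>) \<eta>)) \<partial>lborel \<partial>lborel)"
    by (subst lborel_pair.nn_integral_snd[symmetric]) auto
  also have "\<dots> = (\<integral>\<^sup>+\<eta>. \<integral>\<^sup>+\<xi>. ennreal (cmod (F \<xi> \<eta>)) \<partial>lborel \<partial>lborel)"
  proof (rule nn_integral_cong)
    fix \<eta> show "(\<integral>\<^sup>+\<zeta>. ennreal (cmod (F (\<zeta> + \<eta>) \<eta>)) \<partial>lborel) = (\<integral>\<^sup>+\<xi>. ennreal (cmod (F \<xi> \<eta>)) \<partial>lborel)"
      by (subst nn_integral_shift[of _ \<eta>, symmetric]) simp_all
  qed
  also have "\<dots> = (\<integral>\<^sup>+p. norm (case p of (\<xi>, \<eta>) \<Rightarrow> F \<xi> \<eta>) \<partial>lborel2)"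
    by (subst lborel_pair.nn_integral_snd[symmetric]) auto
  also have "\<dots> < \<infinity>" using int by (simp add: integrable_iff_bounded)
  finally show "(\<integral>\<^sup>+p. norm (case p of (\<zeta>, \<eta>) \<Rightarrow> F (\<zeta> + \<eta>) \<eta>) \<partial>lborel2) < \<infinity>" .
qed measurable

lemma integral_shear:
  fixes F :: "'a::euclidean_space \<Rightarrow> 'a \<Rightarrow> complex"
  assumes int: "integrable lborel2 (\<lambda>(\<xi>, \<eta>). F \<xi> \<eta>)" and F: "(\<lambda>(\<xi>, \<eta>). F \<xi> \<eta>) \<in> borel_measurable (borel \<Otimes>\<^sub>M borel)"
  shows "(LINT \<zeta>|lborel. LINT \<eta>|lborel. F (\<zeta> + \<eta>) \<eta>) = (LINT \<xi>|lborel. LINT \<eta>|lborel. F \<xi> \<eta>)"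
proof -
  have "(LINT \<zeta>|lborel. LINT \<eta>|lborel. F (\<zeta> + \<eta>) \<eta>) = (LINT \<eta>|lborel. LINT \<zeta>|lborel. F (\<zeta> + \<eta>) \<eta>)"
    by (rule lborel_pair.Fubini_integral[OF integrable_shear[OF int F], symmetric])
  also have "\<dots> = (LINT \<eta>|lborel. LINT \<xi>|lborel. F \<xi> \<eta>)"
  proof (rule Bochner_Integration.integral_cong[OF refl])
    fix \<eta> show "(LINT \<zeta>|lborel. F (\<zeta> + \<eta>) \<eta>) = (LINT \<xi>|lborel. F \<xi> \<eta>)"
      by (subst integral_shift[of _ \<eta>, symmetric]) simp
  qed
  also have "\<dots> = (LINT \<xi>|lborel. LINT \<eta>|lborel. F \<xi> \<eta>)"
    by (rule lborel_pair.Fubini_integral[OF int])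
  finally show ?thesis .
qed

theorem product_fourier:
  assumes u: "is_FT u U" and v: "is_FT v V" and \<phi> [measurable]: "testc \<phi>"
    and int: "integrable lborel2 (\<lambda>(\<xi>, \<eta>). U (\<xi> - \<eta>) * V \<eta> * fourier \<phi> (- \<xi>))"
  shows "(LINT x|lborel. u x * v x * \<phi> x) = complex_of_real plancherel_const * (complex_of_real plancherel_const *
           (LINT \<xi>|lborel. (LINT \<eta>|lborel. U (\<xi> - \<eta>) * V \<eta>) * fourier \<phi> (- \<xi>)))"
proof -
  let ?c = "complex_of_real plancherel_const"
  have [measurable]: "v \<in> borel_measurable borel" "U \<in> borel_measurable borel" "V \<in> borel_measurable borel" "\<phi> \<in> borel_measurable borel"
    using is_FT_L2c[OF u] is_FT_L2c[OF v] by auto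
  have [measurable]: "fourier \<phi> \<in> borel_measurable borel" by (rule fourier_measurable) simp
  obtain B where "0 < B" "\<And>x. cmod (\<phi> x) \<le> B" using testc_bound[OF \<phi>] by metis
  then have v\<phi>: "L2c (\<lambda>x. v x * \<phi> x)"
    by (intro L2c_mono(1)[OF is_FT_L2c(1)[OF v], where B=B]) (auto simp: norm_mult mult.commute[of B] mult_left_mono)
  have "(LINT x|lborel. u x * v x * \<phi> x) = (LINT x|lborel. u x * (v x * \<phi> x))" by (simp add: mult.assoc)
  also have "\<dots> = ?c * (LINT \<zeta>|lborel. U \<zeta> * fourier (\<lambda>x. v x * \<phi> x) (- \<zeta>))"
    by (rule parseval_mult[OF u v\<phi> L2c_mult_integrable[OF is_FT_L2c(1)[OF v] testc_L2c[OF \<phi>]]])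
  also have "(LINT \<zeta>|lborel. U \<zeta> * fourier (\<lambda>x. v x * \<phi> x) (- \<zeta>))
      = (LINT \<zeta>|lborel. ?c * (LINT \<eta>|lborel. U \<zeta> * (V \<eta> * fourier \<phi> (- (\<zeta> + \<eta>)))))"
    unfolding fourier_mult_testc[OF v \<phi>] by (subst integral_mult_right_zero) (simp add: mult_ac)
  also have "\<dots> = ?c * (LINT \<zeta>|lborel. LINT \<eta>|lborel. U (\<zeta> + \<eta> - \<eta>) * V \<eta> * fourier \<phi> (- (\<zeta> + \<eta>)))"
    by (simp add: mult.assoc)
  also have "(LINT \<zeta>|lborel. LINT \<eta>|lborel. U (\<zeta> + \<eta> - \<eta>) * V \<eta> * fourier \<phi> (- (\<zeta> + \<eta>)))
      = (LINT \<xi>|lborel. LINT \<eta>|lborel. U (\<xi> - \<eta>) * V \<eta> * fourier \<phi> (- \<xi>))"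
    by (rule integral_shear[OF int]) measurable
  finally show ?thesis by simp
qed

section \<open>Trilinear convolution estimates\<close>

lemma nn_integral_powr_Icc:
  assumes "0 \<le> a" "0 < x" "x \<le> R"
  shows "ennreal (x powr (- a))
      = ennreal (R powr (- a)) + (\<integral>\<^sup>+r. ennreal (a * r powr (- a - 1)) * indicator {x..R} r \<partial>lborel)"
proof -
  have "(\<integral>\<^sup>+r. ennreal (a * r powr (- a - 1)) * indicator {x..R} r \<partial>lborel)
      = ennreal (- (R powr (- a)) - - (x powr (- a)))"
    using assms by (intro nn_integral_FTC_Icc) (auto intro!: derivative_eq_intros)
  moreover have "R powr (- a) \<le> x powr (- a)" using assms by (intro powr_mono2') auto
  ultimately show ?thesis by (simp add: ennreal_plus[symmetric] del: ennreal_plus)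
qed

lemma nn_integral_powr_from_0:
  assumes "- 1 < a" "0 \<le> R"
  shows "(\<integral>\<^sup>+r. ennreal (r powr a) * indicator {0..R} r \<partial>lborel) = ennreal (R powr (a + 1) / (a + 1))"
proof -
  have "((\<lambda>r. r powr a * indicator {0..R} r) has_integral R powr (a + 1) / (a + 1)) UNIV"
    using has_integral_powr_from_0[OF assms] has_integral_restrict_UNIV[of "{0..R}" "\<lambda>r. r powr a"]
    by (simp add: indicator_def of_bool_def if_distrib cong: if_cong)
  from nn_integral_has_integral_lborel[OF _ _ this] show ?thesis
    by (simp add: ennreal_mult ennreal_indicator)
qed

text \<open>Layer cake: \<open>\<bar>\<zeta>\<bar>\<^sup>-\<^sup>a\<close> is \<open>R\<^sup>-\<^sup>a\<close> plus the integral of \<open>a r\<^sup>-\<^sup>a\<^sup>-\<^sup>1\<close> over the radii of the balls that contain \<open>\<zeta>\<close>.\<close>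

lemma norm_powr_layer_cake:
  fixes \<zeta> :: "'a::real_normed_vector"
  assumes "0 \<le> a"
  shows "ennreal (norm \<zeta> powr (- a)) * indicator (cball 0 R) \<zeta> \<le> ennreal (R powr (- a)) * indicator (cball 0 R) \<zeta>
    + (\<integral>\<^sup>+r. ennreal (a * r powr (- a - 1)) * indicator {0<..R} r * indicator {norm \<zeta>..} r \<partial>lborel)"
proof (cases "0 < norm \<zeta> \<and> norm \<zeta> \<le> R")
  case True
  then have "ennreal (norm \<zeta> powr (- a))
      = ennreal (R powr (- a)) + (\<integral>\<^sup>+r. ennreal (a * r powr (- a - 1)) * indicator {norm \<zeta>..R} r \<partial>lborel)"
    by (intro nn_integral_powr_Icc assms) auto
  also have "(\<integral>\<^sup>+r. ennreal (a * r powr (- a - 1)) * indicator {norm \<zeta>..R} r \<partial>lborel)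
      = (\<integral>\<^sup>+r. ennreal (a * r powr (- a - 1)) * indicator {0<..R} r * indicator {norm \<zeta>..} r \<partial>lborel)"
    using True by (intro nn_integral_cong) (auto simp: indicator_def intro: less_le_trans[of 0 "norm \<zeta>"])
  finally show ?thesis using True by simp
qed (auto simp: indicator_def)

lemma emeasure_lborel_cball_powr:
  "0 < r \<Longrightarrow> emeasure lborel (cball (0::'a::euclidean_space) r) = ennreal (unit_ball_vol DIM('a) * r powr DIM('a))"
  by (subst emeasure_cball) (auto simp: powr_realpow)

lemma nn_integral_powr_shell:
  fixes a R r :: real
  defines "d \<equiv> real DIM('a::euclidean_space)"
  assumes a: "0 \<le> a"
  shows "(\<integral>\<^sup>+\<zeta>. ennreal (a * r powr (- a - 1)) * indicator {0<..R} r * indicator {norm (\<zeta>::'a)..} r \<partial>lborel)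
    = ennreal (a * unit_ball_vol d) * (ennreal (r powr (d - a - 1)) * indicator {0..R} r)"
proof -
  let ?V = "unit_ball_vol d" and ?g = "\<lambda>r. ennreal (a * r powr (- a - 1)) * indicator {0<..R} r"
  have "(\<integral>\<^sup>+\<zeta>. ?g r * indicator {norm (\<zeta>::'a)..} r \<partial>lborel) = (\<integral>\<^sup>+\<zeta>. ?g r * indicator (cball (0::'a) r) \<zeta> \<partial>lborel)"
    by (intro nn_integral_cong) (simp add: indicator_def)
  also have "\<dots> = ?g r * emeasure lborel (cball (0::'a) r)"
    by (rule nn_integral_cmult_indicator) simp
  also have "\<dots> = ennreal (a * ?V) * (ennreal (r powr (d - a - 1)) * indicator {0..R} r)"
  proof (cases "r \<in> {0<..R}")
    case True
    have "a * r powr (- a - 1) * (?V * r powr d) = a * ?V * (r powr (- a - 1) * r powr d)" by simp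
    also have "r powr (- a - 1) * r powr d = r powr (d - a - 1)"
      unfolding powr_add[symmetric] by (simp add: algebra_simps)
    finally show ?thesis using True a by (simp add: emeasure_lborel_cball_powr ennreal_mult[symmetric] d_def)
  qed (auto simp: indicator_def)
  finally show ?thesis .
qed

lemma nn_integral_norm_powr_cball:
  fixes a R :: real
  defines "d \<equiv> real DIM('a::euclidean_space)"
  assumes a: "0 \<le> a" "a < d" and R: "0 < R"
  shows "(\<integral>\<^sup>+\<zeta>. ennreal (norm (\<zeta>::'a) powr (- a)) * indicator (cball 0 R) \<zeta> \<partial>lborel)
       \<le> ennreal (unit_ball_vol d * d / (d - a) * R powr (d - a))"
proof -
  let ?V = "unit_ball_vol d" and ?g = "\<lambda>r. ennreal (a * r powr (- a - 1)) * indicator {0<..R} r"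
  have "(\<integral>\<^sup>+\<zeta>. ennreal (norm (\<zeta>::'a) powr (- a)) * indicator (cball 0 R) \<zeta> \<partial>lborel)
     \<le> (\<integral>\<^sup>+\<zeta>. ennreal (R powr (- a)) * indicator (cball 0 R) \<zeta> + (\<integral>\<^sup>+r. ?g r * indicator {norm (\<zeta>::'a)..} r \<partial>lborel) \<partial>lborel)"
    by (intro nn_integral_mono norm_powr_layer_cake a)
  also have "\<dots> = (\<integral>\<^sup>+\<zeta>. ennreal (R powr (- a)) * indicator (cball (0::'a) R) \<zeta> \<partial>lborel)
      + (\<integral>\<^sup>+\<zeta>. \<integral>\<^sup>+r. ?g r * indicator {norm (\<zeta>::'a)..} r \<partial>lborel \<partial>lborel)"
    unfolding indicator_def by (rule nn_integral_add) auto
  also have "(\<integral>\<^sup>+\<zeta>. ennreal (R powr (- a)) * indicator (cball (0::'a) R) \<zeta> \<partial>lborel)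
      = ennreal (R powr (- a) * (?V * R powr d))"
    using emeasure_lborel_cball_powr[OF R, where 'a='a]
    by (simp add: nn_integral_cmult_indicator d_def ennreal_mult[symmetric])
  also have "(\<integral>\<^sup>+\<zeta>. \<integral>\<^sup>+r. ?g r * indicator {norm (\<zeta>::'a)..} r \<partial>lborel \<partial>lborel)
      = (\<integral>\<^sup>+r. \<integral>\<^sup>+\<zeta>. ?g r * indicator {norm (\<zeta>::'a)..} r \<partial>lborel \<partial>lborel)"
    unfolding indicator_def atLeast_iff by (rule lborel_pair.Fubini') measurable
  also have "\<dots> = ennreal (a * ?V) * ennreal (R powr (d - a) / (d - a))"
    unfolding nn_integral_powr_shell[OF a(1), where 'a='a, folded d_def]
    using nn_integral_powr_from_0[of "d - a - 1" R] a R by (subst nn_integral_cmult) auto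
  also have "ennreal (R powr (- a) * (?V * R powr d)) + \<dots>
      = ennreal (R powr (- a) * (?V * R powr d) + a * ?V * (R powr (d - a) / (d - a)))"
    using a by (simp add: d_def ennreal_mult[symmetric] ennreal_plus[symmetric] del: ennreal_plus)
  also have "R powr (- a) * (?V * R powr d) = ?V * R powr (d - a)"
    using powr_add[of R "- a" d] by simp
  also have "?V * R powr (d - a) + a * ?V * (R powr (d - a) / (d - a)) = ?V * d / (d - a) * R powr (d - a)"
    using a by (simp add: field_simps)
  finally show ?thesis .
qed

definition hardy_kernel :: "real \<Rightarrow> pt \<Rightarrow> pt \<Rightarrow> real" where
  "hardy_kernel p \<sigma> \<mu> = (if norm \<sigma> \<le> norm \<mu> then norm \<sigma> powr (- p) * norm \<mu> powr (p - 1) else 0)"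

lemma hardy_kernel_nonneg [simp]: "0 \<le> hardy_kernel p \<sigma> \<mu>"
  by (simp add: hardy_kernel_def)

lemma hardy_kernel_measurable [measurable (raw)]:
  assumes [measurable]: "f \<in> borel_measurable M" "g \<in> borel_measurable M"
  shows "(\<lambda>x. hardy_kernel p (f x) (g x)) \<in> borel_measurable M"
  unfolding hardy_kernel_def by measurable

lemma powr_square: "(x powr a)\<^sup>2 = x powr (2 * a)" for x :: real
  by (simp add: power2_eq_square powr_add[symmetric])

lemma hardy_kernel_square_integral_bounded:
  assumes p: "0 \<le> p" "p < (1::real)"
  shows "\<exists>C\<ge>0. \<forall>\<mu>. (\<integral>\<^sup>+\<sigma>. ennreal ((hardy_kernel p \<sigma> \<mu>)\<^sup>2) \<partial>lborel) \<le> ennreal C"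
proof (intro exI conjI allI)
  let ?C = "unit_ball_vol 2 * 2 / (2 - 2 * p)"
  show "0 \<le> ?C" using p by simp
  fix \<mu>
  show "(\<integral>\<^sup>+\<sigma>. ennreal ((hardy_kernel p \<sigma> \<mu>)\<^sup>2) \<partial>lborel) \<le> ennreal ?C"
  proof (cases "\<mu> = 0")
    case True then have "hardy_kernel p \<sigma> \<mu> = 0" for \<sigma> by (auto simp: hardy_kernel_def)
    then show ?thesis by simp
  next
    case False
    have "(\<integral>\<^sup>+\<sigma>. ennreal ((hardy_kernel p \<sigma> \<mu>)\<^sup>2) \<partial>lborel)
        = (\<integral>\<^sup>+\<sigma>. ennreal (norm \<mu> powr (2 * p - 2)) * (ennreal (norm (\<sigma>::pt) powr (- (2 * p))) * indicator (cball 0 (norm \<mu>)) \<sigma>) \<partial>lborel)"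
      by (rule nn_integral_cong)
         (auto simp: hardy_kernel_def indicator_def power_mult_distrib powr_square ennreal_mult[symmetric] algebra_simps)
    also have "\<dots> = ennreal (norm \<mu> powr (2 * p - 2)) * (\<integral>\<^sup>+\<sigma>. ennreal (norm (\<sigma>::pt) powr (- (2 * p))) * indicator (cball 0 (norm \<mu>)) \<sigma> \<partial>lborel)"
      unfolding indicator_def by (rule nn_integral_cmult) simp
    also have "\<dots> \<le> ennreal (norm \<mu> powr (2 * p - 2)) * ennreal (?C * norm \<mu> powr (2 - 2 * p))"
      using nn_integral_norm_powr_cball[where 'a=pt, of "2 * p" "norm \<mu>"] p False by (intro mult_left_mono) auto
    also have "\<dots> = ennreal (?C * (norm \<mu> powr (2 * p - 2) * norm \<mu> powr (2 - 2 * p)))"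
      using p by (simp add: ennreal_mult[symmetric] mult_ac)
    also have "norm \<mu> powr (2 * p - 2) * norm \<mu> powr (2 - 2 * p) = 1"
      using False by (simp add: powr_add[symmetric])
    finally show ?thesis by simp
  qed
qed

text \<open>Cauchy--Schwarz on the product space replaces the Hardy--Littlewood--Sobolev inequality:
  the kernel only has to be square integrable in one variable, uniformly in the other one.\<close>

lemma trilinear_Cauchy_Schwarz_snd:
  fixes F G K :: "'a::euclidean_space \<Rightarrow> ennreal" and k :: "'a \<Rightarrow> 'a \<Rightarrow> ennreal"
  assumes [measurable]: "F \<in> borel_measurable borel" "G \<in> borel_measurable borel" "K \<in> borel_measurable borel"
     "(\<lambda>(\<xi>, \<eta>). k \<xi> \<eta>) \<in> borel_measurable (borel \<Otimes>\<^sub>M borel)"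
    and k: "\<And>\<eta>. (\<integral>\<^sup>+\<xi>. (k \<xi> \<eta>)\<^sup>2 \<partial>lborel) \<le> C"
  shows "(\<integral>\<^sup>+(\<xi>, \<eta>). k \<xi> \<eta> * F (\<xi> - \<eta>) * G \<eta> * K \<xi> \<partial>lborel2)\<^sup>2
     \<le> C * (\<integral>\<^sup>+x. (F x)\<^sup>2 \<partial>lborel) * (\<integral>\<^sup>+x. (G x)\<^sup>2 \<partial>lborel) * (\<integral>\<^sup>+x. (K x)\<^sup>2 \<partial>lborel)"
proof -
  have FK: "(\<integral>\<^sup>+p. (F (fst p - snd p) * K (fst p))\<^sup>2 \<partial>lborel2) = (\<integral>\<^sup>+x. (F x)\<^sup>2 \<partial>lborel) * (\<integral>\<^sup>+x. (K x)\<^sup>2 \<partial>lborel)"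
  proof -
    have "(\<integral>\<^sup>+p. (F (fst p - snd p) * K (fst p))\<^sup>2 \<partial>lborel2) = (\<integral>\<^sup>+\<xi>. (\<integral>\<^sup>+\<eta>. (F (\<xi> - \<eta>))\<^sup>2 \<partial>lborel) * (K \<xi>)\<^sup>2 \<partial>lborel)"
      by (subst lborel.nn_integral_fst[symmetric]) (auto simp: power_mult_distrib nn_integral_multc)
    also have "\<dots> = (\<integral>\<^sup>+x. (F x)\<^sup>2 \<partial>lborel) * (\<integral>\<^sup>+x. (K x)\<^sup>2 \<partial>lborel)"
      using nn_integral_reflect[of "\<lambda>x. (F x)\<^sup>2"] by (simp add: nn_integral_cmult)
    finally show ?thesis .
  qed
  have kG: "(\<integral>\<^sup>+p. (k (fst p) (snd p) * G (snd p))\<^sup>2 \<partial>lborel2) \<le> C * (\<integral>\<^sup>+x. (G x)\<^sup>2 \<partial>lborel)"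
  proof -
    have "(\<integral>\<^sup>+p. (k (fst p) (snd p) * G (snd p))\<^sup>2 \<partial>lborel2) = (\<integral>\<^sup>+\<eta>. (\<integral>\<^sup>+\<xi>. (k \<xi> \<eta>)\<^sup>2 \<partial>lborel) * (G \<eta>)\<^sup>2 \<partial>lborel)"
      by (subst lborel_pair.nn_integral_snd[symmetric]) (auto simp: split_beta' power_mult_distrib nn_integral_multc)
    also have "\<dots> \<le> (\<integral>\<^sup>+\<eta>. C * (G \<eta>)\<^sup>2 \<partial>lborel)"
      by (intro nn_integral_mono mult_right_mono k) simp
    also have "\<dots> = C * (\<integral>\<^sup>+x. (G x)\<^sup>2 \<partial>lborel)" by (simp add: nn_integral_cmult)
    finally show ?thesis .
  qed
  have "(\<integral>\<^sup>+(\<xi>, \<eta>). k \<xi> \<eta> * F (\<xi> - \<eta>) * G \<eta> * K \<xi> \<partial>lborel2)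
     = (\<integral>\<^sup>+p. (F (fst p - snd p) * K (fst p)) * (k (fst p) (snd p) * G (snd p)) \<partial>lborel2)"
    by (intro nn_integral_cong) (auto simp: mult_ac)
  then have "(\<integral>\<^sup>+(\<xi>, \<eta>). k \<xi> \<eta> * F (\<xi> - \<eta>) * G \<eta> * K \<xi> \<partial>lborel2)\<^sup>2
     \<le> (\<integral>\<^sup>+p. (F (fst p - snd p) * K (fst p))\<^sup>2 \<partial>lborel2) * (\<integral>\<^sup>+p. (k (fst p) (snd p) * G (snd p))\<^sup>2 \<partial>lborel2)"
    using Cauchy_Schwarz_nn_integral[of "\<lambda>p. F (fst p - snd p) * K (fst p)" "lborel \<Otimes>\<^sub>M lborel" "\<lambda>p. k (fst p) (snd p) * G (snd p)"]
    by (simp add: split_beta')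
  also have "\<dots> \<le> ((\<integral>\<^sup>+x. (F x)\<^sup>2 \<partial>lborel) * (\<integral>\<^sup>+x. (K x)\<^sup>2 \<partial>lborel)) * (C * (\<integral>\<^sup>+x. (G x)\<^sup>2 \<partial>lborel))"
    unfolding FK by (rule mult_left_mono[OF kG]) simp
  finally show ?thesis by (simp only: mult_ac)
qed

lemma trilinear_Cauchy_Schwarz_fst:
  fixes F G K :: "'a::euclidean_space \<Rightarrow> ennreal" and k :: "'a \<Rightarrow> 'a \<Rightarrow> ennreal"
  assumes [measurable]: "F \<in> borel_measurable borel" "G \<in> borel_measurable borel" "K \<in> borel_measurable borel"
     "(\<lambda>(\<xi>, \<eta>). k \<xi> \<eta>) \<in> borel_measurable (borel \<Otimes>\<^sub>M borel)"
    and k: "\<And>\<xi>. (\<integral>\<^sup>+\<eta>. (k \<xi> \<eta>)\<^sup>2 \<partial>lborel) \<le> C"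
  shows "(\<integral>\<^sup>+(\<xi>, \<eta>). k \<xi> \<eta> * F (\<xi> - \<eta>) * G \<eta> * K \<xi> \<partial>lborel2)\<^sup>2
     \<le> C * (\<integral>\<^sup>+x. (F x)\<^sup>2 \<partial>lborel) * (\<integral>\<^sup>+x. (G x)\<^sup>2 \<partial>lborel) * (\<integral>\<^sup>+x. (K x)\<^sup>2 \<partial>lborel)"
proof -
  have "(\<integral>\<^sup>+(\<xi>, \<eta>). k \<xi> \<eta> * F (\<xi> - \<eta>) * G \<eta> * K \<xi> \<partial>lborel2)
     = (\<integral>\<^sup>+\<eta>. \<integral>\<^sup>+\<xi>. k \<xi> \<eta> * F (\<xi> - \<eta>) * G \<eta> * K \<xi> \<partial>lborel \<partial>lborel)"
    by (subst lborel_pair.nn_integral_snd[symmetric]) auto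
  also have "\<dots> = (\<integral>\<^sup>+(\<eta>, \<xi>). k \<xi> \<eta> * (F (- (\<eta> - \<xi>))) * K \<xi> * G \<eta> \<partial>lborel2)"
    by (subst lborel.nn_integral_fst[symmetric]) (auto simp: mult_ac)
  also have "\<dots>\<^sup>2 \<le> C * (\<integral>\<^sup>+x. (F (- x))\<^sup>2 \<partial>lborel) * (\<integral>\<^sup>+x. (K x)\<^sup>2 \<partial>lborel) * (\<integral>\<^sup>+x. (G x)\<^sup>2 \<partial>lborel)"
    by (rule trilinear_Cauchy_Schwarz_snd[where k="\<lambda>\<eta> \<xi>. k \<xi> \<eta>" and F="\<lambda>x. F (- x)"]) (use k in auto)
  also have "(\<integral>\<^sup>+x. (F (- x))\<^sup>2 \<partial>lborel) = (\<integral>\<^sup>+x. (F x)\<^sup>2 \<partial>lborel)"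
    using nn_integral_reflect[of "\<lambda>x. (F x)\<^sup>2" 0] by simp
  finally show ?thesis by (simp add: mult_ac)
qed

abbreviation trilinear_form :: "(pt \<Rightarrow> pt \<Rightarrow> real) \<Rightarrow> (pt \<Rightarrow> complex) \<Rightarrow> (pt \<Rightarrow> complex) \<Rightarrow> (pt \<Rightarrow> complex) \<Rightarrow> ennreal" where
  "trilinear_form k a b d \<equiv> (\<integral>\<^sup>+(\<xi>, \<eta>). ennreal (\<bar>k \<xi> \<eta>\<bar> * cmod (a (\<xi> - \<eta>)) * cmod (b \<eta>) * cmod (d \<xi>)) \<partial>lborel2)"

lemma trilinear_form_L2_bound:
  assumes k [measurable]: "(\<lambda>(\<xi>, \<eta>). k \<xi> \<eta>) \<in> borel_measurable (borel \<Otimes>\<^sub>M borel)" and C: "0 \<le> C"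
    and bounded: "(\<forall>\<eta>. (\<integral>\<^sup>+\<xi>. ennreal ((k \<xi> \<eta>)\<^sup>2) \<partial>lborel) \<le> ennreal C) \<or> (\<forall>\<xi>. (\<integral>\<^sup>+\<eta>. ennreal ((k \<xi> \<eta>)\<^sup>2) \<partial>lborel) \<le> ennreal C)"
    and L2c [measurable]: "L2c a" "L2c b" "L2c d"
  shows "trilinear_form k a b d \<le> ennreal (sqrt C * L2norm a * L2norm b * L2norm d)"
proof (rule ennreal_power2_le_imp_le)
  have [measurable]: "a \<in> borel_measurable borel" "b \<in> borel_measurable borel" "d \<in> borel_measurable borel" by auto
  let ?k = "\<lambda>\<xi> \<eta>. ennreal \<bar>k \<xi> \<eta>\<bar>"
  have "trilinear_form k a b d
      = (\<integral>\<^sup>+(\<xi>, \<eta>). ?k \<xi> \<eta> * ennreal (cmod (a (\<xi> - \<eta>))) * ennreal (cmod (b \<eta>)) * ennreal (cmod (d \<xi>)) \<partial>lborel2)"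
    by (intro nn_integral_cong) (auto simp: ennreal_mult)
  also have "\<dots>\<^sup>2 \<le> ennreal C * (\<integral>\<^sup>+x. (ennreal (cmod (a x)))\<^sup>2 \<partial>lborel) * (\<integral>\<^sup>+x. (ennreal (cmod (b x)))\<^sup>2 \<partial>lborel) * (\<integral>\<^sup>+x. (ennreal (cmod (d x)))\<^sup>2 \<partial>lborel)"
    using bounded
  proof
    assume "\<forall>\<eta>. (\<integral>\<^sup>+\<xi>. ennreal ((k \<xi> \<eta>)\<^sup>2) \<partial>lborel) \<le> ennreal C"
    then show ?thesis by (intro trilinear_Cauchy_Schwarz_snd) (auto simp: ennreal_power)
  next
    assume "\<forall>\<xi>. (\<integral>\<^sup>+\<eta>. ennreal ((k \<xi> \<eta>)\<^sup>2) \<partial>lborel) \<le> ennreal C"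
    then show ?thesis by (intro trilinear_Cauchy_Schwarz_fst) (auto simp: ennreal_power)
  qed
  also have "\<dots> = (ennreal (sqrt C * L2norm a * L2norm b * L2norm d))\<^sup>2"
    using C by (simp add: L2c_nn_integral L2c ennreal_mult[symmetric] ennreal_power power_mult_distrib)
  finally show "(trilinear_form k a b d)\<^sup>2 \<le> (ennreal (sqrt C * L2norm a * L2norm b * L2norm d))\<^sup>2" .
qed

definition hardy_bound :: "real \<Rightarrow> real \<Rightarrow> bool" where
  "hardy_bound p C \<longleftrightarrow> 0 \<le> C \<and> (\<forall>a b d. L2c a \<longrightarrow> L2c b \<longrightarrow> L2c d \<longrightarrow>
     trilinear_form (\<lambda>\<xi> \<eta>. hardy_kernel p (\<xi> - \<eta>) \<eta>) a b d \<le> ennreal (C * L2norm a * L2norm b * L2norm d) \<and>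
     trilinear_form (\<lambda>\<xi> \<eta>. hardy_kernel p \<eta> \<xi>) a b d \<le> ennreal (C * L2norm a * L2norm b * L2norm d) \<and>
     trilinear_form (\<lambda>\<xi> \<eta>. hardy_kernel p \<xi> \<eta>) a b d \<le> ennreal (C * L2norm a * L2norm b * L2norm d))"

lemma hardy_bound_exists:
  assumes p: "0 \<le> p" "p < 1"
  shows "\<exists>C. hardy_bound p C"
proof -
  obtain C where C: "0 \<le> C" "\<And>\<mu>. (\<integral>\<^sup>+\<sigma>. ennreal ((hardy_kernel p \<sigma> \<mu>)\<^sup>2) \<partial>lborel) \<le> ennreal C"
    using hardy_kernel_square_integral_bounded[OF p] by auto
  have "(\<integral>\<^sup>+\<xi>. ennreal ((hardy_kernel p (\<xi> - \<eta>) \<eta>)\<^sup>2) \<partial>lborel) \<le> ennreal C" for \<eta>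
    using C(2)[of \<eta>] nn_integral_shift[of "\<lambda>\<sigma>. ennreal ((hardy_kernel p \<sigma> \<eta>)\<^sup>2)" \<eta>] by simp
  then show ?thesis
    unfolding hardy_bound_def using C
    by (intro exI[of _ "sqrt C"] conjI allI impI trilinear_form_L2_bound) auto
qed

lemma hardy_boundD:
  assumes "hardy_bound p C" "L2c a" "L2c b" "L2c d"
  shows "trilinear_form (\<lambda>\<xi> \<eta>. hardy_kernel p (\<xi> - \<eta>) \<eta>) a b d \<le> ennreal (C * L2norm a * L2norm b * L2norm d)"
    and "trilinear_form (\<lambda>\<xi> \<eta>. hardy_kernel p \<eta> \<xi>) a b d \<le> ennreal (C * L2norm a * L2norm b * L2norm d)"
    and "trilinear_form (\<lambda>\<xi> \<eta>. hardy_kernel p \<xi> \<eta>) a b d \<le> ennreal (C * L2norm a * L2norm b * L2norm d)"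
  using assms unfolding hardy_bound_def by blast+

lemma powr_product_le_comparable:
  fixes x y z :: real
  assumes "0 < x" "0 < y" "0 < z" "y \<le> 2 * z" "0 \<le> r" "r \<le> 1" "p + q + r = 1"
  shows "x powr (-p) * y powr (-q) * z powr (-r) \<le> 2 * (x powr (-p) * y powr (p - 1))"
proof -
  have "z powr (-r) \<le> (y / 2) powr (-r)" using assms by (intro powr_mono2') auto
  also have "\<dots> = 2 powr r * y powr (-r)" using assms by (simp add: powr_divide powr_minus divide_simps)
  also have "\<dots> \<le> 2 * y powr (-r)" using assms powr_mono[of r 1 2] by (intro mult_right_mono) auto
  finally have "x powr (-p) * y powr (-q) * z powr (-r) \<le> x powr (-p) * y powr (-q) * (2 * y powr (-r))"
    by (intro mult_left_mono) auto
  also have "\<dots> = 2 * (x powr (-p) * (y powr (-q) * y powr (-r)))" by simp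
  also have "y powr (-q) * y powr (-r) = y powr (p - 1)"
    unfolding powr_add[symmetric] using assms(7) by (intro arg_cong[where f="\<lambda>e. y powr e"]) linarith
  finally show ?thesis .
qed

lemma powr_product_le_hardy_kernels:
  assumes p: "0 \<le> p" "0 \<le> q" "0 \<le> r" "p + q + r = 1"
  shows "norm (\<xi> - \<eta>) powr (-p) * norm \<eta> powr (-q) * norm (\<xi>::pt) powr (-r)
     \<le> 2 * (hardy_kernel p (\<xi> - \<eta>) \<eta> + hardy_kernel q \<eta> \<xi> + hardy_kernel r \<xi> \<eta>)" (is "?L \<le> 2 * (?A + ?B + ?C)")
proof (cases "\<xi> - \<eta> = 0 \<or> \<eta> = 0 \<or> \<xi> = 0")
  case True
  then have "?L = 0" by auto
  moreover have "0 \<le> 2 * (?A + ?B + ?C)" by (intro mult_nonneg_nonneg add_nonneg_nonneg) auto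
  ultimately show ?thesis by (rule ord_eq_le_trans)
next
  case False
  then have pos: "0 < norm (\<xi> - \<eta>)" "0 < norm \<eta>" "0 < norm \<xi>" by auto
  have triangle: "norm \<eta> \<le> norm \<xi> + norm (\<xi> - \<eta>)" "norm \<xi> \<le> norm \<eta> + norm (\<xi> - \<eta>)"
    using norm_triangle_ineq4[of \<xi> "\<xi> - \<eta>"] norm_triangle_ineq[of \<eta> "\<xi> - \<eta>"] by simp_all
  have nonneg: "0 \<le> ?A" "0 \<le> ?B" "0 \<le> ?C" by auto
  consider (diff_least) "norm (\<xi> - \<eta>) \<le> norm \<eta>" "norm (\<xi> - \<eta>) \<le> norm \<xi>"
    | (\<eta>_least) "norm \<eta> \<le> norm (\<xi> - \<eta>)" "norm \<eta> \<le> norm \<xi>"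
    | (\<xi>_least) "norm \<xi> \<le> norm (\<xi> - \<eta>)" "norm \<xi> \<le> norm \<eta>" by linarith
  then show ?thesis
  proof cases
    case diff_least
    have "?L \<le> 2 * ?A" using diff_least powr_product_le_comparable[OF pos, of r p q] p triangle
      by (simp add: hardy_kernel_def)
    also have "\<dots> \<le> 2 * (?A + ?B + ?C)" using nonneg by simp
    finally show ?thesis .
  next
    case \<eta>_least
    have "?L \<le> 2 * ?B" using \<eta>_least powr_product_le_comparable[OF pos(2,3,1), of p q r] p triangle
      by (simp add: hardy_kernel_def mult_ac add_ac)
    also have "\<dots> \<le> 2 * (?A + ?B + ?C)" using nonneg by simp
    finally show ?thesis .
  next
    case \<xi>_least
    have "?L \<le> 2 * ?C" using \<xi>_least powr_product_le_comparable[OF pos(3,2,1), of p r q] p triangle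
      by (simp add: hardy_kernel_def mult_ac add_ac)
    also have "\<dots> \<le> 2 * (?A + ?B + ?C)" using nonneg by simp
    finally show ?thesis .
  qed
qed

definition weighted :: "real \<Rightarrow> (pt \<Rightarrow> complex) \<Rightarrow> pt \<Rightarrow> complex" where
  "weighted r f \<xi> = complex_of_real (norm \<xi> powr r) * f \<xi>"

abbreviation hnorm :: "real \<Rightarrow> (pt \<Rightarrow> complex) \<Rightarrow> real" where
  "hnorm r f \<equiv> L2norm (weighted r f)"

lemma weighted_measurable [measurable (raw)]: "f \<in> borel_measurable borel \<Longrightarrow> weighted r f \<in> borel_measurable borel"
  unfolding weighted_def[abs_def] by measurable

lemma cmod_weighted: "cmod (weighted r f \<xi>) = norm \<xi> powr r * cmod (f \<xi>)"
  by (simp add: weighted_def norm_mult)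

lemma AE_nonzero_frequencies: "AE p in lborel2. fst p \<noteq> 0 \<and> snd p \<noteq> (0::pt) \<and> fst p \<noteq> snd p"
proof (rule lborel_pair.AE_pair_measure)
  show "{p \<in> space lborel2. fst p \<noteq> 0 \<and> snd p \<noteq> (0::pt) \<and> fst p \<noteq> snd p} \<in> sets lborel2" by measurable
  have "AE \<eta> in lborel. \<eta> \<noteq> 0 \<and> \<xi> \<noteq> \<eta>" for \<xi> :: pt
    using AE_lborel_singleton[of 0] AE_lborel_singleton[of \<xi>] by eventually_elim auto
  then show "AE \<xi> in lborel. AE \<eta> in lborel. fst (\<xi>, \<eta>) \<noteq> 0 \<and> snd (\<xi>, \<eta>) \<noteq> (0::pt) \<and> fst (\<xi>, \<eta>) \<noteq> snd (\<xi>, \<eta>)"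
    using AE_lborel_singleton[of "0::pt"] by auto
qed

abbreviation trilinear_density :: "(pt \<Rightarrow> pt \<Rightarrow> real) \<Rightarrow> (pt \<Rightarrow> complex) \<Rightarrow> (pt \<Rightarrow> complex) \<Rightarrow> (pt \<Rightarrow> complex) \<Rightarrow> pt \<Rightarrow> pt \<Rightarrow> real" where
  "trilinear_density k a b d \<xi> \<eta> \<equiv> \<bar>k \<xi> \<eta>\<bar> * cmod (a (\<xi> - \<eta>)) * cmod (b \<eta>) * cmod (d \<xi>)"

lemma trilinear_form_le_three:
  assumes [measurable]: "(\<lambda>(\<xi>, \<eta>). trilinear_density k1 a1 b1 d1 \<xi> \<eta>) \<in> borel_measurable lborel2"
      "(\<lambda>(\<xi>, \<eta>). trilinear_density k2 a2 b2 d2 \<xi> \<eta>) \<in> borel_measurable lborel2"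
      "(\<lambda>(\<xi>, \<eta>). trilinear_density k3 a3 b3 d3 \<xi> \<eta>) \<in> borel_measurable lborel2"
    and pointwise: "\<And>\<xi> \<eta>. \<xi> \<noteq> 0 \<Longrightarrow> \<eta> \<noteq> 0 \<Longrightarrow> \<xi> \<noteq> \<eta> \<Longrightarrow> trilinear_density k a b d \<xi> \<eta>
      \<le> c * (trilinear_density k1 a1 b1 d1 \<xi> \<eta> + trilinear_density k2 a2 b2 d2 \<xi> \<eta> + trilinear_density k3 a3 b3 d3 \<xi> \<eta>)"
    and c: "0 \<le> c"
    and bounds: "trilinear_form k1 a1 b1 d1 \<le> ennreal B1"
      "trilinear_form k2 a2 b2 d2 \<le> ennreal B2" "trilinear_form k3 a3 b3 d3 \<le> ennreal B3"
      "0 \<le> B1" "0 \<le> B2" "0 \<le> B3"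
  shows "trilinear_form k a b d \<le> ennreal (c * (B1 + B2 + B3))"
proof -
  let ?T1 = "trilinear_density k1 a1 b1 d1" and ?T2 = "trilinear_density k2 a2 b2 d2" and ?T3 = "trilinear_density k3 a3 b3 d3"
  have "trilinear_form k a b d
      \<le> (\<integral>\<^sup>+p. ennreal c * (ennreal (case p of (\<xi>, \<eta>) \<Rightarrow> ?T1 \<xi> \<eta>) + ennreal (case p of (\<xi>, \<eta>) \<Rightarrow> ?T2 \<xi> \<eta>) + ennreal (case p of (\<xi>, \<eta>) \<Rightarrow> ?T3 \<xi> \<eta>)) \<partial>lborel2)"
  proof (rule nn_integral_mono_AE, use AE_nonzero_frequencies in eventually_elim)
    case (elim p)
    then have "ennreal (trilinear_density k a b d (fst p) (snd p))
        \<le> ennreal (c * (?T1 (fst p) (snd p) + ?T2 (fst p) (snd p) + ?T3 (fst p) (snd p)))"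
      by (intro ennreal_leI pointwise) auto
    then show ?case by (simp add: c split_beta' ennreal_mult)
  qed
  also have "\<dots> = ennreal c * (trilinear_form k1 a1 b1 d1 + trilinear_form k2 a2 b2 d2 + trilinear_form k3 a3 b3 d3)"
    by (simp add: nn_integral_cmult nn_integral_add) (simp add: split_beta')
  also have "\<dots> \<le> ennreal c * (ennreal B1 + ennreal B2 + ennreal B3)"
    by (intro mult_left_mono add_mono bounds) simp
  also have "\<dots> = ennreal (c * (B1 + B2 + B3))"
    using c bounds by (simp add: ennreal_mult)
  finally show ?thesis .
qed

abbreviation gradient_form :: "(pt \<Rightarrow> complex) \<Rightarrow> (pt \<Rightarrow> complex) \<Rightarrow> (pt \<Rightarrow> complex) \<Rightarrow> ennreal" where
  "gradient_form \<equiv> trilinear_form (\<lambda>\<xi> \<eta>. norm \<eta>)"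

definition gradient_bound :: "real \<Rightarrow> real \<Rightarrow> real \<Rightarrow> real \<Rightarrow> bool" where
  "gradient_bound p q r C \<longleftrightarrow> 0 \<le> C \<and> (\<forall>a b d. L2c (weighted p a) \<longrightarrow> L2c (weighted q b) \<longrightarrow> L2c (weighted r d) \<longrightarrow>
     gradient_form a b d \<le> ennreal (C * hnorm p a * hnorm q b * hnorm r d))"

lemma gradient_weight_le_hardy_kernels:
  assumes p: "0 \<le> p" "1 \<le> q" "0 \<le> r" "p + q + r = 2" and nonzero: "\<xi> \<noteq> 0" "\<eta> \<noteq> 0" "\<xi> \<noteq> \<eta>"
  shows "norm \<eta> * cmod (a (\<xi> - \<eta>)) * cmod (b \<eta>) * cmod (d \<xi>)
     \<le> 2 * (hardy_kernel p (\<xi> - \<eta>) \<eta> + hardy_kernel (q - 1) \<eta> \<xi> + hardy_kernel r \<xi> \<eta>)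
        * (cmod (weighted p a (\<xi> - \<eta>)) * cmod (weighted q b \<eta>) * cmod (weighted r d \<xi>))"
proof -
  have pos: "0 < norm (\<xi> - \<eta>)" "0 < norm \<eta>" "0 < norm \<xi>" using nonzero by auto
  have cancel: "x powr (-e) * (x powr e * y) = y" if "0 < x" for x e y :: real
    using that by (simp add: powr_minus field_simps)
  have cancel_gradient: "norm \<eta> powr (-(q - 1)) * (norm \<eta> powr q * y) = norm \<eta> * y" for y
    using pos by (simp add: powr_diff powr_minus field_simps)
  have "norm \<eta> * cmod (a (\<xi> - \<eta>)) * cmod (b \<eta>) * cmod (d \<xi>)
      = (norm (\<xi> - \<eta>) powr (-p) * cmod (weighted p a (\<xi> - \<eta>))) * (norm \<eta> powr (-(q - 1)) * cmod (weighted q b \<eta>)) * (norm \<xi> powr (-r) * cmod (weighted r d \<xi>))"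
    unfolding cmod_weighted cancel[OF pos(1)] cancel[OF pos(3)] cancel_gradient by (simp only: mult_ac)
  also have "\<dots> = (norm (\<xi> - \<eta>) powr (-p) * norm \<eta> powr (-(q - 1)) * norm \<xi> powr (-r))
      * (cmod (weighted p a (\<xi> - \<eta>)) * cmod (weighted q b \<eta>) * cmod (weighted r d \<xi>))"
    by (simp only: mult_ac)
  also have "\<dots> \<le> 2 * (hardy_kernel p (\<xi> - \<eta>) \<eta> + hardy_kernel (q - 1) \<eta> \<xi> + hardy_kernel r \<xi> \<eta>)
      * (cmod (weighted p a (\<xi> - \<eta>)) * cmod (weighted q b \<eta>) * cmod (weighted r d \<xi>))"
    using p by (intro mult_right_mono powr_product_le_hardy_kernels) auto
  finally show ?thesis .
qed

theorem gradient_bound_exists: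
  assumes p: "0 \<le> p" "p < 1" "1 \<le> q" "q < 2" "0 \<le> r" "r < 1" "p + q + r = 2"
  shows "\<exists>C. gradient_bound p q r C"
proof -
  obtain Cp Cq Cr where C: "hardy_bound p Cp" "hardy_bound (q - 1) Cq" "hardy_bound r Cr"
    using hardy_bound_exists[of p] hardy_bound_exists[of "q - 1"] hardy_bound_exists[of r] p by auto
  have "gradient_form a b d \<le> ennreal (2 * (Cp + Cq + Cr) * hnorm p a * hnorm q b * hnorm r d)"
    if L2c [measurable]: "L2c (weighted p a)" "L2c (weighted q b)" "L2c (weighted r d)" for a b d
  proof -
    let ?N = "hnorm p a * hnorm q b * hnorm r d"
    have [measurable]: "weighted p a \<in> borel_measurable borel" "weighted q b \<in> borel_measurable borel" "weighted r d \<in> borel_measurable borel"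
      by auto
    have "gradient_form a b d \<le> ennreal (2 * (Cp * ?N + Cq * ?N + Cr * ?N))"
    proof (rule trilinear_form_le_three)
      fix \<xi> \<eta> :: pt assume "\<xi> \<noteq> 0" "\<eta> \<noteq> 0" "\<xi> \<noteq> \<eta>"
      then show "trilinear_density (\<lambda>\<xi> \<eta>. norm \<eta>) a b d \<xi> \<eta>
          \<le> 2 * (trilinear_density (\<lambda>\<xi> \<eta>. hardy_kernel p (\<xi> - \<eta>) \<eta>) (weighted p a) (weighted q b) (weighted r d) \<xi> \<eta>
            + trilinear_density (\<lambda>\<xi> \<eta>. hardy_kernel (q - 1) \<eta> \<xi>) (weighted p a) (weighted q b) (weighted r d) \<xi> \<eta>
            + trilinear_density (\<lambda>\<xi> \<eta>. hardy_kernel r \<xi> \<eta>) (weighted p a) (weighted q b) (weighted r d) \<xi> \<eta>)"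
        using gradient_weight_le_hardy_kernels[of p q r \<xi> \<eta> a b d] p by (simp add: algebra_simps)
    next
      show "trilinear_form (\<lambda>\<xi> \<eta>. hardy_kernel p (\<xi> - \<eta>) \<eta>) (weighted p a) (weighted q b) (weighted r d)
          \<le> ennreal (Cp * ?N)"
        "trilinear_form (\<lambda>\<xi> \<eta>. hardy_kernel (q - 1) \<eta> \<xi>) (weighted p a) (weighted q b) (weighted r d)
            \<le> ennreal (Cq * ?N)"
        "trilinear_form (\<lambda>\<xi> \<eta>. hardy_kernel r \<xi> \<eta>) (weighted p a) (weighted q b) (weighted r d) \<le> ennreal (Cr * ?N)"
        using hardy_boundD[OF C(1) L2c] hardy_boundD[OF C(2) L2c] hardy_boundD[OF C(3) L2c]
          by (simp_all add: mult.assoc)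
    qed (use C in \<open>auto simp: hardy_bound_def\<close>)
    then show ?thesis by (simp add: algebra_simps)
  qed
  moreover have "0 \<le> 2 * (Cp + Cq + Cr)" using C by (simp add: hardy_bound_def)
  ultimately show ?thesis unfolding gradient_bound_def by blast
qed

lemma gradient_boundD:
  assumes "gradient_bound p q r C" "L2c (weighted p a)" "L2c (weighted q b)" "L2c (weighted r d)"
  shows "gradient_form a b d \<le> ennreal (C * hnorm p a * hnorm q b * hnorm r d)"
  using assms unfolding gradient_bound_def by blast

section \<open>The commutator estimate\<close>

definition sqg_kernel :: "pt \<Rightarrow> pt \<Rightarrow> real" where
  "sqg_kernel \<xi> \<eta> = (\<xi> $ 2 * \<eta> $ 1 - \<xi> $ 1 * \<eta> $ 2) / norm (\<xi> - \<eta>)"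

lemma sqg_kernel_antisym: "sqg_kernel \<eta> \<xi> = - sqg_kernel \<xi> \<eta>"
  by (simp add: sqg_kernel_def norm_minus_commute[of \<eta>] minus_divide_left)

lemma sqg_kernel_minus: "sqg_kernel (- \<xi>) (- \<eta>) = sqg_kernel \<xi> \<eta>"
proof -
  have "norm (- \<xi> - - \<eta>) = norm (\<xi> - \<eta>)" by (simp add: norm_minus_commute)
  then show ?thesis by (simp add: sqg_kernel_def)
qed

lemma sqg_kernel_measurable [measurable (raw)]:
  assumes [measurable]: "f \<in> borel_measurable M" "g \<in> borel_measurable M"
  shows "(\<lambda>x. sqg_kernel (f x) (g x)) \<in> borel_measurable M"
proof -
  have [measurable]: "(\<lambda>x. (x::pt) $ i) \<in> borel_measurable borel" for i
    by (intro borel_measurable_continuous_onI continuous_intros)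
  show ?thesis unfolding sqg_kernel_def by measurable
qed

lemma abs_cross_le: "\<bar>x $ 2 * y $ 1 - x $ 1 * y $ 2\<bar> \<le> norm x * norm y" for x y :: pt
proof (rule power2_le_imp_le)
  have "(\<bar>x $ 2 * y $ 1 - x $ 1 * y $ 2\<bar>)\<^sup>2 + (x \<bullet> y)\<^sup>2 = (norm x * norm y)\<^sup>2"
    by (simp add: inner_pt power_mult_distrib norm_pt_sq) (simp add: power2_eq_square algebra_simps)
  then show "(\<bar>x $ 2 * y $ 1 - x $ 1 * y $ 2\<bar>)\<^sup>2 \<le> (norm x * norm y)\<^sup>2"
    using zero_le_power2[of "x \<bullet> y"] by linarith
qed simp

lemma sqg_kernel_le_snd: "\<bar>sqg_kernel \<xi> \<eta>\<bar> \<le> norm \<eta>"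
proof (cases "\<xi> = \<eta>")
  case False
  have "\<bar>\<xi> $ 2 * \<eta> $ 1 - \<xi> $ 1 * \<eta> $ 2\<bar> \<le> norm (\<xi> - \<eta>) * norm \<eta>"
    using abs_cross_le[of "\<xi> - \<eta>" \<eta>] by (simp add: algebra_simps)
  then show ?thesis using False by (simp add: sqg_kernel_def field_simps)
qed (simp add: sqg_kernel_def)

lemma sqg_kernel_le_fst: "\<bar>sqg_kernel \<xi> \<eta>\<bar> \<le> norm \<xi>"
  using sqg_kernel_le_snd[of \<eta> \<xi>] by (simp add: sqg_kernel_antisym[of \<eta> \<xi>])

lemma sqg_kernel_degenerate: "\<xi> - \<eta> = 0 \<or> \<eta> = 0 \<or> \<xi> = 0 \<Longrightarrow> sqg_kernel \<xi> \<eta> = 0"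
  by (auto simp: sqg_kernel_def)

abbreviation sqg_form :: "(pt \<Rightarrow> complex) \<Rightarrow> (pt \<Rightarrow> complex) \<Rightarrow> (pt \<Rightarrow> complex) \<Rightarrow> ennreal" where
  "sqg_form \<equiv> trilinear_form sqg_kernel"

lemma sqg_form_le_gradient_form: "sqg_form a b d \<le> gradient_form a b d"
  by (intro nn_integral_mono) (auto intro!: ennreal_leI mult_right_mono sqg_kernel_le_snd)

lemma powr_diff_le_tangent:
  fixes a b e :: real
  assumes "0 \<le> a" "a \<le> b" "1 \<le> e"
  shows "b powr e - a powr e \<le> e * (b - a) * b powr (e - 1)"
proof (cases "a = b")
  case False
  then have "a < b" using assms by simp
  moreover have "continuous_on {a..b} (\<lambda>x. x powr e)"
    using assms by (intro continuous_on_powr') (auto intro: continuous_intros)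
  moreover have "((\<lambda>x. x powr e) has_derivative (\<lambda>h. h * (e * x powr (e - 1)))) (at x)" if "a < x" for x
    using DERIV_fun_powr[OF DERIV_ident, of x e] that assms
      by (simp add: has_field_derivative_def mult.commute[of _ "e * _"])
  ultimately obtain x where x: "a < x" "x < b" "b powr e - a powr e = (b - a) * (e * x powr (e - 1))"
    using mvt[of a b "\<lambda>x. x powr e" "\<lambda>x h. h * (e * x powr (e - 1))"] by auto
  have "(b - a) * (e * x powr (e - 1)) \<le> (b - a) * (e * b powr (e - 1))"
    using x assms by (intro mult_left_mono powr_mono2) auto
  then show ?thesis using x(3) by (simp add: mult_ac)
qed simp

definition cutoff_weight :: "real \<Rightarrow> real \<Rightarrow> pt \<Rightarrow> real" where
  "cutoff_weight s R \<xi> = (min (norm \<xi>) R) powr (2 * s)"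

lemma cutoff_weight_measurable [measurable]: "cutoff_weight s R \<in> borel_measurable borel"
  unfolding cutoff_weight_def[abs_def] by measurable

lemma cutoff_weight_nonneg [simp]: "0 \<le> cutoff_weight s R \<xi>"
  by (simp add: cutoff_weight_def)

lemma cutoff_weight_le: "0 \<le> s \<Longrightarrow> 0 < R \<Longrightarrow> cutoff_weight s R \<xi> \<le> norm \<xi> powr (2 * s)"
  by (auto simp: cutoff_weight_def intro!: powr_mono2)

lemma cutoff_weight_le_radius: "0 \<le> s \<Longrightarrow> 0 < R \<Longrightarrow> cutoff_weight s R \<xi> \<le> R powr (2 * s)"
  by (auto simp: cutoff_weight_def intro!: powr_mono2)

lemma cutoff_weight_eq: "norm \<xi> \<le> R \<Longrightarrow> cutoff_weight s R \<xi> = norm \<xi> powr (2 * s)"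
  by (simp add: cutoff_weight_def)

lemma cutoff_weight_diff_Lipschitz:
  assumes "1 \<le> 2 * s" "0 < R"
  shows "\<bar>cutoff_weight s R \<xi> - cutoff_weight s R \<eta>\<bar> \<le> 2 * s * norm (\<xi> - \<eta>) * (max (norm \<xi>) (norm \<eta>)) powr (2 * s - 1)"
proof -
  have ordered: "\<bar>cutoff_weight s R x - cutoff_weight s R y\<bar> \<le> 2 * s * norm (x - y) * norm x powr (2 * s - 1)"
    if "norm y \<le> norm x" for x y
  proof -
    let ?x = "min (norm x) R" and ?y = "min (norm y) R"
    have "?y powr (2 * s) \<le> ?x powr (2 * s)" using that assms by (intro powr_mono2) auto
    then have "\<bar>cutoff_weight s R x - cutoff_weight s R y\<bar> = ?x powr (2 * s) - ?y powr (2 * s)"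
      by (simp add: cutoff_weight_def)
    also have "\<dots> \<le> 2 * s * (?x - ?y) * ?x powr (2 * s - 1)"
      using that assms by (intro powr_diff_le_tangent) auto
    also have "\<dots> \<le> 2 * s * norm (x - y) * norm x powr (2 * s - 1)"
      using that assms norm_triangle_ineq2[of x y] by (intro mult_mono powr_mono2 mult_left_mono) auto
    finally show ?thesis .
  qed
  show ?thesis
    using ordered[of \<eta> \<xi>] ordered[of \<xi> \<eta>]
    by (cases "norm \<eta> \<le> norm \<xi>") (simp_all add: max_absorb1 max_absorb2 norm_minus_commute abs_minus_commute)
qed

lemma cutoff_weight_diff_le_max:
  assumes "0 \<le> s" "0 < R"
  shows "\<bar>cutoff_weight s R \<xi> - cutoff_weight s R \<eta>\<bar> \<le> (max (norm \<xi>) (norm \<eta>)) powr (2 * s)"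
proof -
  have "cutoff_weight s R \<xi> \<le> (max (norm \<xi>) (norm \<eta>)) powr (2 * s)"
    "cutoff_weight s R \<eta> \<le> (max (norm \<xi>) (norm \<eta>)) powr (2 * s)"
    using assms by (auto simp: cutoff_weight_def intro!: powr_mono2)
  then show ?thesis using cutoff_weight_nonneg[of s R \<xi>] cutoff_weight_nonneg[of s R \<eta>] by linarith
qed

definition commutator_kernel :: "real \<Rightarrow> real \<Rightarrow> pt \<Rightarrow> pt \<Rightarrow> real" where
  "commutator_kernel s R \<xi> \<eta> = sqg_kernel \<xi> \<eta> * (cutoff_weight s R \<xi> - cutoff_weight s R \<eta>)"

lemma commutator_kernel_le_min_max:
  assumes "0 \<le> s" "0 < R"
  shows "\<bar>commutator_kernel s R \<xi> \<eta>\<bar> \<le> min (norm \<xi>) (norm \<eta>) * (max (norm \<xi>) (norm \<eta>)) powr (2 * s)"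
  unfolding commutator_kernel_def abs_mult
  using assms by (intro mult_mono cutoff_weight_diff_le_max) (auto intro: sqg_kernel_le_fst sqg_kernel_le_snd)

lemma commutator_kernel_le_near_diagonal:
  assumes s: "1 \<le> 2 * s" and R: "0 < R" and near: "norm (\<xi> - \<eta>) \<le> norm \<eta>"
  shows "\<bar>commutator_kernel s R \<xi> \<eta>\<bar> \<le> 2 * s * 2 powr (2 * s - 1) * (norm (\<xi> - \<eta>) * norm \<eta> powr (2 * s))"
proof -
  have "norm \<xi> \<le> 2 * norm \<eta>" using norm_triangle_ineq[of \<eta> "\<xi> - \<eta>"] near by simp
  then have "max (norm \<xi>) (norm \<eta>) powr (2 * s - 1) \<le> (2 * norm \<eta>) powr (2 * s - 1)"
    using s by (intro powr_mono2) (auto simp: le_max_iff_disj)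
  also have "\<dots> = 2 powr (2 * s - 1) * norm \<eta> powr (2 * s - 1)" by (simp add: powr_mult)
  finally have largest: "max (norm \<xi>) (norm \<eta>) powr (2 * s - 1) \<le> 2 powr (2 * s - 1) * norm \<eta> powr (2 * s - 1)" .
  have "\<bar>commutator_kernel s R \<xi> \<eta>\<bar> \<le> norm \<eta> * (2 * s * norm (\<xi> - \<eta>) * max (norm \<xi>) (norm \<eta>) powr (2 * s - 1))"
    unfolding commutator_kernel_def abs_mult
      using s R by (intro mult_mono sqg_kernel_le_snd cutoff_weight_diff_Lipschitz) auto
  also have "\<dots> \<le> norm \<eta> * (2 * s * norm (\<xi> - \<eta>) * (2 powr (2 * s - 1) * norm \<eta> powr (2 * s - 1)))"
    using s by (intro mult_left_mono largest) auto
  also have "\<dots> = 2 * s * 2 powr (2 * s - 1) * (norm (\<xi> - \<eta>) * norm \<eta> powr (2 * s))"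
    using powr_add[of "norm \<eta>" 1 "2 * s - 1"] by simp
  finally show ?thesis .
qed

text \<open>In each region the kernel of the commutator is bounded by the smallest of the three
  frequencies times the \<open>2 s\<close>-th power of the largest; where \<open>\<xi> - \<eta>\<close> is the smallest, this is
  where the cancellation is needed.\<close>

lemma commutator_kernel_le_least_frequency:
  assumes s: "1 \<le> 2 * s" and R: "0 < R"
  defines "c \<equiv> 2 * s * 2 powr (2 * s - 1)"
  shows "norm (\<xi> - \<eta>) \<le> norm \<eta> \<Longrightarrow> \<bar>commutator_kernel s R \<xi> \<eta>\<bar> \<le> c * (norm (\<xi> - \<eta>) * norm \<eta> powr (2 * s))"
    and "norm \<eta> \<le> norm \<xi> \<Longrightarrow> \<bar>commutator_kernel s R \<xi> \<eta>\<bar> \<le> c * (norm \<eta> * norm \<xi> powr (2 * s))"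
    and "norm \<xi> \<le> norm \<eta> \<Longrightarrow> \<bar>commutator_kernel s R \<xi> \<eta>\<bar> \<le> c * (norm \<xi> * norm \<eta> powr (2 * s))"
proof -
  have "1 \<le> (2::real) powr (2 * s - 1)" using s by (intro ge_one_powr_ge_zero) auto
  then have "1 * 1 \<le> 2 * s * 2 powr (2 * s - 1)" using s by (intro mult_mono) auto
  then have "1 \<le> c" by (simp add: c_def)
  then have "\<bar>commutator_kernel s R \<xi> \<eta>\<bar> \<le> c * (min (norm \<xi>) (norm \<eta>) * (max (norm \<xi>) (norm \<eta>)) powr (2 * s))"
    using commutator_kernel_le_min_max[of s R \<xi> \<eta>] mult_right_mono[of 1 c "min (norm \<xi>) (norm \<eta>) * (max (norm \<xi>) (norm \<eta>)) powr (2 * s)"] s R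
    by simp
  then show "norm \<eta> \<le> norm \<xi> \<Longrightarrow> \<bar>commutator_kernel s R \<xi> \<eta>\<bar> \<le> c * (norm \<eta> * norm \<xi> powr (2 * s))"
    and "norm \<xi> \<le> norm \<eta> \<Longrightarrow> \<bar>commutator_kernel s R \<xi> \<eta>\<bar> \<le> c * (norm \<xi> * norm \<eta> powr (2 * s))"
    by (simp_all add: min_absorb1 min_absorb2 max_absorb1 max_absorb2)
qed (use commutator_kernel_le_near_diagonal[OF s R] in \<open>simp add: c_def\<close>)

locale sqg_exponents =
  fixes \<alpha> s :: real
  assumes s_eq: "s = 2 - 2 * \<alpha>" and \<alpha>_pos: "0 < \<alpha>" and \<alpha>_less_half: "\<alpha> < 1/2"
begin

lemma s_bounds: "1 < s" "s < 2"
  using s_eq \<alpha>_pos \<alpha>_less_half by auto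

lemma frequency_product_le:
  fixes x y z :: real
  assumes "0 < x" "0 < y" "0 < z" "y \<le> 2 * z"
  shows "x * y powr (2 * s) \<le> 2 powr (s + \<alpha>) * ((x powr (-(s - 1)) * y powr ((s - 1) - 1)) * (x powr s * y powr (s + \<alpha>) * z powr (s + \<alpha>)))"
proof -
  have comparable: "y powr (s + \<alpha>) \<le> 2 powr (s + \<alpha>) * z powr (s + \<alpha>)"
    using powr_mono2[of "s + \<alpha>" y "2 * z"] assms s_bounds \<alpha>_pos by (simp add: powr_mult)
  have "x powr (-(s - 1)) * x powr s = x" using assms(1) by (simp add: powr_add[symmetric])
  moreover have "y powr ((s - 1) - 1) * y powr (s + \<alpha>) * y powr (s + \<alpha>) = y powr (2 * s)"
    unfolding powr_add[symmetric] using s_eq by (intro arg_cong[where f="\<lambda>e. y powr e"]) simp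
  ultimately have "x * y powr (2 * s)
      = (x powr (-(s - 1)) * x powr s) * (y powr ((s - 1) - 1) * y powr (s + \<alpha>) * y powr (s + \<alpha>))"
    by simp
  also have "\<dots> \<le> (x powr (-(s - 1)) * x powr s) * (y powr ((s - 1) - 1) * y powr (s + \<alpha>) * (2 powr (s + \<alpha>) * z powr (s + \<alpha>)))"
    by (intro mult_left_mono comparable) auto
  finally show ?thesis by (simp only: mult_ac)
qed

lemma commutator_kernel_le_hardy_kernels:
  assumes R: "0 < R"
  shows "\<bar>commutator_kernel s R \<xi> \<eta>\<bar> \<le> 2 * s * 2 powr (2 * s - 1) * 2 powr (s + \<alpha>) *
     (hardy_kernel (s - 1) (\<xi> - \<eta>) \<eta> * (norm (\<xi> - \<eta>) powr s * norm \<eta> powr (s + \<alpha>) * norm \<xi> powr (s + \<alpha>))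
    + hardy_kernel (s - 1) \<eta> \<xi> * (norm (\<xi> - \<eta>) powr (s + \<alpha>) * norm \<eta> powr s * norm \<xi> powr (s + \<alpha>))
    + hardy_kernel (s - 1) \<xi> \<eta> * (norm (\<xi> - \<eta>) powr (s + \<alpha>) * norm \<eta> powr (s + \<alpha>) * norm \<xi> powr s))"
   (is "?L \<le> ?c * ?d * (?A + ?B + ?C)")
proof (cases "\<xi> - \<eta> = 0 \<or> \<eta> = 0 \<or> \<xi> = 0")
  case True
  then have "?L = 0" by (simp add: commutator_kernel_def sqg_kernel_degenerate)
  moreover have "0 \<le> ?c * ?d * (?A + ?B + ?C)"
    using s_bounds by (intro mult_nonneg_nonneg add_nonneg_nonneg) auto
  ultimately show ?thesis by (rule ord_eq_le_trans)
next
  case False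
  then have pos: "0 < norm (\<xi> - \<eta>)" "0 < norm \<eta>" "0 < norm \<xi>" by auto
  have nonneg: "0 \<le> ?c" "0 \<le> ?A" "0 \<le> ?B" "0 \<le> ?C" using s_bounds by auto
  have triangle: "norm \<eta> \<le> norm \<xi> + norm (\<xi> - \<eta>)" "norm \<xi> \<le> norm \<eta> + norm (\<xi> - \<eta>)"
    using norm_triangle_ineq4[of \<xi> "\<xi> - \<eta>"] norm_triangle_ineq[of \<eta> "\<xi> - \<eta>"] by simp_all
  have s_ge_half: "1 \<le> 2 * s" using s_bounds by simp
  have conclude: ?thesis
    if "?L \<le> ?c * (x * y powr (2 * s))" "x * y powr (2 * s) \<le> ?d * E" "E \<le> ?A + ?B + ?C" for x y E
  proof -
    have "?L \<le> ?c * (?d * E)" using that(1) mult_left_mono[OF that(2) nonneg(1)] by (rule order_trans)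
    also have "\<dots> = ?c * ?d * E" by simp
    also have "\<dots> \<le> ?c * ?d * (?A + ?B + ?C)" by (intro mult_left_mono that(3) mult_nonneg_nonneg[OF nonneg(1)]) simp
    finally show ?thesis .
  qed
  consider (diff_least) "norm (\<xi> - \<eta>) \<le> norm \<eta>" "norm (\<xi> - \<eta>) \<le> norm \<xi>"
    | (\<eta>_least) "norm \<eta> \<le> norm (\<xi> - \<eta>)" "norm \<eta> \<le> norm \<xi>"
    | (\<xi>_least) "norm \<xi> \<le> norm (\<xi> - \<eta>)" "norm \<xi> \<le> norm \<eta>" by linarith
  then show ?thesis
  proof cases
    case diff_least
    then show ?thesis
      by (intro conclude[OF commutator_kernel_le_least_frequency(1)[OF s_ge_half R] frequency_product_le[OF pos]])
        (use triangle nonneg in \<open>auto simp: hardy_kernel_def\<close>)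
  next
    case \<eta>_least
    then show ?thesis
      by (intro conclude[OF commutator_kernel_le_least_frequency(2)[OF s_ge_half R] frequency_product_le[OF pos(2,3,1)]])
        (use triangle nonneg in \<open>auto simp: hardy_kernel_def mult_ac\<close>)
  next
    case \<xi>_least
    then show ?thesis
      by (intro conclude[OF commutator_kernel_le_least_frequency(3)[OF s_ge_half R] frequency_product_le[OF pos(3,2,1)]])
        (use triangle nonneg in \<open>auto simp: hardy_kernel_def mult_ac\<close>)
  qed
qed

definition commutator_bound :: "real \<Rightarrow> bool" where
  "commutator_bound C \<longleftrightarrow> 0 \<le> C \<and> (\<forall>R w. 0 < R \<longrightarrow> L2c (weighted s w) \<longrightarrow> L2c (weighted (s + \<alpha>) w) \<longrightarrow>
     trilinear_form (commutator_kernel s R) w w w \<le> ennreal (C * hnorm s w * (hnorm (s + \<alpha>) w)\<^sup>2))"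

theorem commutator_bound_exists: "\<exists>C. commutator_bound C"
proof -
  obtain C where C: "hardy_bound (s - 1) C" using hardy_bound_exists[of "s - 1"] s_bounds by auto
  define c where "c = 2 * s * 2 powr (2 * s - 1) * 2 powr (s + \<alpha>)"
  have c_nonneg: "0 \<le> c" using s_bounds by (simp add: c_def)
  have "trilinear_form (commutator_kernel s R) w w w \<le> ennreal (3 * c * C * hnorm s w * (hnorm (s + \<alpha>) w)\<^sup>2)"
    if R: "0 < R" and L2c: "L2c (weighted s w)" "L2c (weighted (s + \<alpha>) w)" for R w
  proof -
    let ?A = "weighted s w" and ?B = "weighted (s + \<alpha>) w"
    let ?N = "hnorm s w * (hnorm (s + \<alpha>) w)\<^sup>2"
    have [measurable]: "?A \<in> borel_measurable borel" "?B \<in> borel_measurable borel" using L2c by auto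
    have "trilinear_form (commutator_kernel s R) w w w \<le> ennreal (c * (C * ?N + C * ?N + C * ?N))"
    proof (rule trilinear_form_le_three)
      fix \<xi> \<eta> :: pt
      have "0 \<le> cmod (w (\<xi> - \<eta>)) * cmod (w \<eta>) * cmod (w \<xi>)" by simp
      from mult_right_mono[OF commutator_kernel_le_hardy_kernels[OF R, of \<xi> \<eta>] this, folded c_def]
      show "trilinear_density (commutator_kernel s R) w w w \<xi> \<eta>
          \<le> c * (trilinear_density (\<lambda>\<xi> \<eta>. hardy_kernel (s - 1) (\<xi> - \<eta>) \<eta>) ?A ?B ?B \<xi> \<eta>
            + trilinear_density (\<lambda>\<xi> \<eta>. hardy_kernel (s - 1) \<eta> \<xi>) ?B ?A ?B \<xi> \<eta>
            + trilinear_density (\<lambda>\<xi> \<eta>. hardy_kernel (s - 1) \<xi> \<eta>) ?B ?B ?A \<xi> \<eta>)"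
        by (simp only: cmod_weighted abs_of_nonneg[OF hardy_kernel_nonneg] distrib_left distrib_right mult_ac)
    next
      show "trilinear_form (\<lambda>\<xi> \<eta>. hardy_kernel (s - 1) (\<xi> - \<eta>) \<eta>) ?A ?B ?B \<le> ennreal (C * ?N)"
        "trilinear_form (\<lambda>\<xi> \<eta>. hardy_kernel (s - 1) \<eta> \<xi>) ?B ?A ?B \<le> ennreal (C * ?N)"
        "trilinear_form (\<lambda>\<xi> \<eta>. hardy_kernel (s - 1) \<xi> \<eta>) ?B ?B ?A \<le> ennreal (C * ?N)"
        using hardy_boundD[OF C L2c(1) L2c(2) L2c(2)] hardy_boundD[OF C L2c(2) L2c(1) L2c(2)] hardy_boundD[OF C L2c(2) L2c(2) L2c(1)]
        by (simp_all add: power2_eq_square mult_ac)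
    qed (use C c_nonneg in \<open>auto simp: hardy_bound_def\<close>)
    then show ?thesis by (simp add: mult_ac)
  qed
  moreover have "0 \<le> 3 * c * C" using C c_nonneg by (simp add: hardy_bound_def)
  ultimately show ?thesis unfolding commutator_bound_def by blast
qed

definition commutator_const :: real where
  "commutator_const = (SOME C. commutator_bound C)"

lemma commutator_const_bound: "commutator_bound commutator_const"
  unfolding commutator_const_def by (rule someI_ex[OF commutator_bound_exists])

lemma commutator_const_nonneg [simp]: "0 \<le> commutator_const"
  using commutator_const_bound by (simp add: commutator_bound_def)

lemma commutator_estimate:
  assumes "0 < R" "L2c (weighted s w)" "L2c (weighted (s + \<alpha>) w)"
  shows "trilinear_form (commutator_kernel s R) w w w \<le> ennreal (commutator_const * hnorm s w * (hnorm (s + \<alpha>) w)\<^sup>2)"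
  using commutator_const_bound assms by (simp add: commutator_bound_def)

definition gradient_const :: real where
  "gradient_const = (SOME C. gradient_bound \<alpha> s \<alpha> C)"

lemma gradient_const_bound: "gradient_bound \<alpha> s \<alpha> gradient_const"
  unfolding gradient_const_def
  by (rule someI_ex, rule gradient_bound_exists) (use s_bounds s_eq \<alpha>_pos \<alpha>_less_half in auto)

lemma gradient_const_nonneg [simp]: "0 \<le> gradient_const"
  using gradient_const_bound by (simp add: gradient_bound_def)

lemma sqg_form_estimate:
  "L2c (weighted \<alpha> a) \<Longrightarrow> L2c (weighted s b) \<Longrightarrow> L2c (weighted \<alpha> d) \<Longrightarrow>
    sqg_form a b d \<le> ennreal (gradient_const * hnorm \<alpha> a * hnorm s b * hnorm \<alpha> d)"
  by (rule order_trans[OF sqg_form_le_gradient_form gradient_boundD[OF gradient_const_bound]])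

end

section \<open>The nonlinearity in frequency space\<close>

definition advection :: "(pt \<Rightarrow> complex) \<Rightarrow> (pt \<Rightarrow> complex) \<Rightarrow> pt \<Rightarrow> complex" where
  "advection a b \<xi> = complex_of_real plancherel_const * (LINT \<eta>|lborel. complex_of_real (sqg_kernel \<xi> \<eta>) * a (\<xi> - \<eta>) * b \<eta>)"

lemma advection_integrand:
  assumes a [measurable]: "L2c a" and b [measurable]: "L2c b"
  shows "integrable lborel (\<lambda>\<eta>. complex_of_real (sqg_kernel \<xi> \<eta>) * a (\<xi> - \<eta>) * b \<eta>)" (is "integrable lborel ?f")
    and "cmod (LINT \<eta>|lborel. complex_of_real (sqg_kernel \<xi> \<eta>) * a (\<xi> - \<eta>) * b \<eta>) \<le> norm \<xi> * L2norm a * L2norm b"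
proof -
  have [measurable]: "a \<in> borel_measurable borel" "b \<in> borel_measurable borel" by auto
  note reflected = L2_reflect[OF a, of \<xi>]
  let ?g = "\<lambda>\<eta>. norm \<xi> * (cmod (a (\<xi> - \<eta>)) * cmod (b \<eta>))"
  have g: "integrable lborel ?g" by (intro integrable_mult_right L2c_mult_integrable_norm reflected b)
  have dominated: "norm (?f \<eta>) \<le> ?g \<eta>" for \<eta>
    unfolding norm_mult mult.assoc norm_of_real by (intro mult_right_mono sqg_kernel_le_fst) auto
  have "norm (?f \<eta>) \<le> norm (?g \<eta>)" for \<eta>
    by (rule order_trans[OF dominated]) (simp only: real_norm_def abs_ge_self)
  then show f: "integrable lborel ?f"
    by (intro Bochner_Integration.integrable_bound[OF g] AE_I2; measurable)
  have "cmod (LINT \<eta>|lborel. ?f \<eta>) \<le> (LINT \<eta>|lborel. ?g \<eta>)"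
    by (rule order_trans[OF integral_norm_bound]) (rule integral_mono[OF integrable_norm[OF f] g dominated])
  also have "\<dots> = norm \<xi> * (LINT \<eta>|lborel. cmod (a (\<xi> - \<eta>)) * cmod (b \<eta>))" by (rule integral_mult_right_zero)
  also have "\<dots> \<le> norm \<xi> * (L2norm a * L2norm b)"
    using L2_Cauchy_Schwarz[OF reflected(1) b] reflected(2) by (intro mult_left_mono) auto
  finally show "cmod (LINT \<eta>|lborel. ?f \<eta>) \<le> norm \<xi> * L2norm a * L2norm b" by (simp add: mult.assoc)
qed

lemma plancherel_const_bounds: "0 < plancherel_const" "plancherel_const \<le> 1"
proof -
  have "1 \<le> 2 * pi" using pi_gt3 by simp
  then have "1 \<le> (2 * pi)\<^sup>2" by (rule one_le_power)
  then show "plancherel_const \<le> 1" by (simp add: plancherel_const_def divide_le_eq_1)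
qed (simp add: plancherel_const_def)

lemma cmod_plancherel_const_mult_le: "cmod (complex_of_real plancherel_const * z) \<le> cmod z"
  unfolding norm_mult norm_of_real abs_of_pos[OF plancherel_const_bounds(1)]
  by (rule mult_left_le_one_le[OF norm_ge_zero less_imp_le[OF plancherel_const_bounds(1)] plancherel_const_bounds(2)])

lemma advection_bound:
  assumes "L2c a" "L2c b"
  shows "cmod (advection a b \<xi>) \<le> norm \<xi> * L2norm a * L2norm b"
  unfolding advection_def by (rule order_trans[OF cmod_plancherel_const_mult_le advection_integrand(2)[OF assms]])

lemma advection_diff_left:
  assumes "L2c a" "L2c a'" "L2c b"
  shows "advection (\<lambda>x. a x - a' x) b \<xi> = advection a b \<xi> - advection a' b \<xi>"
  unfolding advection_def using advection_integrand(1)[OF assms(1,3)] advection_integrand(1)[OF assms(2,3)]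
  by (simp add: left_diff_distrib right_diff_distrib)

lemma advection_diff_right:
  assumes "L2c a" "L2c b" "L2c b'"
  shows "advection a (\<lambda>x. b x - b' x) \<xi> = advection a b \<xi> - advection a b' \<xi>"
  unfolding advection_def using advection_integrand(1)[OF assms(1,2)] advection_integrand(1)[OF assms(1,3)]
  by (simp add: right_diff_distrib)

lemma advection_self_diff:
  assumes "L2c a" "L2c b"
  shows "advection a a \<xi> - advection b b \<xi> = advection (\<lambda>x. a x - b x) a \<xi> + advection b (\<lambda>x. a x - b x) \<xi>"
  using advection_diff_left[OF assms assms(1)] advection_diff_right[OF assms(2) assms] by simp

lemma advection_Lipschitz:
  assumes "L2c a" "L2c b"
  shows "cmod (advection a a \<xi> - advection b b \<xi>) \<le> norm \<xi> * (L2norm a + L2norm b) * L2norm (\<lambda>x. a x - b x)"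
proof -
  have diff: "L2c (\<lambda>x. a x - b x)" using assms by auto
  have "cmod (advection a a \<xi> - advection b b \<xi>)
      \<le> norm \<xi> * L2norm (\<lambda>x. a x - b x) * L2norm a + norm \<xi> * L2norm b * L2norm (\<lambda>x. a x - b x)"
    unfolding advection_self_diff[OF assms]
    by (rule order_trans[OF norm_triangle_ineq add_mono[OF advection_bound[OF diff assms(1)] advection_bound[OF assms(2) diff]]])
  then show ?thesis by (simp add: algebra_simps)
qed

lemma advection_cmult: "advection (\<lambda>x. c * a x) (\<lambda>x. c * b x) \<xi> = c\<^sup>2 * advection a b \<xi>"
proof -
  have "(LINT \<eta>|lborel. complex_of_real (sqg_kernel \<xi> \<eta>) * (c * a (\<xi> - \<eta>)) * (c * b \<eta>))
      = (LINT \<eta>|lborel. c\<^sup>2 * (complex_of_real (sqg_kernel \<xi> \<eta>) * a (\<xi> - \<eta>) * b \<eta>))"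
    by (rule Bochner_Integration.integral_cong) (simp_all add: power2_eq_square mult_ac)
  also have "\<dots> = c\<^sup>2 * (LINT \<eta>|lborel. complex_of_real (sqg_kernel \<xi> \<eta>) * a (\<xi> - \<eta>) * b \<eta>)"
    by (rule integral_mult_right_zero)
  finally show ?thesis unfolding advection_def by simp
qed

abbreviation hermitian :: "(pt \<Rightarrow> complex) \<Rightarrow> bool" where
  "hermitian a \<equiv> (\<forall>\<xi>. a (- \<xi>) = cnj (a \<xi>))"

lemma advection_hermitian:
  assumes "hermitian a" "hermitian b"
  shows "advection a b (- \<xi>) = cnj (advection a b \<xi>)"
proof -
  have "a (- \<xi> - - \<eta>) = cnj (a (\<xi> - \<eta>))" for \<eta>
    using assms(1)[rule_format, of "\<xi> - \<eta>"] by simp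
  then have "(LINT \<eta>|lborel. complex_of_real (sqg_kernel (- \<xi>) (- \<eta>)) * a (- \<xi> - - \<eta>) * b (- \<eta>))
      = cnj (LINT \<eta>|lborel. complex_of_real (sqg_kernel \<xi> \<eta>) * a (\<xi> - \<eta>) * b \<eta>)"
    unfolding cnj_lint by (intro Bochner_Integration.integral_cong) (simp_all add: sqg_kernel_minus assms(2))
  then show ?thesis
    unfolding advection_def using integral_uminus[of "\<lambda>\<eta>. complex_of_real (sqg_kernel (- \<xi>) \<eta>) * a (- \<xi> - \<eta>) * b \<eta>"] by simp
qed

abbreviation jointly_borel :: "(real \<Rightarrow> pt \<Rightarrow> complex) \<Rightarrow> bool" where
  "jointly_borel w \<equiv> (\<lambda>(t, \<xi>). w t \<xi>) \<in> borel_measurable (borel \<Otimes>\<^sub>M borel)"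

lemma measurable_pair_apply:
  assumes w: "(\<lambda>(t, \<xi>). w t \<xi>) \<in> borel_measurable (borel \<Otimes>\<^sub>M borel)"
    and "f \<in> borel_measurable M" "g \<in> borel_measurable M"
  shows "(\<lambda>x. w (f x) (g x)) \<in> borel_measurable M"
  using measurable_compose[OF measurable_Pair[OF assms(2,3)] w] by simp

lemma jointly_borel_slice: assumes "jointly_borel w" shows "w t \<in> borel_measurable borel"
  using measurable_pair_apply[OF assms, of "\<lambda>_. t" borel "\<lambda>x. x"] by simp

lemma jointly_borel_L2norm: assumes "jointly_borel w" shows "(\<lambda>t. L2norm (w t)) \<in> borel_measurable borel"
proof -
  note [measurable (raw)] = measurable_pair_apply[OF assms]
  show ?thesis unfolding L2norm_def L2norm_sq_def by measurable
qed

lemma jointly_borel_weighted: assumes "jointly_borel w" shows "jointly_borel (\<lambda>t. weighted r (w t))"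
proof -
  note [measurable (raw)] = measurable_pair_apply[OF assms]
  show ?thesis unfolding weighted_def split_beta' by measurable
qed

lemma jointly_borel_advection:
  assumes "jointly_borel w" shows "jointly_borel (\<lambda>t. advection (w t) (w t))"
proof -
  note [measurable (raw)] = measurable_pair_apply[OF assms]
  show ?thesis unfolding advection_def split_beta' by measurable
qed

lemma advection_measurable:
  assumes [measurable]: "a \<in> borel_measurable borel" "b \<in> borel_measurable borel"
  shows "advection a b \<in> borel_measurable borel"
  unfolding advection_def[abs_def] by measurable

lemma nn_integral_advection_le:
  assumes [measurable]: "a \<in> borel_measurable borel" "b \<in> borel_measurable borel" "d \<in> borel_measurable borel"
  shows "(\<integral>\<^sup>+\<xi>. ennreal (cmod (advection a b \<xi>) * cmod (d \<xi>)) \<partial>lborel) \<le> sqg_form a b d"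
proof -
  let ?f = "\<lambda>\<xi> \<eta>. complex_of_real (sqg_kernel \<xi> \<eta>) * a (\<xi> - \<eta>) * b \<eta>"
  have "(\<integral>\<^sup>+\<xi>. ennreal (cmod (advection a b \<xi>) * cmod (d \<xi>)) \<partial>lborel)
      \<le> (\<integral>\<^sup>+\<xi>. \<integral>\<^sup>+\<eta>. ennreal (\<bar>sqg_kernel \<xi> \<eta>\<bar> * cmod (a (\<xi> - \<eta>)) * cmod (b \<eta>) * cmod (d \<xi>)) \<partial>lborel \<partial>lborel)"
  proof (rule nn_integral_mono)
    fix \<xi>
    have "ennreal (cmod (advection a b \<xi>)) \<le> ennreal (cmod (LINT \<eta>|lborel. ?f \<xi> \<eta>))"
      unfolding advection_def by (intro ennreal_leI cmod_plancherel_const_mult_le)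
    also have "\<dots> \<le> (\<integral>\<^sup>+\<eta>. ennreal (cmod (?f \<xi> \<eta>)) \<partial>lborel)"
      by (cases "integrable lborel (?f \<xi>)") (auto simp: not_integrable_integral_eq intro: integral_norm_bound_ennreal)
    finally have "ennreal (cmod (advection a b \<xi>)) * ennreal (cmod (d \<xi>))
        \<le> (\<integral>\<^sup>+\<eta>. ennreal (cmod (?f \<xi> \<eta>)) \<partial>lborel) * ennreal (cmod (d \<xi>))"
      by (rule mult_right_mono) simp
    also have "\<dots> = (\<integral>\<^sup>+\<eta>. ennreal (cmod (?f \<xi> \<eta>)) * ennreal (cmod (d \<xi>)) \<partial>lborel)"
      by (rule nn_integral_multc[symmetric]) measurable
    finally show "ennreal (cmod (advection a b \<xi>) * cmod (d \<xi>))
        \<le> (\<integral>\<^sup>+\<eta>. ennreal (\<bar>sqg_kernel \<xi> \<eta>\<bar> * cmod (a (\<xi> - \<eta>)) * cmod (b \<eta>) * cmod (d \<xi>)) \<partial>lborel)"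
      by (simp add: norm_mult ennreal_mult)
  qed
  also have "\<dots> = sqg_form a b d" by (subst lborel.nn_integral_fst[symmetric]) auto
  finally show ?thesis .
qed

definition weighted_inner :: "(pt \<Rightarrow> real) \<Rightarrow> (pt \<Rightarrow> complex) \<Rightarrow> (pt \<Rightarrow> complex) \<Rightarrow> real" where
  "weighted_inner m a b = (LINT \<xi>|lborel. m \<xi> * Re (a \<xi> * cnj (b \<xi>)))"

definition weighted_energy :: "(pt \<Rightarrow> real) \<Rightarrow> (pt \<Rightarrow> complex) \<Rightarrow> real" where
  "weighted_energy m a = (LINT \<xi>|lborel. m \<xi> * (cmod (a \<xi>))\<^sup>2)"

lemma weighted_energy_1: "weighted_energy (\<lambda>_. 1) a = (L2norm a)\<^sup>2"
  by (simp add: weighted_energy_def L2norm_squared L2norm_sq_def)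

lemma weighted_energy_nonneg: "(\<And>\<xi>. 0 \<le> m \<xi>) \<Longrightarrow> 0 \<le> weighted_energy m a"
  unfolding weighted_energy_def by (intro integral_nonneg_AE) simp

lemma abs_Re_mult_cnj_le: "\<bar>Re (x * cnj y)\<bar> \<le> cmod x * cmod y"
  using abs_Re_le_cmod[of "x * cnj y"] unfolding norm_mult complex_mod_cnj .

lemma advection_inner_bound:
  assumes [measurable]: "a \<in> borel_measurable borel" "b \<in> borel_measurable borel" "d \<in> borel_measurable borel"
    and bound: "sqg_form a b d \<le> ennreal K" and K: "0 \<le> K"
  shows "integrable lborel (\<lambda>\<xi>. Re (advection a b \<xi> * cnj (d \<xi>)))" "\<bar>weighted_inner (\<lambda>_. 1) (advection a b) d\<bar> \<le> K"
proof -
  note [measurable] = advection_measurable[OF assms(1,2)]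
  have nn: "(\<integral>\<^sup>+\<xi>. ennreal (cmod (advection a b \<xi>) * cmod (d \<xi>)) \<partial>lborel) \<le> ennreal K"
    using nn_integral_advection_le[OF assms(1-3)] bound by (rule order_trans)
  have int: "integrable lborel (\<lambda>\<xi>. cmod (advection a b \<xi>) * cmod (d \<xi>))"
  proof (rule integrableI_bounded)
    show "(\<integral>\<^sup>+\<xi>. ennreal (norm (cmod (advection a b \<xi>) * cmod (d \<xi>))) \<partial>lborel) < \<infinity>"
      using le_less_trans[OF nn, of \<infinity>] by simp
  qed measurable
  have bounded: "norm (Re (advection a b \<xi> * cnj (d \<xi>))) \<le> norm (cmod (advection a b \<xi>) * cmod (d \<xi>))" for \<xi>
    by (simp only: real_norm_def abs_mult abs_norm_cancel abs_Re_mult_cnj_le)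
  show Re: "integrable lborel (\<lambda>\<xi>. Re (advection a b \<xi> * cnj (d \<xi>)))"
    by (intro Bochner_Integration.integrable_bound[OF int] AE_I2 bounded; measurable)
  have "\<bar>weighted_inner (\<lambda>_. 1) (advection a b) d\<bar> \<le> (LINT \<xi>|lborel. \<bar>Re (advection a b \<xi> * cnj (d \<xi>))\<bar>)"
    unfolding weighted_inner_def mult_1 by (rule integral_abs_bound)
  also have "\<dots> \<le> (LINT \<xi>|lborel. cmod (advection a b \<xi>) * cmod (d \<xi>))"
    by (intro integral_mono integrable_abs Re int abs_Re_mult_cnj_le)
  also have "\<dots> \<le> K"
    using nn nn_integral_eq_integral[OF int] K by (simp add: ennreal_le_iff)
  finally show "\<bar>weighted_inner (\<lambda>_. 1) (advection a b) d\<bar> \<le> K" .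
qed

text \<open>Exchanging \<open>\<xi>\<close> and \<open>\<eta>\<close> conjugates the integrand and, since \<open>sqg_kernel\<close> is antisymmetric, reverses its
  sign: this is the incompressibility of the velocity field.\<close>

context
  fixes a b :: "pt \<Rightarrow> complex" and m :: "pt \<Rightarrow> real" and B :: real
  assumes a [measurable]: "a \<in> borel_measurable borel" and b [measurable]: "b \<in> borel_measurable borel"
    and a_hermitian: "hermitian a" and form_finite: "sqg_form a b b < \<infinity>"
    and m [measurable]: "m \<in> borel_measurable borel" and m_bounded: "\<And>\<xi>. \<bar>m \<xi>\<bar> \<le> B"
begin

definition advection_density :: "pt \<times> pt \<Rightarrow> complex" where
  "advection_density = (\<lambda>(\<xi>, \<eta>). complex_of_real (sqg_kernel \<xi> \<eta>) * a (\<xi> - \<eta>) * b \<eta> * cnj (b \<xi>))"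

lemma multiplier_advection_density_integrable:
  assumes [measurable]: "f \<in> borel_measurable lborel2"
  shows "integrable lborel2 (\<lambda>p. complex_of_real (m (f p)) * advection_density p)"
proof -
  have [measurable]: "advection_density \<in> borel_measurable lborel2" unfolding advection_density_def by measurable
  have "integrable lborel2 advection_density"
    by (rule integrableI_bounded) (use form_finite in \<open>auto simp: advection_density_def norm_mult split_beta'\<close>)
  then show ?thesis
  proof (rule Bochner_Integration.integrable_bound[OF integrable_mult_right[of "complex_of_real B"]])
    have "cmod (complex_of_real (m (f p)) * advection_density p) \<le> cmod (complex_of_real B * advection_density p)" for p
      unfolding norm_mult using m_bounded[of "f p"] by (intro mult_right_mono) auto
    then show "AE p in lborel2. cmod (complex_of_real (m (f p)) * advection_density p)
        \<le> cmod (complex_of_real B * advection_density p)"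
      by simp
  qed measurable
qed

lemma advection_density_inner:
  "complex_of_real plancherel_const * (LINT \<eta>|lborel. complex_of_real (m \<xi>) * advection_density (\<xi>, \<eta>))
    = complex_of_real (m \<xi>) * (advection a b \<xi> * cnj (b \<xi>))"
proof -
  have "(LINT \<eta>|lborel. complex_of_real (m \<xi>) * advection_density (\<xi>, \<eta>))
      = (LINT \<eta>|lborel. (complex_of_real (m \<xi>) * cnj (b \<xi>)) * (complex_of_real (sqg_kernel \<xi> \<eta>) * a (\<xi> - \<eta>) * b \<eta>))"
    by (rule Bochner_Integration.integral_cong) (simp_all add: advection_density_def mult_ac)
  also have "\<dots> = (complex_of_real (m \<xi>) * cnj (b \<xi>)) * (LINT \<eta>|lborel. complex_of_real (sqg_kernel \<xi> \<eta>) * a (\<xi> - \<eta>) * b \<eta>)"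
    by (rule integral_mult_right_zero)
  finally show ?thesis unfolding advection_def by (simp only: mult_ac)
qed

lemma multiplier_advection_integrable: "integrable lborel (\<lambda>\<xi>. complex_of_real (m \<xi>) * (advection a b \<xi> * cnj (b \<xi>)))"
proof -
  have "integrable lborel2 (\<lambda>(\<xi>, \<eta>). complex_of_real (m \<xi>) * advection_density (\<xi>, \<eta>))"
    using multiplier_advection_density_integrable[of fst] by (simp add: split_beta')
  from integrable_mult_right[OF lborel_pair.integrable_fst[OF this], of "complex_of_real plancherel_const"]
  show ?thesis unfolding advection_density_inner .
qed

lemma weighted_inner_advection_density:
  "weighted_inner m (advection a b) b
      = plancherel_const * Re (LINT p|lborel2. complex_of_real (m (fst p)) * advection_density p)"
proof -
  have "weighted_inner m (advection a b) b = Re (LINT \<xi>|lborel. complex_of_real (m \<xi>) * (advection a b \<xi> * cnj (b \<xi>)))"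
    unfolding weighted_inner_def integral_Re[OF multiplier_advection_integrable, symmetric]
    by (rule Bochner_Integration.integral_cong) simp_all
  also have "(LINT \<xi>|lborel. complex_of_real (m \<xi>) * (advection a b \<xi> * cnj (b \<xi>)))
      = complex_of_real plancherel_const * (LINT \<xi>|lborel. LINT \<eta>|lborel. complex_of_real (m \<xi>) * advection_density (\<xi>, \<eta>))"
    unfolding advection_density_inner[symmetric] by (rule integral_mult_right_zero)
  also have "(LINT \<xi>|lborel. LINT \<eta>|lborel. complex_of_real (m \<xi>) * advection_density (\<xi>, \<eta>))
      = (LINT p|lborel2. complex_of_real (m (fst p)) * advection_density p)"
    using lborel_pair.integral_fst[of "\<lambda>\<xi> \<eta>. complex_of_real (m \<xi>) * advection_density (\<xi>, \<eta>)"]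
      multiplier_advection_density_integrable[of fst] by (simp add: split_beta')
  finally show ?thesis by (simp)
qed

lemma advection_density_swap:
  "(LINT p|lborel2. complex_of_real (m (fst p)) * advection_density p)
      = - cnj (LINT p|lborel2. complex_of_real (m (snd p)) * advection_density p)"
proof -
  have exchange: "advection_density (\<eta>, \<xi>) = - cnj (advection_density (\<xi>, \<eta>))" for \<xi> \<eta>
    using a_hermitian[rule_format, of "\<xi> - \<eta>"] by (simp add: advection_density_def sqg_kernel_antisym[of \<eta> \<xi>] mult_ac)
  have antihermitian: "complex_of_real (m \<eta>) * advection_density (\<eta>, \<xi>)
      = - cnj (complex_of_real (m \<eta>) * advection_density (\<xi>, \<eta>))" for \<xi> \<eta>
    by (simp only: exchange[of \<eta> \<xi>]) simp
  have [measurable]: "advection_density \<in> borel_measurable lborel2" unfolding advection_density_def by measurable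
  have "(LINT p|lborel2. complex_of_real (m (fst p)) * advection_density p)
      = (LINT q|lborel2. (\<lambda>(\<xi>, \<eta>). complex_of_real (m \<eta>) * advection_density (\<eta>, \<xi>)) q)"
    by (subst lborel_pair.integral_product_swap[symmetric]) (auto simp: split_beta')
  also have "\<dots> = (LINT p|lborel2. - cnj (complex_of_real (m (snd p)) * advection_density p))"
    unfolding antihermitian by (simp add: split_beta')
  also have "\<dots> = - cnj (LINT p|lborel2. complex_of_real (m (snd p)) * advection_density p)"
    unfolding cnj_lint by (rule integral_minus)
  finally show ?thesis .
qed

theorem weighted_inner_advection_le:
  "ennreal \<bar>2 * weighted_inner m (advection a b) b\<bar> \<le> trilinear_form (\<lambda>\<xi> \<eta>. sqg_kernel \<xi> \<eta> * (m \<xi> - m \<eta>)) a b b"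
proof -
  let ?F = "\<lambda>p. complex_of_real (m (fst p)) * advection_density p" and ?S = "\<lambda>p. complex_of_real (m (snd p)) * advection_density p"
  note int = multiplier_advection_density_integrable[of fst] multiplier_advection_density_integrable[of snd]
  have "2 * Re (LINT p|lborel2. ?F p) = Re (LINT p|lborel2. ?F p) - Re (LINT p|lborel2. ?S p)"
    using arg_cong[OF advection_density_swap, of Re] by simp
  also have "\<dots> = Re (LINT p|lborel2. ?F p - ?S p)"
    using int by simp
  finally have "2 * weighted_inner m (advection a b) b = plancherel_const * Re (LINT p|lborel2. ?F p - ?S p)"
    unfolding weighted_inner_advection_density by (simp only: mult.left_commute[of 2])
  then have "\<bar>2 * weighted_inner m (advection a b) b\<bar> = plancherel_const * \<bar>Re (LINT p|lborel2. ?F p - ?S p)\<bar>"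
    by (simp only: abs_mult abs_of_pos[OF plancherel_const_bounds(1)])
  also have "\<dots> \<le> cmod (LINT p|lborel2. ?F p - ?S p)"
    using mult_left_le_one_le[OF abs_ge_zero less_imp_le[OF plancherel_const_bounds(1)] plancherel_const_bounds(2)]
      abs_Re_le_cmod by (rule order_trans)
  finally have "ennreal \<bar>2 * weighted_inner m (advection a b) b\<bar> \<le> ennreal (cmod (LINT p|lborel2. ?F p - ?S p))"
    by (rule ennreal_leI)
  also have "\<dots> \<le> (\<integral>\<^sup>+p. ennreal (cmod (?F p - ?S p)) \<partial>lborel2)"
    by (rule integral_norm_bound_ennreal) (intro Bochner_Integration.integrable_diff int; measurable)
  also have "\<dots> = trilinear_form (\<lambda>\<xi> \<eta>. sqg_kernel \<xi> \<eta> * (m \<xi> - m \<eta>)) a b b"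
  proof (rule nn_integral_cong, clarify)
    fix \<xi> \<eta>
    have "cmod (?F (\<xi>, \<eta>) - ?S (\<xi>, \<eta>)) = cmod (complex_of_real (m \<xi> - m \<eta>) * advection_density (\<xi>, \<eta>))"
      by (simp add: left_diff_distrib)
    then show "ennreal (cmod (?F (\<xi>, \<eta>) - ?S (\<xi>, \<eta>)))
        = ennreal (\<bar>sqg_kernel \<xi> \<eta> * (m \<xi> - m \<eta>)\<bar> * cmod (a (\<xi> - \<eta>)) * cmod (b \<eta>) * cmod (b \<xi>))"
      unfolding norm_mult[of "complex_of_real (m \<xi> - m \<eta>)"] norm_of_real by (simp add: advection_density_def norm_mult abs_mult mult_ac)
  qed
  finally show ?thesis .
qed

end

lemma (in sqg_exponents) commutator_pairing:
  assumes w: "w \<in> borel_measurable borel" "hermitian w" "L2c (weighted s w)" "L2c (weighted (s + \<alpha>) w)"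
    and "sqg_form w w w < \<infinity>" "0 < R"
  shows "\<bar>2 * weighted_inner (cutoff_weight s R) (advection w w) w\<bar>
      \<le> commutator_const * hnorm s w * (hnorm (s + \<alpha>) w)\<^sup>2"
proof -
  have "\<bar>cutoff_weight s R \<xi>\<bar> \<le> R powr (2 * s)" for \<xi> using cutoff_weight_le_radius[of s R \<xi>] s_bounds \<open>0 < R\<close> by simp
  from weighted_inner_advection_le[OF w(1) w(1) w(2) \<open>sqg_form w w w < \<infinity>\<close> cutoff_weight_measurable this]
  have "ennreal \<bar>2 * weighted_inner (cutoff_weight s R) (advection w w) w\<bar>
      \<le> trilinear_form (commutator_kernel s R) w w w"
    by (simp add: commutator_kernel_def[abs_def])
  also note commutator_estimate[OF \<open>0 < R\<close> w(3,4)]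
  finally show ?thesis by (subst (asm) ennreal_le_iff) auto
qed

section \<open>Duhamel formula and continuity in \<open>L\<^sup>2\<close>\<close>

definition duhamel :: "(pt \<Rightarrow> real) \<Rightarrow> (pt \<Rightarrow> complex) \<Rightarrow> (real \<Rightarrow> pt \<Rightarrow> complex) \<Rightarrow> real \<Rightarrow> pt \<Rightarrow> complex" where
  "duhamel l w0 f t \<xi> = complex_of_real (exp (- t * l \<xi>)) * w0 \<xi>
     - (LINT \<tau>:{0..t}|lborel. complex_of_real (exp (- (t - \<tau>) * l \<xi>)) * f \<tau> \<xi>)"

lemma jointly_borel_duhamel:
  assumes f: "jointly_borel f" and [measurable]: "l \<in> borel_measurable borel" "w0 \<in> borel_measurable borel"
  shows "jointly_borel (duhamel l w0 f)"
proof -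
  note [measurable (raw)] = measurable_pair_apply[OF f]
  show ?thesis
    unfolding duhamel_def set_lebesgue_integral_def split_beta' indicator_def atLeastAtMost_iff by measurable
qed

lemma set_integrable_continuous:
  fixes g :: "real \<Rightarrow> 'b::{banach, second_countable_topology}"
  assumes "continuous_on {0..} g" "0 \<le> r"
  shows "set_integrable lborel {r..t} g"
  by (rule borel_integrable_atLeastAtMost') (rule continuous_on_subset[OF assms(1)], use assms(2) in auto)

lemma at_within_Ici: assumes "0 \<le> (t::real)" shows "at t within {0..} = at t within {0..t+1}"
  by (rule at_within_nhd[of _ "{..<t+1}"]) auto

lemma duhamel_integrating_factor:
  fixes f :: "real \<Rightarrow> pt \<Rightarrow> complex"
  assumes f: "continuous_on {0..} (\<lambda>\<tau>. f \<tau> \<xi>)"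
  shows "duhamel l w0 f t \<xi> = complex_of_real (exp (- t * l \<xi>)) * (w0 \<xi> - integral {0..t} (\<lambda>\<tau>. complex_of_real (exp (\<tau> * l \<xi>)) * f \<tau> \<xi>))"
proof -
  let ?g = "\<lambda>\<tau>. complex_of_real (exp (\<tau> * l \<xi>)) * f \<tau> \<xi>"
  have g: "continuous_on {0..} ?g" by (intro continuous_intros f)
  have "(LINT \<tau>:{0..t}|lborel. complex_of_real (exp (- (t - \<tau>) * l \<xi>)) * f \<tau> \<xi>)
      = (LINT \<tau>:{0..t}|lborel. complex_of_real (exp (- t * l \<xi>)) * ?g \<tau>)"
  proof (rule set_lebesgue_integral_cong)
    have "exp (- (t - \<tau>) * l \<xi>) = exp (- t * l \<xi>) * exp (\<tau> * l \<xi>)" for \<tau>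
      unfolding exp_add[symmetric] by (rule arg_cong[where f=exp]) (simp add: algebra_simps)
    then show "\<forall>\<tau>. \<tau> \<in> {0..t} \<longrightarrow> complex_of_real (exp (- (t - \<tau>) * l \<xi>)) * f \<tau> \<xi>
        = complex_of_real (exp (- t * l \<xi>)) * ?g \<tau>"
      by (simp add: mult.assoc)
  qed simp
  also have "\<dots> = complex_of_real (exp (- t * l \<xi>)) * (LINT \<tau>:{0..t}|lborel. ?g \<tau>)"
    by (rule set_integral_mult_right)
  also have "(LINT \<tau>:{0..t}|lborel. ?g \<tau>) = integral {0..t} ?g"
    using set_borel_integral_eq_integral(2)[OF set_integrable_continuous[OF g, of 0 t]] by simp
  finally show ?thesis unfolding duhamel_def by (simp add: right_diff_distrib)
qed

lemma duhamel_has_vector_derivative: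
  fixes f :: "real \<Rightarrow> pt \<Rightarrow> complex"
  assumes f: "continuous_on {0..} (\<lambda>\<tau>. f \<tau> \<xi>)" and t: "0 \<le> t"
  shows "((\<lambda>t. duhamel l w0 f t \<xi>) has_vector_derivative (- complex_of_real (l \<xi>) * duhamel l w0 f t \<xi> - f t \<xi>)) (at t within {0..})"
proof -
  let ?g = "\<lambda>\<tau>. complex_of_real (exp (\<tau> * l \<xi>)) * f \<tau> \<xi>" and ?e = "\<lambda>t. complex_of_real (exp (- t * l \<xi>))"
  have g: "continuous_on {0..t+1} ?g" by (intro continuous_intros continuous_on_subset[OF f]) auto
  have "(?e has_vector_derivative complex_of_real (- l \<xi> * exp (- t * l \<xi>))) (at t within {0..t+1})"
    unfolding has_real_derivative_iff_has_vector_derivative[symmetric]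
    by (rule has_vector_derivative_of_real) (auto intro!: derivative_eq_intros simp: has_real_derivative_iff_has_vector_derivative[symmetric])
  moreover have "((\<lambda>t. w0 \<xi> - integral {0..t} ?g) has_vector_derivative (0 - ?g t)) (at t within {0..t+1})"
    by (intro derivative_intros integral_has_vector_derivative[OF g]) (use t in auto)
  ultimately have "((\<lambda>t. ?e t * (w0 \<xi> - integral {0..t} ?g)) has_vector_derivative
      (?e t * (0 - ?g t) + complex_of_real (- l \<xi> * exp (- t * l \<xi>)) * (w0 \<xi> - integral {0..t} ?g))) (at t within {0..t+1})"
    by (rule has_vector_derivative_mult)
  moreover have "?e t * (0 - ?g t) + complex_of_real (- l \<xi> * exp (- t * l \<xi>)) * (w0 \<xi> - integral {0..t} ?g)
      = - complex_of_real (l \<xi>) * (?e t * (w0 \<xi> - integral {0..t} ?g)) - ?e t * ?g t"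
    by simp
  moreover have "?e t * ?g t = f t \<xi>"
    by (simp add: mult.assoc[symmetric] of_real_mult[symmetric] exp_minus del: of_real_mult)
  ultimately show ?thesis
    unfolding at_within_Ici[OF t] duhamel_integrating_factor[where f=f and \<xi>=\<xi>, OF f] by (simp only:)
qed

lemma duhamel_diff_bound:
  fixes f g :: "real \<Rightarrow> pt \<Rightarrow> complex"
  assumes cont: "continuous_on {0..} (\<lambda>\<tau>. f \<tau> \<xi>)" "continuous_on {0..} (\<lambda>\<tau>. g \<tau> \<xi>)"
    and l: "0 \<le> l \<xi>" and t: "0 \<le> t"
    and h: "set_integrable lborel {0..t} h" "\<And>\<tau>. \<tau> \<in> {0..t} \<Longrightarrow> cmod (f \<tau> \<xi> - g \<tau> \<xi>) \<le> h \<tau>"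
  shows "cmod (duhamel l w0 f t \<xi> - duhamel l w1 g t \<xi>) \<le> cmod (w0 \<xi> - w1 \<xi>) + (LINT \<tau>:{0..t}|lborel. h \<tau>)"
proof -
  let ?e = "\<lambda>\<tau>. complex_of_real (exp (- (t - \<tau>) * l \<xi>))"
  have int: "set_integrable lborel {0..t} (\<lambda>\<tau>. ?e \<tau> * f \<tau> \<xi>)" "set_integrable lborel {0..t} (\<lambda>\<tau>. ?e \<tau> * g \<tau> \<xi>)"
    by (intro set_integrable_continuous continuous_intros cont order_refl)+
  have split: "duhamel l w0 f t \<xi> - duhamel l w1 g t \<xi>
      = complex_of_real (exp (- t * l \<xi>)) * (w0 \<xi> - w1 \<xi>) - (LINT \<tau>:{0..t}|lborel. ?e \<tau> * f \<tau> \<xi> - ?e \<tau> * g \<tau> \<xi>)"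
    unfolding duhamel_def set_integral_diff(2)[OF int] by (simp add: algebra_simps)
  have initial: "cmod (complex_of_real (exp (- t * l \<xi>)) * (w0 \<xi> - w1 \<xi>)) \<le> cmod (w0 \<xi> - w1 \<xi>)"
    unfolding norm_mult using l t by (intro mult_left_le_one_le) auto
  have forcing: "cmod (LINT \<tau>:{0..t}|lborel. ?e \<tau> * f \<tau> \<xi> - ?e \<tau> * g \<tau> \<xi>) \<le> (LINT \<tau>:{0..t}|lborel. h \<tau>)"
  proof (rule order_trans[OF set_integral_norm_bound[OF set_integral_diff(1)[OF int]]], rule set_integral_mono)
    show "set_integrable lborel {0..t} (\<lambda>\<tau>. cmod (?e \<tau> * f \<tau> \<xi> - ?e \<tau> * g \<tau> \<xi>))"
      by (rule set_integrable_norm[OF set_integral_diff(1)[OF int]])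
    fix \<tau> assume \<tau>: "\<tau> \<in> {0..t}"
    have "cmod (?e \<tau> * f \<tau> \<xi> - ?e \<tau> * g \<tau> \<xi>) = exp (- (t - \<tau>) * l \<xi>) * cmod (f \<tau> \<xi> - g \<tau> \<xi>)"
      unfolding right_diff_distrib[symmetric] norm_mult by simp
    also have "\<dots> \<le> cmod (f \<tau> \<xi> - g \<tau> \<xi>)"
      using \<tau> l mult_nonpos_nonneg[of "\<tau> - t" "l \<xi>"] by (intro mult_left_le_one_le) auto
    also have "\<dots> \<le> h \<tau>" by (rule h(2)[OF \<tau>])
    finally show "cmod (?e \<tau> * f \<tau> \<xi> - ?e \<tau> * g \<tau> \<xi>) \<le> h \<tau>" .
  qed (rule h(1))
  show ?thesis unfolding split by (rule order_trans[OF norm_triangle_ineq4 add_mono[OF initial forcing]])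
qed

definition L2_continuous :: "(real \<Rightarrow> pt \<Rightarrow> complex) \<Rightarrow> bool" where
  "L2_continuous u \<longleftrightarrow> (\<forall>t\<ge>0. L2c (u t)) \<and> (\<forall>t\<ge>0. ((\<lambda>\<tau>. L2norm (\<lambda>\<xi>. u \<tau> \<xi> - u t \<xi>)) \<longlongrightarrow> 0) (at t within {0..}))"

lemma L2_continuous_L2c: "L2_continuous u \<Longrightarrow> 0 \<le> t \<Longrightarrow> L2c (u t)"
  by (simp add: L2_continuous_def)

lemma L2_continuousD: "L2_continuous u \<Longrightarrow> 0 \<le> t \<Longrightarrow> ((\<lambda>\<tau>. L2norm (\<lambda>\<xi>. u \<tau> \<xi> - u t \<xi>)) \<longlongrightarrow> 0) (at t within {0..})"
  by (simp add: L2_continuous_def)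

lemma L2_continuous_dominated:
  assumes u: "jointly_borel u" and cont: "\<And>\<xi>. continuous_on {0..} (\<lambda>t. u t \<xi>)"
    and dom: "\<And>T. 0 \<le> T \<Longrightarrow> \<exists>h. L2c h \<and> (\<forall>t\<in>{0..T}. \<forall>\<xi>. cmod (u t \<xi>) \<le> cmod (h \<xi>))"
  shows "L2_continuous u"
  unfolding L2_continuous_def
proof (intro conjI allI impI)
  note [measurable] = jointly_borel_slice[OF u]
  show "L2c (u t)" if t: "0 \<le> t" for t
  proof -
    obtain h where h: "L2c h" "\<And>\<xi>. cmod (u t \<xi>) \<le> cmod (h \<xi>)" using dom[of t] t by auto
    show ?thesis by (rule L2c_mono(1)[OF h(1), where B=1]) (use h in auto)
  qed
  fix t :: real assume t: "0 \<le> t"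
  show "((\<lambda>\<tau>. L2norm (\<lambda>\<xi>. u \<tau> \<xi> - u t \<xi>)) \<longlongrightarrow> 0) (at t within {0..})"
    unfolding tendsto_at_iff_sequentially
  proof (intro allI impI)
    fix X :: "nat \<Rightarrow> real" assume X: "\<forall>i. X i \<in> {0..} - {t}" "X \<longlonglongrightarrow> t"
    from convergent_imp_Bseq[OF convergentI[OF X(2)]] obtain T where T: "0 < T" "\<And>i. norm (X i) \<le> T"
      by (auto elim: BseqE)
    obtain h where h: "L2c h" "\<And>s \<xi>. s \<in> {0..T + t} \<Longrightarrow> cmod (u s \<xi>) \<le> cmod (h \<xi>)" using dom[of "T + t"] T t by auto
    have "(\<lambda>i. L2norm (\<lambda>\<xi>. u (X i) \<xi> - u t \<xi>)) \<longlonglongrightarrow> 0"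
    proof (rule L2_dominated_convergence[OF _ L2c_cmult[OF h(1), of 2]])
      show "AE \<xi> in lborel. (\<lambda>i. u (X i) \<xi> - u t \<xi>) \<longlonglongrightarrow> 0"
      proof (rule AE_I2)
        fix \<xi>
        have "(\<lambda>i. u (X i) \<xi>) \<longlonglongrightarrow> u t \<xi>"
          by (rule continuous_on_tendsto_compose[OF cont X(2)]) (use X t in auto)
        then show "(\<lambda>i. u (X i) \<xi> - u t \<xi>) \<longlonglongrightarrow> 0" by (rule LIM_zero)
      qed
      show "AE \<xi> in lborel. cmod (u (X i) \<xi> - u t \<xi>) \<le> cmod (2 * h \<xi>)" for i
      proof (rule AE_I2)
        fix \<xi>
        have "X i \<in> {0..T+t}" "t \<in> {0..T+t}" using X(1) T(1) T(2)[of i] t by (auto simp: abs_le_iff)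
        then have "cmod (u (X i) \<xi> - u t \<xi>) \<le> cmod (h \<xi>) + cmod (h \<xi>)"
          by (intro order_trans[OF norm_triangle_ineq4 add_mono] h(2))
        then show "cmod (u (X i) \<xi> - u t \<xi>) \<le> cmod (2 * h \<xi>)" by (simp add: norm_mult)
      qed
    qed auto
    then show "((\<lambda>\<tau>. L2norm (\<lambda>\<xi>. u \<tau> \<xi> - u t \<xi>)) \<circ> X) \<longlonglongrightarrow> 0" by (simp add: o_def)
  qed
qed

lemma L2_continuous_compose_locally_Lipschitz:
  fixes G :: "(pt \<Rightarrow> complex) \<Rightarrow> 'a::real_normed_vector"
  assumes u: "L2_continuous u"
    and G: "\<And>a b. L2c a \<Longrightarrow> L2c b \<Longrightarrow> norm (G a - G b) \<le> (C b + D * L2norm (\<lambda>x. a x - b x)) * L2norm (\<lambda>x. a x - b x)"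
  shows "continuous_on {0..} (\<lambda>\<tau>. G (u \<tau>))"
  unfolding continuous_on_def
proof
  fix t :: real assume "t \<in> {0..}" then have t: "0 \<le> t" by simp
  let ?d = "\<lambda>\<tau>. L2norm (\<lambda>\<xi>. u \<tau> \<xi> - u t \<xi>)"
  have bound: "\<forall>\<^sub>F \<tau> in at t within {0..}. norm (G (u \<tau>) - G (u t)) \<le> (C (u t) + D * ?d \<tau>) * ?d \<tau>"
    unfolding eventually_at_filter using t by (intro always_eventually allI impI G L2_continuous_L2c[OF u]) auto
  have "((\<lambda>\<tau>. (C (u t) + D * ?d \<tau>) * ?d \<tau>) \<longlongrightarrow> (C (u t) + D * 0) * 0) (at t within {0..})"
    by (intro tendsto_intros L2_continuousD[OF u t])
  then have "((\<lambda>\<tau>. (C (u t) + D * ?d \<tau>) * ?d \<tau>) \<longlongrightarrow> 0) (at t within {0..})" by simp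
  with bound show "((\<lambda>\<tau>. G (u \<tau>)) \<longlongrightarrow> G (u t)) (at t within {0..})"
    by (rule tendsto_of_norm_diff_le)
qed

lemma L2_continuous_compose_Lipschitz:
  fixes G :: "(pt \<Rightarrow> complex) \<Rightarrow> 'a::real_normed_vector"
  assumes "L2_continuous u" "\<And>a b. L2c a \<Longrightarrow> L2c b \<Longrightarrow> norm (G a - G b) \<le> C * L2norm (\<lambda>x. a x - b x)"
  shows "continuous_on {0..} (\<lambda>\<tau>. G (u \<tau>))"
  using assms L2_continuous_compose_locally_Lipschitz[of u G "\<lambda>_. C" 0] by simp

lemma L2_continuous_L2norm: "L2_continuous u \<Longrightarrow> continuous_on {0..} (\<lambda>\<tau>. L2norm (u \<tau>))"
  by (rule L2_continuous_compose_Lipschitz[where C=1]) (simp_all add: L2norm_reverse_triangle)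

lemma advection_continuous:
  assumes u: "L2_continuous u" shows "continuous_on {0..} (\<lambda>\<tau>. advection (u \<tau>) (u \<tau>) \<xi>)"
proof (rule L2_continuous_compose_locally_Lipschitz[where G="\<lambda>a. advection a a \<xi>" and C="\<lambda>b. norm \<xi> * (2 * L2norm b)" and D="norm \<xi>", OF u])
  fix a b :: "pt \<Rightarrow> complex" assume L2c: "L2c a" "L2c b"
  let ?d = "L2norm (\<lambda>x. a x - b x)"
  have "L2norm a + L2norm b \<le> 2 * L2norm b + ?d" using L2norm_reverse_triangle[OF L2c] by linarith
  then have "norm \<xi> * (L2norm a + L2norm b) * ?d \<le> norm \<xi> * (2 * L2norm b + ?d) * ?d"
    by (intro mult_right_mono mult_left_mono) auto
  with advection_Lipschitz[OF L2c, of \<xi>] show "norm (advection a a \<xi> - advection b b \<xi>)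
      \<le> (norm \<xi> * (2 * L2norm b) + norm \<xi> * ?d) * ?d"
    by (simp add: distrib_left)
qed

text \<open>Radial retraction onto the ball of radius \<open>M\<close> of L2; it makes the truncated
  nonlinearity globally Lipschitz without destroying its cancellations.\<close>

definition retraction_factor :: "real \<Rightarrow> (pt \<Rightarrow> complex) \<Rightarrow> real" where
  "retraction_factor M a = M / max M (L2norm a)"

lemma retraction_factor_bounds:
  assumes M: "0 < M"
  shows "0 < retraction_factor M a" "retraction_factor M a \<le> 1" "retraction_factor M a * L2norm a \<le> M"
proof -
  have pos: "0 < max M (L2norm a)" using M by simp
  show "0 < retraction_factor M a" "retraction_factor M a \<le> 1" using M pos by (simp_all add: retraction_factor_def)
  have "M * L2norm a \<le> M * max M (L2norm a)" using M by (intro mult_left_mono) auto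
  then show "retraction_factor M a * L2norm a \<le> M" using M pos by (simp add: retraction_factor_def pos_divide_le_eq)
qed

abbreviation L2_retract :: "real \<Rightarrow> (pt \<Rightarrow> complex) \<Rightarrow> pt \<Rightarrow> complex" where
  "L2_retract M a \<equiv> (\<lambda>x. complex_of_real (retraction_factor M a) * a x)"

lemma L2norm_L2_retract: "0 < M \<Longrightarrow> L2norm (L2_retract M a) \<le> M"
  unfolding L2norm_cmult using retraction_factor_bounds[of M a] by simp

lemma L2_retract_Lipschitz:
  assumes M: "0 < M" and L2c: "L2c a" "L2c b"
  shows "L2norm (\<lambda>x. L2_retract M a x - L2_retract M b x) \<le> 2 * L2norm (\<lambda>x. a x - b x)"
proof -
  let ?A = "max M (L2norm a)" and ?B = "max M (L2norm b)" and ?a = "retraction_factor M a" and ?b = "retraction_factor M b"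
  have pos: "0 < ?A" "0 < ?B" using M by auto
  have "\<bar>?B - ?A\<bar> \<le> \<bar>L2norm a - L2norm b\<bar>" by linarith
  also have "\<dots> \<le> L2norm (\<lambda>x. a x - b x)" by (rule L2norm_reverse_triangle[OF L2c])
  finally have radii: "\<bar>?B - ?A\<bar> \<le> L2norm (\<lambda>x. a x - b x)" .
  have "?a - ?b = ?a * ((?B - ?A) / ?B)" using pos by (simp add: retraction_factor_def field_simps)
  then have "\<bar>?a - ?b\<bar> * L2norm b = ?a * (\<bar>?B - ?A\<bar> * (L2norm b / ?B))"
    using retraction_factor_bounds(1)[OF M, of a] pos by (simp add: abs_mult)
  also have "\<dots> \<le> 1 * (L2norm (\<lambda>x. a x - b x) * 1)"
    using retraction_factor_bounds(1,2)[OF M, of a] pos radii by (intro mult_mono) (auto simp: divide_le_eq_1)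
  finally have factors: "\<bar>?a - ?b\<bar> * L2norm b \<le> L2norm (\<lambda>x. a x - b x)" by simp
  have split: "(\<lambda>x. L2_retract M a x - L2_retract M b x)
      = (\<lambda>x. complex_of_real ?a * (a x - b x) + complex_of_real (?a - ?b) * b x)"
    by (simp add: algebra_simps)
  have "L2norm (\<lambda>x. L2_retract M a x - L2_retract M b x)
     \<le> cmod (complex_of_real ?a) * L2norm (\<lambda>x. a x - b x) + cmod (complex_of_real (?a - ?b)) * L2norm b"
    unfolding split L2norm_cmult[symmetric] by (intro L2norm_triangle L2c_cmult L2c_diff L2c)
  also have "\<dots> \<le> 1 * L2norm (\<lambda>x. a x - b x) + L2norm (\<lambda>x. a x - b x)"
    unfolding norm_of_real using retraction_factor_bounds(1,2)[OF M, of a] factors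
      by (intro add_mono mult_right_mono) auto
  finally show ?thesis by simp
qed

definition retracted_advection :: "real \<Rightarrow> (pt \<Rightarrow> complex) \<Rightarrow> pt \<Rightarrow> complex" where
  "retracted_advection M a \<xi> = complex_of_real ((retraction_factor M a)\<^sup>2) * advection a a \<xi>"

lemma retracted_advection_eq: "retracted_advection M a \<xi> = advection (L2_retract M a) (L2_retract M a) \<xi>"
  unfolding retracted_advection_def advection_cmult by simp

lemma retracted_advection_bound:
  assumes "0 < M" "L2c a" shows "cmod (retracted_advection M a \<xi>) \<le> norm \<xi> * M\<^sup>2"
proof -
  have "cmod (retracted_advection M a \<xi>) \<le> norm \<xi> * L2norm (L2_retract M a) * L2norm (L2_retract M a)"
    unfolding retracted_advection_eq by (intro advection_bound L2c_cmult assms)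
  also have "\<dots> \<le> norm \<xi> * M * M" using assms by (intro mult_mono L2norm_L2_retract) auto
  finally show ?thesis by (simp add: power2_eq_square mult.assoc)
qed

lemma retracted_advection_Lipschitz:
  assumes M: "0 < M" and L2c: "L2c a" "L2c b"
  shows "cmod (retracted_advection M a \<xi> - retracted_advection M b \<xi>) \<le> norm \<xi> * (4 * M) * L2norm (\<lambda>x. a x - b x)"
proof -
  have "cmod (retracted_advection M a \<xi> - retracted_advection M b \<xi>)
      \<le> norm \<xi> * (L2norm (L2_retract M a) + L2norm (L2_retract M b)) * L2norm (\<lambda>x. L2_retract M a x - L2_retract M b x)"
    unfolding retracted_advection_eq by (intro advection_Lipschitz L2c_cmult L2c)
  also have "\<dots> \<le> norm \<xi> * (M + M) * (2 * L2norm (\<lambda>x. a x - b x))"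
    using M by (intro mult_mono add_mono L2norm_L2_retract L2_retract_Lipschitz L2c mult_nonneg_nonneg) auto
  finally show ?thesis by (simp add: mult_ac)
qed

lemma retracted_advection_continuous:
  "0 < M \<Longrightarrow> L2_continuous u \<Longrightarrow> continuous_on {0..} (\<lambda>\<tau>. retracted_advection M (u \<tau>) \<xi>)"
  by (rule L2_continuous_compose_Lipschitz) (auto intro: retracted_advection_Lipschitz)

lemma jointly_borel_retracted_advection:
  assumes w: "jointly_borel w" shows "jointly_borel (\<lambda>t. retracted_advection M (w t))"
proof -
  note [measurable (raw)] = measurable_pair_apply[OF jointly_borel_advection[OF w]]
  note [measurable] = jointly_borel_L2norm[OF w]
  show ?thesis unfolding retracted_advection_def retraction_factor_def split_beta' by measurable
qed

lemma retracted_advection_hermitian: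
  "hermitian a \<Longrightarrow> retracted_advection M a (- \<xi>) = cnj (retracted_advection M a \<xi>)"
  by (simp add: retracted_advection_def advection_hermitian)

section \<open>Picard iteration\<close>

lemma set_integral_exp_le:
  fixes b t C :: real
  assumes "0 < b" "0 \<le> t" "0 \<le> C"
  shows "set_integrable lborel {0..t} (\<lambda>\<tau>. C * exp (b * \<tau>))"
    and "(LINT \<tau>:{0..t}|lborel. C * exp (b * \<tau>)) \<le> C * exp (b * t) / b"
proof -
  show "set_integrable lborel {0..t} (\<lambda>\<tau>. C * exp (b * \<tau>))"
    by (rule set_integrable_continuous) (auto intro!: continuous_intros)
  have "(LINT \<tau>:{0..t}|lborel. C * exp (b * \<tau>)) = C * exp (b * t) / b - C * exp (b * 0) / b"
    unfolding set_lebesgue_integral_def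
  proof (rule integral_FTC_Icc)
    show "((\<lambda>\<tau>. C * exp (b * \<tau>) / b) has_vector_derivative C * exp (b * \<tau>)) (at \<tau> within {0..t})" for \<tau>
      unfolding has_real_derivative_iff_has_vector_derivative[symmetric]
      using assms by (auto intro!: derivative_eq_intros)
  qed (use assms in \<open>auto intro!: continuous_intros\<close>)
  also have "\<dots> \<le> C * exp (b * t) / b" using assms by simp
  finally show "(LINT \<tau>:{0..t}|lborel. C * exp (b * \<tau>)) \<le> C * exp (b * t) / b" .
qed

lemma geometric_differences_limit:
  fixes x :: "nat \<Rightarrow> 'a::banach"
  assumes diff: "\<And>k. norm (x (Suc k) - x k) \<le> C * (1/2)^k"
  shows "x \<longlonglongrightarrow> lim x" "norm (x k - lim x) \<le> 2 * C * (1/2)^k"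
proof -
  have C: "0 \<le> C" using order_trans[OF norm_ge_zero diff[of 0]] by simp
  have "summable (\<lambda>k. norm (x (Suc k) - x k))"
    by (rule summable_comparison_test[OF _ summable_mult[OF summable_geometric[of "1/2::real"], of C]]) (use diff in auto)
  then show lim: "x \<longlonglongrightarrow> lim x"
    using convergent_if_summable_differences[OF summable_norm_cancel] by (simp add: convergent_LIMSEQ_iff)
  have tail: "norm (x k - x (k + j)) \<le> 2 * C * (1/2)^k * (1 - (1/2)^j)" for j
  proof (induction j)
    case (Suc j)
    have "norm (x k - x (k + Suc j)) \<le> norm (x k - x (k + j)) + norm (x (k + j) - x (Suc (k + j)))"
      using norm_triangle_ineq[of "x k - x (k + j)" "x (k + j) - x (Suc (k + j))"] by simp
    also have "\<dots> \<le> 2 * C * (1/2)^k * (1 - (1/2)^j) + C * (1/2)^(k + j)"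
      using Suc diff[of "k + j"] by (intro add_mono) (auto simp: norm_minus_commute)
    also have "\<dots> = 2 * C * (1/2)^k * (1 - (1/2)^(Suc j))" by (simp add: field_simps power_add)
    finally show ?case .
  qed simp
  have "(\<lambda>j. norm (x k - x (k + j))) \<longlonglongrightarrow> norm (x k - lim x)"
    using LIMSEQ_ignore_initial_segment[OF lim, of k] by (intro tendsto_intros) (simp add: add.commute)
  then show "norm (x k - lim x) \<le> 2 * C * (1/2)^k"
  proof (rule LIMSEQ_le_const2, intro exI allI impI)
    fix j
    have "2 * C * (1/2)^k * (1 - (1/2)^j) \<le> 2 * C * (1/2)^k * 1" using C by (intro mult_left_mono) auto
    with tail[of j] show "norm (x k - x (k + j)) \<le> 2 * C * (1/2)^k" by simp
  qed
qed

lemma L2_continuous_uniform_limit: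
  assumes W: "\<And>k::nat. L2_continuous (W k)" and w: "\<And>t. 0 \<le> t \<Longrightarrow> L2c (w t)"
    and lim: "\<And>T e. 0 < e \<Longrightarrow> \<exists>k. \<forall>t\<in>{0..T}. L2norm (\<lambda>\<xi>. W k t \<xi> - w t \<xi>) \<le> e"
  shows "L2_continuous w"
  unfolding L2_continuous_def
proof (intro conjI allI impI)
  fix t :: real assume t: "0 \<le> t"
  show "L2c (w t)" by (rule w[OF t])
  show "((\<lambda>\<tau>. L2norm (\<lambda>\<xi>. w \<tau> \<xi> - w t \<xi>)) \<longlongrightarrow> 0) (at t within {0..})"
    unfolding tendsto_iff
  proof (intro allI impI)
    fix e :: real assume e: "0 < e"
    obtain k where "\<forall>s\<in>{0..t+1}. L2norm (\<lambda>\<xi>. W k s \<xi> - w s \<xi>) \<le> e/4"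
      using lim[of "e/4" "t+1"] e by auto
    note close = bspec[OF this]
    have "((\<lambda>\<tau>. L2norm (\<lambda>\<xi>. W k \<tau> \<xi> - W k t \<xi>)) \<longlongrightarrow> 0) (at t within {0..})" by (rule L2_continuousD[OF W t])
    then have "\<forall>\<^sub>F \<tau> in at t within {0..}. L2norm (\<lambda>\<xi>. W k \<tau> \<xi> - W k t \<xi>) < e/4" using e by (intro order_tendstoD) auto
    moreover have "\<forall>\<^sub>F \<tau> in at t within {0..}. \<tau> \<in> {0..t+1}"
      unfolding eventually_at by (intro exI[of _ 1]) (auto simp: dist_real_def)
    ultimately show "\<forall>\<^sub>F \<tau> in at t within {0..}. dist (L2norm (\<lambda>\<xi>. w \<tau> \<xi> - w t \<xi>)) 0 < e"
    proof eventually_elim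
      case (elim \<tau>)
      then have \<tau>: "0 \<le> \<tau>" by simp
      note L2c = L2_continuous_L2c[OF W \<tau>, of k] L2_continuous_L2c[OF W t, of k] w[OF \<tau>] w[OF t]
      have "L2norm (\<lambda>\<xi>. w \<tau> \<xi> - w t \<xi>) \<le> L2norm (\<lambda>\<xi>. W k \<tau> \<xi> - w \<tau> \<xi>) + L2norm (\<lambda>\<xi>. W k \<tau> \<xi> - w t \<xi>)"
        using L2norm_triangle_diff[OF L2c(3,1,4)] by (simp only: L2norm_minus_commute[of "w \<tau>" "W k \<tau>"])
      moreover have "L2norm (\<lambda>\<xi>. W k \<tau> \<xi> - w t \<xi>) \<le> L2norm (\<lambda>\<xi>. W k \<tau> \<xi> - W k t \<xi>) + L2norm (\<lambda>\<xi>. W k t \<xi> - w t \<xi>)"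
        by (rule L2norm_triangle_diff[OF L2c(1,2,4)])
      ultimately show ?case using elim close[of \<tau>] close[of t] t e by simp
    qed
  qed
qed

lemma L2c_ball_const: "L2c (\<lambda>\<xi>. if norm \<xi> \<le> n then c else 0)"
  unfolding L2c_def
  by (auto intro!: integrable_bounded_support[where R=n and B="(cmod c)\<^sup>2"])

definition ball_L2norm :: "real \<Rightarrow> real" where
  "ball_L2norm n = L2norm (\<lambda>\<xi>. if norm \<xi> \<le> n then 1 else 0)"

lemma ball_L2norm_nonneg: "0 \<le> ball_L2norm n"
  by (simp add: ball_L2norm_def)

lemma L2norm_ball_bound:
  assumes [measurable]: "f \<in> borel_measurable borel" and support: "\<And>\<xi>. norm \<xi> > n \<Longrightarrow> f \<xi> = 0"
    and bound: "\<And>\<xi>. norm \<xi> \<le> n \<Longrightarrow> cmod (f \<xi>) \<le> B" and B: "0 \<le> B"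
  shows "L2c f" "L2norm f \<le> B * ball_L2norm n"
proof -
  have "AE \<xi> in lborel. cmod (f \<xi>) \<le> B * cmod (if norm \<xi> \<le> n then 1 else 0)"
    using support bound by (auto intro!: AE_I2 simp: not_le)
  from L2c_mono[OF L2c_ball_const _ this B] show "L2c f" "L2norm f \<le> B * ball_L2norm n" by (auto simp: ball_L2norm_def)
qed

definition ball_duhamel :: "(pt \<Rightarrow> real) \<Rightarrow> (pt \<Rightarrow> complex) \<Rightarrow> real \<Rightarrow> (real \<Rightarrow> pt \<Rightarrow> complex) \<Rightarrow> real \<Rightarrow> pt \<Rightarrow> complex" where
  "ball_duhamel l w0 n f t \<xi> = (if norm \<xi> \<le> n then duhamel l w0 f t \<xi> else 0)"

lemma ball_duhamel_support: "n < norm \<xi> \<Longrightarrow> ball_duhamel l w0 n f t \<xi> = 0"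
  by (simp add: ball_duhamel_def)

lemma ball_duhamel_0:
  "(norm \<xi> \<le> n \<Longrightarrow> continuous_on {0..} (\<lambda>\<tau>. f \<tau> \<xi>)) \<Longrightarrow> ball_duhamel l w0 n f 0 \<xi> = (if norm \<xi> \<le> n then w0 \<xi> else 0)"
  by (simp add: ball_duhamel_def duhamel_integrating_factor)

lemma jointly_borel_ball_duhamel:
  assumes "jointly_borel f" "l \<in> borel_measurable borel" "w0 \<in> borel_measurable borel"
  shows "jointly_borel (ball_duhamel l w0 n f)"
proof -
  note [measurable (raw)] = measurable_pair_apply[OF jointly_borel_duhamel[OF assms]]
  show ?thesis unfolding ball_duhamel_def split_beta' by measurable
qed

lemma ball_duhamel_has_vector_derivative:
  assumes f: "norm \<xi> \<le> n \<Longrightarrow> continuous_on {0..} (\<lambda>\<tau>. f \<tau> \<xi>)" and t: "0 \<le> t"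
  shows "((\<lambda>t. ball_duhamel l w0 n f t \<xi>) has_vector_derivative
    (- complex_of_real (l \<xi>) * ball_duhamel l w0 n f t \<xi> - (if norm \<xi> \<le> n then f t \<xi> else 0))) (at t within {0..})"
proof (cases "norm \<xi> \<le> n")
  case True
  then show ?thesis unfolding ball_duhamel_def
    using duhamel_has_vector_derivative[where f=f and \<xi>=\<xi>, OF f[OF True] t] by simp
qed (simp add: ball_duhamel_def)

lemma ball_duhamel_dominated:
  assumes l: "\<And>\<xi>. 0 \<le> l \<xi>" and w0: "L2c w0" and f: "\<And>\<xi>. norm \<xi> \<le> n \<Longrightarrow> continuous_on {0..} (\<lambda>\<tau>. f \<tau> \<xi>)"
    and bound: "\<And>\<tau> \<xi>. 0 \<le> \<tau> \<Longrightarrow> norm \<xi> \<le> n \<Longrightarrow> cmod (f \<tau> \<xi>) \<le> K" and K: "0 \<le> K" and T: "0 \<le> T"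
  defines "h \<equiv> \<lambda>\<xi>. complex_of_real (cmod (w0 \<xi>)) + (if norm \<xi> \<le> n then complex_of_real (T * K) else 0)"
  shows "L2c h" "L2norm h \<le> L2norm w0 + T * K * ball_L2norm n"
    "t \<in> {0..T} \<Longrightarrow> cmod (ball_duhamel l w0 n f t \<xi>) \<le> cmod (h \<xi>)"
proof -
  let ?c = "\<lambda>\<xi>. if norm \<xi> \<le> n then complex_of_real (T * K) else 0"
  show "L2c h" unfolding h_def by (intro L2c_add L2c_cmod L2c_ball_const w0)
  have "L2norm h \<le> L2norm w0 + L2norm ?c"
    unfolding h_def using L2norm_triangle[OF L2c_cmod[OF w0] L2c_ball_const, of n "complex_of_real (T * K)"] by (simp add: L2norm_cmod)
  also have "\<dots> \<le> L2norm w0 + T * K * ball_L2norm n"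
    using T K by (intro add_left_mono L2norm_ball_bound(2)) (auto simp: norm_mult abs_mult)
  finally show "L2norm h \<le> L2norm w0 + T * K * ball_L2norm n" .
  assume t: "t \<in> {0..T}"
  show "cmod (ball_duhamel l w0 n f t \<xi>) \<le> cmod (h \<xi>)"
  proof (cases "norm \<xi> \<le> n")
    case True
    have "cmod (duhamel l w0 f t \<xi> - duhamel l (\<lambda>_. 0) (\<lambda>_ _. 0) t \<xi>) \<le> cmod (w0 \<xi> - 0) + (LINT \<tau>:{0..t}|lborel. K)"
      by (rule duhamel_diff_bound[where l=l]) (use bound[OF _ True] f[OF True] l t in \<open>auto intro!: set_integrable_continuous\<close>)
    also have "(LINT \<tau>:{0..t}|lborel. K) = t * K"
      using t by (simp add: set_lebesgue_integral_def)
    finally have "cmod (ball_duhamel l w0 n f t \<xi>) \<le> cmod (w0 \<xi>) + t * K"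
      using True by (simp add: ball_duhamel_def duhamel_def set_lebesgue_integral_def)
    also have "\<dots> \<le> cmod (w0 \<xi>) + T * K" using t K by (intro add_left_mono mult_right_mono) auto
    also have "\<dots> \<le> cmod (h \<xi>)" using True complex_Re_le_cmod[of "h \<xi>"] by (simp add: h_def)
    finally show ?thesis .
  qed (simp add: ball_duhamel_def)
qed

locale ball_evolution =
  fixes l :: "pt \<Rightarrow> real" and w0 :: "pt \<Rightarrow> complex" and G :: "(pt \<Rightarrow> complex) \<Rightarrow> pt \<Rightarrow> complex" and n K \<Lambda> :: real
  assumes l_nonneg: "0 \<le> l \<xi>" and l_measurable: "l \<in> borel_measurable borel" and l_even: "l (- \<xi>) = l \<xi>"
    and w0_L2c: "L2c w0" and w0_hermitian: "hermitian w0"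
    and K_nonneg: "0 \<le> K" and \<Lambda>_pos: "0 < \<Lambda>"
    and G_bound: "L2c a \<Longrightarrow> norm \<xi> \<le> n \<Longrightarrow> cmod (G a \<xi>) \<le> K"
    and G_Lipschitz: "L2c a \<Longrightarrow> L2c b \<Longrightarrow> norm \<xi> \<le> n \<Longrightarrow> cmod (G a \<xi> - G b \<xi>) \<le> \<Lambda> * L2norm (\<lambda>x. a x - b x)"
    and G_jointly_borel: "jointly_borel u \<Longrightarrow> jointly_borel (\<lambda>t. G (u t))"
    and G_hermitian: "hermitian a \<Longrightarrow> hermitian (G a)"
begin

lemma G_continuous: "L2_continuous u \<Longrightarrow> norm \<xi> \<le> n \<Longrightarrow> continuous_on {0..} (\<lambda>\<tau>. G (u \<tau>) \<xi>)"
  by (rule L2_continuous_compose_Lipschitz) (auto intro: G_Lipschitz)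

definition picard :: "(real \<Rightarrow> pt \<Rightarrow> complex) \<Rightarrow> real \<Rightarrow> pt \<Rightarrow> complex" where
  "picard u = ball_duhamel l w0 n (\<lambda>\<tau>. G (u \<tau>))"

lemma jointly_borel_picard: "jointly_borel u \<Longrightarrow> jointly_borel (picard u)"
  unfolding picard_def by (intro jointly_borel_ball_duhamel G_jointly_borel l_measurable L2c_measurable[OF w0_L2c])

lemma picard_dominated:
  assumes u: "L2_continuous u" and "0 \<le> T"
  shows "\<exists>h. L2c h \<and> L2norm h \<le> L2norm w0 + T * K * ball_L2norm n \<and> (\<forall>t\<in>{0..T}. \<forall>\<xi>. cmod (picard u t \<xi>) \<le> cmod (h \<xi>))"
proof -
  have "cmod (G (u \<tau>) \<xi>) \<le> K" if "0 \<le> \<tau>" "norm \<xi> \<le> n" for \<tau> \<xi>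
    by (rule G_bound[OF L2_continuous_L2c[OF u that(1)] that(2)])
  note dominated = ball_duhamel_dominated[where f="\<lambda>\<tau>. G (u \<tau>)", OF l_nonneg w0_L2c G_continuous[OF u] this K_nonneg \<open>0 \<le> T\<close>]
  show ?thesis unfolding picard_def
    by (rule exI, intro conjI ballI allI) (rule dominated, assumption+)+
qed

lemma picard_L2_continuous:
  assumes "L2_continuous u" "jointly_borel u" shows "L2_continuous (picard u)"
proof (rule L2_continuous_dominated[OF jointly_borel_picard[OF assms(2)]])
  show "continuous_on {0..} (\<lambda>t. picard u t \<xi>)" for \<xi>
    unfolding picard_def
    by (rule continuous_on_vector_derivative) (rule ball_duhamel_has_vector_derivative, rule G_continuous[OF assms(1)], auto)
  show "\<exists>h. L2c h \<and> (\<forall>t\<in>{0..T}. \<forall>\<xi>. cmod (picard u t \<xi>) \<le> cmod (h \<xi>))" if "0 \<le> T" for T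
    using picard_dominated[OF assms(1) that] by blast
qed

lemma picard_hermitian:
  assumes "\<And>t. hermitian (u t)" shows "hermitian (picard u t)"
proof
  fix \<xi>
  have "(LINT \<tau>:{0..t}|lborel. complex_of_real (exp (- (t - \<tau>) * l (- \<xi>))) * G (u \<tau>) (- \<xi>))
      = (LINT \<tau>:{0..t}|lborel. cnj (complex_of_real (exp (- (t - \<tau>) * l \<xi>)) * G (u \<tau>) \<xi>))"
    using G_hermitian[OF assms] by (intro set_lebesgue_integral_cong) (simp_all add: l_even)
  also have "\<dots> = cnj (LINT \<tau>:{0..t}|lborel. complex_of_real (exp (- (t - \<tau>) * l \<xi>)) * G (u \<tau>) \<xi>)"
    unfolding set_lebesgue_integral_def cnj_lint by simp
  finally show "picard u t (- \<xi>) = cnj (picard u t \<xi>)"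
    using w0_hermitian unfolding picard_def ball_duhamel_def duhamel_def by (simp add: l_even)
qed

text \<open>In the norm weighted by \<open>exp (- b t)\<close> the map gains the factor \<open>\<Lambda> / b\<close>.\<close>

lemma picard_contraction:
  assumes u: "L2_continuous u" and v: "L2_continuous v" and t: "0 \<le> t" and b: "0 < b" and D: "0 \<le> D"
    and diff: "\<And>\<tau>. 0 \<le> \<tau> \<Longrightarrow> L2norm (\<lambda>\<xi>. u \<tau> \<xi> - v \<tau> \<xi>) \<le> D * exp (b * \<tau>)"
  shows "cmod (picard u t \<xi> - picard v t \<xi>) \<le> \<Lambda> * D * exp (b * t) / b"
proof (cases "norm \<xi> \<le> n")
  case True
  have "cmod (duhamel l w0 (\<lambda>\<tau>. G (u \<tau>)) t \<xi> - duhamel l w0 (\<lambda>\<tau>. G (v \<tau>)) t \<xi>)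
      \<le> cmod (w0 \<xi> - w0 \<xi>) + (LINT \<tau>:{0..t}|lborel. \<Lambda> * D * exp (b * \<tau>))"
  proof (rule duhamel_diff_bound[where l=l])
    fix \<tau> assume \<tau>: "\<tau> \<in> {0..t}"
    then have "cmod (G (u \<tau>) \<xi> - G (v \<tau>) \<xi>) \<le> \<Lambda> * L2norm (\<lambda>\<xi>. u \<tau> \<xi> - v \<tau> \<xi>)"
      using True by (intro G_Lipschitz L2_continuous_L2c[OF u] L2_continuous_L2c[OF v]) auto
    also have "\<dots> \<le> \<Lambda> * (D * exp (b * \<tau>))" using \<Lambda>_pos diff[of \<tau>] \<tau> by (intro mult_left_mono) auto
    finally show "cmod (G (u \<tau>) \<xi> - G (v \<tau>) \<xi>) \<le> \<Lambda> * D * exp (b * \<tau>)" by (simp add: mult.assoc)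
  qed (use G_continuous[OF u True] G_continuous[OF v True] l_nonneg t set_integral_exp_le(1)[OF b t] \<Lambda>_pos D in auto)
  also have "(LINT \<tau>:{0..t}|lborel. \<Lambda> * D * exp (b * \<tau>)) \<le> \<Lambda> * D * exp (b * t) / b"
    by (rule set_integral_exp_le(2)[OF b t]) (use \<Lambda>_pos D in auto)
  finally show ?thesis using True by (simp add: picard_def ball_duhamel_def)
qed (use \<Lambda>_pos D b in \<open>auto simp: picard_def ball_duhamel_def\<close>)

definition iterate :: "nat \<Rightarrow> real \<Rightarrow> pt \<Rightarrow> complex" where
  "iterate k = (picard ^^ k) (\<lambda>_ _. 0)"

lemma iterate_0: "iterate 0 = (\<lambda>_ _. 0)" and iterate_Suc: "iterate (Suc k) = picard (iterate k)"
  by (simp_all add: iterate_def)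

lemma jointly_borel_iterate: "jointly_borel (iterate k)"
  by (induction k) (auto simp: iterate_0 iterate_Suc intro!: jointly_borel_picard)

lemma iterate_L2_continuous: "L2_continuous (iterate k)"
  by (induction k) (auto simp: iterate_0 iterate_Suc L2_continuous_def[of "\<lambda>_ _. 0"] intro!: picard_L2_continuous jointly_borel_iterate)

lemma iterate_hermitian: "hermitian (iterate k t)"
  by (induction k arbitrary: t) (simp add: iterate_0, unfold iterate_Suc, rule picard_hermitian)

lemma iterate_support: "n < norm \<xi> \<Longrightarrow> iterate k t \<xi> = 0"
  by (cases k) (simp_all add: iterate_0 iterate_Suc picard_def ball_duhamel_support)

lemma iterate_measurable [measurable]: "iterate k t \<in> borel_measurable borel"
  by (rule jointly_borel_slice[OF jointly_borel_iterate])

definition growth :: real where "growth = 2 * \<Lambda> * (ball_L2norm n + 1)"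

lemma growth_pos: "0 < growth"
  unfolding growth_def using \<Lambda>_pos ball_L2norm_nonneg[of n] by (intro mult_pos_pos) auto

lemma contraction_halves:
  assumes "0 \<le> D" shows "\<Lambda> * D * exp (growth * t) / growth * ball_L2norm n \<le> D / 2 * exp (growth * t)"
proof -
  have "2 * \<Lambda> * ball_L2norm n \<le> growth" using \<Lambda>_pos by (simp add: growth_def)
  then have "(2 * \<Lambda> * ball_L2norm n) * (D * exp (growth * t)) \<le> growth * (D * exp (growth * t))"
    using assms by (intro mult_right_mono) auto
  then show ?thesis using growth_pos by (simp add: field_simps)
qed

definition initial_size :: real where "initial_size = L2norm w0 + ball_L2norm n * K / growth"

lemma initial_size_nonneg: "0 \<le> initial_size"
  unfolding initial_size_def using ball_L2norm_nonneg[of n] K_nonneg growth_pos by simp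

lemma first_iterate_L2norm:
  assumes t: "0 \<le> t" shows "L2norm (iterate 1 t) \<le> initial_size * exp (growth * t)"
proof -
  obtain h where h: "L2c h" "L2norm h \<le> L2norm w0 + t * K * ball_L2norm n" "\<And>\<xi>. cmod (iterate 1 t \<xi>) \<le> cmod (h \<xi>)"
    using picard_dominated[OF iterate_L2_continuous t, of 0] t by (auto simp: iterate_Suc)
  have "L2norm (iterate 1 t) \<le> 1 * L2norm h" by (rule L2c_mono(2)[OF h(1)]) (use h(3) in auto)
  also have "\<dots> \<le> L2norm w0 + t * K * ball_L2norm n" using h(2) by simp
  also have "\<dots> \<le> initial_size * exp (growth * t)"
  proof -
    have "growth * t \<le> exp (growth * t)" using exp_ge_add_one_self[of "growth * t"] by linarith
    then have "t \<le> exp (growth * t) / growth" using growth_pos by (simp add: field_simps)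
    then have "t * (K * ball_L2norm n) \<le> exp (growth * t) / growth * (K * ball_L2norm n)"
      using K_nonneg ball_L2norm_nonneg[of n] by (intro mult_right_mono) auto
    moreover have "L2norm w0 * 1 \<le> L2norm w0 * exp (growth * t)" using t growth_pos by (intro mult_left_mono) auto
    ultimately show ?thesis unfolding initial_size_def by (simp add: algebra_simps)
  qed
  finally show ?thesis .
qed

lemma iterate_L2_difference:
  "0 \<le> t \<Longrightarrow> L2norm (\<lambda>\<xi>. iterate (Suc k) t \<xi> - iterate k t \<xi>) \<le> initial_size * (1/2)^k * exp (growth * t)"
proof (induction k arbitrary: t)
  case 0
  then show ?case using first_iterate_L2norm by (simp add: iterate_0)
next
  case (Suc k)
  let ?D = "initial_size * (1/2)^k"
  have D: "0 \<le> ?D" using initial_size_nonneg by simp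
  have "L2norm (\<lambda>\<xi>. iterate (Suc (Suc k)) t \<xi> - iterate (Suc k) t \<xi>)
      \<le> \<Lambda> * ?D * exp (growth * t) / growth * ball_L2norm n"
  proof (rule L2norm_ball_bound(2))
    show "cmod (iterate (Suc (Suc k)) t \<xi> - iterate (Suc k) t \<xi>) \<le> \<Lambda> * ?D * exp (growth * t) / growth" for \<xi>
      using picard_contraction[OF iterate_L2_continuous iterate_L2_continuous Suc.prems growth_pos D Suc.IH]
        by (simp only: iterate_Suc)
  qed (use D \<Lambda>_pos growth_pos in \<open>auto simp: iterate_support\<close>)
  also have "\<dots> \<le> ?D / 2 * exp (growth * t)" by (rule contraction_halves[OF D])
  finally show ?case by simp
qed

definition pointwise_size :: real where "pointwise_size = \<Lambda> * initial_size / growth"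

lemma pointwise_size_nonneg: "0 \<le> pointwise_size"
  unfolding pointwise_size_def using \<Lambda>_pos initial_size_nonneg growth_pos by simp

lemma iterate_difference:
  assumes t: "0 \<le> t"
  shows "cmod (iterate (Suc (Suc k)) t \<xi> - iterate (Suc k) t \<xi>) \<le> pointwise_size * exp (growth * t) * (1/2)^k"
proof -
  have "cmod (picard (iterate (Suc k)) t \<xi> - picard (iterate k) t \<xi>)
      \<le> \<Lambda> * (initial_size * (1/2)^k) * exp (growth * t) / growth"
    by (rule picard_contraction[OF iterate_L2_continuous iterate_L2_continuous t growth_pos _ iterate_L2_difference])
      (use initial_size_nonneg in auto)
  then show ?thesis by (simp add: pointwise_size_def iterate_Suc mult_ac)
qed

definition fixed_point :: "real \<Rightarrow> pt \<Rightarrow> complex" where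
  "fixed_point t \<xi> = lim (\<lambda>k. iterate (Suc k) t \<xi>)"

lemma iterate_tendsto: "0 \<le> t \<Longrightarrow> (\<lambda>k. iterate (Suc k) t \<xi>) \<longlonglongrightarrow> fixed_point t \<xi>"
  unfolding fixed_point_def by (rule geometric_differences_limit(1)[OF iterate_difference])

lemma iterate_error: "0 \<le> t \<Longrightarrow> cmod (iterate (Suc k) t \<xi> - fixed_point t \<xi>)
    \<le> 2 * (pointwise_size * exp (growth * t)) * (1/2)^k"
  unfolding fixed_point_def by (rule geometric_differences_limit(2)[OF iterate_difference])

lemma jointly_borel_fixed_point: "jointly_borel fixed_point"
proof -
  note [measurable (raw)] = measurable_pair_apply[OF jointly_borel_iterate]
  show ?thesis unfolding fixed_point_def split_beta' by measurable
qed

lemma fixed_point_measurable [measurable]: "fixed_point t \<in> borel_measurable borel"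
  by (rule jointly_borel_slice[OF jointly_borel_fixed_point])

lemma iterate_L2_error:
  assumes t: "0 \<le> t"
  shows "L2c (\<lambda>\<xi>. iterate (Suc k) t \<xi> - fixed_point t \<xi>)"
    and "L2norm (\<lambda>\<xi>. iterate (Suc k) t \<xi> - fixed_point t \<xi>)
        \<le> 2 * pointwise_size * ball_L2norm n * (1/2)^k * exp (growth * t)"
proof -
  let ?f = "\<lambda>\<xi>. iterate (Suc k) t \<xi> - fixed_point t \<xi>" and ?B = "2 * (pointwise_size * exp (growth * t)) * (1/2)^k"
  have f: "?f \<in> borel_measurable borel" by measurable
  have support: "?f \<xi> = 0" if "n < norm \<xi>" for \<xi>
    using iterate_tendsto[OF t, of \<xi>] by (simp add: iterate_support[OF that] LIMSEQ_const_iff)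
  have B: "0 \<le> ?B" using pointwise_size_nonneg by simp
  show "L2c ?f" by (rule L2norm_ball_bound(1)[OF f support iterate_error[OF t] B])
  have "L2norm ?f \<le> ?B * ball_L2norm n" by (rule L2norm_ball_bound(2)[OF f support iterate_error[OF t] B])
  then show "L2norm ?f \<le> 2 * pointwise_size * ball_L2norm n * (1/2)^k * exp (growth * t)" by (simp add: mult_ac)
qed

lemma fixed_point_L2_continuous: "L2_continuous fixed_point"
proof (rule L2_continuous_uniform_limit[of "\<lambda>k. iterate (Suc k)", OF iterate_L2_continuous])
  show "L2c (fixed_point t)" if "0 \<le> t" for t
    using L2c_diff[OF L2_continuous_L2c[OF iterate_L2_continuous that] iterate_L2_error(1)[OF that], of "Suc 0" 0] by simp
  fix T e :: real assume e: "0 < e"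
  let ?c = "2 * pointwise_size * ball_L2norm n"
  have c: "0 \<le> ?c" using pointwise_size_nonneg ball_L2norm_nonneg[of n] by simp
  have "(\<lambda>k. ?c * exp (growth * T) * (1/2)^k) \<longlonglongrightarrow> 0"
    using tendsto_mult_right_zero[OF LIMSEQ_power_zero[of "1/2::real"]] by simp
  from order_tendstoD(2)[OF this e] obtain k where k: "?c * exp (growth * T) * (1/2)^k < e"
    by (auto dest: eventually_happens)
  have "L2norm (\<lambda>\<xi>. iterate (Suc k) t \<xi> - fixed_point t \<xi>) \<le> e" if "t \<in> {0..T}" for t
  proof -
    have "L2norm (\<lambda>\<xi>. iterate (Suc k) t \<xi> - fixed_point t \<xi>) \<le> ?c * (1/2)^k * exp (growth * t)"
      using that by (intro iterate_L2_error(2)) auto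
    also have "\<dots> \<le> ?c * (1/2)^k * exp (growth * T)" using that growth_pos c by (intro mult_left_mono) auto
    also have "\<dots> < e" using k by (simp add: mult_ac)
    finally show ?thesis by simp
  qed
  then show "\<exists>k. \<forall>t\<in>{0..T}. L2norm (\<lambda>\<xi>. iterate (Suc k) t \<xi> - fixed_point t \<xi>) \<le> e" by blast
qed

lemma fixed_point_hermitian:
  assumes "0 \<le> t" shows "hermitian (fixed_point t)"
proof
  fix \<xi>
  have "(\<lambda>k. cnj (iterate (Suc k) t \<xi>)) \<longlonglongrightarrow> fixed_point t (- \<xi>)"
    using iterate_tendsto[OF assms, of "- \<xi>"] iterate_hermitian by simp
  then show "fixed_point t (- \<xi>) = cnj (fixed_point t \<xi>)"
    by (rule LIMSEQ_unique) (intro tendsto_intros iterate_tendsto[OF assms])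
qed

theorem picard_fixed_point:
  assumes t: "0 \<le> t" shows "picard fixed_point t \<xi> = fixed_point t \<xi>"
proof (rule LIMSEQ_unique)
  show "(\<lambda>k. iterate (Suc (Suc k)) t \<xi>) \<longlonglongrightarrow> fixed_point t \<xi>" using LIMSEQ_Suc[OF iterate_tendsto[OF t, of \<xi>]] .
  let ?c = "2 * pointwise_size * ball_L2norm n"
  have "cmod (picard (iterate (Suc k)) t \<xi> - picard fixed_point t \<xi>)
      \<le> \<Lambda> * (?c * (1/2)^k) * exp (growth * t) / growth" for k
    by (rule picard_contraction[OF iterate_L2_continuous fixed_point_L2_continuous t growth_pos _ iterate_L2_error(2)])
      (use pointwise_size_nonneg ball_L2norm_nonneg[of n] in auto)
  then have bound: "\<forall>\<^sub>F k in sequentially. norm (iterate (Suc (Suc k)) t \<xi> - picard fixed_point t \<xi>)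
      \<le> \<Lambda> * ?c * exp (growth * t) / growth * (1/2)^k"
    by (intro always_eventually) (simp add: iterate_Suc[of "Suc _"] mult_ac)
  have "(\<lambda>k. \<Lambda> * ?c * exp (growth * t) / growth * (1/2)^k) \<longlonglongrightarrow> 0"
    by (rule tendsto_mult_right_zero) (rule LIMSEQ_power_zero, simp)
  with bound show "(\<lambda>k. iterate (Suc (Suc k)) t \<xi>) \<longlonglongrightarrow> picard fixed_point t \<xi>"
    by (rule tendsto_of_norm_diff_le)
qed

end

section \<open>Energy identities\<close>

lemma cmod_square_has_vector_derivative:
  assumes y: "(y has_vector_derivative y') (at x within S)"
  shows "((\<lambda>t. (cmod (y t))\<^sup>2) has_vector_derivative 2 * Re (y' * cnj (y x))) (at x within S)"
proof -
  have "((\<lambda>t. y t * cnj (y t)) has_vector_derivative (y x * cnj y' + y' * cnj (y x))) (at x within S)"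
    by (rule has_vector_derivative_mult[OF y has_vector_derivative_cnj[OF y]])
  from bounded_linear.has_vector_derivative[OF bounded_linear_Re this]
  have "((\<lambda>t. Re (y t * cnj (y t))) has_vector_derivative Re (y x * cnj y' + y' * cnj (y x))) (at x within S)" .
  moreover have "Re (y t * cnj (y t)) = (cmod (y t))\<^sup>2" for t unfolding cmod_power2 by (simp add: power2_eq_square)
  moreover have "Re (y x * cnj y' + y' * cnj (y x)) = 2 * Re (y' * cnj (y x))" by simp
  ultimately show ?thesis by simp
qed

locale damped_evolution =
  fixes y f :: "real \<Rightarrow> pt \<Rightarrow> complex" and l :: "pt \<Rightarrow> real"
  assumes jointly_borel_y: "jointly_borel y" and jointly_borel_f: "jointly_borel f" and l_measurable [measurable]: "l \<in> borel_measurable borel"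
    and y_has_vector_derivative: "0
        \<le> t \<Longrightarrow> ((\<lambda>t. y t \<xi>) has_vector_derivative (- complex_of_real (l \<xi>) * y t \<xi> - f t \<xi>)) (at t within {0..})"
    and f_continuous: "continuous_on {0..} (\<lambda>t. f t \<xi>)"
begin

lemma y_measurable [measurable]: "y t \<in> borel_measurable borel"
  by (rule jointly_borel_slice[OF jointly_borel_y])

lemma y_continuous: "continuous_on {0..} (\<lambda>t. y t \<xi>)"
  by (rule continuous_on_vector_derivative) (rule y_has_vector_derivative, simp)

lemma cmod_square_increment:
  assumes r: "0 \<le> r" and rt: "r \<le> t"
  shows "(cmod (y t \<xi>))\<^sup>2 - (cmod (y r \<xi>))\<^sup>2
      = - 2 * (LINT \<tau>:{r..t}|lborel. l \<xi> * (cmod (y \<tau> \<xi>))\<^sup>2) - 2 * (LINT \<tau>:{r..t}|lborel. Re (f \<tau> \<xi> * cnj (y \<tau> \<xi>)))"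
proof -
  let ?y' = "\<lambda>\<tau>. - complex_of_real (l \<xi>) * y \<tau> \<xi> - f \<tau> \<xi>"
  have "continuous_on {r..t} (\<lambda>\<tau>. 2 * Re (?y' \<tau> * cnj (y \<tau> \<xi>)))"
    using r by (intro continuous_intros continuous_on_subset[OF y_continuous] continuous_on_subset[OF f_continuous]) auto
  then have "(LINT \<tau>:{r..t}|lborel. 2 * Re (?y' \<tau> * cnj (y \<tau> \<xi>))) = (cmod (y t \<xi>))\<^sup>2 - (cmod (y r \<xi>))\<^sup>2"
    unfolding set_lebesgue_integral_def
  proof (rule integral_FTC_Icc[OF rt, rotated])
    fix \<tau> assume "r \<le> \<tau>" "\<tau> \<le> t"
    then have "((\<lambda>t. (cmod (y t \<xi>))\<^sup>2) has_vector_derivative 2 * Re (?y' \<tau> * cnj (y \<tau> \<xi>))) (at \<tau> within {0..})"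
      using r by (intro cmod_square_has_vector_derivative[OF y_has_vector_derivative]) auto
    then show "((\<lambda>t. (cmod (y t \<xi>))\<^sup>2) has_vector_derivative 2 * Re (?y' \<tau> * cnj (y \<tau> \<xi>))) (at \<tau> within {r..t})"
      by (rule has_vector_derivative_within_subset) (use r in auto)
  qed
  also have "(\<lambda>\<tau>. 2 * Re (?y' \<tau> * cnj (y \<tau> \<xi>))) = (\<lambda>\<tau>. - 2 * (l \<xi> * (cmod (y \<tau> \<xi>))\<^sup>2) - 2 * Re (f \<tau> \<xi> * cnj (y \<tau> \<xi>)))"
    unfolding cmod_power2 by (simp add: power2_eq_square algebra_simps)
  also have "(LINT \<tau>:{r..t}|lborel. - 2 * (l \<xi> * (cmod (y \<tau> \<xi>))\<^sup>2) - 2 * Re (f \<tau> \<xi> * cnj (y \<tau> \<xi>)))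
      = (LINT \<tau>:{r..t}|lborel. - 2 * (l \<xi> * (cmod (y \<tau> \<xi>))\<^sup>2)) - (LINT \<tau>:{r..t}|lborel. 2 * Re (f \<tau> \<xi> * cnj (y \<tau> \<xi>)))"
    by (intro set_integral_diff(2) set_integrable_continuous r continuous_intros y_continuous f_continuous)
  finally show ?thesis by (simp only: set_integral_mult_right)
qed

lemma energy_identity:
  assumes r: "0 \<le> r" and rt: "r \<le> t"
    and energy: "integrable lborel (\<lambda>\<xi>. m \<xi> * (cmod (y r \<xi>))\<^sup>2)" "integrable lborel (\<lambda>\<xi>. m \<xi> * (cmod (y t \<xi>))\<^sup>2)"
    and damping: "integrable lborel2 (\<lambda>(\<tau>, \<xi>). indicator {r..t} \<tau> * (m \<xi> * l \<xi> * (cmod (y \<tau> \<xi>))\<^sup>2))"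
    and force: "integrable lborel2 (\<lambda>(\<tau>, \<xi>). indicator {r..t} \<tau> * (m \<xi> * Re (f \<tau> \<xi> * cnj (y \<tau> \<xi>))))"
  shows "set_integrable lborel {r..t} (\<lambda>\<tau>. weighted_energy (\<lambda>\<xi>. m \<xi> * l \<xi>) (y \<tau>))"
    and "set_integrable lborel {r..t} (\<lambda>\<tau>. weighted_inner m (f \<tau>) (y \<tau>))"
    and "weighted_energy m (y t)
        = weighted_energy m (y r) - 2 * (LINT \<tau>:{r..t}|lborel. weighted_energy (\<lambda>\<xi>. m \<xi> * l \<xi>) (y \<tau>))
       - 2 * (LINT \<tau>:{r..t}|lborel. weighted_inner m (f \<tau>) (y \<tau>))"
proof -
  let ?a = "\<lambda>\<tau> \<xi>. indicator {r..t} \<tau> * (m \<xi> * l \<xi> * (cmod (y \<tau> \<xi>))\<^sup>2)" and ?b = "\<lambda>\<tau> \<xi>. indicator {r..t} \<tau> * (m \<xi> * Re (f \<tau> \<xi> * cnj (y \<tau> \<xi>)))"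
  show "set_integrable lborel {r..t} (\<lambda>\<tau>. weighted_energy (\<lambda>\<xi>. m \<xi> * l \<xi>) (y \<tau>))"
    using lborel_pair.integrable_fst[OF damping] by (simp add: set_integrable_def weighted_energy_def)
  show "set_integrable lborel {r..t} (\<lambda>\<tau>. weighted_inner m (f \<tau>) (y \<tau>))"
    using lborel_pair.integrable_fst[OF force] by (simp add: set_integrable_def weighted_inner_def)
  have pointwise: "m \<xi> * (cmod (y t \<xi>))\<^sup>2 - m \<xi> * (cmod (y r \<xi>))\<^sup>2
      = - 2 * (LINT \<tau>|lborel. ?a \<tau> \<xi>) - 2 * (LINT \<tau>|lborel. ?b \<tau> \<xi>)" for \<xi>
  proof -
    have "(LINT \<tau>|lborel. ?a \<tau> \<xi>) = m \<xi> * (LINT \<tau>:{r..t}|lborel. l \<xi> * (cmod (y \<tau> \<xi>))\<^sup>2)"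
      "(LINT \<tau>|lborel. ?b \<tau> \<xi>) = m \<xi> * (LINT \<tau>:{r..t}|lborel. Re (f \<tau> \<xi> * cnj (y \<tau> \<xi>)))"
      unfolding set_lebesgue_integral_def integral_mult_right_zero[symmetric] real_scaleR_def
      by (rule Bochner_Integration.integral_cong; simp only: mult_ac)+
    then show ?thesis unfolding right_diff_distrib[symmetric] cmod_square_increment[OF r rt]
      by (simp only: right_diff_distrib mult_ac)
  qed
  have "weighted_energy m (y t) - weighted_energy m (y r)
      = (LINT \<xi>|lborel. - 2 * (LINT \<tau>|lborel. ?a \<tau> \<xi>) - 2 * (LINT \<tau>|lborel. ?b \<tau> \<xi>))"
    unfolding weighted_energy_def Bochner_Integration.integral_diff[OF energy(2,1), symmetric] pointwise ..
  also have "\<dots> = (LINT \<xi>|lborel. - 2 * (LINT \<tau>|lborel. ?a \<tau> \<xi>)) - (LINT \<xi>|lborel. 2 * (LINT \<tau>|lborel. ?b \<tau> \<xi>))"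
    by (intro Bochner_Integration.integral_diff integrable_mult_right lborel_pair.integrable_snd[OF damping] lborel_pair.integrable_snd[OF force])
  also have "\<dots> = - 2 * (LINT \<tau>|lborel. LINT \<xi>|lborel. ?a \<tau> \<xi>) - 2 * (LINT \<tau>|lborel. LINT \<xi>|lborel. ?b \<tau> \<xi>)"
    unfolding integral_mult_right_zero lborel_pair.Fubini_integral[OF damping] lborel_pair.Fubini_integral[OF force] ..
  finally show "weighted_energy m (y t)
      = weighted_energy m (y r) - 2 * (LINT \<tau>:{r..t}|lborel. weighted_energy (\<lambda>\<xi>. m \<xi> * l \<xi>) (y \<tau>))
       - 2 * (LINT \<tau>:{r..t}|lborel. weighted_inner m (f \<tau>) (y \<tau>))"
    unfolding weighted_energy_def weighted_inner_def set_lebesgue_integral_def real_scaleR_def integral_mult_right_zero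
      by linarith
qed

end

lemma integrable_time_slices:
  fixes u :: "real \<Rightarrow> pt \<Rightarrow> 'b::{banach, second_countable_topology}"
  assumes u: "(\<lambda>(\<tau>, \<xi>). u \<tau> \<xi>) \<in> borel_measurable (borel \<Otimes>\<^sub>M borel)"
    and slice: "\<And>\<tau>. \<tau> \<in> {r..t} \<Longrightarrow> (\<integral>\<^sup>+\<xi>. ennreal (norm (u \<tau> \<xi>)) \<partial>lborel) \<le> ennreal B"
  shows "integrable lborel2 (\<lambda>(\<tau>, \<xi>). indicator {r..t} \<tau> *\<^sub>R u \<tau> \<xi>)"
proof (rule integrableI_bounded)
  note [measurable (raw)] = measurable_pair_apply[OF u]
  show meas: "(\<lambda>(\<tau>, \<xi>). indicator {r..t} \<tau> *\<^sub>R u \<tau> \<xi>) \<in> borel_measurable lborel2" by measurable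
  have "(\<integral>\<^sup>+p. ennreal (norm (case p of (\<tau>, \<xi>) \<Rightarrow> indicator {r..t} \<tau> *\<^sub>R u \<tau> \<xi>)) \<partial>lborel2)
     = (\<integral>\<^sup>+\<tau>. \<integral>\<^sup>+\<xi>. ennreal (norm (indicator {r..t} \<tau> *\<^sub>R u \<tau> \<xi>)) \<partial>lborel \<partial>lborel)"
    by (subst lborel.nn_integral_fst[symmetric]) (use meas in auto)
  also have "\<dots> \<le> (\<integral>\<^sup>+\<tau>. indicator {r..t} \<tau> * ennreal B \<partial>lborel)"
  proof (rule nn_integral_mono)
    fix \<tau> :: real
    show "(\<integral>\<^sup>+\<xi>. ennreal (norm (indicator {r..t} \<tau> *\<^sub>R u \<tau> \<xi>)) \<partial>lborel) \<le> indicator {r..t} \<tau> * ennreal B"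
      using slice[of \<tau>] by (cases "\<tau> \<in> {r..t}") auto
  qed
  also have "\<dots> < \<infinity>" by (subst nn_integral_multc) (auto simp: ennreal_mult_less_top emeasure_lborel_Icc_eq)
  finally show "(\<integral>\<^sup>+p. ennreal (norm (case p of (\<tau>, \<xi>) \<Rightarrow> indicator {r..t} \<tau> *\<^sub>R u \<tau> \<xi>)) \<partial>lborel2) < \<infinity>" .
qed

lemma integrable_time_dominated:
  fixes u :: "real \<Rightarrow> pt \<Rightarrow> real"
  assumes u: "(\<lambda>(\<tau>, \<xi>). u \<tau> \<xi>) \<in> borel_measurable (borel \<Otimes>\<^sub>M borel)" and g: "integrable lborel g"
    and dominated: "\<And>\<tau> \<xi>. \<tau> \<in> {r..t} \<Longrightarrow> \<bar>u \<tau> \<xi>\<bar> \<le> g \<xi>"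
  shows "integrable lborel2 (\<lambda>(\<tau>, \<xi>). indicator {r..t} \<tau> * u \<tau> \<xi>)"
proof -
  have "(\<integral>\<^sup>+\<xi>. ennreal (norm (u \<tau> \<xi>)) \<partial>lborel) \<le> ennreal (LINT \<xi>|lborel. g \<xi>)" if "\<tau> \<in> {r..t}" for \<tau>
  proof -
    have "(\<integral>\<^sup>+\<xi>. ennreal (norm (u \<tau> \<xi>)) \<partial>lborel) \<le> (\<integral>\<^sup>+\<xi>. ennreal (g \<xi>) \<partial>lborel)"
      using dominated[OF that] by (intro nn_integral_mono ennreal_leI) simp
    also have "\<dots> = ennreal (LINT \<xi>|lborel. g \<xi>)"
      by (intro nn_integral_eq_integral g AE_I2 order_trans[OF abs_ge_zero dominated[OF that]])
    finally show ?thesis .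
  qed
  from integrable_time_slices[OF u this] show ?thesis by simp
qed

locale ball_damped_evolution = damped_evolution y f l for y f :: "real \<Rightarrow> pt \<Rightarrow> complex" and l :: "pt \<Rightarrow> real" +
  fixes n K \<Lambda> :: real
  assumes y_support: "0 \<le> t \<Longrightarrow> n < norm \<xi> \<Longrightarrow> y t \<xi> = 0"
    and l_bound: "norm \<xi> \<le> n \<Longrightarrow> \<bar>l \<xi>\<bar> \<le> \<Lambda>" and \<Lambda>_nonneg: "0 \<le> \<Lambda>"
    and f_bound: "0 \<le> t \<Longrightarrow> cmod (f t \<xi>) \<le> K"
    and y_dominated: "0 \<le> T \<Longrightarrow> \<exists>h. L2c h \<and> (\<forall>t\<in>{0..T}. \<forall>\<xi>. cmod (y t \<xi>) \<le> cmod (h \<xi>))"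
begin

context
  fixes m :: "pt \<Rightarrow> real" and B t :: real
  assumes m [measurable]: "m \<in> borel_measurable borel" and m_bound: "\<And>\<xi>. norm \<xi>
      \<le> n \<Longrightarrow> \<bar>m \<xi>\<bar> \<le> B" and B: "0 \<le> B" and t: "0 \<le> t"
begin

lemma weighted_density_le:
  assumes "cmod (y \<tau> \<xi>) \<le> c" "0 \<le> \<tau>"
  shows "\<bar>m \<xi> * (cmod (y \<tau> \<xi>))\<^sup>2\<bar> \<le> B * c\<^sup>2" "\<bar>m \<xi> * l \<xi> * (cmod (y \<tau> \<xi>))\<^sup>2\<bar> \<le> \<Lambda> * (B * c\<^sup>2)"
    "\<bar>m \<xi> * Re (f \<tau> \<xi> * cnj (y \<tau> \<xi>))\<bar> \<le> B * K * (cmod (if norm \<xi> \<le> n then 1 else 0 :: complex) * c)"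
proof -
  have square: "(cmod (y \<tau> \<xi>))\<^sup>2 \<le> c\<^sup>2" using assms(1) by (intro power_mono) auto
  have K: "0 \<le> K" using order_trans[OF norm_ge_zero f_bound[OF assms(2)]] .
  show energy: "\<bar>m \<xi> * (cmod (y \<tau> \<xi>))\<^sup>2\<bar> \<le> B * c\<^sup>2"
    using m_bound[of \<xi>] square B y_support[OF assms(2), of \<xi>]
      by (cases "norm \<xi> \<le> n") (auto simp: abs_mult intro!: mult_mono)
  show "\<bar>m \<xi> * l \<xi> * (cmod (y \<tau> \<xi>))\<^sup>2\<bar> \<le> \<Lambda> * (B * c\<^sup>2)"
  proof (cases "norm \<xi> \<le> n")
    case True
    have "\<bar>m \<xi> * l \<xi> * (cmod (y \<tau> \<xi>))\<^sup>2\<bar> = \<bar>l \<xi>\<bar> * \<bar>m \<xi> * (cmod (y \<tau> \<xi>))\<^sup>2\<bar>" by (simp add: abs_mult)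
    also have "\<dots> \<le> \<Lambda> * (B * c\<^sup>2)" using l_bound[OF True] energy \<Lambda>_nonneg by (intro mult_mono) auto
    finally show ?thesis .
  qed (use y_support[OF assms(2)] \<Lambda>_nonneg B in auto)
  show "\<bar>m \<xi> * Re (f \<tau> \<xi> * cnj (y \<tau> \<xi>))\<bar> \<le> B * K * (cmod (if norm \<xi> \<le> n then 1 else 0 :: complex) * c)"
  proof (cases "norm \<xi> \<le> n")
    case True
    have "\<bar>Re (f \<tau> \<xi> * cnj (y \<tau> \<xi>))\<bar> \<le> K * c"
      using f_bound[OF assms(2), of \<xi>] assms(1) K by (intro order_trans[OF abs_Re_mult_cnj_le] mult_mono) auto
    then have "\<bar>m \<xi>\<bar> * \<bar>Re (f \<tau> \<xi> * cnj (y \<tau> \<xi>))\<bar> \<le> B * (K * c)" using m_bound[OF True] B by (intro mult_mono) auto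
    then show ?thesis using True unfolding abs_mult by (simp only: if_True norm_one mult_1 mult.assoc)
  qed (use y_support[OF assms(2)] B in auto)
qed

theorem ball_energy_identity:
  shows "set_integrable lborel {0..t} (\<lambda>\<tau>. weighted_energy (\<lambda>\<xi>. m \<xi> * l \<xi>) (y \<tau>))"
    and "set_integrable lborel {0..t} (\<lambda>\<tau>. weighted_inner m (f \<tau>) (y \<tau>))"
    and "weighted_energy m (y t)
        = weighted_energy m (y 0) - 2 * (LINT \<tau>:{0..t}|lborel. weighted_energy (\<lambda>\<xi>. m \<xi> * l \<xi>) (y \<tau>))
       - 2 * (LINT \<tau>:{0..t}|lborel. weighted_inner m (f \<tau>) (y \<tau>))"
proof -
  obtain h where h: "L2c h" "\<And>\<tau> \<xi>. \<tau> \<in> {0..t} \<Longrightarrow> cmod (y \<tau> \<xi>) \<le> cmod (h \<xi>)" using y_dominated[OF t] by blast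
  note int_h = L2c_integrable[OF h(1)]
  note [measurable (raw)] = measurable_pair_apply[OF jointly_borel_y] measurable_pair_apply[OF jointly_borel_f]
  have energy: "integrable lborel (\<lambda>\<xi>. m \<xi> * (cmod (y \<tau> \<xi>))\<^sup>2)" if "\<tau> \<in> {0..t}" for \<tau>
  proof (rule Bochner_Integration.integrable_bound[OF integrable_mult_right[OF int_h, of B]])
    have "\<bar>m \<xi> * (cmod (y \<tau> \<xi>))\<^sup>2\<bar> \<le> B * (cmod (h \<xi>))\<^sup>2" for \<xi>
      using weighted_density_le(1)[OF h(2)[OF that, of \<xi>]] that by simp
    then show "AE \<xi> in lborel. norm (m \<xi> * (cmod (y \<tau> \<xi>))\<^sup>2) \<le> norm (B * (cmod (h \<xi>))\<^sup>2)"
      unfolding real_norm_def by (intro AE_I2 order_trans[OF _ abs_ge_self])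
  qed measurable
  have damping: "integrable lborel2 (\<lambda>(\<tau>, \<xi>). indicator {0..t} \<tau> * (m \<xi> * l \<xi> * (cmod (y \<tau> \<xi>))\<^sup>2))"
  proof (rule integrable_time_dominated)
    show "integrable lborel (\<lambda>\<xi>. \<Lambda> * (B * (cmod (h \<xi>))\<^sup>2))" by (intro integrable_mult_right int_h)
    show "\<bar>m \<xi> * l \<xi> * (cmod (y \<tau> \<xi>))\<^sup>2\<bar> \<le> \<Lambda> * (B * (cmod (h \<xi>))\<^sup>2)"
      if "\<tau> \<in> {0..t}" for \<tau> \<xi> using weighted_density_le(2)[OF h(2)[OF that, of \<xi>]] that by simp
  qed (unfold split_beta', measurable)
  have force: "integrable lborel2 (\<lambda>(\<tau>, \<xi>). indicator {0..t} \<tau> * (m \<xi> * Re (f \<tau> \<xi> * cnj (y \<tau> \<xi>))))"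
  proof (rule integrable_time_dominated)
    show "integrable lborel (\<lambda>\<xi>. B * K * (cmod (if norm \<xi> \<le> n then 1 else 0 :: complex) * cmod (h \<xi>)))"
      by (intro integrable_mult_right L2c_mult_integrable_norm L2c_ball_const h(1))
    show "\<bar>m \<xi> * Re (f \<tau> \<xi> * cnj (y \<tau> \<xi>))\<bar> \<le> B * K * (cmod (if norm \<xi> \<le> n then 1 else 0 :: complex) * cmod (h \<xi>))"
      if "\<tau> \<in> {0..t}" for \<tau> \<xi> using weighted_density_le(3)[OF h(2)[OF that, of \<xi>]] that by simp
  qed (unfold split_beta', measurable)
  note identity = energy_identity[OF order_refl t energy energy damping force]
  show "set_integrable lborel {0..t} (\<lambda>\<tau>. weighted_energy (\<lambda>\<xi>. m \<xi> * l \<xi>) (y \<tau>))" by (rule identity(1)) (use t in auto)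
  show "set_integrable lborel {0..t} (\<lambda>\<tau>. weighted_inner m (f \<tau>) (y \<tau>))" by (rule identity(2)) (use t in auto)
  show "weighted_energy m (y t)
      = weighted_energy m (y 0) - 2 * (LINT \<tau>:{0..t}|lborel. weighted_energy (\<lambda>\<xi>. m \<xi> * l \<xi>) (y \<tau>))
       - 2 * (LINT \<tau>:{0..t}|lborel. weighted_inner m (f \<tau>) (y \<tau>))" by (rule identity(3)) (use t in auto)
qed

end

end

lemma ball_damped_evolution_diff:
  assumes y: "ball_damped_evolution y f l n K \<Lambda>" and z: "ball_damped_evolution z g l n' K' \<Lambda>'" and "n \<le> n'"
  shows "ball_damped_evolution (\<lambda>t \<xi>. y t \<xi> - z t \<xi>) (\<lambda>t \<xi>. f t \<xi> - g t \<xi>) l n' (K + K') \<Lambda>'"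
proof -
  interpret y: ball_damped_evolution y f l n K \<Lambda> by (rule y)
  interpret z: ball_damped_evolution z g l n' K' \<Lambda>' by (rule z)
  show ?thesis
  proof
    note [measurable (raw)] = measurable_pair_apply[OF y.jointly_borel_y] measurable_pair_apply[OF y.jointly_borel_f]
      measurable_pair_apply[OF z.jointly_borel_y] measurable_pair_apply[OF z.jointly_borel_f]
    show "jointly_borel (\<lambda>t \<xi>. y t \<xi> - z t \<xi>)" "jointly_borel (\<lambda>t \<xi>. f t \<xi> - g t \<xi>)" unfolding split_beta' by measurable
    show "l \<in> borel_measurable borel" by measurable
    show "continuous_on {0..} (\<lambda>t. f t \<xi> - g t \<xi>)" for \<xi> by (intro continuous_on_diff y.f_continuous z.f_continuous)
    show "\<bar>l \<xi>\<bar> \<le> \<Lambda>'" if "norm \<xi> \<le> n'" for \<xi> by (rule z.l_bound[OF that])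
    show "0 \<le> \<Lambda>'" by (rule z.\<Lambda>_nonneg)
    fix t :: real assume t: "0 \<le> t"
    show "y t \<xi> - z t \<xi> = 0" if "n' < norm \<xi>" for \<xi> using y.y_support[OF t] z.y_support[OF t] that \<open>n \<le> n'\<close> by simp
    show "cmod (f t \<xi> - g t \<xi>) \<le> K + K'" for \<xi>
      by (rule order_trans[OF norm_triangle_ineq4 add_mono[OF y.f_bound[OF t] z.f_bound[OF t]]])
    have "- complex_of_real (l \<xi>) * (y t \<xi> - z t \<xi>) - (f t \<xi> - g t \<xi>)
        = (- complex_of_real (l \<xi>) * y t \<xi> - f t \<xi>) - (- complex_of_real (l \<xi>) * z t \<xi> - g t \<xi>)" for \<xi>
      by (simp add: algebra_simps)
    then show "((\<lambda>t. y t \<xi> - z t \<xi>) has_vector_derivative (- complex_of_real (l \<xi>) * (y t \<xi> - z t \<xi>) - (f t \<xi> - g t \<xi>))) (at t within {0..})" for \<xi>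
      by (simp only: has_vector_derivative_diff[OF y.y_has_vector_derivative[OF t] z.y_has_vector_derivative[OF t]])
  next
    fix T :: real assume "0 \<le> T"
    obtain h where h: "L2c h" "\<And>t \<xi>. t \<in> {0..T} \<Longrightarrow> cmod (y t \<xi>) \<le> cmod (h \<xi>)" using y.y_dominated[OF \<open>0 \<le> T\<close>] by blast
    obtain k where k: "L2c k" "\<And>t \<xi>. t \<in> {0..T} \<Longrightarrow> cmod (z t \<xi>) \<le> cmod (k \<xi>)" using z.y_dominated[OF \<open>0 \<le> T\<close>] by blast
    let ?b = "\<lambda>\<xi>. complex_of_real (cmod (h \<xi>)) + complex_of_real (cmod (k \<xi>))"
    have "cmod (y t \<xi> - z t \<xi>) \<le> cmod (?b \<xi>)" if "t \<in> {0..T}" for t \<xi>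
      by (rule order_trans[OF norm_triangle_ineq4 order_trans[OF add_mono[OF h(2)[OF that] k(2)[OF that]]]])
        (use complex_Re_le_cmod[of "?b \<xi>"] in simp)
    moreover have "L2c ?b" by (intro L2c_add L2c_cmod h(1) k(1))
    ultimately show "\<exists>h. L2c h \<and> (\<forall>t\<in>{0..T}. \<forall>\<xi>. cmod (y t \<xi> - z t \<xi>) \<le> cmod (h \<xi>))" by blast
  qed
qed

lemma ball_duhamel_evolution:
  assumes w: "\<And>t \<xi>. 0 \<le> t \<Longrightarrow> w t \<xi> = ball_duhamel l w0 n f t \<xi>" "jointly_borel w" and w0: "L2c w0"
    and l: "\<And>\<xi>. 0 \<le> l \<xi>" "l \<in> borel_measurable borel" "\<And>\<xi>. norm \<xi> \<le> n \<Longrightarrow> l \<xi> \<le> \<Lambda>" "0 \<le> \<Lambda>"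
    and f: "jointly_borel f" "\<And>\<xi>. continuous_on {0..} (\<lambda>t. f t \<xi>)"
      "\<And>t \<xi>. 0 \<le> t \<Longrightarrow> norm \<xi> \<le> n \<Longrightarrow> cmod (f t \<xi>) \<le> K" "0 \<le> K"
  shows "ball_damped_evolution w (\<lambda>t \<xi>. if norm \<xi> \<le> n then f t \<xi> else 0) l n K \<Lambda>"
proof
  note [measurable (raw)] = measurable_pair_apply[OF f(1)]
  show "jointly_borel (\<lambda>t \<xi>. if norm \<xi> \<le> n then f t \<xi> else 0)" unfolding split_beta' by measurable
  show "continuous_on {0..} (\<lambda>t. if norm \<xi> \<le> n then f t \<xi> else 0)" for \<xi> using f(2) by (cases "norm \<xi> \<le> n") auto
  show "((\<lambda>t. w t \<xi>) has_vector_derivative (- complex_of_real (l \<xi>) * w t \<xi> - (if norm \<xi> \<le> n then f t \<xi> else 0))) (at t within {0..})" if t: "0 \<le> t" for t \<xi>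
    unfolding w(1)[OF t] by (rule has_vector_derivative_transform[OF _ _ ball_duhamel_has_vector_derivative[OF f(2) t]]) (use t w(1) in auto)
  show "\<exists>h. L2c h \<and> (\<forall>t\<in>{0..T}. \<forall>\<xi>. cmod (w t \<xi>) \<le> cmod (h \<xi>))" if "0 \<le> T" for T
  proof -
    note dominated = ball_duhamel_dominated[where l=l and f=f and n=n, OF l(1) w0 f(2) f(3) f(4) that]
    have "cmod (w t \<xi>) \<le> cmod (complex_of_real (cmod (w0 \<xi>)) + (if norm \<xi> \<le> n then complex_of_real (T * K) else 0))" if "t \<in> {0..T}" for t \<xi>
      using dominated(3)[OF _ _ that] w(1)[of t \<xi>] that by simp
    then show ?thesis using dominated(1) by blast
  qed
qed (use w l f in \<open>auto simp: ball_duhamel_support\<close>)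


section \<open>Truncated solutions\<close>

definition diss_symbol :: "real \<Rightarrow> pt \<Rightarrow> real" where "diss_symbol \<alpha> \<xi> = norm \<xi> powr (2 * \<alpha>)"

lemma diss_symbol_measurable [measurable]: "diss_symbol \<alpha> \<in> borel_measurable borel"
  unfolding diss_symbol_def[abs_def] by measurable

lemma diss_symbol_nonneg [simp]: "0 \<le> diss_symbol \<alpha> \<xi>" by (simp add: diss_symbol_def)

lemma diss_symbol_even: "diss_symbol \<alpha> (- \<xi>) = diss_symbol \<alpha> \<xi>" by (simp add: diss_symbol_def)

lemma diss_symbol_le: "0 \<le> \<alpha> \<Longrightarrow> norm \<xi> \<le> n \<Longrightarrow> diss_symbol \<alpha> \<xi> \<le> n powr (2 * \<alpha>)"
  by (simp add: diss_symbol_def powr_mono2)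

lemma cmod_weighted_square: "(cmod (weighted r f \<xi>))\<^sup>2 = norm \<xi> powr (2 * r) * (cmod (f \<xi>))\<^sup>2"
  unfolding cmod_weighted power_mult_distrib powr_square ..

lemma weighted_energy_powr: "weighted_energy (\<lambda>\<xi>. norm \<xi> powr (2 * r)) f = (hnorm r f)\<^sup>2"
  unfolding weighted_energy_def L2norm_squared L2norm_sq_def cmod_weighted_square ..

lemma weighted_energy_diss_symbol: "weighted_energy (diss_symbol \<alpha>) f = (hnorm \<alpha> f)\<^sup>2"
  unfolding diss_symbol_def[abs_def] by (rule weighted_energy_powr)

lemma weighted_diff: "weighted r (\<lambda>\<xi>. a \<xi> - b \<xi>) = (\<lambda>\<xi>. weighted r a \<xi> - weighted r b \<xi>)"
  by (simp add: weighted_def[abs_def] right_diff_distrib)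

lemma L2c_weighted_bounded_support:
  assumes a: "L2c a" and support: "\<And>\<xi>. n < norm \<xi> \<Longrightarrow> a \<xi> = 0" and r: "0 \<le> r"
  shows "L2c (weighted r a)" "hnorm r a \<le> n powr r * L2norm a"
proof -
  have "cmod (weighted r a \<xi>) \<le> n powr r * cmod (a \<xi>)" for \<xi>
    using r support[of \<xi>] by (cases "norm \<xi> \<le> n") (auto simp: cmod_weighted intro!: mult_right_mono powr_mono2)
  then have "AE \<xi> in lborel. cmod (weighted r a \<xi>) \<le> n powr r * cmod (a \<xi>)" by simp
  from L2c_mono[OF a weighted_measurable[OF L2c_measurable[OF a]] this]
  show "L2c (weighted r a)" "hnorm r a \<le> n powr r * L2norm a"
    by auto
qed

lemma sqg_form_bounded_support_finite:
  assumes "L2c a" "L2c b" "L2c d"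
    and "\<And>\<xi>. n < norm \<xi> \<Longrightarrow> a \<xi> = 0" "\<And>\<xi>. n < norm \<xi> \<Longrightarrow> b \<xi> = 0" "\<And>\<xi>. n < norm \<xi> \<Longrightarrow> d \<xi> = 0"
  shows "sqg_form a b d < \<infinity>"
proof -
  obtain C where C: "gradient_bound (1/3) (4/3) (1/3) C" using gradient_bound_exists[of "1/3" "4/3" "1/3"] by auto
  have "L2c (weighted (1/3) a)" "L2c (weighted (4/3) b)" "L2c (weighted (1/3) d)"
    using assms by (auto intro!: L2c_weighted_bounded_support(1)[where n=n])
  from le_less_trans[OF order_trans[OF sqg_form_le_gradient_form gradient_boundD[OF C this]]] show ?thesis by simp
qed

lemma advection_cancellation:
  assumes ab: "L2c a" "L2c b" and support: "\<And>\<xi>. n < norm \<xi> \<Longrightarrow> a \<xi> = 0" "\<And>\<xi>. n < norm \<xi> \<Longrightarrow> b \<xi> = 0" and a: "hermitian a"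
  shows "weighted_inner (\<lambda>_. 1) (advection a b) b = 0" "integrable lborel (\<lambda>\<xi>. Re (advection a b \<xi> * cnj (b \<xi>)))"
proof -
  note meas = L2c_measurable[OF ab(1)] L2c_measurable[OF ab(2)]
  have finite: "sqg_form a b b < \<infinity>" by (rule sqg_form_bounded_support_finite[where n=n]) (use ab support in auto)
  then obtain K where K: "sqg_form a b b \<le> ennreal K" "0 \<le> K" by (cases "sqg_form a b b") auto
  show "integrable lborel (\<lambda>\<xi>. Re (advection a b \<xi> * cnj (b \<xi>)))"
    by (rule advection_inner_bound(1)[OF meas meas(2) K])
  have "ennreal \<bar>2 * weighted_inner (\<lambda>_. 1) (advection a b) b\<bar> \<le> 0"
    using weighted_inner_advection_le[OF meas a finite, of "\<lambda>_. 1" 1] by (simp add: split_beta')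
  then show "weighted_inner (\<lambda>_. 1) (advection a b) b = 0" by (simp add: ennreal_eq_0_iff)
qed

lemma weighted_inner_cmult: "weighted_inner m (\<lambda>\<xi>. complex_of_real c * f \<xi>) g = c * weighted_inner m f g"
proof -
  have "m \<xi> * Re (complex_of_real c * f \<xi> * cnj (g \<xi>)) = c * (m \<xi> * Re (f \<xi> * cnj (g \<xi>)))" for \<xi>
    by (simp add: algebra_simps)
  then show ?thesis unfolding weighted_inner_def integral_mult_right_zero[symmetric] by (simp only:)
qed

lemma weighted_inner_restrict:
  assumes "\<And>\<xi>. n < norm \<xi> \<Longrightarrow> g \<xi> = 0"
  shows "weighted_inner m (\<lambda>\<xi>. if norm \<xi> \<le> n then f \<xi> else 0) g = weighted_inner m f g"
  unfolding weighted_inner_def using assms by (intro Bochner_Integration.integral_cong) (auto simp: not_le)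

lemma retracted_solution_exists:
  assumes M: "0 < M" and n: "0 < n" and w0: "L2c w0" "hermitian w0"
  obtains w where "jointly_borel w" "L2_continuous w" "\<And>t. 0 \<le> t \<Longrightarrow> hermitian (w t)"
    "\<And>t \<xi>. 0 \<le> t \<Longrightarrow> w t \<xi> = ball_duhamel (diss_symbol \<alpha>) w0 n (\<lambda>\<tau>. retracted_advection M (w \<tau>)) t \<xi>"
proof -
  interpret ball_evolution "diss_symbol \<alpha>" w0 "retracted_advection M" n "n * M\<^sup>2" "n * (4 * M)"
  proof
    fix \<xi> :: pt and a :: "pt \<Rightarrow> complex" assume a: "L2c a" and \<xi>: "norm \<xi> \<le> n"
    have "norm \<xi> * M\<^sup>2 \<le> n * M\<^sup>2" using \<xi> by (intro mult_right_mono) auto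
    with retracted_advection_bound[OF M a] show "cmod (retracted_advection M a \<xi>) \<le> n * M\<^sup>2" by (rule order_trans)
    fix b assume b: "L2c b"
    have "norm \<xi> * (4 * M) * L2norm (\<lambda>x. a x - b x) \<le> n * (4 * M) * L2norm (\<lambda>x. a x - b x)"
      using \<xi> M by (intro mult_right_mono) auto
    with retracted_advection_Lipschitz[OF M a b]
    show "cmod (retracted_advection M a \<xi> - retracted_advection M b \<xi>) \<le> n * (4 * M) * L2norm (\<lambda>x. a x - b x)"
      by (rule order_trans)
  qed (use M n w0 diss_symbol_even jointly_borel_retracted_advection retracted_advection_hermitian in auto)
  show thesis
    by (rule that[OF jointly_borel_fixed_point fixed_point_L2_continuous fixed_point_hermitian])
      (simp_all only: picard_fixed_point[unfolded picard_def])
qed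

lemma retracted_solution_L2norm_le:
  assumes M: "0 < M" and n: "0 < n" and \<alpha>: "0 < \<alpha>" and w0: "L2c w0"
    and w: "jointly_borel w" "L2_continuous w" "\<And>t. 0 \<le> t \<Longrightarrow> hermitian (w t)"
    and w_eq: "\<And>t \<xi>. 0 \<le> t \<Longrightarrow> w t \<xi> = ball_duhamel (diss_symbol \<alpha>) w0 n (\<lambda>\<tau>. retracted_advection M (w \<tau>)) t \<xi>"
    and t: "0 \<le> t"
  shows "L2norm (w t) \<le> L2norm w0"
proof -
  note w_L2c = L2_continuous_L2c[OF w(2)]
  interpret ball_damped_evolution w "\<lambda>t \<xi>. if norm \<xi>
      \<le> n then retracted_advection M (w t) \<xi> else 0" "diss_symbol \<alpha>" n "n * M\<^sup>2" "n powr (2 * \<alpha>)"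
  proof (rule ball_duhamel_evolution[OF w_eq w(1) w0])
    fix t :: real and \<xi> :: pt assume "0 \<le> t" "norm \<xi> \<le> n"
    then have "norm \<xi> * M\<^sup>2 \<le> n * M\<^sup>2" by (intro mult_right_mono) auto
    with retracted_advection_bound[OF M w_L2c[OF \<open>0 \<le> t\<close>]] show "cmod (retracted_advection M (w t) \<xi>) \<le> n * M\<^sup>2"
      by (rule order_trans)
  qed (use M n \<alpha> w diss_symbol_le jointly_borel_retracted_advection retracted_advection_continuous in auto)
  let ?force = "\<lambda>\<tau> \<xi>. if norm \<xi> \<le> n then retracted_advection M (w \<tau>) \<xi> else 0"
  have "weighted_inner (\<lambda>_. 1) (?force \<tau>) (w \<tau>) = 0" if \<tau>: "0 \<le> \<tau>" for \<tau>
  proof -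
    have "weighted_inner (\<lambda>_. 1) (?force \<tau>) (w \<tau>) = weighted_inner (\<lambda>_. 1) (retracted_advection M (w \<tau>)) (w \<tau>)"
      by (rule weighted_inner_restrict[OF y_support[OF \<tau>]])
    also have "\<dots> = (retraction_factor M (w \<tau>))\<^sup>2 * weighted_inner (\<lambda>_. 1) (advection (w \<tau>) (w \<tau>)) (w \<tau>)"
      unfolding retracted_advection_def[abs_def] by (rule weighted_inner_cmult)
    also have "weighted_inner (\<lambda>_. 1) (advection (w \<tau>) (w \<tau>)) (w \<tau>) = 0"
      by (rule advection_cancellation(1)[OF w_L2c[OF \<tau>] w_L2c[OF \<tau>] y_support[OF \<tau>] y_support[OF \<tau>] w(3)[OF \<tau>]])
    finally show ?thesis by simp
  qed
  then have work: "(LINT \<tau>:{0..t}|lborel. weighted_inner (\<lambda>_. 1) (?force \<tau>) (w \<tau>)) = 0"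
    unfolding set_lebesgue_integral_def by (intro integral_eq_zero_AE) (auto simp: indicator_def)
  have "0 \<le> (LINT \<tau>:{0..t}|lborel. weighted_energy (\<lambda>\<xi>. 1 * diss_symbol \<alpha> \<xi>) (w \<tau>))"
    unfolding set_lebesgue_integral_def
      by (intro integral_nonneg_AE) (auto intro!: mult_nonneg_nonneg weighted_energy_nonneg)
  then have "(L2norm (w t))\<^sup>2 \<le> (L2norm (w 0))\<^sup>2"
    using ball_energy_identity(3)[where m="\<lambda>_. 1" and B=1 and t=t] t unfolding work weighted_energy_1 by simp
  then have "L2norm (w t) \<le> L2norm (w 0)" by (rule power2_le_imp_le) simp
  also have "L2norm (w 0) \<le> 1 * L2norm w0"
  proof (rule L2c_mono(2)[OF w0 y_measurable])
    have "w 0 \<xi> = (if norm \<xi> \<le> n then w0 \<xi> else 0)" for \<xi>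
      unfolding w_eq[OF order_refl] by (rule ball_duhamel_0) (rule retracted_advection_continuous[OF M w(2)])
    then show "AE \<xi> in lborel. cmod (w 0 \<xi>) \<le> 1 * cmod (w0 \<xi>)" by simp
  qed simp
  finally show ?thesis by simp
qed

locale galerkin_solution =
  fixes \<alpha> n :: real and w0 :: "pt \<Rightarrow> complex" and w :: "real \<Rightarrow> pt \<Rightarrow> complex"
  assumes \<alpha>_pos: "0 < \<alpha>" and n_pos: "0 < n" and w0_L2c: "L2c w0"
    and jointly_borel_w: "jointly_borel w" and w_L2_continuous: "L2_continuous w" and w_hermitian: "0
        \<le> t \<Longrightarrow> hermitian (w t)"
    and L2norm_w_le: "0 \<le> t \<Longrightarrow> L2norm (w t) \<le> L2norm w0"
    and w_eq: "0 \<le> t \<Longrightarrow> w t \<xi> = ball_duhamel (diss_symbol \<alpha>) w0 n (\<lambda>\<tau>. advection (w \<tau>) (w \<tau>)) t \<xi>"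

theorem galerkin_solution_exists:
  assumes \<alpha>: "0 < \<alpha>" and n: "0 < n" and w0: "L2c w0" "hermitian w0"
  shows "\<exists>w. galerkin_solution \<alpha> n w0 w"
proof -
  define M where "M = L2norm w0 + 1"
  have M: "0 < M" by (simp add: M_def add_nonneg_pos)
  obtain w where w: "jointly_borel w" "L2_continuous w" "\<And>t. 0 \<le> t \<Longrightarrow> hermitian (w t)"
    "\<And>t \<xi>. 0 \<le> t \<Longrightarrow> w t \<xi> = ball_duhamel (diss_symbol \<alpha>) w0 n (\<lambda>\<tau>. retracted_advection M (w \<tau>)) t \<xi>"
    by (rule retracted_solution_exists[OF M n w0, where \<alpha>=\<alpha>]) (rule that)
  have L2norm_le: "L2norm (w t) \<le> L2norm w0" if "0 \<le> t" for t
    by (rule retracted_solution_L2norm_le[OF M n \<alpha> w0(1) w that])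
  have "retracted_advection M (w t) \<xi> = advection (w t) (w t) \<xi>" if "0 \<le> t" for t \<xi>
  proof -
    have "retraction_factor M (w t) = 1" using L2norm_le[OF that] M unfolding retraction_factor_def M_def by simp
    then show ?thesis by (simp add: retracted_advection_def)
  qed
  then have "ball_duhamel (diss_symbol \<alpha>) w0 n (\<lambda>\<tau>. retracted_advection M (w \<tau>)) t \<xi>
      = ball_duhamel (diss_symbol \<alpha>) w0 n (\<lambda>\<tau>. advection (w \<tau>) (w \<tau>)) t \<xi>" for t \<xi>
    unfolding ball_duhamel_def duhamel_def
      by (intro if_cong refl arg_cong2[where f="(-)"] set_lebesgue_integral_cong) auto
  then have "galerkin_solution \<alpha> n w0 w"
    using \<alpha> n w0 w L2norm_le by unfold_locales auto
  then show ?thesis by blast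
qed

context galerkin_solution
begin

lemma w_L2c: "0 \<le> t \<Longrightarrow> L2c (w t)"
  by (rule L2_continuous_L2c[OF w_L2_continuous])

definition force :: "real \<Rightarrow> pt \<Rightarrow> complex" where
  "force t \<xi> = (if norm \<xi> \<le> n then advection (w t) (w t) \<xi> else 0)"

lemma advection_w_continuous: "continuous_on {0..} (\<lambda>t. advection (w t) (w t) \<xi>)"
  by (rule advection_continuous[OF w_L2_continuous])

sublocale ball_damped_evolution w force "diss_symbol \<alpha>" n "n * (L2norm w0)\<^sup>2" "n powr (2 * \<alpha>)"
  unfolding force_def[abs_def]
proof (rule ball_duhamel_evolution[OF w_eq jointly_borel_w w0_L2c])
  fix t :: real and \<xi> :: pt assume t: "0 \<le> t" and \<xi>: "norm \<xi> \<le> n"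
  have "cmod (advection (w t) (w t) \<xi>) \<le> norm \<xi> * L2norm (w t) * L2norm (w t)" by (intro advection_bound w_L2c t)
  also have "\<dots> \<le> n * L2norm w0 * L2norm w0" using L2norm_w_le[OF t] \<xi> n_pos by (intro mult_mono) auto
  finally show "cmod (advection (w t) (w t) \<xi>) \<le> n * (L2norm w0)\<^sup>2" by (simp add: power2_eq_square mult.assoc)
qed (use n_pos \<alpha>_pos diss_symbol_le jointly_borel_advection[OF jointly_borel_w] advection_w_continuous in auto)

lemma w_0: "w 0 \<xi> = (if norm \<xi> \<le> n then w0 \<xi> else 0)"
  unfolding w_eq[OF order_refl] by (rule ball_duhamel_0) (rule advection_w_continuous)

lemma w_weighted_L2c: "0 \<le> t \<Longrightarrow> 0 \<le> r \<Longrightarrow> L2c (weighted r (w t))"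
  using L2c_weighted_bounded_support(1)[OF w_L2c y_support] by blast

lemma weighted_inner_force: "0 \<le> t \<Longrightarrow> weighted_inner m (force t) (w t) = weighted_inner m (advection (w t) (w t)) (w t)"
  unfolding force_def[abs_def] by (rule weighted_inner_restrict[OF y_support])

lemma galerkin_energy:
  assumes m: "m \<in> borel_measurable borel" "\<And>\<xi>. norm \<xi> \<le> n \<Longrightarrow> \<bar>m \<xi>\<bar> \<le> B" "0 \<le> B" and t: "0 \<le> t"
  shows "set_integrable lborel {0..t} (\<lambda>\<tau>. weighted_energy (\<lambda>\<xi>. m \<xi> * diss_symbol \<alpha> \<xi>) (w \<tau>))"
    and "set_integrable lborel {0..t} (\<lambda>\<tau>. weighted_inner m (advection (w \<tau>) (w \<tau>)) (w \<tau>))"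
    and "weighted_energy m (w t)
        = weighted_energy m (w 0) - 2 * (LINT \<tau>:{0..t}|lborel. weighted_energy (\<lambda>\<xi>. m \<xi> * diss_symbol \<alpha> \<xi>) (w \<tau>))
       - 2 * (LINT \<tau>:{0..t}|lborel. weighted_inner m (advection (w \<tau>) (w \<tau>)) (w \<tau>))"
proof -
  have "set_integrable lborel {0..t} (\<lambda>\<tau>. weighted_inner m (force \<tau>) (w \<tau>))
      \<longleftrightarrow> set_integrable lborel {0..t} (\<lambda>\<tau>. weighted_inner m (advection (w \<tau>) (w \<tau>)) (w \<tau>))"
    by (rule set_integrable_cong) (auto simp: weighted_inner_force)
  moreover have "(LINT \<tau>:{0..t}|lborel. weighted_inner m (force \<tau>) (w \<tau>))
      = (LINT \<tau>:{0..t}|lborel. weighted_inner m (advection (w \<tau>) (w \<tau>)) (w \<tau>))"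
    by (rule set_lebesgue_integral_cong) (auto simp: weighted_inner_force)
  moreover note ball_energy_identity[OF m t]
  ultimately show "set_integrable lborel {0..t} (\<lambda>\<tau>. weighted_energy (\<lambda>\<xi>. m \<xi> * diss_symbol \<alpha> \<xi>) (w \<tau>))"
    "set_integrable lborel {0..t} (\<lambda>\<tau>. weighted_inner m (advection (w \<tau>) (w \<tau>)) (w \<tau>))"
    "weighted_energy m (w t) = weighted_energy m (w 0) - 2 * (LINT \<tau>:{0..t}|lborel. weighted_energy (\<lambda>\<xi>. m \<xi> * diss_symbol \<alpha> \<xi>) (w \<tau>))
       - 2 * (LINT \<tau>:{0..t}|lborel. weighted_inner m (advection (w \<tau>) (w \<tau>)) (w \<tau>))" by simp_all
qed

lemma L2_energy:
  assumes t: "0 \<le> t"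
  shows "set_integrable lborel {0..t} (\<lambda>\<tau>. (hnorm \<alpha> (w \<tau>))\<^sup>2)"
    and "(L2norm (w t))\<^sup>2 + 2 * (LINT \<tau>:{0..t}|lborel. (hnorm \<alpha> (w \<tau>))\<^sup>2) \<le> (L2norm w0)\<^sup>2"
proof -
  note energy = galerkin_energy[of "\<lambda>_. 1" 1, OF _ _ _ t, unfolded mult_1 weighted_energy_1 weighted_energy_diss_symbol]
  show "set_integrable lborel {0..t} (\<lambda>\<tau>. (hnorm \<alpha> (w \<tau>))\<^sup>2)" by (rule energy(1)) auto
  have "(LINT \<tau>:{0..t}|lborel. weighted_inner (\<lambda>_. 1) (advection (w \<tau>) (w \<tau>)) (w \<tau>)) = 0"
    unfolding set_lebesgue_integral_def
    using advection_cancellation(1)[OF w_L2c w_L2c y_support y_support w_hermitian]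
      by (intro integral_eq_zero_AE) (auto simp: indicator_def)
  then have "(L2norm (w t))\<^sup>2 = (L2norm (w 0))\<^sup>2 - 2 * (LINT \<tau>:{0..t}|lborel. (hnorm \<alpha> (w \<tau>))\<^sup>2)"
    using energy(3) by simp
  moreover have "(L2norm (w 0))\<^sup>2 \<le> (L2norm w0)\<^sup>2" using L2norm_w_le[OF order_refl] by (intro power_mono) auto
  ultimately show "(L2norm (w t))\<^sup>2 + 2 * (LINT \<tau>:{0..t}|lborel. (hnorm \<alpha> (w \<tau>))\<^sup>2) \<le> (L2norm w0)\<^sup>2" by linarith
qed

lemma hnorm_0_le: "L2c (weighted r w0) \<Longrightarrow> hnorm r (w 0) \<le> hnorm r w0"
  using L2c_mono(2)[of "weighted r w0" "weighted r (w 0)" 1] by (simp add: weighted_measurable cmod_weighted w_0)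

lemma hnorm_continuous:
  assumes r: "0 \<le> r" shows "continuous_on {0..} (\<lambda>t. hnorm r (w t))"
proof (rule L2_continuous_L2norm, unfold L2_continuous_def, intro conjI allI impI)
  fix t :: real assume t: "0 \<le> t"
  show "L2c (weighted r (w t))" by (rule w_weighted_L2c[OF t r])
  have "L2norm (\<lambda>\<xi>. weighted r (w \<tau>) \<xi> - weighted r (w t) \<xi>) \<le> n powr r * L2norm (\<lambda>\<xi>. w \<tau> \<xi> - w t \<xi>)" if "0 \<le> \<tau>" for \<tau>
    unfolding weighted_diff[symmetric]
    by (rule L2c_weighted_bounded_support(2)) (use w_L2c y_support that t r in auto)
  then have "\<forall>\<^sub>F \<tau> in at t within {0..}. norm (L2norm (\<lambda>\<xi>. weighted r (w \<tau>) \<xi> - weighted r (w t) \<xi>))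
      \<le> n powr r * L2norm (\<lambda>\<xi>. w \<tau> \<xi> - w t \<xi>)"
    unfolding eventually_at_filter by (intro always_eventually) simp
  then show "((\<lambda>\<tau>. L2norm (\<lambda>\<xi>. weighted r (w \<tau>) \<xi> - weighted r (w t) \<xi>)) \<longlongrightarrow> 0) (at t within {0..})"
    by (rule Lim_null_comparison) (rule tendsto_mult_right_zero[OF L2_continuousD[OF w_L2_continuous t]])
qed

end

section \<open>A priori estimates\<close>

lemma continuity_bootstrap:
  fixes Y :: "real \<Rightarrow> real"
  assumes Y: "continuous_on {0..} Y" and below: "Y 0 < K"
    and step: "\<And>t. 0 \<le> t \<Longrightarrow> (\<And>\<tau>. \<tau> \<in> {0..t} \<Longrightarrow> Y \<tau> \<le> K) \<Longrightarrow> Y t \<le> Y 0"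
    and t: "0 \<le> t"
  shows "Y t \<le> Y 0"
proof (rule step[OF t], rule ccontr)
  fix b assume "b \<in> {0..t}" and "\<not> Y b \<le> K"
  then have above: "K \<le> Y b" and b_nonneg: "0 \<le> b" by auto
  have Y_on: "continuous_on {0..x} Y" for x by (rule continuous_on_subset[OF Y]) auto
  define S where "S = {\<tau> \<in> {0..b}. Y \<tau> = K}"
  have "closed S" unfolding S_def by (rule continuous_closed_preimage_constant[OF Y_on]) simp
  then have "compact S" unfolding compact_eq_bounded_closed
    by (auto simp: S_def intro: bounded_subset[of "{0..b}"])
  moreover have "S \<noteq> {}" using IVT'[OF less_imp_le[OF below] above b_nonneg Y_on] by (auto simp: S_def)
  ultimately obtain z where z: "z \<in> S" "\<And>y. y \<in> S \<Longrightarrow> z \<le> y" using compact_attains_inf[of S] by auto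
  have "Y \<tau> \<le> K" if \<tau>: "\<tau> \<in> {0..z}" for \<tau>
  proof (rule ccontr)
    assume "\<not> Y \<tau> \<le> K"
    then have exceeds: "K \<le> Y \<tau>" "Y \<tau> \<noteq> K" by auto
    have \<tau>_nonneg: "0 \<le> \<tau>" using \<tau> by simp
    obtain x where x: "0 \<le> x" "x \<le> \<tau>" "Y x = K" using IVT'[OF less_imp_le[OF below] exceeds(1) \<tau>_nonneg Y_on] by auto
    then have "x \<in> S" using z(1) \<tau> by (auto simp: S_def)
    with z(2) have "z \<le> x" by blast
    with x \<tau> have "x = \<tau>" by auto
    with x exceeds show False by simp
  qed
  then have "Y z \<le> Y 0" using z(1) by (intro step) (auto simp: S_def)
  with z(1) below show False by (auto simp: S_def)
qed

definition (in sqg_exponents) smallness_const :: real where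
  "smallness_const = 1 + commutator_const + gradient_const"

lemma (in sqg_exponents) smallness_const_pos: "0 < smallness_const"
  unfolding smallness_const_def using commutator_const_nonneg gradient_const_nonneg by linarith

locale small_galerkin_solution = sqg_exponents \<alpha> s + galerkin_solution \<alpha> n w0 w
  for \<alpha> s n :: real and w0 :: "pt \<Rightarrow> complex" and w :: "real \<Rightarrow> pt \<Rightarrow> complex" +
  assumes w0_weighted_L2c: "L2c (weighted s w0)" and small: "smallness_const * hnorm s w0 < 1"
begin

lemma weighted_energy_cutoff:
  assumes t: "0 \<le> t"
  shows "weighted_energy (cutoff_weight s n) (w t) = (hnorm s (w t))\<^sup>2"
    and "weighted_energy (\<lambda>\<xi>. cutoff_weight s n \<xi> * diss_symbol \<alpha> \<xi>) (w t) = (hnorm (s + \<alpha>) (w t))\<^sup>2"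
proof -
  have energy: "cutoff_weight s n \<xi> * (cmod (w t \<xi>))\<^sup>2 = norm \<xi> powr (2 * s) * (cmod (w t \<xi>))\<^sup>2" for \<xi>
    using y_support[OF t, of \<xi>] by (cases "norm \<xi> \<le> n") (auto simp: cutoff_weight_eq)
  show "weighted_energy (cutoff_weight s n) (w t) = (hnorm s (w t))\<^sup>2"
    unfolding weighted_energy_powr[symmetric] weighted_energy_def energy ..
  have "norm \<xi> powr (2 * (s + \<alpha>)) = norm \<xi> powr (2 * s) * diss_symbol \<alpha> \<xi>" for \<xi>
    unfolding diss_symbol_def powr_add[symmetric] by (simp add: distrib_left)
  then have "cutoff_weight s n \<xi> * diss_symbol \<alpha> \<xi> * (cmod (w t \<xi>))\<^sup>2
      = norm \<xi> powr (2 * (s + \<alpha>)) * (cmod (w t \<xi>))\<^sup>2" for \<xi>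
    using energy[of \<xi>] by (simp add: mult_ac)
  then show "weighted_energy (\<lambda>\<xi>. cutoff_weight s n \<xi> * diss_symbol \<alpha> \<xi>) (w t) = (hnorm (s + \<alpha>) (w t))\<^sup>2"
    unfolding weighted_energy_powr[symmetric] weighted_energy_def by (simp only:)
qed

lemma commutator_pairing_le:
  assumes t: "0 \<le> t"
  shows "\<bar>2 * weighted_inner (cutoff_weight s n) (advection (w t) (w t)) (w t)\<bar>
      \<le> commutator_const * hnorm s (w t) * (hnorm (s + \<alpha>) (w t))\<^sup>2"
proof (rule commutator_pairing)
  show "sqg_form (w t) (w t) (w t) < \<infinity>"
    by (rule sqg_form_bounded_support_finite[where n=n]) (use w_L2c[OF t] y_support[OF t] in auto)
qed (use w_hermitian[OF t] w_weighted_L2c[OF t] s_bounds \<alpha>_pos n_pos in auto)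

lemma Hs_energy:
  assumes t: "0 \<le> t"
  shows "set_integrable lborel {0..t} (\<lambda>\<tau>. (hnorm (s + \<alpha>) (w \<tau>))\<^sup>2)"
    and "set_integrable lborel {0..t} (\<lambda>\<tau>. weighted_inner (cutoff_weight s n) (advection (w \<tau>) (w \<tau>)) (w \<tau>))"
    and "(hnorm s (w t))\<^sup>2 = (hnorm s (w 0))\<^sup>2 - 2 * (LINT \<tau>:{0..t}|lborel. (hnorm (s + \<alpha>) (w \<tau>))\<^sup>2)
       - 2 * (LINT \<tau>:{0..t}|lborel. weighted_inner (cutoff_weight s n) (advection (w \<tau>) (w \<tau>)) (w \<tau>))"
proof -
  have "\<bar>cutoff_weight s n \<xi>\<bar> \<le> n powr (2 * s)" for \<xi> using cutoff_weight_le_radius[of s n \<xi>] s_bounds n_pos by simp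
  note energy = galerkin_energy[OF cutoff_weight_measurable this powr_ge_zero t]
  have "set_integrable lborel {0..t} (\<lambda>\<tau>. weighted_energy (\<lambda>\<xi>. cutoff_weight s n \<xi> * diss_symbol \<alpha> \<xi>) (w \<tau>))
      \<longleftrightarrow> set_integrable lborel {0..t} (\<lambda>\<tau>. (hnorm (s + \<alpha>) (w \<tau>))\<^sup>2)"
    by (rule set_integrable_cong) (auto simp: weighted_energy_cutoff)
  then show "set_integrable lborel {0..t} (\<lambda>\<tau>. (hnorm (s + \<alpha>) (w \<tau>))\<^sup>2)" using energy(1) by blast
  show "set_integrable lborel {0..t} (\<lambda>\<tau>. weighted_inner (cutoff_weight s n) (advection (w \<tau>) (w \<tau>)) (w \<tau>))"
    by (rule energy(2))
  have "(LINT \<tau>:{0..t}|lborel. weighted_energy (\<lambda>\<xi>. cutoff_weight s n \<xi> * diss_symbol \<alpha> \<xi>) (w \<tau>))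
      = (LINT \<tau>:{0..t}|lborel. (hnorm (s + \<alpha>) (w \<tau>))\<^sup>2)"
    by (rule set_lebesgue_integral_cong) (auto simp: weighted_energy_cutoff)
  then show "(hnorm s (w t))\<^sup>2 = (hnorm s (w 0))\<^sup>2 - 2 * (LINT \<tau>:{0..t}|lborel. (hnorm (s + \<alpha>) (w \<tau>))\<^sup>2)
       - 2 * (LINT \<tau>:{0..t}|lborel. weighted_inner (cutoff_weight s n) (advection (w \<tau>) (w \<tau>)) (w \<tau>))"
    using energy(3) t by (simp add: weighted_energy_cutoff)
qed

lemma Hs_energy_decreases:
  assumes t: "0 \<le> t" and small: "\<And>\<tau>. \<tau> \<in> {0..t} \<Longrightarrow> commutator_const * hnorm s (w \<tau>) \<le> 1"
  shows "(hnorm s (w t))\<^sup>2 + (LINT \<tau>:{0..t}|lborel. (hnorm (s + \<alpha>) (w \<tau>))\<^sup>2) \<le> (hnorm s (w 0))\<^sup>2"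
proof -
  let ?D = "\<lambda>\<tau>. (hnorm (s + \<alpha>) (w \<tau>))\<^sup>2" and ?G = "\<lambda>\<tau>. weighted_inner (cutoff_weight s n) (advection (w \<tau>) (w \<tau>)) (w \<tau>)"
  have "(LINT \<tau>:{0..t}|lborel. (- 1) * ?D \<tau>) \<le> (LINT \<tau>:{0..t}|lborel. 2 * ?G \<tau>)"
  proof (rule set_integral_mono)
    show "set_integrable lborel {0..t} (\<lambda>\<tau>. (- 1) * ?D \<tau>)" "set_integrable lborel {0..t} (\<lambda>\<tau>. 2 * ?G \<tau>)"
      by (intro set_integrable_mult_right Hs_energy t)+
    fix \<tau> assume \<tau>: "\<tau> \<in> {0..t}"
    have "commutator_const * hnorm s (w \<tau>) * ?D \<tau> \<le> 1 * ?D \<tau>" by (intro mult_right_mono small[OF \<tau>]) simp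
    then show "(- 1) * ?D \<tau> \<le> 2 * ?G \<tau>" using commutator_pairing_le[of \<tau>] \<tau> by auto
  qed
  then show ?thesis using Hs_energy(3)[OF t] unfolding set_integral_mult_right by linarith
qed

lemma hnorm_le_initial:
  assumes t: "0 \<le> t" shows "hnorm s (w t) \<le> hnorm s (w 0)"
proof (rule continuity_bootstrap[OF hnorm_continuous _ _ t])
  have commutator_const_le: "commutator_const \<le> smallness_const"
    using gradient_const_nonneg unfolding smallness_const_def by linarith
  have "smallness_const * hnorm s (w 0) \<le> smallness_const * hnorm s w0"
    using smallness_const_pos by (intro mult_left_mono hnorm_0_le w0_weighted_L2c) simp
  from le_less_trans[OF this small] show "hnorm s (w 0) < 1 / smallness_const"
    using smallness_const_pos by (simp add: pos_less_divide_eq mult.commute)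
  fix t :: real assume t: "0 \<le> t" and bound: "\<And>\<tau>. \<tau> \<in> {0..t} \<Longrightarrow> hnorm s (w \<tau>) \<le> 1 / smallness_const"
  have "commutator_const * hnorm s (w \<tau>) \<le> 1" if "\<tau> \<in> {0..t}" for \<tau>
    using mult_right_mono[OF commutator_const_le, of "hnorm s (w \<tau>)"] bound[OF that] smallness_const_pos by (simp add: pos_le_divide_eq mult.commute)
  note decreases = Hs_energy_decreases[OF t this]
  have "0 \<le> (LINT \<tau>:{0..t}|lborel. (hnorm (s + \<alpha>) (w \<tau>))\<^sup>2)"
    unfolding set_lebesgue_integral_def by (intro integral_nonneg_AE) auto
  with decreases have "(hnorm s (w t))\<^sup>2 \<le> (hnorm s (w 0))\<^sup>2" by linarith
  then show "hnorm s (w t) \<le> hnorm s (w 0)" by (rule power2_le_imp_le) simp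
qed (use s_bounds in simp)

lemma hnorm_small:
  assumes "0 \<le> t" shows "commutator_const * hnorm s (w t) \<le> 1" "gradient_const * hnorm s (w t) \<le> 1"
proof -
  have "hnorm s (w t) \<le> hnorm s w0"
    using hnorm_le_initial[OF assms] hnorm_0_le[OF w0_weighted_L2c] by (rule order_trans)
  then have "smallness_const * hnorm s (w t) \<le> smallness_const * hnorm s w0"
    using commutator_const_nonneg gradient_const_nonneg by (intro mult_left_mono) (auto simp: smallness_const_def)
  moreover have "commutator_const * hnorm s (w t)
      \<le> smallness_const * hnorm s (w t)" "gradient_const * hnorm s (w t) \<le> smallness_const * hnorm s (w t)"
    using commutator_const_nonneg gradient_const_nonneg by (auto intro!: mult_right_mono simp: smallness_const_def)
  ultimately show "commutator_const * hnorm s (w t) \<le> 1" "gradient_const * hnorm s (w t) \<le> 1" using small by linarith+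
qed

theorem Hs_energy_le:
  assumes "0 \<le> t"
  shows "(hnorm s (w t))\<^sup>2 + (LINT \<tau>:{0..t}|lborel. (hnorm (s + \<alpha>) (w \<tau>))\<^sup>2) \<le> (hnorm s w0)\<^sup>2"
proof -
  have "(hnorm s (w 0))\<^sup>2 \<le> (hnorm s w0)\<^sup>2" by (intro power_mono hnorm_0_le w0_weighted_L2c) simp
  moreover have "(hnorm s (w t))\<^sup>2 + (LINT \<tau>:{0..t}|lborel. (hnorm (s + \<alpha>) (w \<tau>))\<^sup>2) \<le> (hnorm s (w 0))\<^sup>2"
    by (rule Hs_energy_decreases[OF assms hnorm_small(1)]) simp
  ultimately show ?thesis by linarith
qed

end

section \<open>Stability of truncated solutions\<close>

lemma high_frequency_gain:
  fixes n x \<sigma> :: real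
  assumes "0 < n" "0 \<le> \<sigma>" "n \<le> x" shows "1 \<le> n powr (- \<sigma>) * x powr \<sigma>"
proof -
  have "n powr \<sigma> \<le> x powr \<sigma>" using assms by (intro powr_mono2) auto
  then show ?thesis using assms by (simp add: powr_minus field_simps)
qed

locale galerkin_pair = sqg_exponents \<alpha> s + w: small_galerkin_solution \<alpha> s n w0 w + v: small_galerkin_solution \<alpha> s m w0 v
  for \<alpha> s n m :: real and w0 :: "pt \<Rightarrow> complex" and w v :: "real \<Rightarrow> pt \<Rightarrow> complex" +
  assumes n_ge_1: "1 \<le> n" and n_le_m: "n \<le> m"
begin

abbreviation difference :: "real \<Rightarrow> pt \<Rightarrow> complex" where
  "difference t \<xi> \<equiv> w t \<xi> - v t \<xi>"

sublocale difference: ball_damped_evolution difference "\<lambda>t \<xi>. w.force t \<xi> - v.force t \<xi>" "diss_symbol \<alpha>" m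
    "n * (L2norm w0)\<^sup>2 + m * (L2norm w0)\<^sup>2" "m powr (2 * \<alpha>)"
  by (rule ball_damped_evolution_diff[OF w.ball_damped_evolution_axioms v.ball_damped_evolution_axioms n_le_m])

lemma difference_L2c: "0 \<le> t \<Longrightarrow> L2c (difference t)"
  by (intro L2c_diff w.w_L2c v.w_L2c)

definition tail :: "real \<Rightarrow> pt \<Rightarrow> complex" where
  "tail t \<xi> = (if n < norm \<xi> then v t \<xi> else 0)"

lemma tail_measurable [measurable]: "tail t \<in> borel_measurable borel"
  unfolding tail_def[abs_def] by measurable

lemma tail_hnorm_le:
  assumes t: "0 \<le> t"
  shows "L2c (weighted \<alpha> (tail t))" "hnorm \<alpha> (tail t) \<le> n powr (- s) * hnorm (s + \<alpha>) (v t)"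
proof -
  have "cmod (weighted \<alpha> (tail t) \<xi>) \<le> n powr (- s) * cmod (weighted (s + \<alpha>) (v t) \<xi>)" for \<xi>
  proof (cases "n < norm \<xi>")
    case True
    then have "1 * (norm \<xi> powr \<alpha> * cmod (v t \<xi>)) \<le> (n powr (- s) * norm \<xi> powr s) * (norm \<xi> powr \<alpha> * cmod (v t \<xi>))"
      using n_ge_1 s_bounds by (intro mult_right_mono high_frequency_gain) auto
    then show ?thesis using True by (simp add: cmod_weighted tail_def powr_add mult_ac)
  qed (simp add: cmod_weighted tail_def)
  then have "AE \<xi> in lborel. cmod (weighted \<alpha> (tail t) \<xi>) \<le> n powr (- s) * cmod (weighted (s + \<alpha>) (v t) \<xi>)" by simp
  moreover have "L2c (weighted (s + \<alpha>) (v t))" using v.w_weighted_L2c[OF t] s_bounds \<alpha>_pos by simp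
  ultimately show "L2c (weighted \<alpha> (tail t))" "hnorm \<alpha> (tail t) \<le> n powr (- s) * hnorm (s + \<alpha>) (v t)"
    using L2c_mono[OF _ weighted_measurable[OF tail_measurable]] by auto
qed

lemma force_difference_mult_cnj:
  assumes t: "0 \<le> t"
  shows "(w.force t \<xi> - v.force t \<xi>) * cnj (difference t \<xi>) = advection (difference t) (w t) \<xi> * cnj (difference t \<xi>)
    + advection (v t) (difference t) \<xi> * cnj (difference t \<xi>) + advection (w t) (w t) \<xi> * cnj (tail t \<xi>)"
proof -
  consider (inner) "norm \<xi> \<le> n" | (shell) "n < norm \<xi>" "norm \<xi> \<le> m" | (outer) "n < norm \<xi>" "m < norm \<xi>" by linarith
  then have "(w.force t \<xi> - v.force t \<xi>) * cnj (difference t \<xi>)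
      = (advection (w t) (w t) \<xi> - advection (v t) (v t) \<xi>) * cnj (difference t \<xi>) + advection (w t) (w t) \<xi> * cnj (tail t \<xi>)"
  proof cases
    case inner
    then show ?thesis using n_le_m by (simp add: w.force_def v.force_def tail_def)
  next
    case shell
    then show ?thesis using w.y_support[OF t shell(1)] by (simp add: w.force_def v.force_def tail_def algebra_simps)
  next
    case outer
    then show ?thesis using w.y_support[OF t outer(1)] v.y_support[OF t outer(2)]
      by (simp add: w.force_def v.force_def tail_def)
  qed
  then show ?thesis unfolding advection_self_diff[OF w.w_L2c[OF t] v.w_L2c[OF t]] distrib_right .
qed

lemma weighted_inner_force_difference:
  assumes t: "0 \<le> t"
  shows "\<bar>weighted_inner (\<lambda>_. 1) (\<lambda>\<xi>. w.force t \<xi> - v.force t \<xi>) (difference t)\<bar>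
    \<le> gradient_const * hnorm \<alpha> (difference t) * hnorm s (w t) * hnorm \<alpha> (difference t)
      + gradient_const * hnorm \<alpha> (w t) * hnorm s (w t) * hnorm \<alpha> (tail t)"
proof -
  let ?\<delta> = "difference t"
  have L2c: "L2c (weighted \<alpha> ?\<delta>)" "L2c (weighted \<alpha> (w t))" "L2c (weighted s (w t))"
    using L2c_weighted_bounded_support(1)[OF difference_L2c[OF t] difference.y_support[OF t]] w.w_weighted_L2c[OF t] s_bounds \<alpha>_pos
      by auto
  note low = advection_inner_bound[OF difference.y_measurable w.y_measurable difference.y_measurable sqg_form_estimate[OF L2c(1,3,1)]]
  note high = advection_inner_bound[OF w.y_measurable w.y_measurable tail_measurable sqg_form_estimate[OF L2c(2,3) tail_hnorm_le(1)[OF t]]]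
  note cancel = advection_cancellation[OF v.w_L2c[OF t] difference_L2c[OF t] v.y_support[OF t] difference.y_support[OF t] v.w_hermitian[OF t]]
  have "weighted_inner (\<lambda>_. 1) (\<lambda>\<xi>. w.force t \<xi> - v.force t \<xi>) ?\<delta>
      = weighted_inner (\<lambda>_. 1) (advection ?\<delta> (w t)) ?\<delta> + weighted_inner (\<lambda>_. 1) (advection (v t) ?\<delta>) ?\<delta> + weighted_inner (\<lambda>_. 1) (advection (w t) (w t)) (tail t)"
    unfolding weighted_inner_def mult_1 force_difference_mult_cnj[OF t] plus_complex.sel
    using low(1) high(1) cancel(2) by (simp del: times_complex.sel)
  then show ?thesis using low(2) high(2) cancel(1) by simp
qed

definition production :: "real \<Rightarrow> real" where
  "production t = (hnorm \<alpha> (w t))\<^sup>2 + (hnorm (s + \<alpha>) (v t))\<^sup>2"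

lemma force_difference_work_ge:
  assumes t: "0 \<le> t"
  shows "- ((hnorm \<alpha> (difference t))\<^sup>2 + n powr (- s) / 2 * production t)
    \<le> weighted_inner (\<lambda>_. 1) (\<lambda>\<xi>. w.force t \<xi> - v.force t \<xi>) (difference t)"
proof -
  let ?c = "gradient_const * hnorm s (w t)"
  have "?c * (hnorm \<alpha> (difference t))\<^sup>2 \<le> 1 * (hnorm \<alpha> (difference t))\<^sup>2"
    by (intro mult_right_mono w.hnorm_small(2) t) simp
  moreover have "?c * (hnorm \<alpha> (w t) * hnorm \<alpha> (tail t)) \<le> n powr (- s) / 2 * production t"
  proof -
    have "?c * (hnorm \<alpha> (w t) * hnorm \<alpha> (tail t)) \<le> 1 * (hnorm \<alpha> (w t) * (n powr (- s) * hnorm (s + \<alpha>) (v t)))"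
      using gradient_const_nonneg by (intro mult_mono w.hnorm_small(2) tail_hnorm_le(2) t) auto
    also have "\<dots> = n powr (- s) * (hnorm \<alpha> (w t) * hnorm (s + \<alpha>) (v t))" by simp
    also have "\<dots> \<le> n powr (- s) * (production t / 2)"
      using sum_squares_bound[of "hnorm \<alpha> (w t)" "hnorm (s + \<alpha>) (v t)"] by (intro mult_left_mono) (auto simp: production_def)
    finally show ?thesis by simp
  qed
  ultimately show ?thesis
    using weighted_inner_force_difference[OF t] by (simp add: power2_eq_square mult_ac)
qed

lemma production_integral:
  assumes t: "0 \<le> t"
  shows "set_integrable lborel {0..t} production"
    "(LINT \<tau>:{0..t}|lborel. production \<tau>) \<le> (L2norm w0)\<^sup>2 + (hnorm s w0)\<^sup>2"
proof -
  note int = w.L2_energy(1)[OF t] v.Hs_energy(1)[OF t]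
  show "set_integrable lborel {0..t} production"
    using set_integral_add(1)[OF int] by (simp add: production_def[abs_def])
  have "(LINT \<tau>:{0..t}|lborel. production \<tau>)
      = (LINT \<tau>:{0..t}|lborel. (hnorm \<alpha> (w \<tau>))\<^sup>2) + (LINT \<tau>:{0..t}|lborel. (hnorm (s + \<alpha>) (v \<tau>))\<^sup>2)"
    unfolding production_def by (rule set_integral_add(2)[OF int])
  moreover have "0 \<le> (LINT \<tau>:{0..t}|lborel. (hnorm \<alpha> (w \<tau>))\<^sup>2)"
    unfolding set_lebesgue_integral_def by (intro integral_nonneg_AE) auto
  ultimately show "(LINT \<tau>:{0..t}|lborel. production \<tau>) \<le> (L2norm w0)\<^sup>2 + (hnorm s w0)\<^sup>2"
    using w.L2_energy(2)[OF t] v.Hs_energy_le[OF t] zero_le_power2[of "L2norm (w t)"] zero_le_power2[of "hnorm s (v t)"] by linarith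
qed

lemma initial_difference_L2norm_le: "(L2norm (difference 0))\<^sup>2 \<le> n powr (- s) * (hnorm s w0)\<^sup>2"
proof -
  have "cmod (difference 0 \<xi>) \<le> n powr (- s) * cmod (weighted s w0 \<xi>)" for \<xi>
  proof (cases "n < norm \<xi>")
    case True
    have "1 * cmod (w0 \<xi>) \<le> (n powr (- s) * norm \<xi> powr s) * cmod (w0 \<xi>)"
      using True n_ge_1 s_bounds by (intro mult_right_mono high_frequency_gain) auto
    moreover have "cmod (difference 0 \<xi>) \<le> cmod (w0 \<xi>)" using True by (simp add: w.w_0 v.w_0)
    ultimately show ?thesis by (simp add: cmod_weighted mult.assoc)
  next
    case False
    then show ?thesis using n_le_m by (simp add: w.w_0 v.w_0)
  qed
  then have "L2norm (difference 0) \<le> n powr (- s) * hnorm s w0"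
    by (intro L2c_mono(2)[OF w.w0_weighted_L2c difference.y_measurable]) auto
  then have "(L2norm (difference 0))\<^sup>2 \<le> (n powr (- s) * hnorm s w0)\<^sup>2" by (intro power_mono) auto
  also have "\<dots> = n powr (- s) * (n powr (- s) * (hnorm s w0)\<^sup>2)" by (simp add: power2_eq_square)
  also have "\<dots> \<le> n powr (- s) * (1 * (hnorm s w0)\<^sup>2)"
    using powr_mono[of "- s" 0 n] n_ge_1 s_bounds by (intro mult_left_mono mult_right_mono) auto
  finally show ?thesis by simp
qed

theorem difference_L2norm_le:
  assumes t: "0 \<le> t"
  shows "(L2norm (difference t))\<^sup>2 \<le> n powr (- s) * (2 * (hnorm s w0)\<^sup>2 + (L2norm w0)\<^sup>2)"
proof -
  let ?D = "\<lambda>\<tau>. (hnorm \<alpha> (difference \<tau>))\<^sup>2" and ?W = "\<lambda>\<tau>. weighted_inner (\<lambda>_. 1) (\<lambda>\<xi>. w.force \<tau> \<xi> - v.force \<tau> \<xi>) (difference \<tau>)"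
  note energy = difference.ball_energy_identity[of "\<lambda>_. 1" 1, OF _ _ _ t, unfolded mult_1 weighted_energy_1 weighted_energy_diss_symbol]
  have D: "set_integrable lborel {0..t} ?D" and W: "set_integrable lborel {0..t} ?W"
    by (rule energy(1) energy(2); simp)+
  have P: "set_integrable lborel {0..t} (\<lambda>\<tau>. n powr (- s) / 2 * production \<tau>)"
    by (rule set_integrable_mult_right) (rule production_integral(1)[OF t])
  have "(LINT \<tau>:{0..t}|lborel. (- 1) * (?D \<tau> + n powr (- s) / 2 * production \<tau>)) \<le> (LINT \<tau>:{0..t}|lborel. ?W \<tau>)"
    using force_difference_work_ge by (intro set_integral_mono set_integrable_mult_right set_integral_add(1) D P W) auto
  then have "- (LINT \<tau>:{0..t}|lborel. ?D \<tau>) - n powr (- s) / 2 * (LINT \<tau>:{0..t}|lborel. production \<tau>)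
      \<le> (LINT \<tau>:{0..t}|lborel. ?W \<tau>)"
    unfolding set_integral_mult_right set_integral_add(2)[OF D P] by simp
  moreover have "(L2norm (difference t))\<^sup>2
      = (L2norm (difference 0))\<^sup>2 - 2 * (LINT \<tau>:{0..t}|lborel. ?D \<tau>) - 2 * (LINT \<tau>:{0..t}|lborel. ?W \<tau>)"
    by (rule energy(3)) auto
  ultimately have "(L2norm (difference t))\<^sup>2
      \<le> (L2norm (difference 0))\<^sup>2 + n powr (- s) * (LINT \<tau>:{0..t}|lborel. production \<tau>)"
    by simp
  also have "\<dots> \<le> n powr (- s) * (hnorm s w0)\<^sup>2 + n powr (- s) * ((L2norm w0)\<^sup>2 + (hnorm s w0)\<^sup>2)"
    by (intro add_mono initial_difference_L2norm_le mult_left_mono production_integral(2)[OF t]) simp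
  finally show ?thesis by (simp add: algebra_simps)
qed

end

section \<open>The limit of truncated solutions\<close>

lemma nn_integral_add_weights:
  assumes [measurable]: "u \<in> borel_measurable borel" "m \<in> borel_measurable borel" "m' \<in> borel_measurable borel"
    and "\<And>\<xi>. 0 \<le> m \<xi>" "\<And>\<xi>. 0 \<le> m' \<xi>"
  shows "(\<integral>\<^sup>+\<xi>. ennreal ((m \<xi> + m' \<xi>) * (cmod (u \<xi>))\<^sup>2) \<partial>lborel)
    = (\<integral>\<^sup>+\<xi>. ennreal (m \<xi> * (cmod (u \<xi>))\<^sup>2) \<partial>lborel) + (\<integral>\<^sup>+\<xi>. ennreal (m' \<xi> * (cmod (u \<xi>))\<^sup>2) \<partial>lborel)"
proof -
  have "(\<integral>\<^sup>+\<xi>. ennreal ((m \<xi> + m' \<xi>) * (cmod (u \<xi>))\<^sup>2) \<partial>lborel)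
      = (\<integral>\<^sup>+\<xi>. ennreal (m \<xi> * (cmod (u \<xi>))\<^sup>2) + ennreal (m' \<xi> * (cmod (u \<xi>))\<^sup>2) \<partial>lborel)"
    using assms(4,5) by (intro nn_integral_cong) (simp add: distrib_right)
  also have "\<dots> = (\<integral>\<^sup>+\<xi>. ennreal (m \<xi> * (cmod (u \<xi>))\<^sup>2) \<partial>lborel) + (\<integral>\<^sup>+\<xi>. ennreal (m' \<xi> * (cmod (u \<xi>))\<^sup>2) \<partial>lborel)"
    by (rule nn_integral_add) auto
  finally show ?thesis .
qed

lemma nn_integral_powr_weight:
  "L2c (weighted r u) \<Longrightarrow> (\<integral>\<^sup>+\<xi>. ennreal (norm \<xi> powr (2 * r) * (cmod (u \<xi>))\<^sup>2) \<partial>lborel) = ennreal ((hnorm r u)\<^sup>2)"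
  using L2c_nn_integral[of "weighted r u"] unfolding cmod_weighted_square .

lemma nn_set_integral_eq:
  fixes t :: real
  assumes int: "set_integrable lborel {0..t} F" and nonneg: "\<And>\<tau>. 0 \<le> F \<tau>"
  shows "(\<integral>\<^sup>+\<tau>. indicator {0..t} \<tau> * ennreal (F \<tau>) \<partial>lborel) = ennreal (LINT \<tau>:{0..t}|lborel. F \<tau>)"
proof -
  have "(\<integral>\<^sup>+\<tau>. indicator {0..t} \<tau> * ennreal (F \<tau>) \<partial>lborel) = (\<integral>\<^sup>+\<tau>. ennreal (indicator {0..t} \<tau> *\<^sub>R F \<tau>) \<partial>lborel)"
    by (rule nn_integral_cong) (auto simp: indicator_def)
  also have "\<dots> = ennreal (LINT \<tau>:{0..t}|lborel. F \<tau>)"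
    unfolding set_lebesgue_integral_def
      using int nonneg by (intro nn_integral_eq_integral) (auto simp: set_integrable_def)
  finally show ?thesis .
qed

context sqg_exponents
begin

definition sobolev_energy :: "(pt \<Rightarrow> complex) \<Rightarrow> ennreal" where
  "sobolev_energy u = (\<integral>\<^sup>+\<xi>. ennreal ((1 + norm \<xi> powr (2 * s)) * (cmod (u \<xi>))\<^sup>2) \<partial>lborel)"

definition dissipation :: "(pt \<Rightarrow> complex) \<Rightarrow> ennreal" where
  "dissipation u = (\<integral>\<^sup>+\<xi>. ennreal ((norm \<xi> powr (2 * \<alpha>) + norm \<xi> powr (2 * (s + \<alpha>))) * (cmod (u \<xi>))\<^sup>2) \<partial>lborel)"

lemma sobolev_energy_eq:
  assumes "L2c u" "L2c (weighted s u)" shows "sobolev_energy u = ennreal ((L2norm u)\<^sup>2 + (hnorm s u)\<^sup>2)"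
  unfolding sobolev_energy_def using L2c_nn_integral[OF assms(1)] nn_integral_powr_weight[OF assms(2)]
  by (simp add: nn_integral_add_weights L2c_measurable[OF assms(1)])

lemma dissipation_eq:
  assumes "u \<in> borel_measurable borel" "L2c (weighted \<alpha> u)" "L2c (weighted (s + \<alpha>) u)"
  shows "dissipation u = ennreal ((hnorm \<alpha> u)\<^sup>2 + (hnorm (s + \<alpha>) u)\<^sup>2)"
  unfolding dissipation_def using nn_integral_powr_weight[OF assms(2)] nn_integral_powr_weight[OF assms(3)]
  by (simp add: nn_integral_add_weights assms(1))

text \<open>Integrating over \<open>{0..1}\<close> makes the energy at time \<open>t\<close> and the dissipation up to time \<open>t\<close> a single
  space-time integral, so that one application of Fatou's lemma bounds their sum.\<close>

definition energy_density :: "(real \<Rightarrow> pt \<Rightarrow> complex) \<Rightarrow> real \<Rightarrow> real \<times> pt \<Rightarrow> ennreal" where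
  "energy_density u t p = indicator {0..1} (fst p) * ennreal ((1 + norm (snd p) powr (2 * s)) * (cmod (u t (snd p)))\<^sup>2)
     + indicator {0..t} (fst p) * ennreal ((norm (snd p) powr (2 * \<alpha>) + norm (snd p) powr (2 * (s + \<alpha>))) * (cmod (u (fst p) (snd p)))\<^sup>2)"

lemma energy_density_measurable:
  assumes u: "jointly_borel u" shows "energy_density u t \<in> borel_measurable lborel2"
proof -
  note [measurable (raw)] = measurable_pair_apply[OF u]
  show ?thesis unfolding energy_density_def[abs_def] by measurable
qed

lemma dissipation_measurable: assumes u: "jointly_borel u" shows "(\<lambda>\<tau>. dissipation (u \<tau>)) \<in> borel_measurable borel"
proof -
  note [measurable (raw)] = measurable_pair_apply[OF u]
  show ?thesis unfolding dissipation_def by measurable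
qed

lemma energy_density_integral:
  assumes u: "jointly_borel u"
  shows "(\<integral>\<^sup>+p. energy_density u t p \<partial>lborel2)
      = sobolev_energy (u t) + (\<integral>\<^sup>+\<tau>. indicator {0..t} \<tau> * dissipation (u \<tau>) \<partial>lborel)"
proof -
  note [measurable (raw)] = measurable_pair_apply[OF u]
  note [measurable] = jointly_borel_slice[OF u] dissipation_measurable[OF u]
  have "(\<integral>\<^sup>+p. energy_density u t p \<partial>lborel2) = (\<integral>\<^sup>+\<tau>. \<integral>\<^sup>+\<xi>. energy_density u t (\<tau>, \<xi>) \<partial>lborel \<partial>lborel)"
    by (rule lborel.nn_integral_fst[symmetric]) (rule energy_density_measurable[OF u])
  also have "\<dots> = (\<integral>\<^sup>+\<tau>. indicator {0..1} \<tau> * sobolev_energy (u t) + indicator {0..t} \<tau> * dissipation (u \<tau>) \<partial>lborel)"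
  proof (rule nn_integral_cong)
    fix \<tau> :: real
    show "(\<integral>\<^sup>+\<xi>. energy_density u t (\<tau>, \<xi>) \<partial>lborel)
        = indicator {0..1} \<tau> * sobolev_energy (u t) + indicator {0..t} \<tau> * dissipation (u \<tau>)"
      unfolding energy_density_def fst_conv snd_conv sobolev_energy_def dissipation_def
      by (subst nn_integral_add) (auto simp: nn_integral_cmult)
  qed
  also have "\<dots> = (\<integral>\<^sup>+\<tau>. indicator {0..1} \<tau> * sobolev_energy (u t) \<partial>(lborel::real measure)) + (\<integral>\<^sup>+\<tau>. indicator {0..t} \<tau> * dissipation (u \<tau>) \<partial>lborel)"
    by (rule nn_integral_add) auto
  also have "(\<integral>\<^sup>+\<tau>. indicator {0..1} \<tau> * sobolev_energy (u t) \<partial>(lborel::real measure)) = sobolev_energy (u t)"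
    by (subst nn_integral_multc) auto
  finally show ?thesis .
qed

lemma energy_density_tendsto:
  assumes "\<And>\<tau> \<xi>. 0 \<le> \<tau> \<Longrightarrow> (\<lambda>k. W k \<tau> \<xi>) \<longlonglongrightarrow> w \<tau> \<xi>" "0 \<le> t"
  shows "(\<lambda>k. energy_density (W k) t p) \<longlonglongrightarrow> energy_density w t p"
proof -
  have restricted: "(\<lambda>k. indicator S \<tau> * ennreal (c * (cmod (f k))\<^sup>2)) \<longlonglongrightarrow> indicator S \<tau> * ennreal (c * (cmod l)\<^sup>2)"
    if "\<tau> \<in> S \<Longrightarrow> f \<longlonglongrightarrow> l" for S :: "real set" and \<tau> c f l
  proof (cases "\<tau> \<in> S")
    case True
    have "(\<lambda>k. ennreal (c * (cmod (f k))\<^sup>2)) \<longlonglongrightarrow> ennreal (c * (cmod l)\<^sup>2)"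
      by (intro tendsto_ennrealI tendsto_intros that True)
    then show ?thesis using True by simp
  qed simp
  show ?thesis unfolding energy_density_def by (intro tendsto_add restricted assms(1)) (use assms(2) in auto)
qed

end

lemma (in small_galerkin_solution) energy_density_le:
  assumes t: "0 \<le> t"
  shows "(\<integral>\<^sup>+p. energy_density w t p \<partial>lborel2) \<le> ennreal ((L2norm w0)\<^sup>2 + (hnorm s w0)\<^sup>2)"
proof -
  let ?D = "\<lambda>\<tau>. (hnorm \<alpha> (w \<tau>))\<^sup>2 + (hnorm (s + \<alpha>) (w \<tau>))\<^sup>2"
  note int = L2_energy(1)[OF t] Hs_energy(1)[OF t]
  have "(\<integral>\<^sup>+\<tau>. indicator {0..t} \<tau> * dissipation (w \<tau>) \<partial>lborel) = (\<integral>\<^sup>+\<tau>. indicator {0..t} \<tau> * ennreal (?D \<tau>) \<partial>lborel)"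
  proof (rule nn_integral_cong)
    fix \<tau> :: real
    show "indicator {0..t} \<tau> * dissipation (w \<tau>) = indicator {0..t} \<tau> * ennreal (?D \<tau>)"
      using w_weighted_L2c[of \<tau>] \<alpha>_pos s_bounds by (cases "\<tau> \<in> {0..t}") (auto simp: dissipation_eq)
  qed
  also have "\<dots> = ennreal (LINT \<tau>:{0..t}|lborel. ?D \<tau>)"
    by (rule nn_set_integral_eq[OF set_integral_add(1)[OF int]]) simp
  finally have total: "(\<integral>\<^sup>+p. energy_density w t p \<partial>lborel2)
      = ennreal ((L2norm (w t))\<^sup>2 + (hnorm s (w t))\<^sup>2) + ennreal (LINT \<tau>:{0..t}|lborel. ?D \<tau>)"
    using w_weighted_L2c[OF t, of s] s_bounds
      by (simp add: energy_density_integral[OF jointly_borel_w] sobolev_energy_eq w_L2c[OF t])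
  have nonneg: "0 \<le> (LINT \<tau>:{0..t}|lborel. (hnorm \<alpha> (w \<tau>))\<^sup>2)" "0 \<le> (LINT \<tau>:{0..t}|lborel. ?D \<tau>)"
    unfolding set_lebesgue_integral_def by (intro integral_nonneg_AE; auto)+
  have "(\<integral>\<^sup>+p. energy_density w t p \<partial>lborel2)
      = ennreal ((L2norm (w t))\<^sup>2 + (hnorm s (w t))\<^sup>2 + (LINT \<tau>:{0..t}|lborel. ?D \<tau>))"
    unfolding total by (rule ennreal_plus[symmetric]) (simp_all add: nonneg)
  also have "\<dots> \<le> ennreal ((L2norm w0)\<^sup>2 + (hnorm s w0)\<^sup>2)"
    using L2_energy(2)[OF t] Hs_energy_le[OF t] nonneg(1)
      unfolding set_integral_add(2)[OF int] by (intro ennreal_leI) linarith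
  finally show ?thesis .
qed

lemma advection_Lipschitz_on_ball:
  assumes "L2c a" "L2c b" "L2norm a \<le> M" "L2norm b \<le> M" "L2norm (\<lambda>x. a x - b x) \<le> d"
  shows "cmod (advection a a \<xi> - advection b b \<xi>) \<le> norm \<xi> * (2 * M) * d"
proof -
  have "norm \<xi> * (L2norm a + L2norm b) * L2norm (\<lambda>x. a x - b x) \<le> norm \<xi> * (2 * M) * d"
    using assms(3-5) order_trans[OF L2norm_nonneg assms(3)] by (intro mult_mono) auto
  then show ?thesis using advection_Lipschitz[OF assms(1,2), of \<xi>] by linarith
qed

lemma duhamel_force_diff_le:
  fixes f g :: "real \<Rightarrow> pt \<Rightarrow> complex"
  assumes "continuous_on {0..} (\<lambda>\<tau>. f \<tau> \<xi>)" "continuous_on {0..} (\<lambda>\<tau>. g \<tau> \<xi>)" "0 \<le> l \<xi>" and t: "0 \<le> t"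
    and "\<And>\<tau>. \<tau> \<in> {0..t} \<Longrightarrow> cmod (f \<tau> \<xi> - g \<tau> \<xi>) \<le> C"
  shows "cmod (duhamel l w0 f t \<xi> - duhamel l w0 g t \<xi>) \<le> t * C"
  using duhamel_diff_bound[where f=f and g=g and \<xi>=\<xi> and l=l and h="\<lambda>_. C" and t=t and ?w0.0=w0 and ?w1.0=w0] assms
  by (simp add: set_integrable_continuous set_lebesgue_integral_def)

locale galerkin_sequence = sqg_exponents \<alpha> s for \<alpha> s :: real +
  fixes w0 :: "pt \<Rightarrow> complex" and W :: "nat \<Rightarrow> real \<Rightarrow> pt \<Rightarrow> complex"
  assumes w0_weighted_L2c: "L2c (weighted s w0)" and small: "smallness_const * hnorm s w0 < 1"
    and galerkin: "galerkin_solution \<alpha> (real (Suc k)) w0 (W k)"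
begin

sublocale W: small_galerkin_solution \<alpha> s "real (Suc k)" w0 "W k" for k
  using galerkin[of k] w0_weighted_L2c small
  by (intro small_galerkin_solution.intro sqg_exponents_axioms small_galerkin_solution_axioms.intro)

definition L2_error :: "nat \<Rightarrow> real" where
  "L2_error k = sqrt (real (Suc k) powr (- s) * (2 * (hnorm s w0)\<^sup>2 + (L2norm w0)\<^sup>2))"

lemma L2_error_tendsto: "L2_error \<longlonglongrightarrow> 0"
proof -
  have "(\<lambda>k. real (Suc k) powr (- s)) \<longlonglongrightarrow> 0"
    by (rule tendsto_neg_powr) (use s_bounds filterlim_compose[OF filterlim_real_sequentially filterlim_Suc] in auto)
  then have "L2_error \<longlonglongrightarrow> sqrt (0 * (2 * (hnorm s w0)\<^sup>2 + (L2norm w0)\<^sup>2))"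
    unfolding L2_error_def by (intro tendsto_intros)
  then show ?thesis by simp
qed

lemma W_L2_difference:
  assumes "i \<le> j" "0 \<le> t" shows "L2norm (\<lambda>\<xi>. W i t \<xi> - W j t \<xi>) \<le> L2_error i"
proof -
  interpret galerkin_pair \<alpha> s "real (Suc i)" "real (Suc j)" w0 "W i" "W j"
    using \<open>i \<le> j\<close> by unfold_locales auto
  show ?thesis unfolding L2_error_def by (rule real_le_rsqrt) (rule difference_L2norm_le[OF assms(2)])
qed

lemma W_eq_duhamel:
  "0 \<le> t \<Longrightarrow> norm \<xi> \<le> real (Suc k) \<Longrightarrow> W k t \<xi> = duhamel (diss_symbol \<alpha>) w0 (\<lambda>\<tau>. advection (W k \<tau>) (W k \<tau>)) t \<xi>"
  using W.w_eq[of t k \<xi>] by (simp only: ball_duhamel_def if_True)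

definition pointwise_error :: "real \<Rightarrow> pt \<Rightarrow> nat \<Rightarrow> real" where
  "pointwise_error t \<xi> k = t * (norm \<xi> * (2 * L2norm w0) * L2_error k)"

lemma pointwise_error_tendsto: "pointwise_error t \<xi> \<longlonglongrightarrow> 0"
  unfolding pointwise_error_def[abs_def]
  using tendsto_mult[OF tendsto_const[of t] tendsto_mult[OF tendsto_const[of "norm \<xi> * (2 * L2norm w0)"] L2_error_tendsto]] by simp

lemma W_duhamel_difference:
  assumes t: "0 \<le> t" and \<xi>: "norm \<xi> \<le> real (Suc i)"
    and v: "L2_continuous v"
      "\<And>\<tau>. 0 \<le> \<tau> \<Longrightarrow> L2norm (v \<tau>) \<le> L2norm w0" "\<And>\<tau>. 0 \<le> \<tau> \<Longrightarrow> L2norm (\<lambda>\<xi>. W i \<tau> \<xi> - v \<tau> \<xi>) \<le> L2_error i"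
  shows "cmod (W i t \<xi> - duhamel (diss_symbol \<alpha>) w0 (\<lambda>\<tau>. advection (v \<tau>) (v \<tau>)) t \<xi>) \<le> pointwise_error t \<xi> i"
  unfolding W_eq_duhamel[OF t \<xi>] pointwise_error_def
proof (rule duhamel_force_diff_le[where f="\<lambda>\<tau>. advection (W i \<tau>) (W i \<tau>)" and g="\<lambda>\<tau>. advection (v \<tau>) (v \<tau>)"])
  fix \<tau> assume "\<tau> \<in> {0..t}"
  then show "cmod (advection (W i \<tau>) (W i \<tau>) \<xi> - advection (v \<tau>) (v \<tau>) \<xi>) \<le> norm \<xi> * (2 * L2norm w0) * L2_error i"
    by (intro advection_Lipschitz_on_ball W.w_L2c W.L2norm_w_le L2_continuous_L2c[OF v(1)] v(2,3)) auto
qed (use W.advection_w_continuous advection_continuous[OF v(1)] t in auto)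

lemma W_pointwise_difference:
  assumes "i \<le> j" "0 \<le> t" "norm \<xi> \<le> real (Suc i)"
  shows "cmod (W i t \<xi> - W j t \<xi>) \<le> pointwise_error t \<xi> i"
proof -
  have "W j t \<xi> = duhamel (diss_symbol \<alpha>) w0 (\<lambda>\<tau>. advection (W j \<tau>) (W j \<tau>)) t \<xi>"
    using assms by (intro W_eq_duhamel) auto
  then show ?thesis
    using W_duhamel_difference[OF assms(2,3) W.w_L2_continuous W.L2norm_w_le W_L2_difference[OF assms(1)]]
      by (simp only:)
qed

lemma eventually_norm_le: "\<forall>\<^sub>F k in sequentially. norm (\<xi>::pt) \<le> real (Suc k)"
proof -
  obtain m :: nat where "norm \<xi> \<le> real m" using real_arch_simple by blast
  then show ?thesis by (intro eventually_sequentiallyI[of m]) simp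
qed

definition limit :: "real \<Rightarrow> pt \<Rightarrow> complex" where
  "limit t \<xi> = lim (\<lambda>k. W k t \<xi>)"

lemma W_tendsto:
  assumes t: "0 \<le> t" shows "(\<lambda>k. W k t \<xi>) \<longlonglongrightarrow> limit t \<xi>"
proof -
  have "Cauchy (\<lambda>k. W k t \<xi>)"
  proof (rule CauchyI')
    fix e :: real assume "0 < e"
    from eventually_conj[OF order_tendstoD(2)[OF pointwise_error_tendsto[of t \<xi>] this] eventually_norm_le[of \<xi>]]
    obtain N where N: "pointwise_error t \<xi> i < e" "norm \<xi> \<le> real (Suc i)" if "i \<ge> N" for i
      unfolding eventually_sequentially by blast
    have "norm (W i t \<xi> - W j t \<xi>) < e" if "i \<ge> N" "j > i" for i j
      by (rule le_less_trans[OF W_pointwise_difference N(1)]) (use that t N(2) in auto)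
    then show "\<exists>N. \<forall>i\<ge>N. \<forall>j>i. dist (W i t \<xi>) (W j t \<xi>) < e" unfolding dist_norm by blast
  qed
  then show ?thesis unfolding limit_def by (rule convergent_LIMSEQ_iff[THEN iffD1, OF Cauchy_convergent])
qed

lemma jointly_borel_limit: "jointly_borel limit"
proof -
  note [measurable (raw)] = measurable_pair_apply[OF W.jointly_borel_w]
  show ?thesis unfolding limit_def split_beta' by measurable
qed

lemma limit_measurable [measurable]: "limit t \<in> borel_measurable borel"
  by (rule jointly_borel_slice[OF jointly_borel_limit])

lemma limit_L2:
  assumes t: "0 \<le> t" shows "L2c (limit t)" "L2norm (limit t) \<le> L2norm w0"
  using L2_Fatou[of "\<lambda>k. W k t" "limit t" "L2norm w0"] W.w_L2c[OF t] W_tendsto[OF t] W.L2norm_w_le[OF t] by auto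

lemma limit_L2_error:
  assumes t: "0 \<le> t" shows "L2norm (\<lambda>\<xi>. W k t \<xi> - limit t \<xi>) \<le> L2_error k"
proof (rule L2_Fatou(2)[of "\<lambda>j \<xi>. W k t \<xi> - W j t \<xi>"])
  show "L2c (\<lambda>\<xi>. W k t \<xi> - W j t \<xi>)" for j by (rule L2c_diff[OF W.w_L2c[OF t] W.w_L2c[OF t]])
  show "AE \<xi> in lborel. (\<lambda>j. W k t \<xi> - W j t \<xi>) \<longlonglongrightarrow> W k t \<xi> - limit t \<xi>" by (intro AE_I2 tendsto_intros W_tendsto[OF t])
  show "\<forall>\<^sub>F j in sequentially. L2norm (\<lambda>\<xi>. W k t \<xi> - W j t \<xi>) \<le> L2_error k"
    unfolding eventually_sequentially using W_L2_difference[OF _ t] by blast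
qed measurable

lemma limit_L2_continuous: "L2_continuous limit"
proof (rule L2_continuous_uniform_limit[of W, OF W.w_L2_continuous limit_L2(1)])
  fix T e :: real assume "0 < e"
  from order_tendstoD(2)[OF L2_error_tendsto this] obtain k where "L2_error k < e" by (auto dest: eventually_happens)
  then have "L2norm (\<lambda>\<xi>. W k t \<xi> - limit t \<xi>) \<le> e" if "t \<in> {0..T}" for t using limit_L2_error[of t k] that by auto
  then show "\<exists>k. \<forall>t\<in>{0..T}. L2norm (\<lambda>\<xi>. W k t \<xi> - limit t \<xi>) \<le> e" by blast
qed

lemma limit_hermitian:
  assumes t: "0 \<le> t" shows "hermitian (limit t)"
proof
  fix \<xi>
  have "(\<lambda>k. cnj (W k t \<xi>)) \<longlonglongrightarrow> limit t (- \<xi>)" using W_tendsto[OF t, of "- \<xi>"] W.w_hermitian[OF t] by simp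
  then show "limit t (- \<xi>) = cnj (limit t \<xi>)" by (rule LIMSEQ_unique) (intro tendsto_intros W_tendsto[OF t])
qed

lemma limit_eq_duhamel:
  assumes t: "0 \<le> t" shows "limit t \<xi> = duhamel (diss_symbol \<alpha>) w0 (\<lambda>\<tau>. advection (limit \<tau>) (limit \<tau>)) t \<xi>"
proof (rule LIMSEQ_unique[OF W_tendsto[OF t]])
  have "\<forall>\<^sub>F k in sequentially. norm (W k t \<xi> - duhamel (diss_symbol \<alpha>) w0 (\<lambda>\<tau>. advection (limit \<tau>) (limit \<tau>)) t \<xi>)
      \<le> pointwise_error t \<xi> k"
    using eventually_norm_le[of \<xi>]
    by eventually_elim (rule W_duhamel_difference[OF t _ limit_L2_continuous limit_L2(2) limit_L2_error])
  then show "(\<lambda>k. W k t \<xi>) \<longlonglongrightarrow> duhamel (diss_symbol \<alpha>) w0 (\<lambda>\<tau>. advection (limit \<tau>) (limit \<tau>)) t \<xi>"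
    by (rule tendsto_of_norm_diff_le) (rule pointwise_error_tendsto)
qed

lemma limit_energy_le:
  assumes t: "0 \<le> t"
  shows "(\<integral>\<^sup>+p. energy_density limit t p \<partial>lborel2) \<le> ennreal ((L2norm w0)\<^sup>2 + (hnorm s w0)\<^sup>2)"
proof (rule nn_integral_Fatou)
  show "AE p in lborel2. (\<lambda>k. energy_density (W k) t p) \<longlonglongrightarrow> energy_density limit t p"
    using energy_density_tendsto[of W limit, OF W_tendsto t] by simp
qed (use energy_density_measurable W.jointly_borel_w W.energy_density_le[OF t] in auto)

end

locale fourier_sqg = sqg_exponents \<alpha> s for \<alpha> s :: real +
  fixes w0 :: "pt \<Rightarrow> complex" and w :: "real \<Rightarrow> pt \<Rightarrow> complex"
  assumes jointly_borel_w: "jointly_borel w" and w_L2_continuous: "L2_continuous w" and w_hermitian: "0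
      \<le> t \<Longrightarrow> hermitian (w t)"
    and w_eq_duhamel: "0 \<le> t \<Longrightarrow> w t \<xi> = duhamel (diss_symbol \<alpha>) w0 (\<lambda>\<tau>. advection (w \<tau>) (w \<tau>)) t \<xi>"
    and energy_density_le: "0 \<le> t \<Longrightarrow> (\<integral>\<^sup>+p. energy_density w t p \<partial>lborel2) \<le> ennreal ((L2norm w0)\<^sup>2 + (hnorm s w0)\<^sup>2)"

theorem (in sqg_exponents) fourier_sqg_exists:
  assumes w0: "L2c w0" "L2c (weighted s w0)" "hermitian w0" and small: "smallness_const * hnorm s w0 < 1"
  shows "\<exists>w. fourier_sqg \<alpha> s w0 w"
proof -
  have "\<exists>w. galerkin_solution \<alpha> (real (Suc k)) w0 w" for k
    using galerkin_solution_exists[OF \<alpha>_pos _ w0(1,3)] by simp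
  then obtain W where W: "\<And>k. galerkin_solution \<alpha> (real (Suc k)) w0 (W k)" by metis
  interpret galerkin_sequence \<alpha> s w0 W
    by (intro galerkin_sequence.intro sqg_exponents_axioms galerkin_sequence_axioms.intro w0 small W)
  have "fourier_sqg \<alpha> s w0 limit"
    by unfold_locales (use jointly_borel_limit limit_L2_continuous limit_hermitian limit_eq_duhamel limit_energy_le in auto)
  then show ?thesis by blast
qed

section \<open>Regularity of the limit\<close>

lemma weighted_interpolation:
  assumes u: "L2c u" "L2c (weighted s u)" and r: "0 \<le> r" "r \<le> s"
  shows "L2c (weighted r u)" "hnorm r u \<le> L2norm u + hnorm s u"
proof -
  let ?h = "\<lambda>\<xi>. complex_of_real (cmod (u \<xi>)) + complex_of_real (cmod (weighted s u \<xi>))"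
  have h: "L2c ?h" by (intro L2c_add L2c_cmod u)
  have "norm \<xi> powr r \<le> 1 + norm \<xi> powr s" for \<xi> :: pt
    using powr_mono2[of r "norm \<xi>" 1] powr_mono[of r s "norm \<xi>"] r by (cases "norm \<xi>
        \<le> 1") (auto intro: add_increasing add_increasing2)
  then have "cmod (weighted r u \<xi>) \<le> (1 + norm \<xi> powr s) * cmod (u \<xi>)" for \<xi>
    unfolding cmod_weighted by (intro mult_right_mono) auto
  also have "(1 + norm \<xi> powr s) * cmod (u \<xi>) = 1 * cmod (?h \<xi>)" for \<xi>
    unfolding of_real_add[symmetric] norm_of_real cmod_weighted by (simp add: distrib_right)
  finally have "AE \<xi> in lborel. cmod (weighted r u \<xi>) \<le> 1 * cmod (?h \<xi>)" by simp
  note bound = L2c_mono[OF h weighted_measurable[OF L2c_measurable[OF u(1)]] this zero_le_one]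
  show "L2c (weighted r u)" by (rule bound(1))
  show "hnorm r u \<le> L2norm u + hnorm s u"
    using bound(2) L2norm_triangle[OF L2c_cmod[OF u(1)] L2c_cmod[OF u(2)]] by (simp add: L2norm_cmod)
qed

lemma L2norm_parallelogram:
  assumes "L2c f" "L2c g"
  shows "(L2norm (\<lambda>x. f x + g x))\<^sup>2 + (L2norm (\<lambda>x. f x - g x))\<^sup>2 = 2 * (L2norm f)\<^sup>2 + 2 * (L2norm g)\<^sup>2"
proof -
  have "(cmod (f x + g x))\<^sup>2 + (cmod (f x - g x))\<^sup>2 = 2 * (cmod (f x))\<^sup>2 + 2 * (cmod (g x))\<^sup>2" for x
    unfolding cmod_power2 by (simp add: power2_eq_square algebra_simps)
  then have "(LINT x|lborel. (cmod (f x + g x))\<^sup>2 + (cmod (f x - g x))\<^sup>2)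
      = (LINT x|lborel. 2 * (cmod (f x))\<^sup>2 + 2 * (cmod (g x))\<^sup>2)"
    by (simp only:)
  then show ?thesis
    unfolding L2norm_squared L2norm_sq_def
    using L2c_integrable[OF L2c_add[OF assms]] L2c_integrable[OF L2c_diff[OF assms]] L2c_integrable[OF assms(1)] L2c_integrable[OF assms(2)]
      by simp
qed

text \<open>By Fatou's lemma the norms of \<open>f\<^sub>i + g\<close> are asymptotically at least \<open>2 \<parallel>g\<parallel>\<close>, so the parallelogram law
  leaves nothing for \<open>f\<^sub>i - g\<close>.\<close>

lemma L2_tendsto_if_norm_tendsto:
  assumes f: "\<And>i::nat. L2c (f i)" and g: "L2c g" and lim: "\<And>x. (\<lambda>i. f i x) \<longlonglongrightarrow> g x"
    and norms: "(\<lambda>i. (L2norm (f i))\<^sup>2) \<longlonglongrightarrow> (L2norm g)\<^sup>2"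
  shows "(\<lambda>i. L2norm (\<lambda>x. f i x - g x)) \<longlonglongrightarrow> 0"
proof -
  define D where "D i = (L2norm (\<lambda>x. f i x - g x))\<^sup>2" for i
  have "\<forall>\<^sub>F i in sequentially. D i < a" if a: "0 < a" for a
  proof (rule ccontr)
    assume "\<not> (\<forall>\<^sub>F i in sequentially. D i < a)"
    then obtain r :: "nat \<Rightarrow> nat" where r: "strict_mono r" and not_less_D: "\<forall>i. \<not> D (r i) < a"
      by (blast dest: not_eventually_sequentiallyD)
    have "\<forall>\<^sub>F i in sequentially. (L2norm (f (r i)))\<^sup>2 < (L2norm g)\<^sup>2 + a / 4"
      using order_tendstoD(2)[OF LIMSEQ_subseq_LIMSEQ[OF norms r]] a by (simp add: comp_def)
    then have "\<forall>\<^sub>F i in sequentially. L2norm (\<lambda>x. f (r i) x + g x) \<le> sqrt (4 * (L2norm g)\<^sup>2 - a / 2)"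
    proof eventually_elim
      case (elim i)
      then show ?case
        using L2norm_parallelogram[OF f[of "r i"] g] not_less_D[rule_format, of i] unfolding D_def by (intro real_le_rsqrt) linarith
    qed
    moreover have "(\<lambda>i. f (r i) x + g x) \<longlonglongrightarrow> 2 * g x" for x
      using tendsto_add[OF LIMSEQ_subseq_LIMSEQ[OF lim r] tendsto_const, of x "g x"] by (simp add: comp_def)
    ultimately have "L2norm (\<lambda>x. 2 * g x) \<le> sqrt (4 * (L2norm g)\<^sup>2 - a / 2)"
      using L2c_measurable[OF g] by (intro L2_Fatou(2)[OF L2c_add[OF f g]]) auto
    then have "(L2norm (\<lambda>x. 2 * g x))\<^sup>2 \<le> (sqrt (4 * (L2norm g)\<^sup>2 - a / 2))\<^sup>2" by (intro power_mono) auto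
    moreover have "0 \<le> sqrt (4 * (L2norm g)\<^sup>2 - a / 2)"
      using \<open>L2norm (\<lambda>x. 2 * g x) \<le> _\<close> by (rule order_trans[OF L2norm_nonneg])
    ultimately show False using a by (simp add: L2norm_cmult power_mult_distrib)
  qed
  then have "D \<longlonglongrightarrow> 0"
    by (intro order_tendstoI) (simp_all add: D_def less_le_trans[OF _ zero_le_power2])
  then have "(\<lambda>i. sqrt (D i)) \<longlonglongrightarrow> sqrt 0" by (rule tendsto_real_sqrt)
  then show ?thesis by (simp add: D_def)
qed

context fourier_sqg
begin

definition initial_energy :: real where "initial_energy = (L2norm w0)\<^sup>2 + (hnorm s w0)\<^sup>2"

lemma initial_energy_nonneg [simp]: "0 \<le> initial_energy" by (simp add: initial_energy_def)

lemma w_L2c: "0 \<le> t \<Longrightarrow> L2c (w t)" by (rule L2_continuous_L2c[OF w_L2_continuous])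

lemma w_measurable [measurable]: "w t \<in> borel_measurable borel" by (rule jointly_borel_slice[OF jointly_borel_w])

lemma energy_balance:
  assumes "0 \<le> t"
  shows "sobolev_energy (w t) + (\<integral>\<^sup>+\<tau>. indicator {0..t} \<tau> * dissipation (w \<tau>) \<partial>lborel) \<le> ennreal initial_energy"
  using energy_density_le[OF assms] unfolding energy_density_integral[OF jointly_borel_w] initial_energy_def .

lemma total_dissipation_le: "0 \<le> t \<Longrightarrow> (\<integral>\<^sup>+\<tau>. indicator {0..t} \<tau> * dissipation (w \<tau>) \<partial>lborel) \<le> ennreal initial_energy"
  by (rule order_trans[OF _ energy_balance]) auto

lemma Hs_L2c: assumes t: "0 \<le> t" shows "L2c (weighted s (w t))"
proof (rule L2c_nn_leI(1)[where B="sqrt initial_energy"])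
  have "(\<integral>\<^sup>+\<xi>. ennreal ((cmod (weighted s (w t) \<xi>))\<^sup>2) \<partial>lborel) \<le> sobolev_energy (w t)"
    unfolding cmod_weighted_square sobolev_energy_def by (intro nn_integral_mono ennreal_leI mult_right_mono) auto
  also have "\<dots> \<le> ennreal initial_energy" by (rule order_trans[OF _ energy_balance[OF t]]) simp
  finally show "(\<integral>\<^sup>+\<xi>. ennreal ((cmod (weighted s (w t) \<xi>))\<^sup>2) \<partial>lborel) \<le> ennreal ((sqrt initial_energy)\<^sup>2)" by simp
qed (simp_all add: weighted_measurable)

lemma AE_dissipation_finite: "AE \<tau> in lborel. 0 \<le> \<tau> \<longrightarrow> dissipation (w \<tau>) < \<infinity>"
proof -
  note [measurable] = dissipation_measurable[OF jointly_borel_w]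
  have "AE \<tau> in lborel. indicator {0..real n} \<tau> * dissipation (w \<tau>) \<noteq> \<infinity>" for n
    by (rule nn_integral_noteq_infinite) (use le_less_trans[OF total_dissipation_le[of "real n"], of \<infinity>] in auto)
  then have "AE \<tau> in lborel. \<forall>n. indicator {0..real n} \<tau> * dissipation (w \<tau>) \<noteq> \<infinity>" by (simp add: AE_all_countable)
  then show ?thesis
  proof eventually_elim
    case (elim \<tau>)
    obtain n :: nat where "\<tau> \<le> real n" using real_arch_simple by blast
    then show ?case using elim[rule_format, of n] by (auto simp: indicator_def top.not_eq_extremum)
  qed
qed

lemma weighted_L2c_if_dissipation_finite:
  assumes finite: "dissipation (w \<tau>) < \<infinity>" and r: "r = \<alpha> \<or> r = s + \<alpha>"
  shows "L2c (weighted r (w \<tau>))"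
proof -
  obtain B where B: "dissipation (w \<tau>) = ennreal B" "0 \<le> B" using finite by (cases "dissipation (w \<tau>)") auto
  have "(\<integral>\<^sup>+\<xi>. ennreal ((cmod (weighted r (w \<tau>) \<xi>))\<^sup>2) \<partial>lborel) \<le> dissipation (w \<tau>)"
    unfolding cmod_weighted_square dissipation_def using r by (intro nn_integral_mono ennreal_leI mult_right_mono) auto
  then show ?thesis using B by (intro L2c_nn_leI(1)[where B="sqrt B"]) (simp_all add: weighted_measurable)
qed

lemma AE_weighted_L2c: "AE \<tau> in lborel. 0 \<le> \<tau> \<longrightarrow> L2c (weighted \<alpha> (w \<tau>)) \<and> L2c (weighted (s + \<alpha>) (w \<tau>))"
  using AE_dissipation_finite by eventually_elim (auto intro: weighted_L2c_if_dissipation_finite)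

lemma hnorm_measurable [measurable]: "(\<lambda>\<tau>. hnorm r (w \<tau>)) \<in> borel_measurable borel"
  by (rule jointly_borel_L2norm[OF jointly_borel_weighted[OF jointly_borel_w]])

theorem energy_inequality:
  assumes t: "0 \<le> t"
  shows "set_integrable lborel {0..t} (\<lambda>\<tau>. (hnorm \<alpha> (w \<tau>))\<^sup>2 + (hnorm (s + \<alpha>) (w \<tau>))\<^sup>2)"
    and "(L2norm (w t))\<^sup>2 + (hnorm s (w t))\<^sup>2 + (LINT \<tau>:{0..t}|lborel. (hnorm \<alpha> (w \<tau>))\<^sup>2 + (hnorm (s + \<alpha>) (w \<tau>))\<^sup>2)
        \<le> initial_energy"
proof -
  let ?D = "\<lambda>\<tau>. (hnorm \<alpha> (w \<tau>))\<^sup>2 + (hnorm (s + \<alpha>) (w \<tau>))\<^sup>2"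
  have total: "(\<integral>\<^sup>+\<tau>. indicator {0..t} \<tau> * dissipation (w \<tau>) \<partial>lborel)
      = (\<integral>\<^sup>+\<tau>. indicator {0..t} \<tau> * ennreal (?D \<tau>) \<partial>lborel)"
  proof (rule nn_integral_cong_AE)
    show "AE \<tau> in lborel. indicator {0..t} \<tau> * dissipation (w \<tau>) = indicator {0..t} \<tau> * ennreal (?D \<tau>)"
      using AE_weighted_L2c by eventually_elim (auto simp: indicator_def dissipation_eq[OF w_measurable])
  qed
  show int: "set_integrable lborel {0..t} ?D" unfolding set_integrable_def
  proof (rule integrableI_nonneg)
    have "(\<integral>\<^sup>+\<tau>. ennreal (indicator {0..t} \<tau> *\<^sub>R ?D \<tau>) \<partial>lborel) = (\<integral>\<^sup>+\<tau>. indicator {0..t} \<tau> * ennreal (?D \<tau>) \<partial>lborel)"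
      by (rule nn_integral_cong) (auto simp: indicator_def)
    then show "(\<integral>\<^sup>+\<tau>. ennreal (indicator {0..t} \<tau> *\<^sub>R ?D \<tau>) \<partial>lborel) < \<infinity>"
      using le_less_trans[OF total_dissipation_le[OF t], of \<infinity>] unfolding total by simp
  qed auto
  have nonneg: "0 \<le> (LINT \<tau>:{0..t}|lborel. ?D \<tau>)" unfolding set_lebesgue_integral_def by (intro integral_nonneg_AE) auto
  have "ennreal ((L2norm (w t))\<^sup>2 + (hnorm s (w t))\<^sup>2) + ennreal (LINT \<tau>:{0..t}|lborel. ?D \<tau>) \<le> ennreal initial_energy"
    using energy_balance[OF t] unfolding sobolev_energy_eq[OF w_L2c[OF t] Hs_L2c[OF t]] total
      nn_set_integral_eq[OF int add_nonneg_nonneg[OF zero_le_power2 zero_le_power2]] .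
  then have "ennreal ((L2norm (w t))\<^sup>2 + (hnorm s (w t))\<^sup>2 + (LINT \<tau>:{0..t}|lborel. ?D \<tau>)) \<le> ennreal initial_energy"
    by (subst ennreal_plus) (use nonneg in auto)
  then show "(L2norm (w t))\<^sup>2 + (hnorm s (w t))\<^sup>2 + (LINT \<tau>:{0..t}|lborel. ?D \<tau>) \<le> initial_energy"
    by (simp only: ennreal_le_iff initial_energy_nonneg)
qed

lemma norms_le: assumes t: "0 \<le> t" shows "L2norm (w t) \<le> sqrt initial_energy" "hnorm s (w t) \<le> sqrt initial_energy"
proof -
  have "0 \<le> (LINT \<tau>:{0..t}|lborel. (hnorm \<alpha> (w \<tau>))\<^sup>2 + (hnorm (s + \<alpha>) (w \<tau>))\<^sup>2)"
    unfolding set_lebesgue_integral_def by (intro integral_nonneg_AE) auto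
  then have "(L2norm (w t))\<^sup>2 \<le> initial_energy" "(hnorm s (w t))\<^sup>2 \<le> initial_energy"
    using energy_inequality(2)[OF t] zero_le_power2[of "L2norm (w t)"] zero_le_power2[of "hnorm s (w t)"] by linarith+
  then show "L2norm (w t) \<le> sqrt initial_energy" "hnorm s (w t) \<le> sqrt initial_energy" by (auto intro: real_le_rsqrt)
qed

lemma Hs_dissipation_integrable:
  assumes r: "0 \<le> r" shows "set_integrable lborel {r..t} (\<lambda>\<tau>. (hnorm (s + \<alpha>) (w \<tau>))\<^sup>2)"
proof (rule set_integrable_subset)
  show "set_integrable lborel {0..\<bar>t\<bar>} (\<lambda>\<tau>. (hnorm (s + \<alpha>) (w \<tau>))\<^sup>2)"
    unfolding set_integrable_def
    by (rule Bochner_Integration.integrable_bound[OF energy_inequality(1)[of "\<bar>t\<bar>", unfolded set_integrable_def]]) (auto simp: indicator_def)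
qed (use r in auto)

definition interpolated_bound :: real where "interpolated_bound = 2 * sqrt initial_energy"

lemma weighted_bound:
  assumes t: "0 \<le> t" and r: "0 \<le> r" "r \<le> s" shows "L2c (weighted r (w t))" "hnorm r (w t) \<le> interpolated_bound"
  using weighted_interpolation[OF w_L2c[OF t] Hs_L2c[OF t] r] norms_le[OF t] by (auto simp: interpolated_bound_def)

lemma interpolated_bound_nonneg [simp]: "0 \<le> interpolated_bound"
  by (simp add: interpolated_bound_def)

lemma sqg_form_le:
  assumes t: "0 \<le> t" shows "sqg_form (w t) (w t) (w t)
      \<le> ennreal (gradient_const * interpolated_bound * interpolated_bound * interpolated_bound)"
proof (rule order_trans[OF sqg_form_estimate])
  have exponents: "0 \<le> \<alpha>" "\<alpha> \<le> s" "0 \<le> s" using \<alpha>_pos s_bounds \<alpha>_less_half by auto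
  show "L2c (weighted \<alpha> (w t))" "L2c (weighted s (w t))" "L2c (weighted \<alpha> (w t))"
    by (intro weighted_bound t exponents order_refl)+
  show "ennreal (gradient_const * hnorm \<alpha> (w t) * hnorm s (w t) * hnorm \<alpha> (w t))
      \<le> ennreal (gradient_const * interpolated_bound * interpolated_bound * interpolated_bound)"
    using gradient_const_nonneg by (intro ennreal_leI mult_mono weighted_bound t exponents order_refl) auto
qed

lemma advection_w_continuous: "continuous_on {0..} (\<lambda>t. advection (w t) (w t) \<xi>)"
  by (rule advection_continuous[OF w_L2_continuous])

lemma w_0: "w 0 = w0"
  by (rule ext) (simp add: w_eq_duhamel duhamel_integrating_factor[OF advection_w_continuous])

sublocale damped_evolution w "\<lambda>t. advection (w t) (w t)" "diss_symbol \<alpha>"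
proof
  fix t :: real and \<xi> :: pt assume t: "0 \<le> t"
  have "((\<lambda>t. duhamel (diss_symbol \<alpha>) w0 (\<lambda>\<tau>. advection (w \<tau>) (w \<tau>)) t \<xi>) has_vector_derivative
      (- complex_of_real (diss_symbol \<alpha> \<xi>) * w t \<xi> - advection (w t) (w t) \<xi>)) (at t within {0..})"
    using duhamel_has_vector_derivative[where f="\<lambda>\<tau>. advection (w \<tau>) (w \<tau>)" and l="diss_symbol \<alpha>" and ?w0.0=w0 and \<xi>=\<xi>, OF advection_w_continuous t]
    unfolding w_eq_duhamel[OF t, symmetric] .
  then show "((\<lambda>t. w t \<xi>) has_vector_derivative (- complex_of_real (diss_symbol \<alpha> \<xi>) * w t \<xi> - advection (w t) (w t) \<xi>)) (at t within {0..})"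
    by (rule has_vector_derivative_transform[rotated 2]) (use t w_eq_duhamel in auto)
qed (use jointly_borel_w jointly_borel_advection advection_w_continuous in auto)

lemma cutoff_diss_symbol_le: "0 < R \<Longrightarrow> cutoff_weight s R \<xi> * diss_symbol \<alpha> \<xi> \<le> norm \<xi> powr (2 * (s + \<alpha>))"
  unfolding diss_symbol_def distrib_left powr_add
    using cutoff_weight_le[of s R \<xi>] s_bounds by (intro mult_right_mono) auto

lemma cutoff_diss_symbol_nonneg: "0 \<le> cutoff_weight s R \<xi> * diss_symbol \<alpha> \<xi>"
  by (intro mult_nonneg_nonneg diss_symbol_nonneg cutoff_weight_nonneg)

lemma truncated_damping_integrable:
  assumes R: "0 < R" and rt: "0 \<le> r" "r \<le> t"
  shows "integrable lborel2 (\<lambda>(\<tau>, \<xi>). indicator {r..t} \<tau> * (cutoff_weight s R \<xi> * diss_symbol \<alpha> \<xi> * (cmod (w \<tau> \<xi>))\<^sup>2))"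
proof (rule integrableI_bounded)
  note [measurable (raw)] = measurable_pair_apply[OF jointly_borel_w]
  show "(\<lambda>(\<tau>, \<xi>). indicator {r..t} \<tau> * (cutoff_weight s R \<xi> * diss_symbol \<alpha> \<xi> * (cmod (w \<tau> \<xi>))\<^sup>2)) \<in> borel_measurable lborel2"
    by measurable
  have density: "ennreal (norm (indicator {r..t} \<tau> * (cutoff_weight s R \<xi> * diss_symbol \<alpha> \<xi> * (cmod (w \<tau> \<xi>))\<^sup>2)))
      \<le> energy_density w t (\<tau>, \<xi>)" for \<tau> \<xi>
  proof (cases "\<tau> \<in> {r..t}")
    case True
    have "cutoff_weight s R \<xi> * diss_symbol \<alpha> \<xi> \<le> norm \<xi> powr (2 * \<alpha>) + norm \<xi> powr (2 * (s + \<alpha>))"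
      using cutoff_diss_symbol_le[OF R] by (rule add_increasing[OF powr_ge_zero])
    then have "ennreal (cutoff_weight s R \<xi> * diss_symbol \<alpha> \<xi> * (cmod (w \<tau> \<xi>))\<^sup>2)
        \<le> ennreal ((norm \<xi> powr (2 * \<alpha>) + norm \<xi> powr (2 * (s + \<alpha>))) * (cmod (w \<tau> \<xi>))\<^sup>2)"
      by (intro ennreal_leI mult_right_mono) auto
    also have "\<dots> \<le> energy_density w t (\<tau>, \<xi>)"
      unfolding energy_density_def fst_conv snd_conv using True rt by (intro add_increasing) auto
    finally show ?thesis using True mult_nonneg_nonneg[OF cutoff_diss_symbol_nonneg zero_le_power2, of R \<xi> "cmod (w \<tau> \<xi>)"] by simp
  qed simp
  have "(\<integral>\<^sup>+p. ennreal (norm (case p of (\<tau>, \<xi>) \<Rightarrow> indicator {r..t} \<tau> * (cutoff_weight s R \<xi> * diss_symbol \<alpha> \<xi> * (cmod (w \<tau> \<xi>))\<^sup>2))) \<partial>lborel2)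
     \<le> (\<integral>\<^sup>+p. energy_density w t p \<partial>lborel2)"
    by (intro nn_integral_mono, clarify) (rule density)
  also have "\<dots> < \<infinity>" by (rule le_less_trans[OF energy_density_le]) (use rt in auto)
  finally show "(\<integral>\<^sup>+p. ennreal (norm (case p of (\<tau>, \<xi>) \<Rightarrow> indicator {r..t} \<tau> * (cutoff_weight s R \<xi> * diss_symbol \<alpha> \<xi> * (cmod (w \<tau> \<xi>))\<^sup>2))) \<partial>lborel2) < \<infinity>" .
qed

lemma truncated_force_integrable:
  assumes R: "0 < R" and r: "0 \<le> r"
  shows "integrable lborel2 (\<lambda>(\<tau>, \<xi>). indicator {r..t} \<tau> * (cutoff_weight s R \<xi> * Re (advection (w \<tau>) (w \<tau>) \<xi> * cnj (w \<tau> \<xi>))))"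
  unfolding real_scaleR_def[symmetric]
proof (rule integrable_time_slices)
  note [measurable (raw)] = measurable_pair_apply[OF jointly_borel_w] measurable_pair_apply[OF jointly_borel_advection[OF jointly_borel_w]]
  note [measurable] = jointly_borel_slice[OF jointly_borel_advection[OF jointly_borel_w]]
  show "(\<lambda>(\<tau>, \<xi>). cutoff_weight s R \<xi> *\<^sub>R Re (advection (w \<tau>) (w \<tau>) \<xi> * cnj (w \<tau> \<xi>))) \<in> borel_measurable (borel \<Otimes>\<^sub>M borel)"
    by measurable
  fix \<tau> assume "\<tau> \<in> {r..t}"
  then have \<tau>: "0 \<le> \<tau>" using r by simp
  let ?B = "gradient_const * interpolated_bound * interpolated_bound * interpolated_bound"
  have "(\<integral>\<^sup>+\<xi>. ennreal (norm (cutoff_weight s R \<xi> *\<^sub>R Re (advection (w \<tau>) (w \<tau>) \<xi> * cnj (w \<tau> \<xi>)))) \<partial>lborel)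
      \<le> (\<integral>\<^sup>+\<xi>. ennreal (R powr (2 * s)) * ennreal (cmod (advection (w \<tau>) (w \<tau>) \<xi>) * cmod (w \<tau> \<xi>)) \<partial>lborel)"
  proof (rule nn_integral_mono)
    fix \<xi>
    have "norm (cutoff_weight s R \<xi> *\<^sub>R Re (advection (w \<tau>) (w \<tau>) \<xi> * cnj (w \<tau> \<xi>)))
        \<le> R powr (2 * s) * (cmod (advection (w \<tau>) (w \<tau>) \<xi>) * cmod (w \<tau> \<xi>))"
      unfolding real_norm_def real_scaleR_def abs_mult
        using cutoff_weight_le_radius[of s R \<xi>] s_bounds R by (intro mult_mono abs_Re_mult_cnj_le) auto
    then show "ennreal (norm (cutoff_weight s R \<xi> *\<^sub>R Re (advection (w \<tau>) (w \<tau>) \<xi> * cnj (w \<tau> \<xi>))))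
        \<le> ennreal (R powr (2 * s)) * ennreal (cmod (advection (w \<tau>) (w \<tau>) \<xi>) * cmod (w \<tau> \<xi>))"
      by (subst ennreal_mult[symmetric]) (auto intro: ennreal_leI)
  qed
  also have "\<dots> \<le> ennreal (R powr (2 * s)) * ennreal ?B"
    using order_trans[OF nn_integral_advection_le sqg_form_le[OF \<tau>]]
      by (subst nn_integral_cmult) (auto intro: mult_left_mono)
  also have "\<dots> = ennreal (R powr (2 * s) * ?B)" by (rule ennreal_mult[symmetric]) simp_all
  finally show "(\<integral>\<^sup>+\<xi>. ennreal (norm (cutoff_weight s R \<xi> *\<^sub>R Re (advection (w \<tau>) (w \<tau>) \<xi> * cnj (w \<tau> \<xi>)))) \<partial>lborel)
      \<le> ennreal (R powr (2 * s) * ?B)" .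
qed

lemma truncated_energy_integrable:
  assumes R: "0 < R" and t: "0 \<le> t" shows "integrable lborel (\<lambda>\<xi>. cutoff_weight s R \<xi> * (cmod (w t \<xi>))\<^sup>2)"
  by (rule Bochner_Integration.integrable_bound[OF L2c_integrable[OF Hs_L2c[OF t]]])
    (use cutoff_weight_le[of s R] s_bounds R in \<open>auto simp: cmod_weighted_square abs_mult intro!: mult_right_mono\<close>)

lemma truncated_damping_bounds:
  assumes R: "0 < R" and L2c: "L2c (weighted (s + \<alpha>) (w \<tau>))"
  shows "0 \<le> weighted_energy (\<lambda>\<xi>. cutoff_weight s R \<xi> * diss_symbol \<alpha> \<xi>) (w \<tau>)"
    and "weighted_energy (\<lambda>\<xi>. cutoff_weight s R \<xi> * diss_symbol \<alpha> \<xi>) (w \<tau>) \<le> (hnorm (s + \<alpha>) (w \<tau>))\<^sup>2"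
proof -
  show "0 \<le> weighted_energy (\<lambda>\<xi>. cutoff_weight s R \<xi> * diss_symbol \<alpha> \<xi>) (w \<tau>)"
    by (rule weighted_energy_nonneg[OF cutoff_diss_symbol_nonneg])
  have le: "cutoff_weight s R \<xi> * diss_symbol \<alpha> \<xi> * (cmod (w \<tau> \<xi>))\<^sup>2
      \<le> norm \<xi> powr (2 * (s + \<alpha>)) * (cmod (w \<tau> \<xi>))\<^sup>2" for \<xi>
    by (rule mult_right_mono[OF cutoff_diss_symbol_le[OF R]]) simp
  have int: "integrable lborel (\<lambda>\<xi>. norm \<xi> powr (2 * (s + \<alpha>)) * (cmod (w \<tau> \<xi>))\<^sup>2)"
    using L2c_integrable[OF L2c] unfolding cmod_weighted_square .
  have "norm (cutoff_weight s R \<xi> * diss_symbol \<alpha> \<xi> * (cmod (w \<tau> \<xi>))\<^sup>2)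
      \<le> norm (norm \<xi> powr (2 * (s + \<alpha>)) * (cmod (w \<tau> \<xi>))\<^sup>2)" for \<xi>
    using le[of \<xi>] mult_nonneg_nonneg[OF cutoff_diss_symbol_nonneg zero_le_power2, of R \<xi> "cmod (w \<tau> \<xi>)"] by simp
  then have "integrable lborel (\<lambda>\<xi>. cutoff_weight s R \<xi> * diss_symbol \<alpha> \<xi> * (cmod (w \<tau> \<xi>))\<^sup>2)"
    by (intro Bochner_Integration.integrable_bound[OF int] AE_I2; measurable)
  then show "weighted_energy (\<lambda>\<xi>. cutoff_weight s R \<xi> * diss_symbol \<alpha> \<xi>) (w \<tau>) \<le> (hnorm (s + \<alpha>) (w \<tau>))\<^sup>2"
    unfolding weighted_energy_powr[symmetric] weighted_energy_def by (rule integral_mono[OF _ int le])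
qed

lemma truncated_pairing_le:
  assumes \<tau>: "0 \<le> \<tau>" and L2c: "L2c (weighted (s + \<alpha>) (w \<tau>))" and R: "0 < R"
  shows "\<bar>2 * weighted_inner (cutoff_weight s R) (advection (w \<tau>) (w \<tau>)) (w \<tau>)\<bar>
      \<le> commutator_const * sqrt initial_energy * (hnorm (s + \<alpha>) (w \<tau>))\<^sup>2"
proof -
  have "sqg_form (w \<tau>) (w \<tau>) (w \<tau>) < \<infinity>" by (rule le_less_trans[OF sqg_form_le[OF \<tau>]]) simp
  from commutator_pairing[OF w_measurable w_hermitian[OF \<tau>] Hs_L2c[OF \<tau>] L2c this R]
  have "\<bar>2 * weighted_inner (cutoff_weight s R) (advection (w \<tau>) (w \<tau>)) (w \<tau>)\<bar>
      \<le> commutator_const * hnorm s (w \<tau>) * (hnorm (s + \<alpha>) (w \<tau>))\<^sup>2" .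
  also have "\<dots> \<le> commutator_const * sqrt initial_energy * (hnorm (s + \<alpha>) (w \<tau>))\<^sup>2"
    by (intro mult_right_mono mult_left_mono norms_le \<tau>) auto
  finally show ?thesis .
qed

definition increment_const :: real where "increment_const = 2 + commutator_const * sqrt initial_energy"

lemma increment_const_nonneg: "0 \<le> increment_const"
  unfolding increment_const_def using commutator_const_nonneg by (intro add_nonneg_nonneg mult_nonneg_nonneg) auto

lemma truncated_energy_increment_le:
  assumes R: "0 < R" and rt: "0 \<le> r" "r \<le> t"
  shows "\<bar>weighted_energy (cutoff_weight s R) (w t) - weighted_energy (cutoff_weight s R) (w r)\<bar>
    \<le> increment_const * (LINT \<tau>:{r..t}|lborel. (hnorm (s + \<alpha>) (w \<tau>))\<^sup>2)"
proof -
  let ?E = "\<lambda>\<tau>. weighted_energy (\<lambda>\<xi>. cutoff_weight s R \<xi> * diss_symbol \<alpha> \<xi>) (w \<tau>)"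
    and ?G = "\<lambda>\<tau>. weighted_inner (cutoff_weight s R) (advection (w \<tau>) (w \<tau>)) (w \<tau>)" and ?D = "\<lambda>\<tau>. (hnorm (s + \<alpha>) (w \<tau>))\<^sup>2"
  note energy = energy_identity[OF rt truncated_energy_integrable[OF R rt(1)] truncated_energy_integrable[OF R order_trans[OF rt]]
      truncated_damping_integrable[OF R rt] truncated_force_integrable[OF R rt(1)]]
  have int: "set_integrable lborel {r..t} (\<lambda>\<tau>. 2 * ?E \<tau>)" "set_integrable lborel {r..t} (\<lambda>\<tau>. 2 * ?G \<tau>)"
    by (intro set_integrable_mult_right energy)+
  have "weighted_energy (cutoff_weight s R) (w t) - weighted_energy (cutoff_weight s R) (w r)
      = - (LINT \<tau>:{r..t}|lborel. 2 * ?E \<tau> + 2 * ?G \<tau>)"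
    unfolding set_integral_add(2)[OF int] set_integral_mult_right energy(3) by simp
  also have "\<bar>- (LINT \<tau>:{r..t}|lborel. 2 * ?E \<tau> + 2 * ?G \<tau>)\<bar> \<le> (LINT \<tau>:{r..t}|lborel. increment_const * ?D \<tau>)"
    unfolding abs_minus_cancel unfolding set_lebesgue_integral_def real_norm_def[symmetric]
  proof (rule order_trans[OF integral_norm_bound], rule integral_mono_AE)
    show "integrable lborel (\<lambda>\<tau>. norm (indicator {r..t} \<tau> *\<^sub>R (2 * ?E \<tau> + 2 * ?G \<tau>)))"
      using set_integral_add(1)[OF int] unfolding set_integrable_def by (rule integrable_norm)
    show "integrable lborel (\<lambda>\<tau>. indicator {r..t} \<tau> *\<^sub>R (increment_const * ?D \<tau>))"
      using set_integrable_mult_right[OF Hs_dissipation_integrable[OF rt(1)]] unfolding set_integrable_def by simp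
    show "AE \<tau> in lborel. norm (indicator {r..t} \<tau> *\<^sub>R (2 * ?E \<tau> + 2 * ?G \<tau>))
        \<le> indicator {r..t} \<tau> *\<^sub>R (increment_const * ?D \<tau>)"
      using AE_weighted_L2c
    proof eventually_elim
      case (elim \<tau>)
      show ?case
      proof (cases "\<tau> \<in> {r..t}")
        case True
        then have \<tau>: "0 \<le> \<tau>" "L2c (weighted (s + \<alpha>) (w \<tau>))" using rt elim by auto
        have "\<bar>2 * ?E \<tau> + 2 * ?G \<tau>\<bar> \<le> 2 * ?D \<tau> + commutator_const * sqrt initial_energy * ?D \<tau>"
          using truncated_damping_bounds[OF R \<tau>(2)] truncated_pairing_le[OF \<tau> R] by linarith
        then show ?thesis using True by (simp add: increment_const_def distrib_right)
      qed simp
    qed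
  qed
  finally show ?thesis unfolding set_integral_mult_right .
qed

lemma truncated_energy_tendsto:
  assumes t: "0 \<le> t" shows "(\<lambda>k. weighted_energy (cutoff_weight s (real (Suc k))) (w t)) \<longlonglongrightarrow> (hnorm s (w t))\<^sup>2"
  unfolding weighted_energy_powr[symmetric] weighted_energy_def
proof (rule integral_dominated_convergence)
  show "integrable lborel (\<lambda>\<xi>. norm \<xi> powr (2 * s) * (cmod (w t \<xi>))\<^sup>2)"
    using L2c_integrable[OF Hs_L2c[OF t]] unfolding cmod_weighted_square .
  show "AE \<xi> in lborel. norm (cutoff_weight s (real (Suc k)) \<xi> * (cmod (w t \<xi>))\<^sup>2)
      \<le> norm \<xi> powr (2 * s) * (cmod (w t \<xi>))\<^sup>2" for k
    by (rule AE_I2) (use cutoff_weight_le[of s "real (Suc k)"] s_bounds in \<open>auto simp: abs_mult intro!: mult_right_mono\<close>)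
  have "\<forall>\<^sub>F k in sequentially. cutoff_weight s (real (Suc k)) \<xi> * (cmod (w t \<xi>))\<^sup>2
      = norm \<xi> powr (2 * s) * (cmod (w t \<xi>))\<^sup>2" for \<xi>
  proof -
    obtain m :: nat where "norm \<xi> \<le> real m" using real_arch_simple by blast
    then show ?thesis by (intro eventually_sequentiallyI[of m]) (simp add: cutoff_weight_eq)
  qed
  then show "AE \<xi> in lborel. (\<lambda>k. cutoff_weight s (real (Suc k)) \<xi> * (cmod (w t \<xi>))\<^sup>2) \<longlonglongrightarrow> norm \<xi> powr (2 * s) * (cmod (w t \<xi>))\<^sup>2"
    by (intro AE_I2 tendsto_eventually)
qed auto

lemma hnorm_increment_le:
  assumes rt: "0 \<le> r" "r \<le> t"
  shows "\<bar>(hnorm s (w t))\<^sup>2 - (hnorm s (w r))\<^sup>2\<bar> \<le> increment_const * (LINT \<tau>:{r..t}|lborel. (hnorm (s + \<alpha>) (w \<tau>))\<^sup>2)"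
proof (rule LIMSEQ_le_const2)
  show "(\<lambda>k. \<bar>weighted_energy (cutoff_weight s (real (Suc k))) (w t) - weighted_energy (cutoff_weight s (real (Suc k))) (w r)\<bar>)
      \<longlonglongrightarrow> \<bar>(hnorm s (w t))\<^sup>2 - (hnorm s (w r))\<^sup>2\<bar>"
    using rt by (intro tendsto_rabs tendsto_diff truncated_energy_tendsto) auto
qed (use truncated_energy_increment_le[OF _ rt] in auto)

definition total_Hs_dissipation :: "real \<Rightarrow> real" where
  "total_Hs_dissipation t = integral {0..t} (\<lambda>\<tau>. (hnorm (s + \<alpha>) (w \<tau>))\<^sup>2)"

lemma Hs_dissipation_integral:
  assumes "0 \<le> r" "r \<le> t"
  shows "(LINT \<tau>:{r..t}|lborel. (hnorm (s + \<alpha>) (w \<tau>))\<^sup>2) = total_Hs_dissipation t - total_Hs_dissipation r"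
proof -
  let ?D = "\<lambda>\<tau>. (hnorm (s + \<alpha>) (w \<tau>))\<^sup>2"
  have "integral {0..r} ?D + integral {r..t} ?D = integral {0..t} ?D"
    by (rule Henstock_Kurzweil_Integration.integral_combine)
      (use assms set_borel_integral_eq_integral(1)[OF Hs_dissipation_integrable[of 0 t]] in auto)
  then show ?thesis
    using set_borel_integral_eq_integral(2)[OF Hs_dissipation_integrable[OF assms(1)]]
      unfolding total_Hs_dissipation_def by simp
qed

lemma total_Hs_dissipation_continuous: "continuous_on {0..} total_Hs_dissipation"
proof (rule continuous_on_eq_continuous_within[THEN iffD2], rule ballI)
  fix t :: real assume "t \<in> {0..}"
  then have t: "0 \<le> t" by simp
  have "continuous_on {0..t+1} total_Hs_dissipation"
    unfolding total_Hs_dissipation_def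
    by (rule indefinite_integral_continuous_1) (use set_borel_integral_eq_integral(1)[OF Hs_dissipation_integrable[of 0 "t + 1"]] in auto)
  then show "continuous (at t within {0..}) total_Hs_dissipation"
    unfolding at_within_Ici[OF t] using t by (simp add: continuous_on_eq_continuous_within)
qed

lemma hnorm_square_continuous: "continuous_on {0..} (\<lambda>t. (hnorm s (w t))\<^sup>2)"
  unfolding continuous_on_def
proof
  fix t :: real assume "t \<in> {0..}"
  then have t: "0 \<le> t" by simp
  let ?P = total_Hs_dissipation
  have "\<bar>(hnorm s (w r))\<^sup>2 - (hnorm s (w t))\<^sup>2\<bar> \<le> increment_const * \<bar>?P r - ?P t\<bar>" if r: "0 \<le> r" for r
  proof (cases "r \<le> t")
    case True
    then show ?thesis
      using hnorm_increment_le[OF r True] increment_const_nonneg mult_left_mono[of "?P t - ?P r" "\<bar>?P r - ?P t\<bar>" increment_const]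
      unfolding Hs_dissipation_integral[OF r True] by linarith
  next
    case False
    then have tr: "t \<le> r" by simp
    then show ?thesis
      using hnorm_increment_le[OF t tr] increment_const_nonneg mult_left_mono[of "?P r - ?P t" "\<bar>?P r - ?P t\<bar>" increment_const]
      unfolding Hs_dissipation_integral[OF t tr] by linarith
  qed
  then have bound: "\<forall>\<^sub>F r in at t within {0..}. norm ((hnorm s (w r))\<^sup>2 - (hnorm s (w t))\<^sup>2)
      \<le> increment_const * \<bar>?P r - ?P t\<bar>"
    unfolding eventually_at_filter by (intro always_eventually) simp
  have "(?P \<longlongrightarrow> ?P t) (at t within {0..})" using total_Hs_dissipation_continuous t by (simp add: continuous_on_def)
  then have "((\<lambda>r. increment_const * \<bar>?P r - ?P t\<bar>) \<longlongrightarrow> 0) (at t within {0..})"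
    by (intro tendsto_mult_right_zero tendsto_rabs_zero) (rule LIM_zero)
  with bound show "((\<lambda>t. (hnorm s (w t))\<^sup>2) \<longlongrightarrow> (hnorm s (w t))\<^sup>2) (at t within {0..})"
    by (rule tendsto_of_norm_diff_le)
qed

theorem Hs_continuous:
  assumes t: "0 \<le> t"
  shows "((\<lambda>\<tau>. L2norm (\<lambda>\<xi>. weighted s (w \<tau>) \<xi> - weighted s (w t) \<xi>)) \<longlongrightarrow> 0) (at t within {0..})"
  unfolding tendsto_at_iff_sequentially comp_def
proof (intro allI impI)
  fix X :: "nat \<Rightarrow> real" assume X: "\<forall>i. X i \<in> {0..} - {t}" and X_lim: "X \<longlonglongrightarrow> t"
  have X_nonneg: "0 \<le> X i" for i using X by auto
  have compose: "(\<lambda>i. g (X i)) \<longlonglongrightarrow> g t" if "continuous_on {0..} g" for g :: "real \<Rightarrow> 'b::topological_space"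
    by (rule continuous_on_tendsto_compose[OF that X_lim]) (use t X_nonneg in auto)
  show "(\<lambda>i. L2norm (\<lambda>\<xi>. weighted s (w (X i)) \<xi> - weighted s (w t) \<xi>)) \<longlonglongrightarrow> 0"
  proof (rule L2_tendsto_if_norm_tendsto[OF Hs_L2c[OF X_nonneg] Hs_L2c[OF t] _ compose[OF hnorm_square_continuous]])
    show "(\<lambda>i. weighted s (w (X i)) \<xi>) \<longlonglongrightarrow> weighted s (w t) \<xi>" for \<xi>
      unfolding weighted_def by (intro tendsto_intros compose y_continuous)
  qed
qed

lemma Hs_dissipation_integrable_Ici: "set_integrable lborel {0..} (\<lambda>\<tau>. (hnorm (s + \<alpha>) (w \<tau>))\<^sup>2)"
  unfolding set_integrable_def
proof (rule integrableI_nonneg)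
  let ?D = "\<lambda>\<tau>. (hnorm (s + \<alpha>) (w \<tau>))\<^sup>2"
  have "(\<integral>\<^sup>+\<tau>. ennreal (indicator {0..} \<tau> *\<^sub>R ?D \<tau>) \<partial>lborel) \<le> ennreal initial_energy"
  proof (rule nn_integral_Fatou)
    have "\<forall>\<^sub>F k in sequentially. ennreal (indicator {0..real k} \<tau> *\<^sub>R ?D \<tau>)
        = ennreal (indicator {0..} \<tau> *\<^sub>R ?D \<tau>)" for \<tau>
    proof -
      obtain m :: nat where "\<tau> \<le> real m" using real_arch_simple by blast
      then show ?thesis by (intro eventually_sequentiallyI[of m]) (auto simp: indicator_def)
    qed
    then show "AE \<tau> in lborel. (\<lambda>k. ennreal (indicator {0..real k} \<tau> *\<^sub>R ?D \<tau>)) \<longlonglongrightarrow> ennreal (indicator {0..} \<tau> *\<^sub>R ?D \<tau>)"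
      by (intro AE_I2 tendsto_eventually)
    have "(\<integral>\<^sup>+\<tau>. ennreal (indicator {0..real k} \<tau> *\<^sub>R ?D \<tau>) \<partial>lborel) \<le> ennreal initial_energy" for k
    proof -
      have "(\<integral>\<^sup>+\<tau>. ennreal (indicator {0..real k} \<tau> *\<^sub>R ?D \<tau>) \<partial>lborel) = ennreal (LINT \<tau>:{0..real k}|lborel. ?D \<tau>)"
        unfolding set_lebesgue_integral_def
          using Hs_dissipation_integrable[of 0 "real k"] by (intro nn_integral_eq_integral) (auto simp: set_integrable_def)
      also have "(LINT \<tau>:{0..real k}|lborel. ?D \<tau>) \<le> (LINT \<tau>:{0..real k}|lborel. (hnorm \<alpha> (w \<tau>))\<^sup>2 + ?D \<tau>)"
        by (intro set_integral_mono Hs_dissipation_integrable energy_inequality(1)) auto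
      also have "\<dots> \<le> initial_energy"
        using energy_inequality(2)[of "real k"] zero_le_power2[of "L2norm (w (real k))"] zero_le_power2[of "hnorm s (w (real k))"] by linarith
      finally show ?thesis by (simp add: ennreal_leI)
    qed
    then show "\<forall>\<^sub>F k in sequentially. (\<integral>\<^sup>+\<tau>. ennreal (indicator {0..real k} \<tau> *\<^sub>R ?D \<tau>) \<partial>lborel)
        \<le> ennreal initial_energy"
      by simp
  qed measurable
  also have "\<dots> < \<infinity>" by simp
  finally show "(\<integral>\<^sup>+\<tau>. ennreal (indicator {0..} \<tau> *\<^sub>R ?D \<tau>) \<partial>lborel) < \<infinity>" .
qed auto

end

section \<open>Back to physical space\<close>

lemma FTL2_measurable: "L2c f \<Longrightarrow> FTL2 f \<in> borel_measurable borel"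
  using L2c_measurable[OF is_FT_L2c(2)[OF FTL2_is_FT]] by simp

lemma FTL2_weighted_energy:
  assumes f: "is_FT f g" and [measurable]: "m \<in> borel_measurable borel"
  shows "weighted_energy m (FTL2 f) = weighted_energy m g"
    and "integrable lborel (\<lambda>\<xi>. m \<xi> * (cmod (FTL2 f \<xi>))\<^sup>2) \<longleftrightarrow> integrable lborel (\<lambda>\<xi>. m \<xi> * (cmod (g \<xi>))\<^sup>2)"
proof -
  note [measurable] = FTL2_measurable[OF is_FT_L2c(1)[OF f]] L2c_measurable[OF is_FT_L2c(2)[OF f]]
  have AE: "AE \<xi> in lborel. m \<xi> * (cmod (FTL2 f \<xi>))\<^sup>2 = m \<xi> * (cmod (g \<xi>))\<^sup>2"
    using is_FT_FTL2[OF f] by eventually_elim simp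
  show "weighted_energy m (FTL2 f) = weighted_energy m g"
    unfolding weighted_energy_def by (rule integral_cong_AE[OF _ _ AE]) auto
  show "integrable lborel (\<lambda>\<xi>. m \<xi> * (cmod (FTL2 f \<xi>))\<^sup>2) \<longleftrightarrow> integrable lborel (\<lambda>\<xi>. m \<xi> * (cmod (g \<xi>))\<^sup>2)"
    by (rule integrable_cong_AE[OF _ _ AE]) auto
qed

lemma hdot_norm_sq_is_FT: "is_FT f g \<Longrightarrow> hdot_norm_sq r f = plancherel_const * (hnorm r g)\<^sup>2"
  unfolding hdot_norm_sq_def weighted_energy_def[symmetric] plancherel_const_def weighted_energy_powr[symmetric]
  by (simp add: FTL2_weighted_energy(1))

lemma sob_norm_sq_is_FT: "is_FT f g \<Longrightarrow> sob_norm_sq r f = plancherel_const * ((L2norm g)\<^sup>2 + (hnorm r g)\<^sup>2)"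
  unfolding sob_norm_sq_def
  by (simp add: hdot_norm_sq_is_FT is_FT_L2norm L2norm_squared[symmetric] plancherel_const_def power_mult_distrib distrib_left)

lemma L2c_weighted_iff:
  assumes [measurable]: "g \<in> borel_measurable borel"
  shows "L2c (weighted r g) \<longleftrightarrow> integrable lborel (\<lambda>\<xi>. norm \<xi> powr (2 * r) * (cmod (g \<xi>))\<^sup>2)"
  unfolding L2c_def cmod_weighted_square by simp

lemma in_Hdot_iff: "is_FT f g \<Longrightarrow> in_Hdot r f \<longleftrightarrow> L2c (weighted r g)"
  unfolding in_Hdot_def using L2c_weighted_iff[OF L2c_measurable[OF is_FT_L2c(2)]] FTL2_weighted_energy(2) by auto

lemma power2_powr: "0 \<le> x \<Longrightarrow> (x\<^sup>2) powr r = x powr (2 * r)" for x :: real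
  by (cases "x = 0") (auto simp: powr_powr[symmetric] powr_numeral)

lemma bessel_weight_bounds:
  assumes r: "0 \<le> r"
  shows "norm \<xi> powr (2 * r) \<le> (1 + (norm \<xi>)\<^sup>2) powr r"
    and "(1 + (norm \<xi>)\<^sup>2) powr r \<le> 2 powr r * (1 + norm \<xi> powr (2 * r))"
proof -
  show "norm \<xi> powr (2 * r) \<le> (1 + (norm \<xi>)\<^sup>2) powr r"
    using r by (subst power2_powr[symmetric]) (auto intro: powr_mono2)
  have "(1 + (norm \<xi>)\<^sup>2) powr r \<le> (2 * max 1 ((norm \<xi>)\<^sup>2)) powr r" using r by (intro powr_mono2) auto
  also have "\<dots> = 2 powr r * (max 1 ((norm \<xi>)\<^sup>2)) powr r" by (simp add: powr_mult)
  also have "(max 1 ((norm \<xi>)\<^sup>2)) powr r \<le> 1 + norm \<xi> powr (2 * r)" by (auto simp: max_def power2_powr)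
  finally show "(1 + (norm \<xi>)\<^sup>2) powr r \<le> 2 powr r * (1 + norm \<xi> powr (2 * r))" by simp
qed

lemma in_H_iff:
  assumes f: "is_FT f g" and r: "0 \<le> r" shows "in_H r f \<longleftrightarrow> L2c (weighted r g)"
proof -
  note g = is_FT_L2c(2)[OF f]
  note [measurable] = L2c_measurable[OF g]
  let ?bessel = "\<lambda>\<xi>. (1 + (norm \<xi>)\<^sup>2) powr r * (cmod (g \<xi>))\<^sup>2" and ?riesz = "\<lambda>\<xi>. norm \<xi> powr (2 * r) * (cmod (g \<xi>))\<^sup>2"
  have "integrable lborel ?riesz" if "integrable lborel ?bessel"
    by (rule Bochner_Integration.integrable_bound[OF that]) (auto simp: abs_mult intro!: mult_right_mono bessel_weight_bounds r)
  moreover have "integrable lborel ?bessel" if "integrable lborel ?riesz"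
  proof (rule Bochner_Integration.integrable_bound)
    show "integrable lborel (\<lambda>\<xi>. 2 powr r * ((cmod (g \<xi>))\<^sup>2 + ?riesz \<xi>))" using L2c_integrable[OF g] that by auto
    have "?bessel \<xi> \<le> 2 powr r * ((cmod (g \<xi>))\<^sup>2 + ?riesz \<xi>)" for \<xi>
      using mult_right_mono[OF bessel_weight_bounds(2)[OF r, of \<xi>], of "(cmod (g \<xi>))\<^sup>2"] by (simp add: algebra_simps)
    then show "AE \<xi> in lborel. norm (?bessel \<xi>) \<le> norm (2 powr r * ((cmod (g \<xi>))\<^sup>2 + ?riesz \<xi>))" by (intro AE_I2) simp
  qed simp
  ultimately have "integrable lborel ?bessel \<longleftrightarrow> integrable lborel ?riesz" by blast
  then show ?thesis unfolding in_H_def using f by (auto simp: L2c_weighted_iff FTL2_weighted_energy(2)[OF f])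
qed

lemma fmult_is_FT:
  assumes f: "is_FT f g" and [measurable]: "m \<in> borel_measurable borel" and mg: "L2c (\<lambda>\<xi>. m \<xi> * g \<xi>)"
  shows "is_FT (fmult m f) (\<lambda>\<xi>. m \<xi> * g \<xi>)"
proof -
  note [measurable] = FTL2_measurable[OF is_FT_L2c(1)[OF f]] L2c_measurable[OF is_FT_L2c(2)[OF f]]
  have AE: "AE \<xi> in lborel. m \<xi> * g \<xi> = m \<xi> * FTL2 f \<xi>" using is_FT_FTL2[OF f] by eventually_elim simp
  have "L2c (\<lambda>\<xi>. m \<xi> * FTL2 f \<xi>)" by (rule L2c_cong_AE[OF mg _ AE]) simp
  then have FT: "is_FT (fmult m f) (\<lambda>\<xi>. m \<xi> * FTL2 f \<xi>)"
    unfolding fmult_def by (rule someI_ex[OF is_FT_inverse_exists])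
  note [measurable] = L2c_measurable[OF is_FT_L2c(1)[OF FT]]
  show ?thesis by (rule is_FT_cong_AE[OF FT]) (use AE in auto)
qed

lemma fmult_is_FT_if_symbol_le:
  assumes f: "is_FT f g" and m [measurable]: "m \<in> borel_measurable borel" and symbol: "\<And>\<xi>. cmod (m \<xi>) \<le> norm \<xi> powr r"
    and g: "L2c (weighted r g)"
  shows "is_FT (fmult m f) (\<lambda>\<xi>. m \<xi> * g \<xi>)"
proof (rule fmult_is_FT[OF f m])
  note [measurable] = L2c_measurable[OF is_FT_L2c(2)[OF f]]
  show "L2c (\<lambda>\<xi>. m \<xi> * g \<xi>)"
    by (rule L2c_mono(1)[OF g, where B=1]) (auto simp: cmod_weighted norm_mult intro!: mult_right_mono symbol)
qed

lemma Dpow_is_FT: "is_FT f g \<Longrightarrow> L2c (weighted r g) \<Longrightarrow> is_FT (Dpow r f) (weighted r g)"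
  unfolding Dpow_def weighted_def[abs_def] by (rule fmult_is_FT) auto

lemma weighted_weighted: "weighted r (weighted q f) = weighted (r + q) f"
  by (rule ext) (simp add: weighted_def powr_add)

lemma L2c_mult_testc_integrable:
  assumes f: "L2c f" and g: "L2c g" and \<phi>: "testc \<phi>" shows "integrable lborel (\<lambda>x. f x * g x * \<phi> x)"
proof -
  note [measurable] = L2c_measurable[OF f] L2c_measurable[OF g] testc_measurable[OF \<phi>]
  obtain B where B: "0 < B" "\<And>x. cmod (\<phi> x) \<le> B" using testc_bound[OF \<phi>] by metis
  have "integrable lborel (\<lambda>x. f x * g x * complex_of_real B)" by (intro integrable_mult_left L2c_mult_integrable f g)
  then show ?thesis
    by (rule Bochner_Integration.integrable_bound) (use B in \<open>auto simp: norm_mult intro!: mult_left_mono\<close>)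
qed

text \<open>At the origin these symbols are \<open>0 / 0 = 0\<close>, so they are bounded there by \<open>norm 0 powr 0\<close>, which is \<open>0\<close> as well.\<close>

definition velocity_symbol :: "2 \<Rightarrow> pt \<Rightarrow> complex" where
  "velocity_symbol j \<xi> = (if j = 1 then - \<i> * complex_of_real (\<xi> $ 2 / norm \<xi>) else \<i> * complex_of_real (\<xi> $ 1 / norm \<xi>))"

definition gradient_symbol :: "2 \<Rightarrow> pt \<Rightarrow> complex" where
  "gradient_symbol j \<xi> = \<i> * complex_of_real (\<xi> $ j)"

lemma symbols_measurable [measurable]:
  "velocity_symbol j \<in> borel_measurable borel" "gradient_symbol j \<in> borel_measurable borel"
  unfolding velocity_symbol_def[abs_def] gradient_symbol_def[abs_def] by (cases "j = 1"; simp)+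

lemma sqg_velocity_eq_fmult: "sqg_u1 f = fmult (velocity_symbol 1) f" "sqg_u2 f = fmult (velocity_symbol 2) f"
  unfolding sqg_u1_def sqg_u2_def velocity_symbol_def by simp_all

lemma pderiv2_eq_fmult: "pderiv2 j f = fmult (gradient_symbol j) f"
  unfolding pderiv2_def gradient_symbol_def ..

lemma velocity_symbol_le: "cmod (velocity_symbol j \<xi>) \<le> norm \<xi> powr 0"
  using component_le_norm_cart[of \<xi> 1] component_le_norm_cart[of \<xi> 2]
  by (cases "\<xi> = 0") (auto simp: velocity_symbol_def norm_mult norm_divide divide_le_eq_1)

lemma gradient_symbol_le: "cmod (gradient_symbol j \<xi>) \<le> norm \<xi> powr 1"
  using component_le_norm_cart[of \<xi> j] by (simp add: gradient_symbol_def norm_mult)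

lemma sqg_kernel_eq_symbols:
  "complex_of_real (sqg_kernel \<xi> \<eta>)
      = velocity_symbol 1 (\<xi> - \<eta>) * gradient_symbol 1 \<eta> + velocity_symbol 2 (\<xi> - \<eta>) * gradient_symbol 2 \<eta>"
proof -
  have "sqg_kernel \<xi> \<eta> = ((\<xi> - \<eta>) $ 2 * \<eta> $ 1 - (\<xi> - \<eta>) $ 1 * \<eta> $ 2) / norm (\<xi> - \<eta>)"
    unfolding sqg_kernel_def by (simp add: algebra_simps)
  then show ?thesis
    by (simp add: velocity_symbol_def gradient_symbol_def complex_eq_iff diff_divide_distrib left_diff_distrib)
qed

definition transport_density :: "2 \<Rightarrow> (pt \<Rightarrow> complex) \<Rightarrow> pt \<Rightarrow> pt \<Rightarrow> complex" where
  "transport_density j a \<xi> \<eta> = (velocity_symbol j (\<xi> - \<eta>) * a (\<xi> - \<eta>)) * (gradient_symbol j \<eta> * a \<eta>)"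

definition sqg_operator :: "real \<Rightarrow> (pt \<Rightarrow> complex) \<Rightarrow> pt \<Rightarrow> complex" where
  "sqg_operator \<alpha> f x = Dpow (2 * \<alpha>) f x + sqg_u1 f x * pderiv2 1 f x + sqg_u2 f x * pderiv2 2 f x"

definition fourier_sqg_operator :: "real \<Rightarrow> (pt \<Rightarrow> complex) \<Rightarrow> pt \<Rightarrow> complex" where
  "fourier_sqg_operator \<alpha> a \<xi> = complex_of_real (diss_symbol \<alpha> \<xi>) * a \<xi> + advection a a \<xi>"

context sqg_exponents
begin

lemma test_bound_exists: "\<exists>C. gradient_bound (2 * \<alpha>) s 0 C"
  by (rule gradient_bound_exists) (use s_eq \<alpha>_pos \<alpha>_less_half in auto)

lemma L2c_weighted_0: "L2c d \<Longrightarrow> L2c (weighted 0 d)"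
  by (rule L2c_mono(1)[where f=d and B=1]) (auto simp: weighted_def norm_mult mult_le_cancel_right1 dest: L2c_measurable)

context
  fixes f a \<phi> :: "pt \<Rightarrow> complex"
  assumes f: "is_FT f a" and a_Hs: "L2c (weighted s a)" and \<phi>: "testc \<phi>"
begin

lemma a_weighted_L2c: "0 \<le> r \<Longrightarrow> r \<le> s \<Longrightarrow> L2c (weighted r a)"
  using weighted_interpolation(1)[OF is_FT_L2c(2)[OF f] a_Hs] by blast

lemma a_measurable [measurable]: "a \<in> borel_measurable borel"
  using L2c_measurable[OF is_FT_L2c(2)[OF f]] by simp

lemma test_L2c: "L2c (\<lambda>\<xi>. fourier \<phi> (- \<xi>))"
  by (rule L2c_uminus_arg) (rule plancherel_testc(1)[OF \<phi>])

lemma test_measurable [measurable]: "(\<lambda>\<xi>. fourier \<phi> (- \<xi>)) \<in> borel_measurable borel"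
  using L2c_measurable[OF test_L2c] by simp

lemma Dpow_is_FT_a: "is_FT (Dpow (2 * \<alpha>) f) (weighted (2 * \<alpha>) a)"
  by (intro Dpow_is_FT f a_weighted_L2c) (use \<alpha>_pos \<alpha>_less_half s_bounds in auto)

lemma velocity_is_FT: "is_FT (fmult (velocity_symbol j) f) (\<lambda>\<xi>. velocity_symbol j \<xi> * a \<xi>)"
  by (rule fmult_is_FT_if_symbol_le[OF f _ velocity_symbol_le a_weighted_L2c]) (use s_bounds in auto)

lemma pderiv2_is_FT: "is_FT (pderiv2 j f) (\<lambda>\<xi>. gradient_symbol j \<xi> * a \<xi>)"
  unfolding pderiv2_eq_fmult by (rule fmult_is_FT_if_symbol_le[OF f _ gradient_symbol_le a_weighted_L2c]) (use s_bounds in auto)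

lemma transport_density_integrable: "integrable lborel2 (\<lambda>(\<xi>, \<eta>). transport_density j a \<xi> \<eta> * fourier \<phi> (- \<xi>))"
proof (rule integrableI_bounded)
  let ?d = "\<lambda>\<xi>. fourier \<phi> (- \<xi>)"
  show "(\<lambda>(\<xi>, \<eta>). transport_density j a \<xi> \<eta> * ?d \<xi>) \<in> borel_measurable lborel2"
    unfolding transport_density_def by measurable
  obtain C where C: "gradient_bound (2 * \<alpha>) s 0 C" using test_bound_exists by blast
  have "cmod (transport_density j a \<xi> \<eta> * ?d \<xi>) \<le> \<bar>norm \<eta>\<bar> * cmod (a (\<xi> - \<eta>)) * cmod (a \<eta>) * cmod (?d \<xi>)" for \<xi> \<eta>
  proof -
    have "cmod (velocity_symbol j (\<xi> - \<eta>)) \<le> 1" using order_trans[OF velocity_symbol_le[of j "\<xi> - \<eta>"], of 1] by simp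
    then have "cmod (velocity_symbol j (\<xi> - \<eta>)) * cmod (gradient_symbol j \<eta>) \<le> 1 * norm \<eta>"
      using gradient_symbol_le[of j \<eta>] by (intro mult_mono) auto
    then have "(cmod (velocity_symbol j (\<xi> - \<eta>)) * cmod (gradient_symbol j \<eta>)) * (cmod (a (\<xi> - \<eta>)) * cmod (a \<eta>) * cmod (?d \<xi>))
        \<le> norm \<eta> * (cmod (a (\<xi> - \<eta>)) * cmod (a \<eta>) * cmod (?d \<xi>))" by (intro mult_right_mono) auto
    then show ?thesis by (simp add: transport_density_def norm_mult mult_ac)
  qed
  then have "(\<integral>\<^sup>+p. ennreal (norm (case p of (\<xi>, \<eta>) \<Rightarrow> transport_density j a \<xi> \<eta> * ?d \<xi>)) \<partial>lborel2)
      \<le> gradient_form a a ?d"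
    by (intro nn_integral_mono) (auto intro!: ennreal_leI)
  also have "\<dots> \<le> ennreal (C * hnorm (2 * \<alpha>) a * hnorm s a * hnorm 0 ?d)"
    by (intro gradient_boundD[OF C] a_weighted_L2c L2c_weighted_0 test_L2c) (use \<alpha>_pos \<alpha>_less_half s_bounds in auto)
  also have "\<dots> < \<infinity>" by simp
  finally show "(\<integral>\<^sup>+p. ennreal (norm (case p of (\<xi>, \<eta>) \<Rightarrow> transport_density j a \<xi> \<eta> * ?d \<xi>)) \<partial>lborel2) < \<infinity>" .
qed

lemma transport_pairing_integrable: "integrable lborel (\<lambda>\<xi>. (LINT \<eta>|lborel. transport_density j a \<xi> \<eta>) * fourier \<phi> (- \<xi>))"
  using lborel_pair.integrable_fst[OF transport_density_integrable[of j]] by simp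

lemma transport_pairing:
  "integrable lborel (\<lambda>x. fmult (velocity_symbol j) f x * pderiv2 j f x * \<phi> x)"
  "(LINT x|lborel. fmult (velocity_symbol j) f x * pderiv2 j f x * \<phi> x) = complex_of_real plancherel_const *
    (complex_of_real plancherel_const * (LINT \<xi>|lborel. (LINT \<eta>|lborel. transport_density j a \<xi> \<eta>) * fourier \<phi> (- \<xi>)))"
  using L2c_mult_testc_integrable[OF is_FT_L2c(1)[OF velocity_is_FT] is_FT_L2c(1)[OF pderiv2_is_FT] \<phi>, of j j]
    product_fourier[OF velocity_is_FT pderiv2_is_FT \<phi>, of j j] transport_density_integrable[of j]
  unfolding transport_density_def by blast+

lemma advection_eq_transport:
  "advection a a \<xi> = complex_of_real plancherel_const *
    ((LINT \<eta>|lborel. transport_density 1 a \<xi> \<eta>) + (LINT \<eta>|lborel. transport_density 2 a \<xi> \<eta>))"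
proof -
  have "integrable lborel (\<lambda>\<eta>. transport_density j a \<xi> \<eta>)" for j
    unfolding transport_density_def
    using L2_reflect(1)[OF is_FT_L2c(2)[OF velocity_is_FT], of j \<xi>] is_FT_L2c(2)[OF pderiv2_is_FT]
      by (rule L2c_mult_integrable)
  from Bochner_Integration.integral_add[OF this[of 1] this[of 2]] show ?thesis
    unfolding advection_def sqg_kernel_eq_symbols by (simp add: transport_density_def algebra_simps)
qed

lemma advection_pairing:
  "integrable lborel (\<lambda>\<xi>. advection a a \<xi> * fourier \<phi> (- \<xi>))"
  "(LINT \<xi>|lborel. advection a a \<xi> * fourier \<phi> (- \<xi>)) = complex_of_real plancherel_const *
    ((LINT \<xi>|lborel. (LINT \<eta>|lborel. transport_density 1 a \<xi> \<eta>) * fourier \<phi> (- \<xi>))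
      + (LINT \<xi>|lborel. (LINT \<eta>|lborel. transport_density 2 a \<xi> \<eta>) * fourier \<phi> (- \<xi>)))"
  using transport_pairing_integrable[of 1] transport_pairing_integrable[of 2]
  unfolding advection_eq_transport by (simp_all add: distrib_right mult.assoc)

theorem sqg_operator_pairing:
  "(LINT x|lborel. sqg_operator \<alpha> f x * \<phi> x)
    = complex_of_real plancherel_const * (LINT \<xi>|lborel. fourier_sqg_operator \<alpha> a \<xi> * fourier \<phi> (- \<xi>))"
proof -
  let ?c = "complex_of_real plancherel_const" and ?d = "\<lambda>\<xi>. fourier \<phi> (- \<xi>)"
  have damping: "integrable lborel (\<lambda>x. Dpow (2 * \<alpha>) f x * \<phi> x)" "integrable lborel (\<lambda>\<xi>. weighted (2 * \<alpha>) a \<xi> * ?d \<xi>)"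
    using is_FT_L2c[OF Dpow_is_FT_a] by (auto intro!: L2c_mult_integrable testc_L2c \<phi> test_L2c)
  have "(LINT x|lborel. sqg_operator \<alpha> f x * \<phi> x)
      = (LINT x|lborel. Dpow (2 * \<alpha>) f x * \<phi> x) + (LINT x|lborel. sqg_u1 f x * pderiv2 1 f x * \<phi> x) + (LINT x|lborel. sqg_u2 f x * pderiv2 2 f x * \<phi> x)"
    unfolding sqg_operator_def sqg_velocity_eq_fmult using damping(1) transport_pairing(1) by (simp add: distrib_right)
  also have "\<dots> = ?c * ((LINT \<xi>|lborel. weighted (2 * \<alpha>) a \<xi> * ?d \<xi>) + (LINT \<xi>|lborel. advection a a \<xi> * ?d \<xi>))"
    unfolding sqg_velocity_eq_fmult transport_pairing(2) advection_pairing(2)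
      parseval_mult[OF Dpow_is_FT_a testc_L2c[OF \<phi>] testc_integrable[OF \<phi>]] by (simp only: distrib_left add.assoc)
  also have "\<dots> = ?c * (LINT \<xi>|lborel. fourier_sqg_operator \<alpha> a \<xi> * ?d \<xi>)"
    unfolding Bochner_Integration.integral_add[OF damping(2) advection_pairing(1), symmetric]
    by (simp add: fourier_sqg_operator_def weighted_def diss_symbol_def distrib_right)
  finally show ?thesis .
qed

end

end

context fourier_sqg
begin

lemma jointly_borel_operator: "jointly_borel (\<lambda>\<tau>. fourier_sqg_operator \<alpha> (w \<tau>))"
proof -
  note [measurable (raw)] = measurable_pair_apply[OF jointly_borel_w] measurable_pair_apply[OF jointly_borel_advection[OF jointly_borel_w]]
  show ?thesis unfolding fourier_sqg_operator_def by measurable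
qed

lemma operator_pairing_bounded:
  assumes d: "L2c d"
  shows "\<exists>B. \<forall>\<tau>\<ge>0. (\<integral>\<^sup>+\<xi>. ennreal (cmod (fourier_sqg_operator \<alpha> (w \<tau>) \<xi> * d \<xi>)) \<partial>lborel) \<le> ennreal B"
proof -
  have [measurable]: "d \<in> borel_measurable borel" using L2c_measurable[OF d] by simp
  obtain C where C: "gradient_bound (2 * \<alpha>) s 0 C" using test_bound_exists by blast
  then have "0 \<le> C" by (simp add: gradient_bound_def)
  let ?B = interpolated_bound
  have "(\<integral>\<^sup>+\<xi>. ennreal (cmod (fourier_sqg_operator \<alpha> (w \<tau>) \<xi> * d \<xi>)) \<partial>lborel)
      \<le> ennreal (?B * L2norm d + C * ?B * ?B * hnorm 0 d)"
    if \<tau>: "0 \<le> \<tau>" for \<tau>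
  proof -
    have exponents: "0 \<le> 2 * \<alpha>" "2 * \<alpha> \<le> s" using \<alpha>_pos \<alpha>_less_half s_bounds by auto
    note damping = weighted_bound[OF \<tau> exponents]
    note [measurable] = advection_measurable[OF w_measurable w_measurable, of \<tau> \<tau>] jointly_borel_slice[OF jointly_borel_operator, of \<tau>]
    have "cmod (fourier_sqg_operator \<alpha> (w \<tau>) \<xi> * d \<xi>)
        \<le> cmod (weighted (2 * \<alpha>) (w \<tau>) \<xi>) * cmod (d \<xi>) + cmod (advection (w \<tau>) (w \<tau>) \<xi>) * cmod (d \<xi>)" for \<xi>
      unfolding fourier_sqg_operator_def weighted_def diss_symbol_def norm_mult distrib_right[symmetric]
      by (intro mult_right_mono order_trans[OF norm_triangle_ineq]) (auto simp: norm_mult)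
    then have "(\<integral>\<^sup>+\<xi>. ennreal (cmod (fourier_sqg_operator \<alpha> (w \<tau>) \<xi> * d \<xi>)) \<partial>lborel)
        \<le> (\<integral>\<^sup>+\<xi>. ennreal (cmod (weighted (2 * \<alpha>) (w \<tau>) \<xi>) * cmod (d \<xi>)) + ennreal (cmod (advection (w \<tau>) (w \<tau>) \<xi>) * cmod (d \<xi>)) \<partial>lborel)"
      by (intro nn_integral_mono) (simp add: ennreal_plus[symmetric] ennreal_leI del: ennreal_plus)
    also have "\<dots> = (\<integral>\<^sup>+\<xi>. ennreal (cmod (weighted (2 * \<alpha>) (w \<tau>) \<xi>) * cmod (d \<xi>)) \<partial>lborel)
        + (\<integral>\<^sup>+\<xi>. ennreal (cmod (advection (w \<tau>) (w \<tau>) \<xi>) * cmod (d \<xi>)) \<partial>lborel)" by (rule nn_integral_add) auto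
    also have "\<dots> \<le> ennreal (?B * L2norm d) + ennreal (C * ?B * ?B * hnorm 0 d)"
    proof (rule add_mono)
      show "(\<integral>\<^sup>+\<xi>. ennreal (cmod (weighted (2 * \<alpha>) (w \<tau>) \<xi>) * cmod (d \<xi>)) \<partial>lborel) \<le> ennreal (?B * L2norm d)"
        by (rule order_trans[OF L2_Cauchy_Schwarz_nn[OF damping(1) d]]) (intro ennreal_leI mult_right_mono damping(2), simp)
      have "sqg_form (w \<tau>) (w \<tau>) d \<le> ennreal (C * hnorm (2 * \<alpha>) (w \<tau>) * hnorm s (w \<tau>) * hnorm 0 d)"
        by (rule order_trans[OF sqg_form_le_gradient_form gradient_boundD[OF C damping(1) Hs_L2c[OF \<tau>] L2c_weighted_0[OF d]]])
      also have "\<dots> \<le> ennreal (C * ?B * ?B * hnorm 0 d)"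
        using \<open>0 \<le> C\<close> s_bounds by (intro ennreal_leI mult_mono weighted_bound(2) \<tau> exponents mult_nonneg_nonneg) auto
      finally show "(\<integral>\<^sup>+\<xi>. ennreal (cmod (advection (w \<tau>) (w \<tau>) \<xi>) * cmod (d \<xi>)) \<partial>lborel)
          \<le> ennreal (C * ?B * ?B * hnorm 0 d)"
        by (intro order_trans[OF nn_integral_advection_le]) auto
    qed
    finally show ?thesis using \<open>0 \<le> C\<close> by simp
  qed
  then show ?thesis by blast
qed

lemma operator_time_integral:
  assumes t: "0 \<le> t"
  shows "(LINT \<tau>|lborel. indicator {0..t} \<tau> *\<^sub>R fourier_sqg_operator \<alpha> (w \<tau>) \<xi>) = w0 \<xi> - w t \<xi>"
proof -
  have "(LINT \<tau>|lborel. indicator {0..t} \<tau> *\<^sub>R fourier_sqg_operator \<alpha> (w \<tau>) \<xi>) = - w t \<xi> - (- w 0 \<xi>)"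
  proof (rule integral_FTC_Icc[OF t])
    show "continuous_on {0..t} (\<lambda>\<tau>. fourier_sqg_operator \<alpha> (w \<tau>) \<xi>)" unfolding fourier_sqg_operator_def
      by (intro continuous_intros continuous_on_subset[OF y_continuous] continuous_on_subset[OF advection_w_continuous]) auto
    fix \<tau> assume \<tau>: "0 \<le> \<tau>" "\<tau> \<le> t"
    have "((\<lambda>\<tau>. - w \<tau> \<xi>) has_vector_derivative - (- complex_of_real (diss_symbol \<alpha> \<xi>) * w \<tau> \<xi> - advection (w \<tau>) (w \<tau>) \<xi>)) (at \<tau> within {0..t})"
      by (intro has_vector_derivative_minus has_vector_derivative_within_subset[OF y_has_vector_derivative[OF \<tau>(1)]]) auto
    then show "((\<lambda>\<tau>. - w \<tau> \<xi>) has_vector_derivative fourier_sqg_operator \<alpha> (w \<tau>) \<xi>) (at \<tau> within {0..t})"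
      unfolding fourier_sqg_operator_def by (simp add: add.commute)
  qed
  then show ?thesis by (simp add: w_0)
qed

lemma operator_pairing_time_integral:
  assumes t: "0 \<le> t" and d: "L2c d"
  shows "set_integrable lborel {0..t} (\<lambda>\<tau>. LINT \<xi>|lborel. fourier_sqg_operator \<alpha> (w \<tau>) \<xi> * d \<xi>)"
    and "(LINT \<tau>:{0..t}|lborel. LINT \<xi>|lborel. fourier_sqg_operator \<alpha> (w \<tau>) \<xi> * d \<xi>)
        = (LINT \<xi>|lborel. w0 \<xi> * d \<xi>) - (LINT \<xi>|lborel. w t \<xi> * d \<xi>)"
proof -
  let ?q = "\<lambda>\<tau> \<xi>. fourier_sqg_operator \<alpha> (w \<tau>) \<xi>"
  obtain B where B: "\<And>\<tau>. 0 \<le> \<tau> \<Longrightarrow> (\<integral>\<^sup>+\<xi>. ennreal (cmod (?q \<tau> \<xi> * d \<xi>)) \<partial>lborel) \<le> ennreal B"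
    using operator_pairing_bounded[OF d] by blast
  have int: "integrable lborel2 (\<lambda>(\<tau>, \<xi>). indicator {0..t} \<tau> *\<^sub>R (?q \<tau> \<xi> * d \<xi>))"
  proof (rule integrable_time_slices[OF _ B])
    note [measurable (raw)] = measurable_pair_apply[OF jointly_borel_operator]
    have [measurable]: "d \<in> borel_measurable borel" using L2c_measurable[OF d] by simp
    show "(\<lambda>(\<tau>, \<xi>). ?q \<tau> \<xi> * d \<xi>) \<in> borel_measurable (borel \<Otimes>\<^sub>M borel)" by measurable
  qed simp
  show "set_integrable lborel {0..t} (\<lambda>\<tau>. LINT \<xi>|lborel. ?q \<tau> \<xi> * d \<xi>)"
    using lborel_pair.integrable_fst[OF int] unfolding set_integrable_def by simp
  have "(LINT \<tau>:{0..t}|lborel. LINT \<xi>|lborel. ?q \<tau> \<xi> * d \<xi>)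
      = (LINT \<tau>|lborel. LINT \<xi>|lborel. indicator {0..t} \<tau> *\<^sub>R (?q \<tau> \<xi> * d \<xi>))"
    unfolding set_lebesgue_integral_def by simp
  also have "\<dots> = (LINT \<xi>|lborel. LINT \<tau>|lborel. (indicator {0..t} \<tau> *\<^sub>R ?q \<tau> \<xi>) * d \<xi>)"
    using lborel_pair.Fubini_integral[OF int, symmetric] by simp
  also have "\<dots> = (LINT \<xi>|lborel. w0 \<xi> * d \<xi> - w t \<xi> * d \<xi>)"
    unfolding integral_mult_left_zero operator_time_integral[OF t] left_diff_distrib ..
  also have "\<dots> = (LINT \<xi>|lborel. w0 \<xi> * d \<xi>) - (LINT \<xi>|lborel. w t \<xi> * d \<xi>)"
    using w_L2c[of 0] by (intro Bochner_Integration.integral_diff L2c_mult_integrable d w_L2c t) (simp add: w_0)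
  finally show "(LINT \<tau>:{0..t}|lborel. LINT \<xi>|lborel. ?q \<tau> \<xi> * d \<xi>)
      = (LINT \<xi>|lborel. w0 \<xi> * d \<xi>) - (LINT \<xi>|lborel. w t \<xi> * d \<xi>)" .
qed

end

lemma real_inverse_FT_exists:
  assumes g: "L2c g" and hermitian: "hermitian g"
  shows "\<exists>f :: pt \<Rightarrow> real. is_FT (cR f) g"
proof -
  obtain f where f: "is_FT f g" using is_FT_inverse_exists[OF g] by blast
  have "is_FT (\<lambda>x. cnj (f x)) g" using is_FT_cnj[OF f] by (simp add: hermitian)
  from is_FT_inj[OF f this AE_I2[OF refl]] have AE: "AE x in lborel. f x = complex_of_real (Re (f x))"
    by eventually_elim (simp add: complex_eq_iff)
  note [measurable] = L2c_measurable[OF is_FT_L2c(1)[OF f]] L2c_measurable[OF g]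
  have "is_FT (cR (\<lambda>x. Re (f x))) g" by (rule is_FT_cong_AE[OF f _ _ AE]) auto
  then show ?thesis by (rule exI[of _ "\<lambda>x. Re (f x)"])
qed

lemma hermitian_FT_exists:
  assumes f: "L2c (cR f)" shows "\<exists>g. is_FT (cR f) g \<and> hermitian g"
proof -
  define h where "h = FTL2 (cR f)"
  have h: "is_FT (cR f) h" unfolding h_def by (rule FTL2_is_FT[OF f])
  define g where "g \<xi> = (h \<xi> + cnj (h (- \<xi>))) / 2" for \<xi>
  have "is_FT (cR f) (\<lambda>\<xi>. cnj (h (- \<xi>)))" using is_FT_cnj[OF h] by simp
  from is_FT_unique[OF h this] have AE: "AE \<xi> in lborel. h \<xi> = g \<xi>"
    unfolding g_def by eventually_elim simp
  note [measurable] = L2c_measurable[OF f] L2c_measurable[OF is_FT_L2c(2)[OF h]]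
  have "is_FT (cR f) g" by (rule is_FT_cong_AE[OF h _ _ _ AE]) (auto simp: g_def[abs_def])
  moreover have "hermitian g" by (simp add: g_def add.commute)
  ultimately show ?thesis by blast
qed

locale physical_sqg = fourier_sqg \<alpha> s w0 w for \<alpha> s w0 w +
  fixes \<theta>0 :: "pt \<Rightarrow> real" and \<theta> :: "real \<Rightarrow> pt \<Rightarrow> real"
  assumes \<theta>0_FT: "is_FT (cR \<theta>0) w0" and \<theta>_FT: "0 \<le> t \<Longrightarrow> is_FT (cR (\<theta> t)) (w t)"
begin

lemma weak_equation:
  assumes t: "0 \<le> t" and \<phi>: "testc \<phi>"
  defines "F \<equiv> \<lambda>\<tau>. LINT x|lborel. sqg_operator \<alpha> (cR (\<theta> \<tau>)) x * \<phi> x"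
  shows "set_integrable lborel {0..t} F"
    and "(LINT x|lborel. cR (\<theta> t) x * \<phi> x) - (LINT x|lborel. cR \<theta>0 x * \<phi> x) + (LINT \<tau>:{0..t}|lborel. F \<tau>) = 0"
proof -
  let ?c = "complex_of_real plancherel_const" and ?d = "\<lambda>\<xi>. fourier \<phi> (- \<xi>)"
  let ?G = "\<lambda>\<tau>. LINT \<xi>|lborel. fourier_sqg_operator \<alpha> (w \<tau>) \<xi> * ?d \<xi>"
  have d: "L2c ?d" by (rule L2c_uminus_arg) (rule plancherel_testc(1)[OF \<phi>])
  have F_eq: "F \<tau> = ?c * ?G \<tau>" if "\<tau> \<in> {0..t}" for \<tau>
    unfolding F_def using that by (intro sqg_operator_pairing \<theta>_FT Hs_L2c \<phi>) auto
  have "set_integrable lborel {0..t} F \<longleftrightarrow> set_integrable lborel {0..t} (\<lambda>\<tau>. ?c * ?G \<tau>)"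
    by (rule set_integrable_cong) (use F_eq in auto)
  then show "set_integrable lborel {0..t} F"
    using set_integrable_mult_right[OF operator_pairing_time_integral(1)[OF t d]] by simp
  have "(LINT \<tau>:{0..t}|lborel. F \<tau>) = (LINT \<tau>:{0..t}|lborel. ?c * ?G \<tau>)"
    by (rule set_lebesgue_integral_cong) (use F_eq in auto)
  also have "\<dots> = ?c * (LINT \<xi>|lborel. w0 \<xi> * ?d \<xi>) - ?c * (LINT \<xi>|lborel. w t \<xi> * ?d \<xi>)"
    unfolding set_integral_mult_right operator_pairing_time_integral(2)[OF t d] by (rule right_diff_distrib)
  also have "\<dots> = (LINT x|lborel. cR \<theta>0 x * \<phi> x) - (LINT x|lborel. cR (\<theta> t) x * \<phi> x)"
    using parseval_mult[OF _ testc_L2c[OF \<phi>] testc_integrable[OF \<phi>]] \<theta>0_FT \<theta>_FT[OF t] by simp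
  finally show "(LINT x|lborel. cR (\<theta> t) x * \<phi> x) - (LINT x|lborel. cR \<theta>0 x * \<phi> x) + (LINT \<tau>:{0..t}|lborel. F \<tau>) = 0"
    by simp
qed

theorem solves_sqg: "sqg_solution \<alpha> \<theta>0 \<theta>"
  unfolding sqg_solution_def Let_def sqg_operator_def[symmetric] using weak_equation by blast

theorem continuous_in_H: "cont_H s \<theta>"
  unfolding cont_H_def
proof (intro conjI allI impI)
  fix t :: real assume t: "0 \<le> t"
  show "in_H s (cR (\<theta> t))" using in_H_iff[OF \<theta>_FT[OF t]] Hs_L2c[OF t] s_bounds by simp
  let ?N = "\<lambda>\<tau>. sqrt (plancherel_const * ((L2norm (\<lambda>\<xi>. w \<tau> \<xi> - w t \<xi>))\<^sup>2 + (L2norm (\<lambda>\<xi>. weighted s (w \<tau>) \<xi> - weighted s (w t) \<xi>))\<^sup>2))"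
  have "(?N \<longlongrightarrow> sqrt (plancherel_const * (0\<^sup>2 + 0\<^sup>2))) (at t within {0..})"
    using w_L2_continuous t unfolding L2_continuous_def by (intro tendsto_intros Hs_continuous t) auto
  moreover have "?N \<tau> = sob_norm s (\<lambda>x. cR (\<theta> \<tau>) x - cR (\<theta> t) x)" if "0 \<le> \<tau>" for \<tau>
    unfolding sob_norm_def sob_norm_sq_is_FT[OF is_FT_diff[OF \<theta>_FT[OF that] \<theta>_FT[OF t]]] weighted_diff ..
  then have "\<forall>\<^sub>F \<tau> in at t within {0..}. ?N \<tau> = sob_norm s (\<lambda>x. cR (\<theta> \<tau>) x - cR (\<theta> t) x)"
    by (simp add: eventually_at_filter)
  ultimately have "((\<lambda>\<tau>. sob_norm s (\<lambda>x. cR (\<theta> \<tau>) x - cR (\<theta> t) x)) \<longlongrightarrow> sqrt (plancherel_const * (0\<^sup>2 + 0\<^sup>2))) (at t within {0..})"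
    by (rule Lim_transform_eventually)
  then show "((\<lambda>\<tau>. sob_norm s (\<lambda>x. cR (\<theta> \<tau>) x - cR (\<theta> t) x)) \<longlongrightarrow> 0) (at t within {0..})" by simp
qed

theorem square_integrable_in_Hdot: "L2_Hdot (2 - \<alpha>) \<theta>"
proof -
  have "AE \<tau> in lborel. 0 \<le> \<tau> \<longrightarrow> in_Hdot (s + \<alpha>) (cR (\<theta> \<tau>))"
    using AE_weighted_L2c by eventually_elim (auto simp: in_Hdot_iff[OF \<theta>_FT])
  moreover have "set_integrable lborel {0..} (\<lambda>\<tau>. hdot_norm_sq (s + \<alpha>) (cR (\<theta> \<tau>)))
      \<longleftrightarrow> set_integrable lborel {0..} (\<lambda>\<tau>. plancherel_const * (hnorm (s + \<alpha>) (w \<tau>))\<^sup>2)"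
    by (rule set_integrable_cong) (auto simp: hdot_norm_sq_is_FT[OF \<theta>_FT])
  moreover have "set_integrable lborel {0..} (\<lambda>\<tau>. plancherel_const * (hnorm (s + \<alpha>) (w \<tau>))\<^sup>2)"
    by (rule set_integrable_mult_right) (rule Hs_dissipation_integrable_Ici)
  moreover have "2 - \<alpha> = s + \<alpha>" by (simp add: s_eq)
  ultimately show ?thesis unfolding L2_Hdot_def by (simp only:)
qed

theorem sobolev_energy_inequality:
  assumes t: "0 \<le> t"
  shows "set_integrable lborel {0..t} (\<lambda>\<tau>. sob_norm_sq s (Dpow \<alpha> (cR (\<theta> \<tau>))))"
    and "sob_norm_sq s (cR (\<theta> t)) + (LINT \<tau>:{0..t}|lborel. sob_norm_sq s (Dpow \<alpha> (cR (\<theta> \<tau>)))) \<le> sob_norm_sq s (cR \<theta>0)"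
proof -
  let ?D = "\<lambda>\<tau>. (hnorm \<alpha> (w \<tau>))\<^sup>2 + (hnorm (s + \<alpha>) (w \<tau>))\<^sup>2"
  have D_eq: "sob_norm_sq s (Dpow \<alpha> (cR (\<theta> \<tau>))) = plancherel_const * ?D \<tau>" if "\<tau> \<in> {0..t}" for \<tau>
  proof -
    have "L2c (weighted \<alpha> (w \<tau>))" using that \<alpha>_pos \<alpha>_less_half s_bounds by (intro weighted_bound(1)) auto
    with that have "is_FT (Dpow \<alpha> (cR (\<theta> \<tau>))) (weighted \<alpha> (w \<tau>))" by (intro Dpow_is_FT \<theta>_FT) auto
    from sob_norm_sq_is_FT[OF this] show ?thesis unfolding weighted_weighted .
  qed
  have "set_integrable lborel {0..t} (\<lambda>\<tau>. sob_norm_sq s (Dpow \<alpha> (cR (\<theta> \<tau>))))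
      \<longleftrightarrow> set_integrable lborel {0..t} (\<lambda>\<tau>. plancherel_const * ?D \<tau>)"
    by (rule set_integrable_cong) (use D_eq in auto)
  then show "set_integrable lborel {0..t} (\<lambda>\<tau>. sob_norm_sq s (Dpow \<alpha> (cR (\<theta> \<tau>))))"
    using set_integrable_mult_right[OF energy_inequality(1)[OF t]] by simp
  have "(LINT \<tau>:{0..t}|lborel. sob_norm_sq s (Dpow \<alpha> (cR (\<theta> \<tau>)))) = (LINT \<tau>:{0..t}|lborel. plancherel_const * ?D \<tau>)"
    by (rule set_lebesgue_integral_cong) (use D_eq in auto)
  also have "\<dots> = plancherel_const * (LINT \<tau>:{0..t}|lborel. ?D \<tau>)" by (rule set_integral_mult_right)
  finally show "sob_norm_sq s (cR (\<theta> t)) + (LINT \<tau>:{0..t}|lborel. sob_norm_sq s (Dpow \<alpha> (cR (\<theta> \<tau>))))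
      \<le> sob_norm_sq s (cR \<theta>0)"
    using mult_left_mono[OF energy_inequality(2)[OF t], of plancherel_const] plancherel_const_bounds(1)
    unfolding sob_norm_sq_is_FT[OF \<theta>_FT[OF t]] sob_norm_sq_is_FT[OF \<theta>0_FT] initial_energy_def
      by (simp add: distrib_left)
qed

end

context sqg_exponents
begin

lemma hnorm_le_sob_norm:
  assumes f: "is_FT f g" shows "hnorm r g \<le> 2 * pi * sob_norm r f"
proof -
  have "hnorm r g \<le> sqrt ((L2norm g)\<^sup>2 + (hnorm r g)\<^sup>2)" by (rule real_le_rsqrt) simp
  also have "\<dots> = 2 * pi * sob_norm r f"
    unfolding sob_norm_def sob_norm_sq_is_FT[OF f] plancherel_const_def by (simp add: real_sqrt_mult real_sqrt_divide)
  finally show ?thesis .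
qed

theorem physical_sqg_exists:
  assumes \<theta>0: "in_H s (cR \<theta>0)" and small: "sob_norm s (cR \<theta>0) < 1 / (2 * pi * smallness_const)"
  shows "\<exists>w0 w \<theta>. physical_sqg \<alpha> s w0 w \<theta>0 \<theta>"
proof -
  have "L2c (cR \<theta>0)" using \<theta>0 is_FT_L2c(1) unfolding in_H_def by blast
  then obtain w0 where FT: "is_FT (cR \<theta>0) w0" and "hermitian w0" using hermitian_FT_exists by blast
  moreover have "L2c (weighted s w0)" using in_H_iff[OF FT] \<theta>0 s_bounds by simp
  moreover have "smallness_const * hnorm s w0 < 1"
  proof -
    have "smallness_const * hnorm s w0 \<le> smallness_const * (2 * pi * sob_norm s (cR \<theta>0))"
      using smallness_const_pos by (intro mult_left_mono hnorm_le_sob_norm FT) simp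
    also have "\<dots> < 1" using small smallness_const_pos by (simp add: pos_less_divide_eq mult_ac)
    finally show ?thesis .
  qed
  ultimately obtain w where "fourier_sqg \<alpha> s w0 w" using fourier_sqg_exists is_FT_L2c(2)[OF FT] by blast
  then interpret fourier_sqg \<alpha> s w0 w .
  have "\<exists>f :: pt \<Rightarrow> real. is_FT (cR f) (w t)" if "0 \<le> t" for t
    by (rule real_inverse_FT_exists[OF w_L2c[OF that] w_hermitian[OF that]])
  then obtain \<theta> :: "real \<Rightarrow> pt \<Rightarrow> real" where "\<And>t. 0 \<le> t \<Longrightarrow> is_FT (cR (\<theta> t)) (w t)" by metis
  then have "physical_sqg \<alpha> s w0 w \<theta>0 \<theta>" using FT by unfold_locales
  then show ?thesis by blast
qed

end

theorem theorem1p3: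
  fixes \<alpha> :: real
  assumes "0 < \<alpha>" and "\<alpha> < 1/2"
  shows "\<exists>\<epsilon>0>0. \<forall>\<theta>0 :: pt \<Rightarrow> real.
           in_H (2 - 2*\<alpha>) (cR \<theta>0) \<and> sob_norm (2 - 2*\<alpha>) (cR \<theta>0) < \<epsilon>0 \<longrightarrow>
           (\<exists>\<theta> :: real \<Rightarrow> pt \<Rightarrow> real.
              sqg_solution \<alpha> \<theta>0 \<theta> \<and>
              cont_H (2 - 2*\<alpha>) \<theta> \<and>
              L2_Hdot (2 - \<alpha>) \<theta> \<and>
              (\<forall>t\<ge>0. set_integrable lborel {0..t}
                        (\<lambda>\<tau>. sob_norm_sq (2 - 2*\<alpha>) (Dpow \<alpha> (cR (\<theta> \<tau>)))) \<and>
                      sob_norm_sq (2 - 2*\<alpha>) (cR (\<theta> t))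
                      + (LINT \<tau>:{0..t}|lborel. sob_norm_sq (2 - 2*\<alpha>) (Dpow \<alpha> (cR (\<theta> \<tau>))))
                      \<le> sob_norm_sq (2 - 2*\<alpha>) (cR \<theta>0)))"
proof -
  interpret sqg_exponents \<alpha> "2 - 2*\<alpha>" using assms by unfold_locales auto
  show ?thesis
  proof (intro exI[of _ "1 / (2 * pi * smallness_const)"] conjI allI impI)
    show "0 < 1 / (2 * pi * smallness_const)" using smallness_const_pos by simp
    fix \<theta>0 :: "pt \<Rightarrow> real"
    assume "in_H (2 - 2*\<alpha>) (cR \<theta>0) \<and> sob_norm (2 - 2*\<alpha>) (cR \<theta>0) < 1 / (2 * pi * smallness_const)"
    then obtain w0 w \<theta> where "physical_sqg \<alpha> (2 - 2*\<alpha>) w0 w \<theta>0 \<theta>" using physical_sqg_exists by blast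
    then interpret physical_sqg \<alpha> "2 - 2*\<alpha>" w0 w \<theta>0 \<theta> .
    show "\<exists>\<theta> :: real \<Rightarrow> pt \<Rightarrow> real. sqg_solution \<alpha> \<theta>0 \<theta> \<and> cont_H (2 - 2*\<alpha>) \<theta> \<and> L2_Hdot (2 - \<alpha>) \<theta> \<and>
        (\<forall>t\<ge>0. set_integrable lborel {0..t} (\<lambda>\<tau>. sob_norm_sq (2 - 2*\<alpha>) (Dpow \<alpha> (cR (\<theta> \<tau>)))) \<and>
          sob_norm_sq (2 - 2*\<alpha>) (cR (\<theta> t)) + (LINT \<tau>:{0..t}|lborel. sob_norm_sq (2 - 2*\<alpha>) (Dpow \<alpha> (cR (\<theta> \<tau>))))
            \<le> sob_norm_sq (2 - 2*\<alpha>) (cR \<theta>0))"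
      using solves_sqg continuous_in_H square_integrable_in_Hdot sobolev_energy_inequality by blast
  qed
qed

end
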